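(* For each $n\ge1$ let $X_1,\dots,X_n$ be i.i.d. non-negative integer valued random variables (with distribution depending on $n$), let $p_n:=\mathbb P(X_1=1)>0$ with $p_n\to0$, and suppose $\lim_{n\to\infty}\frac1{p_n}\mathbb E X_1=1$. Put $r_n:=1/p_n$. Let $G_n$ be a simple undirected graph on $n$ vertices with adjacency matrix $(a_{uv}(G_n))$, with $|E(G_n)|p_n^2=\Theta(1)$, and let $T_n:=\frac12\sum_{1\le u,v\le n}a_{uv}(G_n)X_uX_v$. Assume the vertices of $G_n$ are labelled $\{1,\dots,n\}$ in non-increasing order of the degrees and that the following hold: (a) $\lim_{K\to\infty}\lim_{n\to\infty}\frac12\int_K^\infty\int_K^\infty W_{G_n}(x,y)\,dx\,dy=\lambda_0$. (b) There exists $W\in\mathcal W$ such that for all $K>0$ large enough, $\lim_{n\to\infty}\|W_{G_n}-W\|_{\square([0,K]^2)}=0$. (c) There exists a function $d:[0,\infty)\to[0,\infty)$ in $L_1([0,\infty))$ such that for all $K,M>0$ large enough, $$\lim_{n\to\infty}\int_0^K\left|d_{W_{G_n}}(x)\mathbf 1\{d_{W_{G_n}}(x)\le M\}-d(x)\mathbf 1\{d(x)\le M\}\right|dx=0.$$ Then $T_n$ converges in distribution to $Q_1+Q_2+Q_3$, where $Q_3\sim\mathrm{Pois}(\lambda_0)$ is independent of $(Q_1,Q_2)$, and for $t_1,t_2\ge0$ $$\mathbb E\exp\{-t_1Q_1-t_2Q_2\}=\mathbb E\exp\left\{\frac12\int_0^\infty\int_0^\infty\phi_{W,t_1}(x,y)\,dN(x)\,dN(y)-(1-e^{-t_2})\int_0^\infty\Delta(x)\,dN(x)\right\},$$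 where $\Delta(x):=d(x)-\int_0^\infty W(x,y)\,dy$, $\phi_{W,t_1}(x,y):=\log(1-W(x,y)+W(x,y)e^{-t_1})$, and $\{N(t),t\ge0\}$ is a homogeneous Poisson process of rate $1$.
   Context: $\Theta(1)$ means bounded above and below by positive constants for all large $n$. $\mathrm{Pois}(0)$ is the point mass at $0$. $\mathcal W$ is the set of symmetric measurable functions $[0,\infty)^2\to[0,1]$. $W_{G_n}\in\mathcal W$ is $W_{G_n}(x,y)=\mathbf 1\{(\lceil xr_n\rceil,\lceil yr_n\rceil)\in E(G_n)\}$ for $x,y\in[0,n/r_n]$ and $0$ otherwise; $d_{W_{G_n}}(x):=\int_0^\infty W_{G_n}(x,y)\,dy$. Cut-distance: $\|W_1-W_2\|_{\square([0,K]^2)}:=\sup_{f,g:[0,K]\to[-1,1]}\left|\int_{[0,K]^2}(W_1(x,y)-W_2(x,y))f(x)g(y)\,dx\,dy\right|$. Double limits: $\lim_{K\to\infty}\lim_{n\to\infty}a_{n,K}=a$ means $\limsup_{K}\limsup_{n}a_{n,K}=\liminf_{K}\liminf_{n}a_{n,K}=a$. Stochastic integrals: let $N(A)$ be the number of points of the rate-1 Poisson process in the Borel set $A\subseteq[0,\infty)$. If $f=\sum_{i_1,\dots,i_k=1}^m a_{i_1\dots i_k}\mathbf 1_{A_{i_1}\times\cdots\times A_{i_k}}\in L_1([0,\infty)^k)$ with $A_1,\dots,A_m$ pairwise disjoint Borel sets and $a_{i_1\dots i_k}=0$ whenever two indices coincide, then $\int f\prod_j dN(x_j):=\sum a_{i_1\dots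 i_k}N(A_{i_1})\cdots N(A_{i_k})$. For general $f\in L_1([0,\infty)^k)$ the integral is the $L_1(\Omega)$-limit of the integrals of any sequence of such elementary functions converging to $f$ in $L_1$ (the limit exists and does not depend on the sequence). *)

theory Defs
  imports "HOL-Probability.Probability" "HOL-Library.Landau_Symbols"
begin

text \<open>Simple graphs on the vertex set \<open>{1..n}\<close>, given by their set of edges, an edge being a
  two-element set of vertices.\<close>

definition simple_graph :: "nat \<Rightarrow> nat set set \<Rightarrow> bool" where
  "simple_graph n E \<longleftrightarrow> E \<subseteq> {e. e \<subseteq> {1..n} \<and> card e = 2}"

definition adj :: "nat set set \<Rightarrow> nat \<Rightarrow> nat \<Rightarrow> real" where
  "adj E u v = (if {u, v} \<in> E then 1 else 0)"

definition degree_in :: "nat set set \<Rightarrow> nat \<Rightarrow> nat" where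
  "degree_in E v = card {u. {u, v} \<in> E}"

definition degree_ordered :: "nat \<Rightarrow> nat set set \<Rightarrow> bool" where
  "degree_ordered n E \<longleftrightarrow> (\<forall>u\<in>{1..n}. \<forall>v\<in>{1..n}. u \<le> v \<longrightarrow> degree_in E v \<le> degree_in E u)"

definition T_stat :: "nat \<Rightarrow> nat set set \<Rightarrow> (nat \<Rightarrow> 'a \<Rightarrow> nat) \<Rightarrow> 'a \<Rightarrow> real" where
  "T_stat n E X \<omega> = 1 / 2 * (\<Sum>u=1..n. \<Sum>v=1..n. adj E u v * real (X u \<omega>) * real (X v \<omega>))"

text \<open>Functions on \<open>[0,\<infinity>)\<close> or \<open>[0,\<infinity>)\<^sup>2\<close> are represented by functions on the reals,
  whose values elsewhere never matter. \<open>graphon W\<close> says that \<open>W\<close> is a symmetric Borel function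
  from \<open>[0,\<infinity>)\<^sup>2\<close> to \<open>[0,1]\<close>.\<close>

definition graphon :: "(real \<Rightarrow> real \<Rightarrow> real) \<Rightarrow> bool" where
  "graphon W \<longleftrightarrow>
     (\<lambda>(x, y). W x y) \<in> borel_measurable (restrict_space borel ({0..} \<times> {0..})) \<and>
     (\<forall>x\<ge>0. \<forall>y\<ge>0. W x y = W y x \<and> 0 \<le> W x y \<and> W x y \<le> 1)"

text \<open>For \<open>x = 0\<close> the ceiling is \<open>0\<close>, which is not a vertex, so the value is \<open>0\<close>.\<close>

definition graph_kernel :: "nat \<Rightarrow> real \<Rightarrow> nat set set \<Rightarrow> real \<Rightarrow> real \<Rightarrow> real" where
  "graph_kernel n r E x y =
     (if x \<in> {0..real n / r} \<and> y \<in> {0..real n / r}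
      then adj E (nat \<lceil>x * r\<rceil>) (nat \<lceil>y * r\<rceil>) else 0)"

definition kernel_degree :: "(real \<Rightarrow> real \<Rightarrow> real) \<Rightarrow> real \<Rightarrow> real" where
  "kernel_degree W x = (LINT y:{0..}|lborel. W x y)"

text \<open>For two graphons the set below is bounded, so the real supremum is the true one.\<close>

definition cut_dist :: "real \<Rightarrow> (real \<Rightarrow> real \<Rightarrow> real) \<Rightarrow> (real \<Rightarrow> real \<Rightarrow> real) \<Rightarrow> real" where
  "cut_dist K W1 W2 =
     Sup {\<bar>LINT z:{0..K} \<times> {0..K}|lborel.
             (W1 (fst z) (snd z) - W2 (fst z) (snd z)) * f (fst z) * g (snd z)\<bar> | f g.
          f \<in> borel_measurable (restrict_space borel {0..K}) \<and> f ` {0..K} \<subseteq> {-1..1} \<and>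
          g \<in> borel_measurable (restrict_space borel {0..K}) \<and> g ` {0..K} \<subseteq> {-1..1}}"

definition has_double_lim :: "(nat \<Rightarrow> real \<Rightarrow> real) \<Rightarrow> real \<Rightarrow> bool" where
  "has_double_lim a l \<longleftrightarrow>
     Limsup at_top (\<lambda>K. limsup (\<lambda>n. ereal (a n K))) = ereal l \<and>
     Liminf at_top (\<lambda>K. liminf (\<lambda>n. ereal (a n K))) = ereal l"

text \<open>\<open>poisson_pmf\<close> is meaningful only for a positive rate.\<close>

definition pois :: "real \<Rightarrow> nat pmf" where
  "pois l = (if l = 0 then return_pmf 0 else poisson_pmf l)"

text \<open>The homogeneous Poisson process of rate 1 on \<open>[0,\<infinity>)\<close>, as a locally finite random set \<open>S\<close>
  of points; \<open>N(t)\<close> is \<open>npoints S {0..t}\<close>. \<open>card\<close> of an infinite set is \<open>0\<close>; a set of finite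
  Lebesgue measure almost surely contains only finitely many points.\<close>

definition npoints :: "('b \<Rightarrow> real set) \<Rightarrow> real set \<Rightarrow> 'b \<Rightarrow> nat" where
  "npoints S A \<omega> = card (S \<omega> \<inter> A)"

definition poisson_process :: "'b measure \<Rightarrow> ('b \<Rightarrow> real set) \<Rightarrow> bool" where
  "poisson_process P S \<longleftrightarrow>
     prob_space P \<and>
     (\<forall>\<omega>\<in>space P. S \<omega> \<subseteq> {0..} \<and> (\<forall>t. finite (S \<omega> \<inter> {0..t}))) \<and>
     (\<forall>A\<in>sets borel. A \<subseteq> {0..} \<longrightarrow> emeasure lborel A < \<infinity> \<longrightarrow>
        npoints S A \<in> measurable P (count_space UNIV) \<and>
        distr P (count_space UNIV) (npoints S A) = measure_pmf (pois (measure lborel A))) \<and>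
     (\<forall>(m::nat) A. (\<forall>i<m. A i \<in> sets borel \<and> A i \<subseteq> {0..} \<and> emeasure lborel (A i) < \<infinity>) \<longrightarrow>
        disjoint_family_on A {..<m} \<longrightarrow>
        prob_space.indep_vars P (\<lambda>_. count_space UNIV) (\<lambda>i. npoints S (A i)) {..<m})"

text \<open>Stochastic integrals of functions in \<open>L\<^sub>1([0,\<infinity>)\<^sup>k)\<close>. A point of \<open>[0,\<infinity>)\<^sup>k\<close> is an extensional
  function on \<open>{..<k}\<close>, and so is a multi-index \<open>(i\<^sub>1,\<dots>,i\<^sub>k)\<close> with entries below \<open>m\<close>.\<close>

definition orthant :: "nat \<Rightarrow> (nat \<Rightarrow> real) measure" where
  "orthant k = PiM {..<k} (\<lambda>_. restrict_space lborel {0..})"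

definition elem_fun ::
  "nat \<Rightarrow> nat \<Rightarrow> (nat \<Rightarrow> real set) \<Rightarrow> ((nat \<Rightarrow> nat) \<Rightarrow> real) \<Rightarrow> (nat \<Rightarrow> real) \<Rightarrow> real" where
  "elem_fun k m A a x =
     (\<Sum>i\<in>{..<k} \<rightarrow>\<^sub>E {..<m}. a i * (\<Prod>j<k. indicator (A (i j)) (x j)))"

definition elementary ::
  "nat \<Rightarrow> nat \<Rightarrow> (nat \<Rightarrow> real set) \<Rightarrow> ((nat \<Rightarrow> nat) \<Rightarrow> real) \<Rightarrow> bool" where
  "elementary k m A a \<longleftrightarrow>
     (\<forall>i<m. A i \<in> sets borel \<and> A i \<subseteq> {0..}) \<and> disjoint_family_on A {..<m} \<and>
     (\<forall>i\<in>{..<k} \<rightarrow>\<^sub>E {..<m}. \<not> inj_on i {..<k} \<longrightarrow> a i = 0) \<and>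
     integrable (orthant k) (elem_fun k m A a)"

definition elem_integral ::
  "('b \<Rightarrow> real set) \<Rightarrow> nat \<Rightarrow> nat \<Rightarrow> (nat \<Rightarrow> real set) \<Rightarrow> ((nat \<Rightarrow> nat) \<Rightarrow> real) \<Rightarrow> 'b \<Rightarrow> real" where
  "elem_integral S k m A a \<omega> =
     (\<Sum>i\<in>{..<k} \<rightarrow>\<^sub>E {..<m}. a i * (\<Prod>j<k. real (npoints S (A (i j)) \<omega>)))"

text \<open>The limit \<open>Z\<close> does not depend on the approximating sequence and is unique up to null sets,
  hence the existential quantifier and the choice.\<close>

definition has_stoch_integral ::
  "'b measure \<Rightarrow> ('b \<Rightarrow> real set) \<Rightarrow> nat \<Rightarrow> ((nat \<Rightarrow> real) \<Rightarrow> real) \<Rightarrow> ('b \<Rightarrow> real) \<Rightarrow> bool" where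
  "has_stoch_integral P S k f Z \<longleftrightarrow>
     integrable (orthant k) f \<and> integrable P Z \<and>
     (\<exists>m A a. (\<forall>l::nat. elementary k (m l) (A l) (a l)) \<and>
        (\<lambda>l. \<integral>\<^sup>+x. ennreal \<bar>elem_fun k (m l) (A l) (a l) x - f x\<bar> \<partial>orthant k) \<longlonglongrightarrow> 0 \<and>
        (\<lambda>l. \<integral>\<^sup>+\<omega>. ennreal \<bar>elem_integral S k (m l) (A l) (a l) \<omega> - Z \<omega>\<bar> \<partial>P) \<longlonglongrightarrow> 0)"

definition stoch_integral ::
  "'b measure \<Rightarrow> ('b \<Rightarrow> real set) \<Rightarrow> nat \<Rightarrow> ((nat \<Rightarrow> real) \<Rightarrow> real) \<Rightarrow> 'b \<Rightarrow> real" where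
  "stoch_integral P S k f = (SOME Z. has_stoch_integral P S k f Z)"

definition phi :: "(real \<Rightarrow> real \<Rightarrow> real) \<Rightarrow> real \<Rightarrow> real \<Rightarrow> real \<Rightarrow> real" where
  "phi W t x y = ln (1 - W x y + W x y * exp (- t))"

definition Delta :: "(real \<Rightarrow> real) \<Rightarrow> (real \<Rightarrow> real \<Rightarrow> real) \<Rightarrow> real \<Rightarrow> real" where
  "Delta d W x = d x - kernel_degree W x"

end

theory Submission
  imports Defs
begin

text \<open>Only the indicators of \<open>X\<^sub>u = 1\<close> matter: their quadratic form differs from \<open>T\<^sub>n\<close> with probability at most
  \<open>2 |E| ((E X)\<^sup>2 - p\<^sup>2) \<longlonglongrightarrow> 0\<close>. Split the vertices at \<open>N = \<lfloor>K / p\<rfloor>\<close> into a head \<open>{1..N}\<close> and a tail. Because of the degree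
  ordering a tail vertex has degree at most \<open>2 |E| / N\<close>, so that, given the chosen head vertices, the chosen edges which meet
  the tail are nearly independent Poisson variables; those inside the tail give \<open>Q\<^sub>3\<close>. What remains is a functional of the
  Bernoulli random subset of the head, a product over pairs and over points. It is continuous in the kernel for the cut norm
  and in the degrees for the truncated \<open>L\<^sub>1\<close> distance, so both may be replaced by step functions. For these the functional
  depends on the number of chosen vertices per cell only. A vertex is chosen with probability exactly \<open>p\<close> if this means that an
  interval of length \<open>- ln (1 - p)\<close> contains a Poisson point, and then the counts converge almost surely to those of the
  Poisson process. The law of \<open>(Q\<^sub>1, Q\<^sub>2)\<close> is a limit point of the tight laws of the numbers of head-head and head-tail
  edges.\<close>

section \<open>Bernoulli random subsets of a finite set\<close>

text \<open>The cut norm controls bilinear forms only: the 0/1-valued kernels of the graphs need not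
  approach the fractional \<open>W\<close> pointwise or in L1. Hence the pair functional is kept as
  a product of factors \<open>1 - s * w u v\<close>, affine in each kernel value, whose derivative
  between two kernels is such a form up to a small error. Two chosen vertices of one cell would
  contribute \<open>N (N - 1)\<close> instead of a square; step kernels with zero diagonal blocks
  avoid this, and the elementary functions of the stochastic integral demand them as well.
  Integrability of \<open>W\<close> and the sign of \<open>Delta\<close> are not assumed: they come
  out of the bounded rescaled number of edges and of the tail degrees. Some tail errors vanish only
  if first \<open>n\<close> and then \<open>K\<close> tends to infinity. One iterated limit, that of
  the joint generating function of the head-head, head-tail and tail-tail edge counts, is used
  twice: without the tail-tail mark it identifies the limit points of the first two counts, and with
  three equal arguments it no longer depends on \<open>K\<close> and yields the convergence of the
  number of chosen edges.\<close>

definition bern :: "'v set \<Rightarrow> real \<Rightarrow> ('v set \<Rightarrow> real) \<Rightarrow> real" where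
  "bern V p f = (\<Sum>A\<in>Pow V. p ^ card A * (1 - p) ^ card (V - A) * f A)"

lemma bern_empty [simp]: "bern {} p f = f {}"
  by (simp add: bern_def)

text \<open>Conditioning on whether \<open>v\<close> is chosen. With this recursion the basic facts
  about \<open>bern\<close> become inductions over \<open>V\<close>, and neither measurability nor a
  probability space enters. It is an identity of polynomials, valid for every real
  \<open>p\<close>.\<close>

lemma bern_insert:
  assumes "finite V" "v \<notin> V"
  shows "bern (insert v V) p f = p * bern V p (\<lambda>A. f (insert v A)) + (1 - p) * bern V p f"
proof -
  have fin: "finite A" if "A \<subseteq> V" for A using that assms(1) finite_subset by auto
  have inj: "inj_on (insert v) (Pow V)"
    using assms(2) by (auto simp: inj_on_def dest!: insert_ident[THEN iffD1, rotated 2])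
  have "bern (insert v V) p f =
      (\<Sum>A\<in>Pow V. p ^ card A * (1 - p) ^ card (insert v V - A) * f A) +
      (\<Sum>A\<in>insert v ` Pow V. p ^ card A * (1 - p) ^ card (insert v V - A) * f A)"
    unfolding bern_def Pow_insert using assms by (intro sum.union_disjoint) auto
  also have "(\<Sum>A\<in>Pow V. p ^ card A * (1 - p) ^ card (insert v V - A) * f A) = (1 - p) * bern V p f"
    unfolding bern_def sum_distrib_left
  proof (intro sum.cong refl)
    fix A assume "A \<in> Pow V"
    then have "insert v V - A = insert v (V - A)" "v \<notin> V - A" "finite (V - A)" using assms by auto
    then show "p ^ card A * (1 - p) ^ card (insert v V - A) * f A = (1 - p) * (p ^ card A * (1 - p) ^ card (V - A) * f A)"
      by simp
  qed
  also have "(\<Sum>A\<in>insert v ` Pow V. p ^ card A * (1 - p) ^ card (insert v V - A) * f A) = p * bern V p (\<lambda>A. f (insert v A))"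
    unfolding bern_def sum_distrib_left sum.reindex[OF inj] o_def
  proof (intro sum.cong refl)
    fix A assume A: "A \<in> Pow V"
    then have "insert v V - insert v A = V - A" "v \<notin> A" "finite A" using assms fin by auto
    then show "p ^ card (insert v A) * (1 - p) ^ card (insert v V - insert v A) * f (insert v A) =
      p * (p ^ card A * (1 - p) ^ card (V - A) * f (insert v A))"
      by simp
  qed
  finally show ?thesis by simp
qed

lemma bern_cong: "(\<And>A. A \<subseteq> V \<Longrightarrow> f A = g A) \<Longrightarrow> bern V p f = bern V p g"
  by (simp add: bern_def)

lemma bern_add: "bern V p (\<lambda>A. f A + g A) = bern V p f + bern V p g"
  by (simp add: bern_def sum.distrib algebra_simps)

lemma bern_diff: "bern V p (\<lambda>A. f A - g A) = bern V p f - bern V p g"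
  by (simp add: bern_def sum_subtractf algebra_simps)

lemma bern_cmult: "bern V p (\<lambda>A. c * f A) = c * bern V p f"
  by (simp add: bern_def sum_distrib_left algebra_simps)

lemma bern_sum: "bern V p (\<lambda>A. \<Sum>i\<in>I. f i A) = (\<Sum>i\<in>I. bern V p (f i))"
  unfolding bern_def sum_distrib_left by (rule sum.swap)

lemma bern_const: "finite V \<Longrightarrow> bern V p (\<lambda>_. c) = c"
  by (induction V rule: finite_induct) (simp_all add: bern_insert algebra_simps)

lemma bern_mono:
  assumes "0 \<le> p" "p \<le> 1" "\<And>A. A \<subseteq> V \<Longrightarrow> f A \<le> g A"
  shows "bern V p f \<le> bern V p g"
  unfolding bern_def using assms by (intro sum_mono mult_left_mono) auto

lemma bern_abs:
  assumes "0 \<le> p" "p \<le> 1"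
  shows "\<bar>bern V p f\<bar> \<le> bern V p (\<lambda>A. \<bar>f A\<bar>)"
  unfolding bern_def using assms by (intro order_trans[OF sum_abs] sum_mono) (auto simp: abs_mult)

text \<open>Fubini for the independent choices in two disjoint sets; later it serves to condition on
  the chosen head vertices.\<close>

lemma bern_union:
  assumes "finite V" "finite U" "V \<inter> U = {}"
  shows "bern (V \<union> U) p f = bern V p (\<lambda>A. bern U p (\<lambda>B. f (A \<union> B)))"
  using assms(2,3)
proof (induction U arbitrary: f rule: finite_induct)
  case (insert u U)
  then have "bern (V \<union> insert u U) p f = p * bern (V \<union> U) p (\<lambda>A. f (insert u A)) + (1 - p) * bern (V \<union> U) p f"
    using assms(1) by (simp add: bern_insert)
  also have "\<dots> = bern V p (\<lambda>A. p * bern U p (\<lambda>B. f (insert u (A \<union> B))) + (1 - p) * bern U p (\<lambda>B. f (A \<union> B)))"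
    using insert by (simp add: bern_add bern_cmult)
  also have "\<dots> = bern V p (\<lambda>A. bern (insert u U) p (\<lambda>B. f (A \<union> B)))"
    using insert by (simp add: bern_insert)
  finally show ?case .
qed simp

text \<open>The choice of \<open>v\<close> is independent of the other choices, and inserting
  \<open>v\<close> forgets whether it was chosen, so the right side may average over all subsets,
  those containing \<open>v\<close> included. This is the finite Mecke identity for one point;
  applied twice it gives the one for two points.\<close>

lemma bern_mem:
  assumes "finite V" "v \<in> V"
  shows "bern V p (\<lambda>A. of_bool (v \<in> A) * f A) = p * bern V p (\<lambda>A. f (insert v A))"
proof -
  define U where "U = V - {v}"
  have V: "V = insert v U" "v \<notin> U" "finite U" using assms by (auto simp: U_def)
  have 0: "bern U p (\<lambda>A. of_bool (v \<in> A) * f A) = bern U p (\<lambda>_. 0)"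
    using V by (intro bern_cong) auto
  show ?thesis unfolding V(1)
    unfolding bern_insert[OF V(3,2)] 0 bern_const[OF V(3)] by simp algebra
qed

lemma bern_mem2:
  assumes "finite V" "u \<in> V" "v \<in> V" "u \<noteq> v"
  shows "bern V p (\<lambda>A. of_bool (u \<in> A \<and> v \<in> A) * f A) = p\<^sup>2 * bern V p (\<lambda>A. f (insert u (insert v A)))"
proof -
  have "bern V p (\<lambda>A. of_bool (u \<in> A \<and> v \<in> A) * f A) = bern V p (\<lambda>A. of_bool (u \<in> A) * (of_bool (v \<in> A) * f A))"
    by (intro bern_cong) auto
  also have "\<dots> = p * bern V p (\<lambda>A. of_bool (v \<in> A) * f (insert u A))"
    using assms by (simp add: bern_mem)
  also have "\<dots> = p\<^sup>2 * bern V p (\<lambda>A. f (insert u (insert v A)))"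
    using assms by (simp add: bern_mem power2_eq_square)
  finally show ?thesis .
qed

lemma bern_prob:
  assumes "finite V" "v \<in> V" shows "bern V p (\<lambda>A. of_bool (v \<in> A)) = p"
  using bern_mem[OF assms, of p "\<lambda>_. 1"] assms by (simp add: bern_const)

lemma bern_prob2:
  assumes "finite V" "u \<in> V" "v \<in> V" "u \<noteq> v" shows "bern V p (\<lambda>A. of_bool (u \<in> A \<and> v \<in> A)) = p\<^sup>2"
  using bern_mem2[OF assms, of p "\<lambda>_. 1"] assms by (simp add: bern_const)

text \<open>The choices outside \<open>U\<close> do not influence the value and are averaged
  out.\<close>

lemma bern_restrict:
  assumes "finite V" "U \<subseteq> V" "\<And>A. A \<subseteq> V \<Longrightarrow> f A = f (A \<inter> U)"
  shows "bern V p f = bern U p f"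
proof -
  have V: "V = U \<union> (V - U)" using assms by auto
  have "bern V p f = bern U p (\<lambda>A. bern (V - U) p (\<lambda>B. f (A \<union> B)))"
    by (subst V, subst bern_union) (use assms finite_subset in auto)
  also have "\<dots> = bern U p (\<lambda>A. bern (V - U) p (\<lambda>B. f A))"
  proof (intro bern_cong)
    fix A B assume "A \<subseteq> U" "B \<subseteq> V - U"
    then have "A \<union> B \<subseteq> V" "(A \<union> B) \<inter> U = A" using assms by auto
    then show "f (A \<union> B) = f A" using assms(3)[of "A \<union> B"] by simp
  qed
  also have "\<dots> = bern U p f" using assms by (simp add: bern_const)
  finally show ?thesis .
qed

text \<open>The bridge from probability spaces to the finite sums: the random set takes finitely
  many values, and independence gives each its weight. It is applied to the occupied intervals of
  the Poisson process, to a product of Bernoulli laws and to the events that a variable equals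
  1.\<close>

lemma (in prob_space) expectation_bern:
  assumes V: "finite V" and ind: "indep_vars (\<lambda>_. count_space UNIV) Y V"
    and p: "\<And>v. v \<in> V \<Longrightarrow> prob {\<omega> \<in> space M. Y v \<omega>} = p"
  shows "expectation (\<lambda>\<omega>. f {v \<in> V. Y v \<omega>}) = bern V p f"
    and "(\<lambda>\<omega>. f {v \<in> V. Y v \<omega>}) \<in> borel_measurable M"
proof -
  let ?E = "\<lambda>A. {\<omega> \<in> space M. {v \<in> V. Y v \<omega>} = A}"
  have meas: "Y v \<in> measurable M (count_space UNIV)" if "v \<in> V" for v
    using ind that by (auto simp: indep_vars_def)
  have ev: "?E A \<in> events"
    and pr: "prob (?E A) = p ^ card A * (1 - p) ^ card (V - A)" if A: "A \<in> Pow V" for A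
  proof -
    \<comment> \<open>For empty \<open>V\<close> the intersection would be the universe instead of
      the space, and the product rule for independent events wants a non-empty index set.\<close>
    have eq: "?E A = (if V = {} then space M else (\<Inter>v\<in>V. Y v -` {v \<in> A} \<inter> space M))"
      using A by auto
    have fin: "finite A" using A V finite_subset by auto
    show "?E A \<in> events"
      unfolding eq using V meas
      by (cases "V = {}") (simp, simp del: INT_simps, intro sets.finite_INT measurable_sets[OF meas], auto)
    have pv: "prob (Y v -` {v \<in> A} \<inter> space M) = (if v \<in> A then p else 1 - p)" if v: "v \<in> V" for v
    proof (cases "v \<in> A")
      case True
      have "Y v -` {True} \<inter> space M = {\<omega> \<in> space M. Y v \<omega>}" by auto
      with True p[OF v] show ?thesis by simp
    next
      case False
      have "Y v -` {False} \<inter> space M = space M - {\<omega> \<in> space M. Y v \<omega>}" by auto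
      moreover have "{\<omega> \<in> space M. Y v \<omega>} \<in> events" using meas[OF v] by measurable
      ultimately show ?thesis using False p[OF v] by (simp add: prob_compl)
    qed
    show "prob (?E A) = p ^ card A * (1 - p) ^ card (V - A)"
    proof (cases "V = {}")
      case True
      then show ?thesis using A by (simp add: eq prob_space)
    next
      case False
      have "prob (\<Inter>v\<in>V. Y v -` {v \<in> A} \<inter> space M) = (\<Prod>v\<in>V. prob (Y v -` {v \<in> A} \<inter> space M))"
        by (rule indep_varsD_finite[OF ind]) (use False V in auto)
      also have "\<dots> = (\<Prod>v\<in>V. if v \<in> A then p else 1 - p)" by (intro prod.cong refl pv)
      also have "\<dots> = p ^ card A * (1 - p) ^ card (V - A)"
      proof -
        have "V \<inter> A = A" "V \<inter> - A = V - A" using A by auto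
        then show ?thesis using V by (simp add: prod.If_cases Collect_neg_eq[symmetric])
      qed
      finally show ?thesis using False by (simp add: eq)
    qed
  qed
  have rep: "f {v \<in> V. Y v \<omega>} = (\<Sum>A\<in>Pow V. f A * indicator (?E A) \<omega>)" if "\<omega> \<in> space M" for \<omega>
  proof -
    have "(\<Sum>A\<in>Pow V. f A * indicator (?E A) \<omega>) = (\<Sum>A\<in>Pow V. if A = {v \<in> V. Y v \<omega>} then f A else 0)"
      using that by (intro sum.cong) (auto simp: indicator_def)
    also have "\<dots> = f {v \<in> V. Y v \<omega>}" using V by (simp add: sum.delta)
    finally show ?thesis by simp
  qed
  have "expectation (\<lambda>\<omega>. f {v \<in> V. Y v \<omega>}) = expectation (\<lambda>\<omega>. \<Sum>A\<in>Pow V. f A * indicator (?E A) \<omega>)"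
    by (intro Bochner_Integration.integral_cong refl rep)
  also have "\<dots> = (\<Sum>A\<in>Pow V. f A * prob (?E A))"
    using ev by (subst Bochner_Integration.integral_sum) (auto simp: less_top[symmetric])
  also have "\<dots> = bern V p f"
    unfolding bern_def using pr by (intro sum.cong) auto
  finally show "expectation (\<lambda>\<omega>. f {v \<in> V. Y v \<omega>}) = bern V p f" .
  show "(\<lambda>\<omega>. f {v \<in> V. Y v \<omega>}) \<in> borel_measurable M"
    by (subst measurable_cong[OF rep], assumption) (use ev in \<open>auto intro!: borel_measurable_sum borel_measurable_times borel_measurable_indicator\<close>)
qed

section \<open>Poisson approximation of the sparse part of the graph\<close>

text \<open>A generating function solves \<open>g' = - \<mu> g\<close> up to a small error; this replaces Stein's method.\<close>

lemma exp_ode_bound: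
  fixes g g' :: "real \<Rightarrow> real"
  assumes der: "\<And>t. (g has_real_derivative g' t) (at t)"
    and err: "\<And>t. 0 \<le> t \<Longrightarrow> t \<le> 1 \<Longrightarrow> \<bar>g' t + \<mu> * g t\<bar> \<le> e"
    and "\<mu> \<ge> 0" "g 0 = 1"
  shows "\<bar>g 1 - exp (- \<mu>)\<bar> \<le> e"
proof -
  \<comment> \<open>Integrating factor: \<open>h\<close> would be constant without the error. The
    mean value theorem bounds its increment by \<open>e * exp \<mu>\<close>, and multiplication by
    \<open>exp (- \<mu>)\<close> removes the exponential, so the bound does not depend on
    \<open>\<mu>\<close>.\<close>
  define h where "h t = g t * exp (\<mu> * t)" for t
  have dh: "(h has_real_derivative (g' t + \<mu> * g t) * exp (\<mu> * t)) (at t)" for t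
    unfolding h_def by (auto intro!: derivative_eq_intros der simp: algebra_simps)
  obtain t where t: "0 < t" "t < 1" "h 1 - h 0 = (1 - 0) * ((g' t + \<mu> * g t) * exp (\<mu> * t))"
    using MVT2[of 0 1 h "\<lambda>t. (g' t + \<mu> * g t) * exp (\<mu> * t)"] dh by auto
  have "\<bar>h 1 - h 0\<bar> = \<bar>g' t + \<mu> * g t\<bar> * exp (\<mu> * t)" using t by (simp add: abs_mult)
  also have "\<dots> \<le> e * exp \<mu>"
  proof (rule mult_mono)
    have "\<mu> * t \<le> \<mu> * 1" using t assms(3) by (intro mult_left_mono) auto
    then show "exp (\<mu> * t) \<le> exp \<mu>" by simp
    show "\<bar>g' t + \<mu> * g t\<bar> \<le> e" using err t by auto
    then show "0 \<le> e" by linarith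
  qed auto
  finally have "\<bar>h 1 - h 0\<bar> * exp (- \<mu>) \<le> e * exp \<mu> * exp (- \<mu>)" by (intro mult_right_mono) auto
  moreover have "\<bar>h 1 - h 0\<bar> * exp (- \<mu>) = \<bar>(h 1 - h 0) * exp (- \<mu>)\<bar>" by (simp add: abs_mult)
  moreover have "(h 1 - h 0) * exp (- \<mu>) = g 1 - exp (- \<mu>)"
    using assms(4) by (simp add: h_def algebra_simps exp_minus field_simps)
  moreover have "e * exp \<mu> * exp (- \<mu>) = e" by (simp add: exp_minus)
  ultimately show ?thesis by simp
qed

section \<open>Edge counts, neighbour counts and their moments\<close>

definition ec :: "'v set set \<Rightarrow> 'v set \<Rightarrow> nat" where
  "ec E A = card {e \<in> E. e \<subseteq> A}"

definition nb :: "'v set set \<Rightarrow> 'v set \<Rightarrow> 'v \<Rightarrow> nat" where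
  "nb E A v = card {u \<in> A. {u, v} \<in> E}"

lemma nb_real: "finite A \<Longrightarrow> real (nb E A v) = (\<Sum>u\<in>A. of_bool ({u, v} \<in> E))"
  by (simp add: nb_def of_bool_def sum.If_cases Int_def conj_commute)

lemma nb_mono: "finite B \<Longrightarrow> A \<subseteq> B \<Longrightarrow> nb E A v \<le> nb E B v"
  unfolding nb_def by (intro card_mono) auto

lemma nb_restrict: "finite R \<Longrightarrow> B \<subseteq> R \<Longrightarrow> real (nb E B v) = (\<Sum>u\<in>R. of_bool ({u, v} \<in> E) * of_bool (u \<in> B))"
  unfolding nb_real[OF finite_subset] by (intro sum.mono_neutral_cong_left) auto

lemma bern_nb:
  assumes "finite R" shows "bern R p (\<lambda>B. real (nb E B v)) = p * nb E R v"
proof -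
  have "bern R p (\<lambda>B. real (nb E B v)) = bern R p (\<lambda>B. \<Sum>u\<in>R. of_bool ({u, v} \<in> E) * of_bool (u \<in> B))"
    by (intro bern_cong nb_restrict assms)
  also have "\<dots> = (\<Sum>u\<in>R. of_bool ({u, v} \<in> E) * p)"
    unfolding bern_sum bern_cmult using assms by (intro sum.cong) (auto simp: bern_prob)
  finally show ?thesis using assms by (simp add: nb_real sum_distrib_right mult.commute)
qed

text \<open>The second factorial moment counts ordered pairs of distinct chosen neighbours, each
  present with probability \<open>p\<^sup>2\<close>; adding the diagonal pairs only enlarges the
  bound. It makes negligible that a tail vertex has several chosen neighbours in the head.\<close>

lemma bern_nb_square:
  assumes "finite R" "p \<ge> 0"
  shows "bern R p (\<lambda>B. real (nb E B v) * (real (nb E B v) - 1)) \<le> p\<^sup>2 * (real (nb E R v))\<^sup>2"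
proof -
  let ?a = "\<lambda>u. of_bool ({u, v} \<in> E) :: real"
  have eq: "real (nb E B v) * (real (nb E B v) - 1) =
      (\<Sum>u\<in>R. \<Sum>w\<in>R - {u}. ?a u * ?a w * of_bool (u \<in> B \<and> w \<in> B))" if "B \<subseteq> R" for B
  proof -
    have fB: "finite B" using that assms finite_subset by auto
    have "real (nb E B v) * (real (nb E B v) - 1) = (\<Sum>u\<in>R. ?a u * of_bool (u \<in> B) * (real (nb E B v) - 1))"
      using nb_restrict[OF assms(1) that, of E v] by (simp add: sum_distrib_right)
    also have "\<dots> = (\<Sum>u\<in>R. \<Sum>w\<in>R - {u}. ?a u * ?a w * of_bool (u \<in> B \<and> w \<in> B))"
    proof (intro sum.cong refl)
      fix u assume u: "u \<in> R"
      show "?a u * of_bool (u \<in> B) * (real (nb E B v) - 1) = (\<Sum>w\<in>R - {u}. ?a u * ?a w * of_bool (u \<in> B \<and> w \<in> B))"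
      proof (cases "{u, v} \<in> E \<and> u \<in> B")
        case True
        have "real (nb E B v) = 1 + (\<Sum>w\<in>R - {u}. ?a w * of_bool (w \<in> B))"
          using nb_restrict[OF assms(1) that, of E v] u True assms by (subst (asm) sum.remove[of _ u]) auto
        then show ?thesis using True by (simp add: sum_distrib_left)
      qed auto
    qed
    finally show ?thesis .
  qed
  have "bern R p (\<lambda>B. real (nb E B v) * (real (nb E B v) - 1)) =
     bern R p (\<lambda>B. \<Sum>u\<in>R. \<Sum>w\<in>R - {u}. ?a u * ?a w * of_bool (u \<in> B \<and> w \<in> B))"
    by (intro bern_cong eq)
  also have "\<dots> = (\<Sum>u\<in>R. \<Sum>w\<in>R - {u}. ?a u * ?a w * p\<^sup>2)"
    unfolding bern_sum bern_cmult using assms by (intro sum.cong refl) (subst bern_prob2, auto)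
  also have "\<dots> \<le> (\<Sum>u\<in>R. \<Sum>w\<in>R. ?a u * ?a w * p\<^sup>2)"
    using assms by (intro sum_mono sum_mono2) auto
  also have "\<dots> = p\<^sup>2 * (real (nb E R v))\<^sup>2"
  proof -
    have "(\<Sum>u\<in>R. \<Sum>w\<in>R. ?a u * ?a w * p\<^sup>2) = (\<Sum>u\<in>R. ?a u) * (\<Sum>w\<in>R. ?a w) * p\<^sup>2"
      by (subst sum_product) (simp only: sum_distrib_right)
    then show ?thesis unfolding nb_real[OF assms(1)] by (simp only: power2_eq_square mult_ac)
  qed
  finally show ?thesis .
qed

text \<open>Comparing powers only by whether the exponents agree turns differences of generating
  functions into probabilities that the insertion of a point changes a count.\<close>

lemma pow_diff_le:
  fixes x y :: real
  assumes "0 \<le> x" "x \<le> 1" "0 \<le> y" "y \<le> 1"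
  shows "\<bar>x ^ i * y ^ j - x ^ i' * y ^ j'\<bar> \<le> of_bool (i \<noteq> i' \<or> j \<noteq> j')"
proof -
  have "0 \<le> x ^ i * y ^ j" "x ^ i * y ^ j \<le> 1" "0 \<le> x ^ i' * y ^ j'" "x ^ i' * y ^ j' \<le> 1"
    using assms by (auto intro!: mult_le_one power_le_one)
  then show ?thesis by (auto simp: abs_le_iff)
qed

text \<open>The Mecke identity reduces the derivative of the generating function to the effect of adding one or
  two points, which is trivial unless these points have a neighbour among the chosen ones.\<close>

lemma bern_poisson_approx:
  fixes E :: "'v set set" and c :: "'v \<Rightarrow> nat"
  assumes R: "finite R" and E: "finite E" "\<And>e. e \<in> E \<Longrightarrow> card e = 2"
    and p: "0 \<le> p" "p \<le> 1" and s: "0 \<le> s" "s \<le> 1" "0 \<le> r" "r \<le> 1"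
  shows "\<bar>bern R p (\<lambda>B. (1 - s) ^ (\<Sum>v\<in>B. c v) * (1 - r) ^ ec E B)
      - exp (- (s * p * (\<Sum>v\<in>R. real (c v)) + r * p\<^sup>2 * real (ec E R)))\<bar>
    \<le> p * (\<Sum>v\<in>R. real (c v) * (p + (real (c v) - 1) + p * nb E R v))
      + p\<^sup>2 * (\<Sum>v\<in>R. real (nb E R v) * (p + real (c v) + p * nb E R v))"
proof -
  define ER where "ER = {e \<in> E. e \<subseteq> R}"
  have ER: "finite ER" "\<And>e. e \<in> ER \<Longrightarrow> card e = 2" "\<And>e. e \<in> ER \<Longrightarrow> e \<subseteq> R" "card ER = ec E R"
    using E by (auto simp: ER_def ec_def)
  define C where "C B = (\<Sum>v\<in>B. c v)" for B
  \<comment> \<open>The parameter \<open>t\<close> switches both marks on together: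
    \<open>g 0 = 1\<close>, while \<open>g 1\<close> is the expectation in question, and
    \<open>mu\<close> is the rate which the derivative should exhibit.\<close>
  define F where "F t i j = (1 - t * s) ^ i * (1 - t * r) ^ j" for t i j
  define g where "g t = bern R p (\<lambda>B. F t (C B) (ec E B))" for t
  define g' where "g' t = bern R p (\<lambda>B. - s * (real (C B) * F t (C B - 1) (ec E B)) - r * (real (ec E B) * F t (C B) (ec E B - 1)))" for t
  define mu where "mu = s * p * (\<Sum>v\<in>R. real (c v)) + r * p\<^sup>2 * real (ec E R)"
  define e1 where "e1 = p * (\<Sum>v\<in>R. real (c v) * (p + (real (c v) - 1) + p * nb E R v))"
  define e2 where "e2 = p\<^sup>2 * (\<Sum>v\<in>R. real (nb E R v) * (p + real (c v) + p * nb E R v))"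
  \<comment> \<open>The arguments after insertion of the end points of an edge, and of one vertex.
    The \<open>- 1\<close> stems from differentiating a power and should cancel the mark which the
    insertion brings.\<close>
  let ?Fe = "\<lambda>t e B. F t (C (e \<union> B)) (ec E (e \<union> B) - 1)"
  let ?Fv = "\<lambda>t v B. F t (C (insert v B) - 1) (ec E (insert v B))"
  \<comment> \<open>Truncated subtraction does no harm at exponent 0, where the factor in front
    vanishes.\<close>
  have dF: "((\<lambda>t. F t i j) has_real_derivative (- s * (real i * F t (i - 1) j) - r * (real j * F t i (j - 1)))) (at t)" for t i j
    unfolding F_def by (auto intro!: derivative_eq_intros simp: algebra_simps)
  have dg: "(g has_real_derivative g' t) (at t)" for t
    unfolding g_def g'_def bern_def by (auto intro!: derivative_eq_intros dF sum.cong)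
  have c1: "bern R p (\<lambda>B. real (C B) * F t (C B - 1) (ec E B)) = (\<Sum>v\<in>R. real (c v) * (p * bern R p (?Fv t v)))" for t
  proof -
    have "bern R p (\<lambda>B. real (C B) * F t (C B - 1) (ec E B)) = bern R p (\<lambda>B. \<Sum>v\<in>R. real (c v) * (of_bool (v \<in> B) * F t (C B - 1) (ec E B)))"
    proof (rule bern_cong)
      fix B assume "B \<subseteq> R"
      then have "real (C B) = (\<Sum>v\<in>R. real (c v) * of_bool (v \<in> B))"
        unfolding C_def of_nat_sum using R by (intro sum.mono_neutral_cong_left) auto
      then show "real (C B) * F t (C B - 1) (ec E B) = (\<Sum>v\<in>R. real (c v) * (of_bool (v \<in> B) * F t (C B - 1) (ec E B)))"
        by (simp only: sum_distrib_right mult.assoc)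
    qed
    then show ?thesis unfolding bern_sum bern_cmult using R by (simp add: bern_mem)
  qed
  have c2: "bern R p (\<lambda>B. real (ec E B) * F t (C B) (ec E B - 1)) = (\<Sum>e\<in>ER. p\<^sup>2 * bern R p (?Fe t e))" for t
  proof -
    have "bern R p (\<lambda>B. real (ec E B) * F t (C B) (ec E B - 1)) = bern R p (\<lambda>B. \<Sum>e\<in>ER. of_bool (e \<subseteq> B) * F t (C B) (ec E B - 1))"
    proof (rule bern_cong)
      fix B assume "B \<subseteq> R"
      then have "{e \<in> E. e \<subseteq> B} = {e \<in> ER. e \<subseteq> B}" by (auto simp: ER_def)
      then have "real (ec E B) = (\<Sum>e\<in>ER. of_bool (e \<subseteq> B))"
        using ER(1) by (simp add: ec_def of_bool_def sum.If_cases Int_def)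
      then show "real (ec E B) * F t (C B) (ec E B - 1) = (\<Sum>e\<in>ER. of_bool (e \<subseteq> B) * F t (C B) (ec E B - 1))"
        by (simp add: sum_distrib_right)
    qed
    also have "\<dots> = (\<Sum>e\<in>ER. p\<^sup>2 * bern R p (?Fe t e))"
      unfolding bern_sum
    proof (intro sum.cong refl)
      fix e assume e: "e \<in> ER"
      then obtain u v where uv: "e = {u, v}" "u \<noteq> v" using ER(2)[OF e] by (auto simp: card_2_iff)
      show "bern R p (\<lambda>B. of_bool (e \<subseteq> B) * F t (C B) (ec E B - 1)) = p\<^sup>2 * bern R p (?Fe t e)"
        using bern_mem2[OF R _ _ uv(2), of p "\<lambda>B. F t (C B) (ec E B - 1)"] ER(3)[OF e] uv by simp
    qed
    finally show ?thesis .
  qed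
  have err: "\<bar>g' t + mu * g t\<bar> \<le> e1 + e2" if t: "0 \<le> t" "t \<le> 1" for t
  proof -
    have xy: "0 \<le> 1 - t * s" "1 - t * s \<le> 1" "0 \<le> 1 - t * r" "1 - t * r \<le> 1"
      using t s mult_le_one[of t s] mult_le_one[of t r] by auto
    have FF: "\<bar>F t i j - F t i' j'\<bar> \<le> of_bool (i \<noteq> i' \<or> j \<noteq> j')" for i j i' j'
      unfolding F_def by (rule pow_diff_le[OF xy])
    \<comment> \<open>For \<open>c v = 0\<close> the weight vanishes. Otherwise
      \<open>c v - 1\<close> dominates the event that \<open>c v\<close> is not 1; outside it, a new
      \<open>v\<close> without chosen neighbours adds exactly the one mark that was taken off, and
      no edge.\<close>
    have d1: "real (c v) * \<bar>bern R p (?Fv t v) - g t\<bar> \<le> real (c v) * (p + (real (c v) - 1) + p * nb E R v)"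
      if v: "v \<in> R" for v
    proof (cases "c v = 0")
      case False
      have "\<bar>bern R p (?Fv t v) - g t\<bar> =
         \<bar>bern R p (\<lambda>B. F t (C (insert v B) - 1) (ec E (insert v B)) - F t (C B) (ec E B))\<bar>"
        by (simp add: bern_diff g_def)
      also have "\<dots> \<le> bern R p (\<lambda>B. \<bar>F t (C (insert v B) - 1) (ec E (insert v B)) - F t (C B) (ec E B)\<bar>)"
        by (rule bern_abs[OF p])
      also have "\<dots> \<le> bern R p (\<lambda>B. of_bool (v \<in> B) + (real (c v) - 1) + real (nb E B v))"
      proof (rule bern_mono[OF p])
        fix B assume B: "B \<subseteq> R"
        have fB: "finite B" using B R finite_subset by auto
        have "of_bool (C (insert v B) - 1 \<noteq> C B \<or> ec E (insert v B) \<noteq> ec E B) \<le> of_bool (v \<in> B) + (real (c v) - 1) + real (nb E B v)"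
        proof (cases "v \<in> B \<or> c v \<noteq> 1 \<or> nb E B v \<noteq> 0")
          case True
          then show ?thesis using False by (auto simp: of_bool_def)
        next
          case F: False
          then have 1: "C (insert v B) - 1 = C B" using fB by (simp add: C_def)
          have no: "{u, v} \<notin> E" if "u \<in> B" for u
            using F fB that by (auto simp: nb_def)
          have "{e \<in> E. e \<subseteq> insert v B} = {e \<in> E. e \<subseteq> B}"
          proof (intro Collect_cong conj_cong refl)
            fix e assume e: "e \<in> E"
            then obtain a b where ab: "e = {a, b}" "a \<noteq> b" using E(2)[OF e] by (auto simp: card_2_iff)
            show "e \<subseteq> insert v B \<longleftrightarrow> e \<subseteq> B"
              using no[of a] no[of b] e ab by (auto simp: insert_commute)
          qed
          then have "ec E (insert v B) = ec E B" by (simp add: ec_def)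
          then show ?thesis using 1 F by simp
        qed
        then show "\<bar>F t (C (insert v B) - 1) (ec E (insert v B)) - F t (C B) (ec E B)\<bar> \<le> of_bool (v \<in> B) + (real (c v) - 1) + real (nb E B v)"
          using FF order_trans by blast
      qed
      also have "\<dots> = p + (real (c v) - 1) + p * nb E R v"
        by (simp only: bern_add bern_const[OF R] bern_prob[OF R v] bern_nb[OF R])
      finally show ?thesis by (intro mult_left_mono) auto
    qed simp
    \<comment> \<open>If no end point of \<open>e\<close> is chosen, has a mark or has a chosen
      neighbour, then \<open>e\<close> itself is the only new edge, and it is the one taken off. All
      other cases are paid for by a union bound over the two end points.\<close>
    have d2: "\<bar>bern R p (?Fe t e) - g t\<bar> \<le> (\<Sum>v\<in>e. p + real (c v) + p * nb E R v)"
      if e: "e \<in> ER" for e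
    proof -
      have eR: "e \<subseteq> R" "e \<in> E" using e by (auto simp: ER_def)
      have fe: "finite e" using eR(1) R by (rule finite_subset)
      obtain u v where uv: "e = {u, v}" "u \<noteq> v" using ER(2)[OF e] by (auto simp: card_2_iff)
      have "\<bar>bern R p (?Fe t e) - g t\<bar> =
         \<bar>bern R p (\<lambda>B. F t (C (e \<union> B)) (ec E (e \<union> B) - 1) - F t (C B) (ec E B))\<bar>"
        by (simp add: bern_diff g_def)
      also have "\<dots> \<le> bern R p (\<lambda>B. \<bar>F t (C (e \<union> B)) (ec E (e \<union> B) - 1) - F t (C B) (ec E B)\<bar>)"
        by (rule bern_abs[OF p])
      also have "\<dots> \<le> bern R p (\<lambda>B. \<Sum>v\<in>e. of_bool (v \<in> B) + real (c v) + real (nb E B v))"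
      proof (rule bern_mono[OF p])
        fix B assume B: "B \<subseteq> R"
        have fB: "finite B" using B R finite_subset by auto
        have "of_bool (C (e \<union> B) \<noteq> C B \<or> ec E (e \<union> B) - 1 \<noteq> ec E B) \<le> (\<Sum>v\<in>e. of_bool (v \<in> B) + real (c v) + real (nb E B v))"
        proof (cases "\<forall>v\<in>e. v \<notin> B \<and> c v = 0 \<and> nb E B v = 0")
          case True
          then have "C (e \<union> B) = C B"
            unfolding C_def using fe fB by (subst sum.union_disjoint) auto
          moreover have "ec E (e \<union> B) = Suc (ec E B)"
          proof -
            have no: "{a, b} \<notin> E" "{b, a} \<notin> E" if "a \<in> B" "b \<in> e" for a b
              using True fB that by (auto simp: nb_def insert_commute)
            have "{e' \<in> E. e' \<subseteq> e \<union> B} = insert e {e' \<in> E. e' \<subseteq> B}"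
            proof (intro set_eqI iffI)
              fix e' assume e': "e' \<in> {e' \<in> E. e' \<subseteq> e \<union> B}"
              then obtain a b where ab: "e' = {a, b}" "a \<noteq> b" using E(2)[of e'] by (auto simp: card_2_iff)
              show "e' \<in> insert e {e' \<in> E. e' \<subseteq> B}"
                using e' ab uv no[of a b] no[of b a] by auto
            qed (use eR in auto)
            moreover have "e \<notin> {e' \<in> E. e' \<subseteq> B}" using True uv by auto
            ultimately show ?thesis using E(1) by (simp add: ec_def)
          qed
          ultimately show ?thesis by (simp add: sum_nonneg)
        next
          case False
          then obtain w where w: "w \<in> e" "w \<in> B \<or> c w \<noteq> 0 \<or> nb E B w \<noteq> 0" by auto
          have "of_bool (C (e \<union> B) \<noteq> C B \<or> ec E (e \<union> B) - 1 \<noteq> ec E B) \<le> of_bool (w \<in> B) + real (c w) + real (nb E B w)"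
            using w(2) by (auto simp: of_bool_def)
          also have "\<dots> \<le> (\<Sum>v\<in>e. of_bool (v \<in> B) + real (c v) + real (nb E B v))"
            using w(1) fe by (intro member_le_sum) auto
          finally show ?thesis .
        qed
        then show "\<bar>F t (C (e \<union> B)) (ec E (e \<union> B) - 1) - F t (C B) (ec E B)\<bar> \<le> (\<Sum>v\<in>e. of_bool (v \<in> B) + real (c v) + real (nb E B v))"
          using FF order_trans by blast
      qed
      also have "\<dots> = (\<Sum>v\<in>e. p + real (c v) + p * nb E R v)"
        unfolding bern_sum using eR by (intro sum.cong refl) (simp add: bern_add bern_const[OF R] bern_prob[OF R] bern_nb[OF R] subsetD)
      finally show ?thesis .
    qed
    \<comment> \<open>Handshake counting: \<open>v\<close> is an end point of
      \<open>nb E R v\<close> edges inside \<open>R\<close>.\<close>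
    have swap: "(\<Sum>e\<in>ER. \<Sum>v\<in>e. f v) = (\<Sum>v\<in>R. real (nb E R v) * f v)" for f :: "'v \<Rightarrow> real"
    proof -
      have "(\<Sum>e\<in>ER. \<Sum>v\<in>e. f v) = (\<Sum>e\<in>ER. \<Sum>v\<in>R. of_bool (v \<in> e) * f v)"
        using ER(3) R by (intro sum.cong refl sum.mono_neutral_cong_left) auto
      also have "\<dots> = (\<Sum>v\<in>R. (\<Sum>e\<in>ER. of_bool (v \<in> e)) * f v)"
        by (subst sum.swap) (simp add: sum_distrib_right)
      also have "\<dots> = (\<Sum>v\<in>R. real (nb E R v) * f v)"
      proof (intro sum.cong refl)
        fix v assume v: "v \<in> R"
        have "bij_betw (\<lambda>u. {u, v}) {u \<in> R. {u, v} \<in> E} {e \<in> ER. v \<in> e}"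
          unfolding bij_betw_def
        proof
          show "inj_on (\<lambda>u. {u, v}) {u \<in> R. {u, v} \<in> E}"
            by (auto simp: inj_on_def doubleton_eq_iff)
          show "(\<lambda>u. {u, v}) ` {u \<in> R. {u, v} \<in> E} = {e \<in> ER. v \<in> e}"
          proof (intro set_eqI iffI)
            fix e assume e: "e \<in> {e \<in> ER. v \<in> e}"
            then obtain a b where ab: "e = {a, b}" "a \<noteq> b" using ER(2)[of e] by (auto simp: card_2_iff)
            show "e \<in> (\<lambda>u. {u, v}) ` {u \<in> R. {u, v} \<in> E}"
              using e ab unfolding ER_def by (auto simp: insert_commute)
          qed (use v in \<open>auto simp: ER_def\<close>)
        qed
        then have "nb E R v = card {e \<in> ER. v \<in> e}" unfolding nb_def by (rule bij_betw_same_card)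
        then show "(\<Sum>e\<in>ER. of_bool (v \<in> e)) * f v = real (nb E R v) * f v"
          using ER(1) by (simp add: of_bool_def sum.If_cases Int_def)
      qed
      finally show ?thesis .
    qed
    have "g' t + mu * g t = - s * p * (\<Sum>v\<in>R. real (c v) * (bern R p (?Fv t v) - g t))
        - r * p\<^sup>2 * (\<Sum>e\<in>ER. bern R p (?Fe t e) - g t)"
      unfolding g'_def bern_diff bern_cmult c1 c2
      by (simp add: mu_def sum_subtractf right_diff_distrib ER(4) sum_distrib_left sum_distrib_right sum_negf algebra_simps)
    also have "\<bar>\<dots>\<bar> \<le> s * p * (\<Sum>v\<in>R. real (c v) * \<bar>bern R p (?Fv t v) - g t\<bar>)
        + r * p\<^sup>2 * (\<Sum>e\<in>ER. \<bar>bern R p (?Fe t e) - g t\<bar>)"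
    proof -
      have tri: "\<bar>- s * p * a - r * p\<^sup>2 * b\<bar> \<le> s * p * a' + r * p\<^sup>2 * b'" if "\<bar>a\<bar> \<le> a'" "\<bar>b\<bar> \<le> b'" for a b a' b'
      proof -
        have "\<bar>- s * p * a - r * p\<^sup>2 * b\<bar> \<le> \<bar>- s * p * a\<bar> + \<bar>r * p\<^sup>2 * b\<bar>" by (rule abs_triangle_ineq4)
        also have "\<dots> = (s * p) * \<bar>a\<bar> + (r * p\<^sup>2) * \<bar>b\<bar>" using s p by (simp add: abs_mult)
        also have "\<dots> \<le> (s * p) * a' + (r * p\<^sup>2) * b'" using s p that by (intro add_mono mult_left_mono) auto
        finally show ?thesis .
      qed
      show ?thesis
        by (rule tri) (auto intro!: order_trans[OF sum_abs] sum_mono simp: abs_mult)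
    qed
    also have "\<dots> \<le> 1 * p * (\<Sum>v\<in>R. real (c v) * (p + (real (c v) - 1) + p * nb E R v))
        + 1 * p\<^sup>2 * (\<Sum>e\<in>ER. \<Sum>v\<in>e. p + real (c v) + p * nb E R v)"
      by (intro add_mono mult_mono sum_mono d1 d2) (use s p in \<open>auto intro!: sum_nonneg\<close>)
    also have "\<dots> = e1 + e2" by (simp add: e1_def e2_def swap)
    finally show ?thesis .
  qed
  have "\<bar>g 1 - exp (- mu)\<bar> \<le> e1 + e2"
  proof (rule exp_ode_bound[OF dg err])
    show "mu \<ge> 0" unfolding mu_def using s p by (auto intro!: add_nonneg_nonneg mult_nonneg_nonneg sum_nonneg)
    show "g 0 = 1" by (simp add: g_def F_def bern_const[OF R])
  qed
  then show ?thesis by (simp add: g_def F_def C_def mu_def e1_def e2_def)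
qed

section \<open>Cut norm perturbation of the dense part\<close>

definition pairs :: "nat set \<Rightarrow> (nat \<times> nat) set" where
  "pairs A = {(u, v). u \<in> A \<and> v \<in> A \<and> u < v}"

text \<open>The weight of a chosen head set \<open>A\<close> after the tail has been averaged out.
  For \<open>w = adj E\<close> the first product is \<open>(1 - s) ^ ec E A\<close>; the factor
  \<open>th u\<close> carries the effect of the tail neighbours of \<open>u\<close>. Since the
  product is affine in each kernel value, fractional \<open>w\<close> make sense as well.\<close>

definition Psi :: "real \<Rightarrow> (nat \<Rightarrow> nat \<Rightarrow> real) \<Rightarrow> (nat \<Rightarrow> real) \<Rightarrow> nat set \<Rightarrow> real" where
  "Psi s w th A = (\<Prod>(u, v)\<in>pairs A. 1 - s * w u v) * (\<Prod>u\<in>A. th u)"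

lemma finite_pairs [simp]: "finite A \<Longrightarrow> finite (pairs A)"
  by (rule finite_subset[of _ "A \<times> A"]) (auto simp: pairs_def)

lemma prod_pairs_insert:
  fixes q :: "nat \<Rightarrow> nat \<Rightarrow> real"
  assumes "finite A" "u \<notin> A" "\<And>v. v \<in> A \<Longrightarrow> q u v = q v u"
  shows "(\<Prod>(x, y)\<in>pairs (insert u A). q x y) = (\<Prod>(x, y)\<in>pairs A. q x y) * (\<Prod>v\<in>A. q u v)"
proof -
  let ?h = "\<lambda>v. if u < v then (u, v) else (v, u)"
  have eq: "pairs (insert u A) = pairs A \<union> ?h ` A"
    using assms(2) by (auto simp: pairs_def image_iff) (metis linorder_neqE_nat)
  have inj: "inj_on ?h A" by (auto simp: inj_on_def split: if_splits)
  have "(\<Prod>(x, y)\<in>pairs (insert u A). q x y) = (\<Prod>(x, y)\<in>pairs A. q x y) * (\<Prod>(x, y)\<in>?h ` A. q x y)"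
    unfolding eq using assms by (intro prod.union_disjoint finite_pairs finite_imageI) (auto simp: pairs_def)
  also have "(\<Prod>(x, y)\<in>?h ` A. q x y) = (\<Prod>v\<in>A. q u v)"
    unfolding prod.reindex[OF inj] o_def using assms by (intro prod.cong) auto
  finally show ?thesis .
qed

lemma sum_pairs_sym:
  fixes F :: "nat \<Rightarrow> nat \<Rightarrow> real"
  assumes "finite A" "\<And>u v. u \<in> A \<Longrightarrow> v \<in> A \<Longrightarrow> F u v = F v u" "\<And>u. u \<in> A \<Longrightarrow> F u u = 0"
  shows "(\<Sum>u\<in>A. \<Sum>v\<in>A. F u v) = 2 * (\<Sum>(u, v)\<in>pairs A. F u v)"
proof -
  have eq: "A \<times> A = pairs A \<union> prod.swap ` pairs A \<union> (\<lambda>u. (u, u)) ` A"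
    by (auto simp: pairs_def image_iff)
  have "(\<Sum>u\<in>A. \<Sum>v\<in>A. F u v) = (\<Sum>(u, v)\<in>A \<times> A. F u v)"
    by (simp add: sum.cartesian_product)
  also have "\<dots> = (\<Sum>(u, v)\<in>pairs A. F u v) + (\<Sum>(u, v)\<in>prod.swap ` pairs A. F u v) + (\<Sum>(u, v)\<in>(\<lambda>u. (u, u)) ` A. F u v)"
  proof -
    have "(\<Sum>(u, v)\<in>pairs A \<union> prod.swap ` pairs A \<union> (\<lambda>u. (u, u)) ` A. F u v) =
       (\<Sum>(u, v)\<in>pairs A \<union> prod.swap ` pairs A. F u v) + (\<Sum>(u, v)\<in>(\<lambda>u. (u, u)) ` A. F u v)"
      using assms(1) by (intro sum.union_disjoint finite_UnI finite_imageI finite_pairs) (auto simp: pairs_def)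
    also have "(\<Sum>(u, v)\<in>pairs A \<union> prod.swap ` pairs A. F u v) = (\<Sum>(u, v)\<in>pairs A. F u v) + (\<Sum>(u, v)\<in>prod.swap ` pairs A. F u v)"
      using assms(1) by (intro sum.union_disjoint finite_UnI finite_imageI finite_pairs) (auto simp: pairs_def)
    finally show ?thesis unfolding eq .
  qed
  also have "(\<Sum>(u, v)\<in>prod.swap ` pairs A. F u v) = (\<Sum>(u, v)\<in>pairs A. F u v)"
    by (subst sum.reindex) (auto simp: inj_on_def pairs_def assms(2) intro!: sum.cong)
  also have "(\<Sum>(u, v)\<in>(\<lambda>u. (u, u)) ` A. F u v) = 0"
    by (intro sum.neutral) (auto simp: assms(3))
  finally show ?thesis by simp
qed

lemma Psi_bounds:
  assumes "finite A" "0 \<le> s" "s \<le> 1" "\<And>u v. u \<in> A \<Longrightarrow> v \<in> A \<Longrightarrow> 0 \<le> w u v \<and> w u v \<le> 1"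
    "\<And>u. u \<in> A \<Longrightarrow> 0 \<le> th u \<and> th u \<le> 1"
  shows "0 \<le> Psi s w th A" "Psi s w th A \<le> 1"
proof -
  have q: "0 \<le> 1 - s * w u v \<and> 1 - s * w u v \<le> 1" if "u \<in> A" "v \<in> A" for u v
    using assms(2,3) assms(4)[OF that] mult_le_one[of s "w u v"] by auto
  have 1: "0 \<le> (\<Prod>(u, v)\<in>pairs A. 1 - s * w u v)" "(\<Prod>(u, v)\<in>pairs A. 1 - s * w u v) \<le> 1"
    using q by (auto intro!: prod_nonneg prod_le_1 simp: pairs_def)
  have 2: "0 \<le> (\<Prod>u\<in>A. th u)" "(\<Prod>u\<in>A. th u) \<le> 1"
    using assms(5) by (auto intro!: prod_nonneg prod_le_1)
  show "0 \<le> Psi s w th A" "Psi s w th A \<le> 1"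
    unfolding Psi_def using 1 2 by (auto intro!: mult_le_one)
qed

text \<open>In the derivative along the segment from \<open>w0\<close> to \<open>w1\<close>, conditioning on the two end points \<open>u\<close> and \<open>v\<close> of
  the differentiated pair leaves a function of the form \<open>f(u) f(v)\<close>, to which the cut norm applies.\<close>

lemma bern_Psi_cut:
  fixes H :: "nat set" and w0 w1 :: "nat \<Rightarrow> nat \<Rightarrow> real" and th :: "nat \<Rightarrow> real"
  assumes H: "finite H" and p: "0 \<le> p" "p \<le> 1" and s: "0 \<le> s" "s \<le> 1"
    and w0: "\<And>u v. u \<in> H \<Longrightarrow> v \<in> H \<Longrightarrow> 0 \<le> w0 u v \<and> w0 u v \<le> 1 \<and> w0 u v = w0 v u \<and> w0 u u = 0"
    and w1: "\<And>u v. u \<in> H \<Longrightarrow> v \<in> H \<Longrightarrow> 0 \<le> w1 u v \<and> w1 u v \<le> 1 \<and> w1 u v = w1 v u \<and> w1 u u = 0"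
    and th: "\<And>u. u \<in> H \<Longrightarrow> 0 \<le> th u \<and> th u \<le> 1"
    and cut: "\<And>f. (\<And>u. u \<in> H \<Longrightarrow> 0 \<le> f u \<and> f u \<le> 1) \<Longrightarrow>
        \<bar>p\<^sup>2 * (\<Sum>u\<in>H. \<Sum>v\<in>H. (w1 u v - w0 u v) * f u * f v)\<bar> \<le> \<kappa>"
  shows "\<bar>bern H p (Psi s w1 th) - bern H p (Psi s w0 th)\<bar> \<le> \<kappa> + 2 * p ^ 3 * (real (card H))\<^sup>2"
proof -
  define dw where "dw u v = w1 u v - w0 u v" for u v
  define wt where "wt t u v = w0 u v + t * dw u v" for t u v
  define q where "q t u v = 1 - s * wt t u v" for t u v
  \<comment> \<open>The weight with the factor of one pair left out: the derivative of that affine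
    factor is the constant \<open>- s * dw u v\<close>.\<close>
  define G where "G t u v A = (\<Prod>(x, y)\<in>pairs A - {(u, v)}. q t x y) * (\<Prod>u\<in>A. th u)" for t u v A
  define g where "g t = bern H p (Psi s (wt t) th)" for t
  define g' where "g' t = bern H p (\<lambda>A. (\<Sum>(u, v)\<in>pairs A. - s * dw u v * (\<Prod>(x, y)\<in>pairs A - {(u, v)}. q t x y)) * (\<Prod>u\<in>A. th u))" for t
  have dq: "((\<lambda>t. q t u v) has_real_derivative - s * dw u v) (at t)" for t u v
    unfolding q_def wt_def by (auto intro!: derivative_eq_intros)
  have dPi: "((\<lambda>t. \<Prod>z\<in>pairs A. case z of (u, v) \<Rightarrow> q t u v) has_real_derivative
       (\<Sum>z\<in>pairs A. (case z of (u, v) \<Rightarrow> - s * dw u v) * (\<Prod>z'\<in>pairs A - {z}. case z' of (x, y) \<Rightarrow> q t x y))) (at t)" for t A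
    by (rule has_field_derivative_prod) (use dq in auto)
  have dg: "(g has_real_derivative g' t) (at t)" for t
    unfolding g_def g'_def bern_def Psi_def q_def[symmetric]
    by (rule derivative_eq_intros refl dPi)+ (auto intro!: sum.cong simp: case_prod_unfold sum_distrib_right sum_distrib_left mult_ac)
  have bound: "\<bar>g' t\<bar> \<le> \<kappa> + 2 * p ^ 3 * (real (card H))\<^sup>2" if t: "0 \<le> t" "t \<le> 1" for t
  proof -
    have wt: "0 \<le> wt t u v \<and> wt t u v \<le> 1 \<and> wt t u v = wt t v u \<and> wt t u u = 0" if "u \<in> H" "v \<in> H" for u v
    proof -
      have "wt t u v = (1 - t) * w0 u v + t * w1 u v" by (simp add: wt_def dw_def algebra_simps)
      moreover have "(1 - t) * w0 u v + t * w1 u v \<le> (1 - t) * 1 + t * 1"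
        using t w0[OF that] w1[OF that] by (intro add_mono mult_left_mono) auto
      moreover have "0 \<le> (1 - t) * w0 u v + t * w1 u v"
        using t w0[OF that] w1[OF that] by (intro add_nonneg_nonneg mult_nonneg_nonneg) auto
      moreover have "w0 u v = w0 v u" "w1 u v = w1 v u" "w0 u u = 0" "w1 u u = 0"
        using w0[OF that] w1[OF that] by blast+
      ultimately show ?thesis by (simp add: wt_def dw_def)
    qed
    have q: "0 \<le> q t u v \<and> q t u v \<le> 1 \<and> q t u v = q t v u" if "u \<in> H" "v \<in> H" for u v
      using wt[OF that] s mult_le_one[of s "wt t u v"] by (auto simp: q_def)
    \<comment> \<open>\<open>f A u\<close> is the factor by which a new point \<open>u\<close>
      multiplies the weight of \<open>A\<close>. For fixed \<open>A\<close> it is a function of a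
      single vertex with values in [0, 1], hence an admissible test function in the hypothesis on
      \<open>\<kappa>\<close>.\<close>
    define f where "f A u = th u * (\<Prod>w\<in>A. q t u w)" for A u
    let ?d = "\<lambda>A. \<Sum>z\<in>pairs H. dw (fst z) (snd z) * f A (fst z) * f A (snd z)"
    let ?g = "\<lambda>z A. G t (fst z) (snd z) (insert (fst z) (insert (snd z) A))"
    let ?h = "\<lambda>z A. Psi s (wt t) th A * f A (fst z) * f A (snd z)"
    have f01: "0 \<le> f A u \<and> f A u \<le> 1" if "A \<subseteq> H" "u \<in> H" for A u
      unfolding f_def using that th q by (auto intro!: mult_le_one mult_nonneg_nonneg prod_nonneg prod_le_1 dest: subsetD)
    have Psi01: "0 \<le> Psi s (wt t) th A \<and> Psi s (wt t) th A \<le> 1" if "A \<subseteq> H" for A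
    proof -
      have "finite A" using that H finite_subset by auto
      then show ?thesis using Psi_bounds[of A s "wt t" th] s wt th that by (simp add: subset_iff)
    qed
    have G01: "0 \<le> G t u v A \<and> G t u v A \<le> 1" if "A \<subseteq> H" for A u v
    proof -
      have "0 \<le> (\<Prod>(x, y)\<in>pairs A - {(u, v)}. q t x y) \<and> (\<Prod>(x, y)\<in>pairs A - {(u, v)}. q t x y) \<le> 1"
        using that q by (auto intro!: prod_nonneg prod_le_1 simp: pairs_def dest: subsetD)
      moreover have "0 \<le> (\<Prod>u\<in>A. th u) \<and> (\<Prod>u\<in>A. th u) \<le> 1"
        using that th by (auto intro!: prod_nonneg prod_le_1 dest: subsetD)
      ultimately show ?thesis unfolding G_def by (auto intro!: mult_le_one)
    qed
    have Gins: "G t u v (insert u (insert v A)) = Psi s (wt t) th A * f A u * f A v"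
      if A: "A \<subseteq> H" and uv: "u \<in> H" "v \<in> H" "u < v" "u \<notin> A" "v \<notin> A" for u v A
    proof -
      \<comment> \<open>Giving the pair \<open>{u, v}\<close> the factor 1 has the effect of leaving
        it out, and lets the recursion for products over pairs insert the two points one after the
        other.\<close>
      define q' where "q' x y = (if {x, y} = {u, v} then 1 else q t x y)" for x y
      have fA: "finite A" using A H finite_subset by auto
      let ?B = "insert u (insert v A)"
      have uvB: "(u, v) \<in> pairs ?B" using uv by (auto simp: pairs_def)
      have "(\<Prod>(x, y)\<in>pairs ?B - {(u, v)}. q t x y) = (\<Prod>(x, y)\<in>pairs ?B - {(u, v)}. q' x y)"
        using uv by (intro prod.cong refl) (auto simp: q'_def pairs_def doubleton_eq_iff split: if_splits)
      also have "\<dots> = (\<Prod>(x, y)\<in>pairs ?B. q' x y)"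
        using fA uvB by (subst prod.remove[of "pairs ?B" "(u, v)"]) (auto simp: q'_def)
      also have "\<dots> = (\<Prod>(x, y)\<in>pairs (insert v A). q' x y) * (\<Prod>y\<in>insert v A. q' u y)"
        using fA uv A q by (intro prod_pairs_insert) (auto simp: q'_def insert_commute dest: subsetD)
      also have "(\<Prod>(x, y)\<in>pairs (insert v A). q' x y) = (\<Prod>(x, y)\<in>pairs A. q' x y) * (\<Prod>y\<in>A. q' v y)"
        using fA uv A q by (intro prod_pairs_insert) (auto simp: q'_def insert_commute dest: subsetD)
      also have "(\<Prod>y\<in>insert v A. q' u y) = (\<Prod>y\<in>A. q' u y)"
        using fA uv by (simp add: q'_def)
      also have "(\<Prod>y\<in>A. q' u y) = (\<Prod>y\<in>A. q t u y)"
        using uv by (intro prod.cong) (auto simp: q'_def doubleton_eq_iff)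
      also have "(\<Prod>y\<in>A. q' v y) = (\<Prod>y\<in>A. q t v y)"
        using uv by (intro prod.cong) (auto simp: q'_def doubleton_eq_iff)
      also have "(\<Prod>(x, y)\<in>pairs A. q' x y) = (\<Prod>(x, y)\<in>pairs A. q t x y)"
        using uv by (intro prod.cong) (auto simp: q'_def pairs_def doubleton_eq_iff)
      finally show ?thesis using fA uv by (simp add: G_def Psi_def f_def q_def)
    qed
    \<comment> \<open>The product form fails only if \<open>u\<close> or \<open>v\<close> is already
      in \<open>A\<close>, which has probability at most \<open>2 * p\<close>. Together with the
      weight \<open>p\<^sup>2\<close> of the pair this is the term \<open>2 * p ^ 3\<close> per
      pair.\<close>
    have main: "\<bar>bern H p (\<lambda>A. G t u v (insert u (insert v A))) - bern H p (\<lambda>A. Psi s (wt t) th A * f A u * f A v)\<bar> \<le> 2 * p"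
      if uv: "u \<in> H" "v \<in> H" "u < v" for u v
    proof -
      have "\<bar>bern H p (\<lambda>A. G t u v (insert u (insert v A))) - bern H p (\<lambda>A. Psi s (wt t) th A * f A u * f A v)\<bar>
          \<le> bern H p (\<lambda>A. \<bar>G t u v (insert u (insert v A)) - Psi s (wt t) th A * f A u * f A v\<bar>)"
        unfolding bern_diff[symmetric] by (rule bern_abs[OF p])
      also have "\<dots> \<le> bern H p (\<lambda>A. of_bool (u \<in> A) + of_bool (v \<in> A))"
      proof (rule bern_mono[OF p])
        fix A assume A: "A \<subseteq> H"
        show "\<bar>G t u v (insert u (insert v A)) - Psi s (wt t) th A * f A u * f A v\<bar> \<le> of_bool (u \<in> A) + of_bool (v \<in> A)"
        proof (cases "u \<in> A \<or> v \<in> A")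
          case True
          have "0 \<le> Psi s (wt t) th A * f A u * f A v \<and> Psi s (wt t) th A * f A u * f A v \<le> 1"
            using Psi01[OF A] f01[OF A uv(1)] f01[OF A uv(2)] by (auto intro!: mult_le_one)
          moreover have "insert u (insert v A) \<subseteq> H" using A uv by auto
          ultimately have "\<bar>G t u v (insert u (insert v A)) - Psi s (wt t) th A * f A u * f A v\<bar> \<le> 1"
            using G01[of "insert u (insert v A)" u v] by (auto simp: abs_le_iff)
          also have "1 \<le> (of_bool (u \<in> A) + of_bool (v \<in> A) :: real)" using True by auto
          finally show ?thesis .
        qed (use Gins A uv in auto)
      qed
      also have "\<dots> = 2 * p" using uv H by (simp add: bern_add bern_prob)
      finally show ?thesis .
    qed
    have "g' t = bern H p (\<lambda>A. \<Sum>z\<in>pairs H. - s * dw (fst z) (snd z) * (of_bool (fst z \<in> A \<and> snd z \<in> A) * G t (fst z) (snd z) A))"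
      unfolding g'_def
    proof (rule bern_cong)
      fix A assume A: "A \<subseteq> H"
      have "(\<Sum>z\<in>pairs H. - s * dw (fst z) (snd z) * (of_bool (fst z \<in> A \<and> snd z \<in> A) * G t (fst z) (snd z) A))
        = (\<Sum>z\<in>pairs A. - s * dw (fst z) (snd z) * G t (fst z) (snd z) A)"
        using H A by (intro sum.mono_neutral_cong_right finite_pairs) (auto simp: pairs_def)
      then show "(\<Sum>(u, v)\<in>pairs A. - s * dw u v * (\<Prod>(x, y)\<in>pairs A - {(u, v)}. q t x y)) * (\<Prod>u\<in>A. th u) =
         (\<Sum>z\<in>pairs H. - s * dw (fst z) (snd z) * (of_bool (fst z \<in> A \<and> snd z \<in> A) * G t (fst z) (snd z) A))"
        unfolding G_def sum_distrib_right by (simp only: case_prod_unfold mult.assoc)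
    qed
    also have "\<dots> = (\<Sum>z\<in>pairs H. - s * dw (fst z) (snd z) * (p\<^sup>2 * bern H p (?g z)))"
      unfolding bern_sum bern_cmult using H by (intro sum.cong refl) (subst bern_mem2, auto simp: pairs_def)
    also have "\<dots> = (\<Sum>z\<in>pairs H. - s * dw (fst z) (snd z) * (p\<^sup>2 * (bern H p (?g z)
            - bern H p (?h z))))
        - s * bern H p (\<lambda>A. Psi s (wt t) th A * (p\<^sup>2 * ?d A))"
    proof -
      have "bern H p (\<lambda>A. Psi s (wt t) th A * (p\<^sup>2 * ?d A)) =
         bern H p (\<lambda>A. \<Sum>z\<in>pairs H. (p\<^sup>2 * dw (fst z) (snd z)) * (Psi s (wt t) th A * f A (fst z) * f A (snd z)))"
        by (intro bern_cong) (simp add: sum_distrib_left mult_ac)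
      also have "\<dots> = (\<Sum>z\<in>pairs H. (p\<^sup>2 * dw (fst z) (snd z)) * bern H p (?h z))"
        by (simp only: bern_sum bern_cmult)
      finally show ?thesis
        by (simp only: sum_distrib_left sum_subtractf[symmetric]) (intro sum.cong refl, simp add: algebra_simps)
    qed
    also have "\<bar>\<dots>\<bar> \<le> real (card (pairs H)) * (2 * p ^ 3) + \<kappa>"
    proof (intro order_trans[OF abs_triangle_ineq4] add_mono)
      show "\<bar>\<Sum>z\<in>pairs H. - s * dw (fst z) (snd z) * (p\<^sup>2 * (bern H p (?g z)
            - bern H p (?h z)))\<bar> \<le> real (card (pairs H)) * (2 * p ^ 3)"
      proof (intro order_trans[OF sum_abs] sum_bounded_above)
        fix z assume "z \<in> pairs H"
        then have z: "fst z \<in> H" "snd z \<in> H" "fst z < snd z" by (auto simp: pairs_def)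
        have dw1: "\<bar>dw (fst z) (snd z)\<bar> \<le> 1" using w0[OF z(1,2)] w1[OF z(1,2)] by (auto simp: dw_def abs_le_iff)
        have "\<bar>- s * dw (fst z) (snd z) * (p\<^sup>2 * (bern H p (?g z)
            - bern H p (?h z)))\<bar> =
            (s * \<bar>dw (fst z) (snd z)\<bar>) * (p\<^sup>2 * \<bar>bern H p (?g z)
            - bern H p (?h z)\<bar>)"
          using s by (simp add: abs_mult)
        also have "\<dots> \<le> 1 * (p\<^sup>2 * (2 * p))"
          using s p dw1 main[OF z] by (intro mult_mono mult_le_one) auto
        finally show "\<bar>- s * dw (fst z) (snd z) * (p\<^sup>2 * (bern H p (?g z)
            - bern H p (?h z)))\<bar> \<le> 2 * p ^ 3"
          by (simp add: power2_eq_square power3_eq_cube)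
      qed
      have "\<bar>bern H p (\<lambda>A. Psi s (wt t) th A * (p\<^sup>2 * ?d A))\<bar>
         \<le> bern H p (\<lambda>A. \<kappa>)"
      proof (intro order_trans[OF bern_abs[OF p]] bern_mono[OF p])
        fix A assume A: "A \<subseteq> H"
        \<comment> \<open>The hypothesis runs over ordered pairs, the derivative over unordered
          ones; by symmetry the sum needed here is half of the controlled one.\<close>
        have "(\<Sum>u\<in>H. \<Sum>v\<in>H. (w1 u v - w0 u v) * f A u * f A v) = 2 * (\<Sum>(u, v)\<in>pairs H. (w1 u v - w0 u v) * f A u * f A v)"
        proof (rule sum_pairs_sym[OF H])
          fix u v assume "u \<in> H" "v \<in> H"
          then have "w1 u v = w1 v u" "w0 u v = w0 v u" using w0 w1 by blast+
          then show "(w1 u v - w0 u v) * f A u * f A v = (w1 v u - w0 v u) * f A v * f A u" by simp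
        next
          fix u assume "u \<in> H"
          then have "w1 u u = 0" "w0 u u = 0" using w0 w1 by blast+
          then show "(w1 u u - w0 u u) * f A u * f A u = 0" by simp
        qed
        then have eq: "?d A = (\<Sum>u\<in>H. \<Sum>v\<in>H. (w1 u v - w0 u v) * f A u * f A v) / 2"
          by (simp add: dw_def case_prod_unfold)
        have k: "\<bar>p\<^sup>2 * (\<Sum>u\<in>H. \<Sum>v\<in>H. (w1 u v - w0 u v) * f A u * f A v)\<bar> \<le> \<kappa>"
          using cut[of "f A"] f01[OF A] by auto
        define x where "x = p\<^sup>2 * (\<Sum>u\<in>H. \<Sum>v\<in>H. (w1 u v - w0 u v) * f A u * f A v)"
        have "p\<^sup>2 * ?d A = x / 2"
          unfolding eq x_def by simp
        moreover have "\<bar>x / 2\<bar> \<le> \<kappa>" using k unfolding x_def[symmetric] by linarith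
        ultimately have "\<bar>p\<^sup>2 * ?d A\<bar> \<le> \<kappa>" by simp
        then have "\<bar>Psi s (wt t) th A\<bar> * \<bar>p\<^sup>2 * ?d A\<bar> \<le> 1 * \<kappa>"
          using Psi01[OF A] by (intro mult_mono) auto
        then show "\<bar>Psi s (wt t) th A * (p\<^sup>2 * ?d A)\<bar> \<le> \<kappa>"
          by (simp add: abs_mult)
      qed
      then have "s * \<bar>bern H p (\<lambda>A. Psi s (wt t) th A * (p\<^sup>2 * ?d A))\<bar> \<le> 1 * \<kappa>"
        using s unfolding bern_const[OF H] by (intro mult_mono) auto
      then show "\<bar>s * bern H p (\<lambda>A. Psi s (wt t) th A * (p\<^sup>2 * ?d A))\<bar> \<le> \<kappa>"
        using s by (simp add: abs_mult)
    qed
    also have "real (card (pairs H)) * (2 * p ^ 3) \<le> (real (card H))\<^sup>2 * (2 * p ^ 3)"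
    proof -
      have "card (pairs H) \<le> card (H \<times> H)" using H by (intro card_mono) (auto simp: pairs_def)
      then have "real (card (pairs H)) \<le> (real (card H))\<^sup>2"
        by (simp add: card_cartesian_product power2_eq_square flip: of_nat_mult)
      then show ?thesis using p by (intro mult_right_mono) auto
    qed
    finally show ?thesis by (simp add: mult_ac)
  qed
  obtain t where t: "0 < t" "t < 1" "g 1 - g 0 = (1 - 0) * g' t"
    using MVT2[of 0 1 g g'] dg by auto
  have "g 1 = bern H p (Psi s w1 th)" "g 0 = bern H p (Psi s w0 th)"
  proof -
    have "wt 1 = w1" "wt 0 = w0" by (auto simp: fun_eq_iff wt_def dw_def)
    then show "g 1 = bern H p (Psi s w1 th)" "g 0 = bern H p (Psi s w0 th)" by (simp_all add: g_def)
  qed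
  then show ?thesis using t bound[of t] by simp
qed

section \<open>Stochastic integrals\<close>

abbreviation L1dist :: "'a measure \<Rightarrow> ('a \<Rightarrow> real) \<Rightarrow> ('a \<Rightarrow> real) \<Rightarrow> ennreal" where
  "L1dist M f g \<equiv> \<integral>\<^sup>+x. ennreal \<bar>f x - g x\<bar> \<partial>M"

abbreviation idx :: "nat \<Rightarrow> 'i set \<Rightarrow> (nat \<Rightarrow> 'i) set" where
  "idx k J \<equiv> {..<k} \<rightarrow>\<^sub>E J"

lemma nn_integral_pois: "l \<ge> 0 \<Longrightarrow> (\<integral>\<^sup>+k. ennreal (real k) \<partial>measure_pmf (pois l)) = ennreal l"
proof (cases "l = 0")
  case False
  assume "l \<ge> 0"
  with False have l: "l > 0" by simp
  have "(\<lambda>j. l * exp (- l) * (l ^ j /\<^sub>R fact j)) sums (l * exp (- l) * exp l)"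
    by (intro sums_mult exp_converges)
  then have "(\<lambda>j. l ^ Suc j / fact (Suc j) * exp (- l) * real (Suc j)) sums l"
    by (simp add: exp_minus field_simps del: of_nat_Suc)
  then have s: "(\<lambda>k. l ^ k / fact k * exp (- l) * real k) sums l"
    by (subst (asm) sums_Suc_iff) simp
  have "(\<integral>\<^sup>+k. ennreal (real k) \<partial>measure_pmf (poisson_pmf l)) = (\<integral>\<^sup>+k. ennreal (l ^ k / fact k * exp (- l) * real k) \<partial>count_space UNIV)"
    unfolding nn_integral_measure_pmf using l by (intro nn_integral_cong) (simp add: ennreal_mult'[symmetric] mult_ac)
  also have "\<dots> = (\<Sum>k. ennreal (l ^ k / fact k * exp (- l) * real k))"
    by (rule nn_integral_count_space_nat)
  also have "\<dots> = ennreal (\<Sum>k. l ^ k / fact k * exp (- l) * real k)"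
    using l s by (intro suminf_ennreal2) (auto simp: sums_iff)
  also have "\<dots> = ennreal l" using s by (simp add: sums_iff)
  finally show ?thesis using False by (simp add: pois_def)
qed (simp add: pois_def)

text \<open>Multilinearity: if each coarse piece \<open>i\<close> is the sum of the fine pieces in
  its fibre under \<open>h\<close>, the products multiply out. Fine pieces with
  \<open>h t \<ge> m\<close> belong to no coarse piece and get coefficient 0. It is used once with
  indicators and once with counts.\<close>

lemma sum_PiE_fibres:
  fixes \<gamma> :: "nat \<Rightarrow> 'j \<Rightarrow> real" and h :: "'j \<Rightarrow> nat"
  assumes J: "finite J"
    and \<alpha>: "\<And>j i. j < k \<Longrightarrow> i < m \<Longrightarrow> \<alpha> j i = (\<Sum>t\<in>{t \<in> J. h t = i}. \<gamma> j t)"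
  shows "(\<Sum>i\<in>idx k {..<m}. a i * (\<Prod>j<k. \<alpha> j (i j))) =
    (\<Sum>t\<in>idx k J. (if \<forall>j<k. h (t j) < m then a (\<lambda>j\<in>{..<k}. h (t j)) else 0) * (\<Prod>j<k. \<gamma> j (t j)))"
proof -
  let ?S = "{t \<in> idx k J. \<forall>j<k. h (t j) < m}"
  let ?r = "\<lambda>t. \<lambda>j\<in>{..<k}. h (t j)"
  have fin: "finite (idx k J)" using J by (intro finite_PiE) auto
  have "(\<Sum>i\<in>idx k {..<m}. a i * (\<Prod>j<k. \<alpha> j (i j))) =
        (\<Sum>i\<in>idx k {..<m}. \<Sum>t\<in>{t \<in> ?S. ?r t = i}. a (?r t) * (\<Prod>j<k. \<gamma> j (t j)))"
  proof (intro sum.cong refl)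
    fix i assume i: "i \<in> idx k {..<m}"
    have eq: "(\<Pi>\<^sub>E j\<in>{..<k}. {t \<in> J. h t = i j}) = {t \<in> ?S. ?r t = i}"
    proof (intro set_eqI iffI)
      fix t assume t: "t \<in> (\<Pi>\<^sub>E j\<in>{..<k}. {t \<in> J. h t = i j})"
      then have "?r t = i" using i by (auto simp: fun_eq_iff PiE_def Pi_def extensional_def)
      moreover have "t \<in> ?S" using t i by (auto simp: PiE_def Pi_def)
      ultimately show "t \<in> {t \<in> ?S. ?r t = i}" by auto
    qed (auto simp: PiE_def Pi_def)
    have "(\<Prod>j<k. \<alpha> j (i j)) = (\<Prod>j<k. \<Sum>t\<in>{t \<in> J. h t = i j}. \<gamma> j t)"
      using i by (intro prod.cong) (auto intro!: \<alpha>)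
    also have "\<dots> = (\<Sum>t\<in>(\<Pi>\<^sub>E j\<in>{..<k}. {t \<in> J. h t = i j}). \<Prod>j<k. \<gamma> j (t j))"
      using J by (intro prod_sum_PiE) auto
    finally show "a i * (\<Prod>j<k. \<alpha> j (i j)) = (\<Sum>t\<in>{t \<in> ?S. ?r t = i}. a (?r t) * (\<Prod>j<k. \<gamma> j (t j)))"
      by (simp add: eq sum_distrib_left)
  qed
  also have "\<dots> = (\<Sum>t\<in>?S. a (?r t) * (\<Prod>j<k. \<gamma> j (t j)))"
    using fin by (intro sum.group) (auto intro!: finite_PiE)
  also have "\<dots> = (\<Sum>t\<in>idx k J. (if \<forall>j<k. h (t j) < m then a (?r t) else 0) * (\<Prod>j<k. \<gamma> j (t j)))"
    using fin by (intro sum.mono_neutral_cong_left) auto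
  finally show ?thesis .
qed

text \<open>The boxes of distinct multi-indices are disjoint, so at each point at most one term is
  non-zero and the absolute value passes inside the sum. Pieces of infinite measure are
  allowed.\<close>

lemma nn_integral_orthant_elem:
  fixes C :: "'j \<Rightarrow> real set" and k :: nat
  assumes J: "finite J" and C: "\<And>e. e \<in> J \<Longrightarrow> C e \<in> sets borel" "\<And>e. e \<in> J \<Longrightarrow> C e \<subseteq> {0..}" "disjoint_family_on C J"
  shows "(\<integral>\<^sup>+x. ennreal \<bar>\<Sum>i\<in>idx k J. c i * (\<Prod>j<k. indicator (C (i j)) (x j))\<bar> \<partial>orthant k) =
    (\<Sum>i\<in>idx k J. ennreal \<bar>c i\<bar> * (\<Prod>j<k. emeasure lborel (C (i j))))"
proof -
  interpret product_sigma_finite "\<lambda>_::nat. restrict_space lborel {0::real..}"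
    unfolding product_sigma_finite_def
    by (intro allI sigma_finite_measure_restrict_space sigma_finite_lborel) simp
  have fin: "finite (idx k J)" using J by (intro finite_PiE) auto
  have pt: "ennreal \<bar>\<Sum>i\<in>idx k J. c i * (\<Prod>j<k. indicator (C (i j)) (x j))\<bar> =
      (\<Sum>i\<in>idx k J. ennreal \<bar>c i\<bar> * (\<Prod>j<k. indicator (C (i j)) (x j)))" for x
  proof (cases "\<exists>i\<in>idx k J. \<forall>j<k. x j \<in> C (i j)")
    case True
    then obtain i0 where i0: "i0 \<in> idx k J" "\<And>j. j < k \<Longrightarrow> x j \<in> C (i0 j)" by auto
    have z: "\<exists>j<k. x j \<notin> C (i j)" if i: "i \<in> idx k J" "i \<noteq> i0" for i
    proof -
      obtain j where j: "j < k" "i j \<noteq> i0 j"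
        using i i0 by (metis PiE_ext lessThan_iff)
      have "i j \<in> J" "i0 j \<in> J" using i i0 j by auto
      then have "C (i j) \<inter> C (i0 j) = {}" using C(3) j by (auto simp: disjoint_family_on_def)
      then show ?thesis using i0(2) j by auto
    qed
    have "(\<Sum>i\<in>idx k J. c i * (\<Prod>j<k. indicator (C (i j)) (x j))) = (\<Sum>i\<in>idx k J. if i = i0 then c i else 0)"
    proof (intro sum.cong refl)
      fix i assume i: "i \<in> idx k J"
      show "c i * (\<Prod>j<k. indicator (C (i j)) (x j)) = (if i = i0 then c i else 0)"
        using z[OF i] i0(2) by (cases "i = i0") (auto simp: indicator_def intro!: prod.neutral)
    qed
    moreover have "(\<Sum>i\<in>idx k J. ennreal \<bar>c i\<bar> * (\<Prod>j<k. indicator (C (i j)) (x j))) = (\<Sum>i\<in>idx k J. if i = i0 then ennreal \<bar>c i\<bar> else 0)"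
    proof (intro sum.cong refl)
      fix i assume i: "i \<in> idx k J"
      show "ennreal \<bar>c i\<bar> * (\<Prod>j<k. indicator (C (i j)) (x j)) = (if i = i0 then ennreal \<bar>c i\<bar> else 0)"
        using z[OF i] i0(2) by (cases "i = i0") (auto simp: indicator_def intro!: prod.neutral)
    qed
    ultimately show ?thesis using fin i0(1) by simp
  next
    case False
    then have z: "\<exists>j<k. x j \<notin> C (i j)" if "i \<in> idx k J" for i using that by auto
    have "(\<Sum>i\<in>idx k J. c i * (\<Prod>j<k. indicator (C (i j)) (x j))) = 0"
      using z by (intro sum.neutral) (auto simp: indicator_def)
    moreover have "(\<Sum>i\<in>idx k J. ennreal \<bar>c i\<bar> * (\<Prod>j<k. indicator (C (i j)) (x j))) = 0"
      using z by (intro sum.neutral) (auto simp: indicator_def)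
    ultimately show ?thesis by simp
  qed
  have meas: "(indicator (C (i j)) :: real \<Rightarrow> ennreal) \<in> borel_measurable (restrict_space lborel {0::real..})" if "i \<in> idx k J" "j < k" for i j
    using C(1)[of "i j"] that by (intro measurable_restrict_space1 borel_measurable_indicator) auto
  have meas': "(\<lambda>x. \<Prod>j<k. indicator (C (i j)) (x j) :: ennreal) \<in> borel_measurable (orthant k)" if "i \<in> idx k J" for i
    unfolding orthant_def using meas[OF that]
    by (intro borel_measurable_prod_ennreal) (auto intro!: measurable_compose[OF measurable_component_singleton])
  have "(\<integral>\<^sup>+x. (\<Sum>i\<in>idx k J. ennreal \<bar>c i\<bar> * (\<Prod>j<k. indicator (C (i j)) (x j))) \<partial>orthant k)
     = (\<Sum>i\<in>idx k J. ennreal \<bar>c i\<bar> * (\<integral>\<^sup>+x. (\<Prod>j<k. indicator (C (i j)) (x j)) \<partial>orthant k))"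
    using meas' by (subst nn_integral_sum) (auto intro!: sum.cong simp: nn_integral_cmult)
  also have "\<dots> = (\<Sum>i\<in>idx k J. ennreal \<bar>c i\<bar> * (\<Prod>j<k. emeasure lborel (C (i j))))"
  proof (intro sum.cong refl arg_cong2[where f = "(*)"])
    fix i assume i: "i \<in> idx k J"
    have "(\<integral>\<^sup>+x. (\<Prod>j<k. indicator (C (i j)) (x j)) \<partial>orthant k) = (\<Prod>j<k. \<integral>\<^sup>+y. indicator (C (i j)) y \<partial>restrict_space lborel {0..})"
      unfolding orthant_def using meas[OF i] by (intro product_nn_integral_prod) auto
    also have "\<dots> = (\<Prod>j<k. emeasure lborel (C (i j)))"
    proof (intro prod.cong refl)
      fix j assume "j \<in> {..<k}"
      then have j: "i j \<in> J" using i by auto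
      have s: "C (i j) \<in> sets (restrict_space lborel {0..})"
        using C(1,2)[OF j] by (subst sets_restrict_space_iff) auto
      have "(\<integral>\<^sup>+y. indicator (C (i j)) y \<partial>restrict_space lborel {0..}) = emeasure (restrict_space lborel {0..}) (C (i j))"
        using s by simp
      also have "\<dots> = emeasure lborel (C (i j))"
        using C(1,2)[OF j] by (intro emeasure_restrict_space) auto
      finally show "(\<integral>\<^sup>+y. indicator (C (i j)) y \<partial>restrict_space lborel {0..}) = emeasure lborel (C (i j))" .
    qed
    finally show "(\<integral>\<^sup>+x. (\<Prod>j<k. indicator (C (i j)) (x j)) \<partial>orthant k) = (\<Prod>j<k. emeasure lborel (C (i j)))" .
  qed
  finally show ?thesis by (simp add: pt)
qed

section \<open>Counts of a Poisson process of rate 1\<close>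

locale pois_proc = prob_space P for P :: "'b measure" +
  fixes S :: "'b \<Rightarrow> real set"
  assumes pp: "poisson_process P S"
begin

lemma S_nonneg: "\<omega> \<in> space P \<Longrightarrow> S \<omega> \<subseteq> {0..}"
  and S_finite: "\<omega> \<in> space P \<Longrightarrow> finite (S \<omega> \<inter> {0..t})"
  using pp[unfolded poisson_process_def, THEN conjunct2, THEN conjunct1, rule_format, of \<omega>] by auto

lemma npoints_measurable:
  assumes "A \<in> sets borel" "A \<subseteq> {0..}" "emeasure lborel A < \<infinity>"
  shows "npoints S A \<in> measurable P (count_space UNIV)"
  using pp[unfolded poisson_process_def, THEN conjunct2, THEN conjunct2, THEN conjunct1, rule_format, of A] assms by auto

lemma npoints_distr:
  assumes "A \<in> sets borel" "A \<subseteq> {0..}" "emeasure lborel A < \<infinity>"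
  shows "distr P (count_space UNIV) (npoints S A) = measure_pmf (pois (measure lborel A))"
  using pp[unfolded poisson_process_def, THEN conjunct2, THEN conjunct2, THEN conjunct1, rule_format, of A] assms by auto

lemma npoints_real_measurable:
  assumes "A \<in> sets borel" "A \<subseteq> {0..}" "emeasure lborel A < \<infinity>"
  shows "(\<lambda>\<omega>. real (npoints S A \<omega>)) \<in> borel_measurable P"
  using measurable_compose[OF npoints_measurable[OF assms], of real borel] by simp

lemma nn_integral_npoints:
  assumes A: "A \<in> sets borel" "A \<subseteq> {0..}" "emeasure lborel A < \<infinity>"
  shows "(\<integral>\<^sup>+\<omega>. ennreal (real (npoints S A \<omega>)) \<partial>P) = emeasure lborel A"
proof -
  have "(\<integral>\<^sup>+\<omega>. ennreal (real (npoints S A \<omega>)) \<partial>P) = (\<integral>\<^sup>+k. ennreal (real k) \<partial>distr P (count_space UNIV) (npoints S A))"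
    using npoints_measurable[OF A] by (subst nn_integral_distr) auto
  also have "\<dots> = emeasure lborel A"
    unfolding npoints_distr[OF A] using A(3) by (simp add: nn_integral_pois emeasure_eq_ennreal_measure)
  finally show ?thesis .
qed

text \<open>Counts are cardinalities, and an infinite set has cardinality 0 by convention, so
  additivity of counts depends on almost sure finiteness. The mean numbers of points in bounded
  parts of \<open>A\<close> are at most the measure of \<open>A\<close>, and monotone convergence
  bounds the mean of their supremum.\<close>

lemma AE_finite_points:
  assumes A: "A \<in> sets borel" "A \<subseteq> {0..}" "emeasure lborel A < \<infinity>"
  shows "AE \<omega> in P. finite (S \<omega> \<inter> A)"
proof -
  define B where "B n = A \<inter> {0..real n}" for n :: nat
  have B: "B n \<in> sets borel" "B n \<subseteq> {0..}" "emeasure lborel (B n) < \<infinity>" for n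
    using A le_less_trans[OF emeasure_mono[of "B n" A lborel] A(3)] by (auto simp: B_def)
  let ?f = "\<lambda>n \<omega>. ennreal (real (npoints S (B n) \<omega>))"
  have m: "?f n \<in> borel_measurable P" for n using npoints_real_measurable[OF B] by simp
  have mono: "?f n \<omega> \<le> ?f (Suc n) \<omega>" if "\<omega> \<in> space P" for n \<omega>
  proof -
    have "finite (S \<omega> \<inter> B (Suc n))" by (rule finite_subset[OF _ S_finite[OF that, of "real (Suc n)"]]) (auto simp: B_def)
    then show ?thesis unfolding npoints_def by (intro ennreal_leI of_nat_mono card_mono) (auto simp: B_def)
  qed
  have "(\<integral>\<^sup>+\<omega>. (SUP n. ?f n \<omega>) \<partial>P) = (SUP n. \<integral>\<^sup>+\<omega>. ?f n \<omega> \<partial>P)"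
    using m mono by (intro nn_integral_monotone_convergence_SUP_AE) auto
  also have "\<dots> \<le> emeasure lborel A"
    unfolding nn_integral_npoints[OF B] using A by (intro SUP_least emeasure_mono) (auto simp: B_def)
  finally have "(\<integral>\<^sup>+\<omega>. (SUP n. ?f n \<omega>) \<partial>P) \<noteq> \<infinity>" using A(3) by auto
  then have "AE \<omega> in P. (SUP n. ?f n \<omega>) \<noteq> \<infinity>"
    using m by (intro nn_integral_PInf_AE) auto
  moreover have "AE \<omega> in P. \<omega> \<in> space P" by simp
  ultimately show ?thesis
  proof eventually_elim
    case (elim \<omega>)
    show ?case
    proof (rule ccontr)
      assume inf: "infinite (S \<omega> \<inter> A)"
      obtain q where q: "(SUP n. ?f n \<omega>) = ennreal q" "q \<ge> 0" using elim(1) by (cases "SUP n. ?f n \<omega>") auto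
      obtain T where T: "T \<subseteq> S \<omega> \<inter> A" "finite T" "card T = Suc (nat \<lceil>q\<rceil>)"
        using infinite_arbitrarily_large[OF inf] by metis
      obtain n where n: "\<And>x. x \<in> T \<Longrightarrow> x \<le> real n"
      proof (cases "T = {}")
        case False
        obtain n where "Max T \<le> real n" using real_arch_simple by blast
        then have "x \<le> real n" if "x \<in> T" for x using Max_ge[OF T(2) that] by linarith
        then show ?thesis using that by blast
      qed (use that in auto)
      have fin: "finite (S \<omega> \<inter> B n)" by (rule finite_subset[OF _ S_finite[OF elim(2), of "real n"]]) (auto simp: B_def)
      have "T \<subseteq> S \<omega> \<inter> B n" using T n A by (auto simp: B_def)
      then have "Suc (nat \<lceil>q\<rceil>) \<le> npoints S (B n) \<omega>" unfolding npoints_def T(3)[symmetric] using fin by (intro card_mono)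
      then have "ennreal (real (Suc (nat \<lceil>q\<rceil>))) \<le> ?f n \<omega>" by (intro ennreal_leI) linarith
      also have "\<dots> \<le> ennreal q" unfolding q(1)[symmetric] by (rule SUP_upper) simp
      finally have "real (Suc (nat \<lceil>q\<rceil>)) \<le> q" using q(2) by (subst (asm) ennreal_le_iff)
      then show False using q(2) by linarith
    qed
  qed
qed

lemma npoints_UN:
  assumes "finite J" "disjoint_family_on C J" "finite (S \<omega> \<inter> (\<Union>t\<in>J. C t))"
  shows "npoints S (\<Union>t\<in>J. C t) \<omega> = (\<Sum>t\<in>J. npoints S (C t) \<omega>)"
proof -
  have "S \<omega> \<inter> (\<Union>t\<in>J. C t) = (\<Union>t\<in>J. S \<omega> \<inter> C t)" by auto
  moreover have "card (\<Union>t\<in>J. S \<omega> \<inter> C t) = (\<Sum>t\<in>J. card (S \<omega> \<inter> C t))"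
    using assms by (intro card_UN_disjoint) (auto simp: disjoint_family_on_def intro: finite_subset[OF _ assms(3)])
  ultimately show ?thesis by (simp add: npoints_def)
qed

lemma nn_integral_prod_npoints:
  fixes k :: nat
  assumes C: "\<And>j. j < k \<Longrightarrow> C j \<in> sets borel" "\<And>j. j < k \<Longrightarrow> C j \<subseteq> {0..}" "\<And>j. j < k \<Longrightarrow> emeasure lborel (C j) < \<infinity>"
    and dj: "disjoint_family_on C {..<k}"
  shows "(\<integral>\<^sup>+\<omega>. (\<Prod>j<k. ennreal (real (npoints S (C j) \<omega>))) \<partial>P) = (\<Prod>j<k. emeasure lborel (C j))"
proof -
  have "indep_vars (\<lambda>_. count_space UNIV) (\<lambda>i. npoints S (C i)) {..<k}"
    using pp[unfolded poisson_process_def, THEN conjunct2, THEN conjunct2, THEN conjunct2, rule_format, of k C] C dj by auto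
  then have "indep_vars (\<lambda>_. borel) (\<lambda>j \<omega>. ennreal (real (npoints S (C j) \<omega>))) {..<k}"
    by (rule indep_vars_compose2) auto
  then have "(\<integral>\<^sup>+\<omega>. (\<Prod>j<k. ennreal (real (npoints S (C j) \<omega>))) \<partial>P) = (\<Prod>j<k. \<integral>\<^sup>+\<omega>. ennreal (real (npoints S (C j) \<omega>)) \<partial>P)"
    by (intro indep_vars_nn_integral) auto
  also have "\<dots> = (\<Prod>j<k. emeasure lborel (C j))"
    using C by (intro prod.cong refl nn_integral_npoints) auto
  finally show ?thesis .
qed

text \<open>The coefficients vanish on repeated indices, hence every remaining product is over
  disjoint pieces, whose counts are independent, and its mean is the volume of the box. The right
  side is the L1 norm of the corresponding function, so integration is a contraction.\<close>

lemma nn_integral_multilinear: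
  fixes C :: "'j \<Rightarrow> real set" and k :: nat
  assumes J: "finite J" and C: "\<And>e. e \<in> J \<Longrightarrow> C e \<in> sets borel" "\<And>e. e \<in> J \<Longrightarrow> C e \<subseteq> {0..}"
      "\<And>e. e \<in> J \<Longrightarrow> emeasure lborel (C e) < \<infinity>" "disjoint_family_on C J"
    and c: "\<And>i. i \<in> idx k J \<Longrightarrow> \<not> inj_on i {..<k} \<Longrightarrow> c i = 0"
  shows "(\<integral>\<^sup>+\<omega>. ennreal \<bar>\<Sum>i\<in>idx k J. c i * (\<Prod>j<k. real (npoints S (C (i j)) \<omega>))\<bar> \<partial>P) \<le>
    (\<Sum>i\<in>idx k J. ennreal \<bar>c i\<bar> * (\<Prod>j<k. emeasure lborel (C (i j))))"
proof -
  let ?N = "\<lambda>i \<omega>. \<Prod>j<k. ennreal (real (npoints S (C (i j)) \<omega>))"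
  let ?R = "\<lambda>i \<omega>. \<Prod>j<k. real (npoints S (C (i j)) \<omega>)"
  have fin: "finite (idx k J)" using J by (intro finite_PiE) auto
  have m: "(\<lambda>\<omega>. \<Prod>j<k. ennreal (real (npoints S (C (i j)) \<omega>))) \<in> borel_measurable P" if "i \<in> idx k J" for i
  proof (intro borel_measurable_prod_ennreal measurable_compose[OF npoints_real_measurable measurable_ennreal])
    fix j assume "j \<in> {..<k}"
    then have "i j \<in> J" using that by auto
    then show "C (i j) \<in> sets borel" "C (i j) \<subseteq> {0..}" "emeasure lborel (C (i j)) < \<infinity>" using C(1-3) by blast+
  qed
  have "(\<integral>\<^sup>+\<omega>. ennreal \<bar>\<Sum>i\<in>idx k J. c i * ?R i \<omega>\<bar> \<partial>P) \<le>
    (\<integral>\<^sup>+\<omega>. (\<Sum>i\<in>idx k J. ennreal \<bar>c i\<bar> * ?N i \<omega>) \<partial>P)"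
  proof (rule nn_integral_mono)
    fix \<omega>
    have "ennreal \<bar>\<Sum>i\<in>idx k J. c i * ?R i \<omega>\<bar>
      \<le> ennreal (\<Sum>i\<in>idx k J. \<bar>c i\<bar> * ?R i \<omega>)"
      by (intro ennreal_leI order_trans[OF sum_abs] sum_mono) (simp add: abs_mult abs_prod)
    also have "\<dots> = (\<Sum>i\<in>idx k J. ennreal \<bar>c i\<bar> * ?N i \<omega>)"
    proof -
      have nn: "0 \<le> ?R i \<omega>" for i by (intro prod_nonneg) simp
      have "(\<Sum>i\<in>idx k J. ennreal \<bar>c i\<bar> * ?N i \<omega>) =
         (\<Sum>i\<in>idx k J. ennreal (\<bar>c i\<bar> * ?R i \<omega>))"
        by (intro sum.cong refl, subst prod_ennreal, simp, rule ennreal_mult[symmetric]) (simp_all add: nn)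
      then show ?thesis using nn by (simp add: sum_ennreal)
    qed
    finally show "ennreal \<bar>\<Sum>i\<in>idx k J. c i * ?R i \<omega>\<bar> \<le>
      (\<Sum>i\<in>idx k J. ennreal \<bar>c i\<bar> * ?N i \<omega>)" .
  qed
  also have "\<dots> = (\<Sum>i\<in>idx k J. ennreal \<bar>c i\<bar> * (\<integral>\<^sup>+\<omega>. ?N i \<omega> \<partial>P))"
    using m by (subst nn_integral_sum) (auto intro!: sum.cong simp: nn_integral_cmult)
  also have "\<dots> = (\<Sum>i\<in>idx k J. ennreal \<bar>c i\<bar> * (\<Prod>j<k. emeasure lborel (C (i j))))"
  proof (intro sum.cong refl)
    fix i assume i: "i \<in> idx k J"
    show "ennreal \<bar>c i\<bar> * (\<integral>\<^sup>+\<omega>. ?N i \<omega> \<partial>P) = ennreal \<bar>c i\<bar> * (\<Prod>j<k. emeasure lborel (C (i j)))"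
    proof (cases "inj_on i {..<k}")
      case True
      have "disjoint_family_on (\<lambda>j. C (i j)) {..<k}"
        unfolding disjoint_family_on_def
      proof (intro ballI impI)
        fix a b assume ab: "a \<in> {..<k}" "b \<in> {..<k}" "a \<noteq> b"
        then have "i a \<noteq> i b" "i a \<in> J" "i b \<in> J" using True i by (auto simp: inj_on_def)
        then show "C (i a) \<inter> C (i b) = {}" using C(4) by (auto simp: disjoint_family_on_def)
      qed
      moreover have "i j \<in> J" if "j < k" for j using i that by auto
      ultimately have "(\<integral>\<^sup>+\<omega>. ?N i \<omega> \<partial>P) = (\<Prod>j<k. emeasure lborel (C (i j)))"
        using C(1-3) by (intro nn_integral_prod_npoints) blast+
      then show ?thesis by simp
    qed (use c i in simp)
  qed
  finally show ?thesis .
qed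

end

text \<open>Integrability of the function does not force its pieces to have finite measure, because
  a coefficient may be 0 or another piece of the box may be null. Counts of pieces of infinite
  measure have no prescribed law or measurability; they are excluded here and dealt with
  afterwards.\<close>

definition fin_elem :: "nat \<Rightarrow> nat \<Rightarrow> (nat \<Rightarrow> real set) \<Rightarrow> ((nat \<Rightarrow> nat) \<Rightarrow> real) \<Rightarrow> bool" where
  "fin_elem k m A a \<longleftrightarrow> elementary k m A a \<and> (\<forall>i<m. emeasure lborel (A i) < \<infinity>)"

lemma fin_elemD:
  assumes "fin_elem k m A a"
  shows "\<And>i. i < m \<Longrightarrow> A i \<in> sets borel" "\<And>i. i < m \<Longrightarrow> A i \<subseteq> {0..}" "\<And>i. i < m \<Longrightarrow> emeasure lborel (A i) < \<infinity>"
    "disjoint_family_on A {..<m}" "\<And>i. i \<in> idx k {..<m} \<Longrightarrow> \<not> inj_on i {..<k} \<Longrightarrow> a i = 0"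
  using assms unfolding fin_elem_def elementary_def by blast+

lemma elem_fun_measurable:
  assumes "\<And>i. i < m \<Longrightarrow> A i \<in> sets borel"
  shows "elem_fun k m A a \<in> borel_measurable (orthant k)"
proof -
  have meas: "(\<lambda>x. indicator (A (i j)) (x j) :: real) \<in> borel_measurable (orthant k)" if "i \<in> idx k {..<m}" "j < k" for i j
  proof -
    have "A (i j) \<in> sets borel" using assms that by auto
    then have "(indicator (A (i j)) :: real \<Rightarrow> real) \<in> borel_measurable (restrict_space lborel {0..})"
      by (intro measurable_restrict_space1 borel_measurable_indicator) auto
    then show ?thesis unfolding orthant_def
      using that by (intro measurable_compose[OF measurable_component_singleton[of j]]) auto
  qed
  show ?thesis unfolding elem_fun_def
    by (intro borel_measurable_sum borel_measurable_times borel_measurable_const borel_measurable_prod meas) auto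
qed

lemma nn_integral_abs_cong_AE:
  fixes f g f' g' :: "'c \<Rightarrow> real"
  assumes "AE x in M. f x = f' x" "AE x in M. g x = g' x"
  shows "L1dist M f g = L1dist M f' g'"
  by (rule nn_integral_cong_AE) (use assms in \<open>eventually_elim, simp\<close>)

section \<open>The L1 contraction property of elementary integrals\<close>

context pois_proc
begin

lemma elem_integral_measurable:
  assumes "fin_elem k m A a"
  shows "elem_integral S k m A a \<in> borel_measurable P"
  unfolding elem_integral_def
proof (intro borel_measurable_sum borel_measurable_times borel_measurable_const borel_measurable_prod npoints_real_measurable)
  fix i j assume "i \<in> idx k {..<m}" "j \<in> {..<k}"
  then have "i j < m" by auto
  then show "A (i j) \<in> sets borel" "A (i j) \<subseteq> {0..}" "emeasure lborel (A (i j)) < \<infinity>"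
    using fin_elemD(1-3)[OF assms] by blast+
qed

text \<open>Both integrals are written over the common refinement of the two partitions.\<close>

lemma fin_elem_dist:
  assumes A: "fin_elem k m A a" and B: "fin_elem k m' B b"
  shows "L1dist P (elem_integral S k m A a) (elem_integral S k m' B b) \<le>
    L1dist (orthant k) (elem_fun k m A a) (elem_fun k m' B b)"
proof -
  note A' = fin_elemD[OF A] and B' = fin_elemD[OF B]
  define UA where "UA = (\<Union>i<m. A i)"
  define UB where "UB = (\<Union>i<m'. B i)"
  \<comment> \<open>The additional index \<open>m\<close> collects what only the other family
    covers; then both families partition the same union, and their intersections form the common
    refinement.\<close>
  define AA where "AA i = (if i < m then A i else UB - UA)" for i
  define BB where "BB i = (if i < m' then B i else UA - UB)" for i
  define J where "J = {..m} \<times> {..m'}"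
  define C where "C t = AA (fst t) \<inter> BB (snd t)" for t
  \<comment> \<open>Multi-indices that use the additional piece get coefficient 0, as the original
    function vanishes there.\<close>
  define ca where "ca t = (if \<forall>j<k. fst (t j) < m then a (\<lambda>j\<in>{..<k}. fst (t j)) else 0)" for t :: "nat \<Rightarrow> nat \<times> nat"
  define cb where "cb t = (if \<forall>j<k. snd (t j) < m' then b (\<lambda>j\<in>{..<k}. snd (t j)) else 0)" for t :: "nat \<Rightarrow> nat \<times> nat"
  have J: "finite J" by (simp add: J_def)
  have UA: "UA \<in> sets borel" "UA \<subseteq> {0..}"
    using A'(1,2) by (auto simp: UA_def)
  have UB: "UB \<in> sets borel" "UB \<subseteq> {0..}"
    using B'(1,2) by (auto simp: UB_def)
  have AAs: "AA i \<in> sets borel" "AA i \<subseteq> {0..}" for i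
    using A'(1,2)[of i] UA UB by (auto simp: AA_def)
  have BBs: "BB i \<in> sets borel" for i
    using B'(1)[of i] UA UB by (auto simp: BB_def)
  have dAA: "AA i \<inter> AA j = {}" if "i \<le> m" "j \<le> m" "i \<noteq> j" for i j
  proof -
    have "A i \<inter> A j = {}" if "i < m" "j < m" using A'(4) that \<open>i \<noteq> j\<close> by (auto simp: disjoint_family_on_def)
    then show ?thesis using that by (auto simp: AA_def UA_def)
  qed
  have dBB: "BB i \<inter> BB j = {}" if "i \<le> m'" "j \<le> m'" "i \<noteq> j" for i j
  proof -
    have "B i \<inter> B j = {}" if "i < m'" "j < m'" using B'(4) that \<open>i \<noteq> j\<close> by (auto simp: disjoint_family_on_def)
    then show ?thesis using that by (auto simp: BB_def UB_def)
  qed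
  have Cs: "C t \<in> sets borel" "C t \<subseteq> {0..}" for t
    using AAs BBs by (auto simp: C_def)
  have Cf: "emeasure lborel (C t) < \<infinity>" for t
  proof -
    consider "fst t < m" | "snd t < m'" | "\<not> fst t < m" "\<not> snd t < m'" by blast
    then show ?thesis
    proof cases
      case 1
      then have "emeasure lborel (C t) \<le> emeasure lborel (A (fst t))"
        using A'(1) by (intro emeasure_mono) (auto simp: C_def AA_def)
      then show ?thesis using A'(3)[OF 1] by (rule le_less_trans)
    next
      case 2
      then have "emeasure lborel (C t) \<le> emeasure lborel (B (snd t))"
        using B'(1) by (intro emeasure_mono) (auto simp: C_def BB_def)
      then show ?thesis using B'(3)[OF 2] by (rule le_less_trans)
    next
      case 3
      \<comment> \<open>What only the first family covers is disjoint from what only the second one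
        covers.\<close>
      then have "C t = {}" by (auto simp: C_def AA_def BB_def)
      then show ?thesis by simp
    qed
  qed
  have Cd: "disjoint_family_on C J"
    unfolding disjoint_family_on_def
  proof (intro ballI impI)
    fix t u assume tu: "t \<in> J" "u \<in> J" "t \<noteq> u"
    then have "fst t \<noteq> fst u \<or> snd t \<noteq> snd u" by (auto simp: prod_eq_iff)
    then show "C t \<inter> C u = {}"
      using tu dAA[of "fst t" "fst u"] dBB[of "snd t" "snd u"] by (auto simp: C_def J_def)
  qed
  have UNA: "A i = (\<Union>t\<in>{t \<in> J. fst t = i}. C t)" if i: "i < m" for i
  proof
    show "A i \<subseteq> (\<Union>t\<in>{t \<in> J. fst t = i}. C t)"
    proof
      fix x assume x: "x \<in> A i"
      then have "x \<in> UA" using i by (auto simp: UA_def)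
      then obtain e where "e \<le> m'" "x \<in> BB e"
      proof (cases "x \<in> UB")
        case True
        then obtain e where "e < m'" "x \<in> B e" by (auto simp: UB_def)
        then show ?thesis by (intro that[of e]) (auto simp: BB_def)
      next
        case False
        then show ?thesis using \<open>x \<in> UA\<close> by (intro that[of m']) (auto simp: BB_def)
      qed
      then show "x \<in> (\<Union>t\<in>{t \<in> J. fst t = i}. C t)"
        using x i by (intro UN_I[of "(i, e)"]) (auto simp: J_def C_def AA_def)
    qed
  qed (use i in \<open>auto simp: C_def AA_def\<close>)
  have UNB: "B i = (\<Union>t\<in>{t \<in> J. snd t = i}. C t)" if i: "i < m'" for i
  proof
    show "B i \<subseteq> (\<Union>t\<in>{t \<in> J. snd t = i}. C t)"
    proof
      fix x assume x: "x \<in> B i"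
      then have "x \<in> UB" using i by (auto simp: UB_def)
      then obtain e where "e \<le> m" "x \<in> AA e"
      proof (cases "x \<in> UA")
        case True
        then obtain e where "e < m" "x \<in> A e" by (auto simp: UA_def)
        then show ?thesis by (intro that[of e]) (auto simp: AA_def)
      next
        case False
        then show ?thesis using \<open>x \<in> UB\<close> by (intro that[of m]) (auto simp: AA_def)
      qed
      then show "x \<in> (\<Union>t\<in>{t \<in> J. snd t = i}. C t)"
        using x i by (intro UN_I[of "(e, i)"]) (auto simp: J_def C_def BB_def)
    qed
  qed (use i in \<open>auto simp: C_def BB_def\<close>)
  have dsub: "disjoint_family_on C {t \<in> J. Q t}" for Q
    using Cd by (auto simp: disjoint_family_on_def)
  have fun_diff: "elem_fun k m A a x - elem_fun k m' B b x = (\<Sum>t\<in>idx k J. (ca t - cb t) * (\<Prod>j<k. indicator (C (t j)) (x j)))" for x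
  proof -
    have "elem_fun k m A a x = (\<Sum>t\<in>idx k J. ca t * (\<Prod>j<k. indicator (C (t j)) (x j)))"
      unfolding elem_fun_def ca_def
      by (rule sum_PiE_fibres[OF J]) (subst UNA, simp, subst indicator_UN_disjoint, use J dsub in auto)
    moreover have "elem_fun k m' B b x = (\<Sum>t\<in>idx k J. cb t * (\<Prod>j<k. indicator (C (t j)) (x j)))"
      unfolding elem_fun_def cb_def
      by (rule sum_PiE_fibres[OF J]) (subst UNB, simp, subst indicator_UN_disjoint, use J dsub in auto)
    ultimately show ?thesis by (simp add: sum_subtractf left_diff_distrib)
  qed
  have "AE \<omega> in P. \<forall>i\<in>{..<m}. finite (S \<omega> \<inter> A i)"
    using A'(1-3) by (intro AE_finite_allI AE_finite_points) auto
  moreover have "AE \<omega> in P. \<forall>i\<in>{..<m'}. finite (S \<omega> \<inter> B i)"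
    using B'(1-3) by (intro AE_finite_allI AE_finite_points) auto
  ultimately have "AE \<omega> in P. ennreal \<bar>elem_integral S k m A a \<omega> - elem_integral S k m' B b \<omega>\<bar> =
      ennreal \<bar>\<Sum>t\<in>idx k J. (ca t - cb t) * (\<Prod>j<k. real (npoints S (C (t j)) \<omega>))\<bar>"
  proof eventually_elim
    case (elim \<omega>)
    have nA: "real (npoints S (A i) \<omega>) = (\<Sum>t\<in>{t \<in> J. fst t = i}. real (npoints S (C t) \<omega>))" if i: "i < m" for i
    proof -
      have "npoints S (\<Union>t\<in>{t \<in> J. fst t = i}. C t) \<omega> = (\<Sum>t\<in>{t \<in> J. fst t = i}. npoints S (C t) \<omega>)"
      proof (intro npoints_UN dsub)
        show "finite (S \<omega> \<inter> (\<Union>t\<in>{t \<in> J. fst t = i}. C t))" using elim(1) i unfolding UNA[OF i, symmetric] by auto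
      qed (use J in auto)
      then show ?thesis using UNA[OF i] by simp
    qed
    have nB: "real (npoints S (B i) \<omega>) = (\<Sum>t\<in>{t \<in> J. snd t = i}. real (npoints S (C t) \<omega>))" if i: "i < m'" for i
    proof -
      have "npoints S (\<Union>t\<in>{t \<in> J. snd t = i}. C t) \<omega> = (\<Sum>t\<in>{t \<in> J. snd t = i}. npoints S (C t) \<omega>)"
      proof (intro npoints_UN dsub)
        show "finite (S \<omega> \<inter> (\<Union>t\<in>{t \<in> J. snd t = i}. C t))" using elim(2) i unfolding UNB[OF i, symmetric] by auto
      qed (use J in auto)
      then show ?thesis using UNB[OF i] by simp
    qed
    have "elem_integral S k m A a \<omega> = (\<Sum>t\<in>idx k J. ca t * (\<Prod>j<k. real (npoints S (C (t j)) \<omega>)))"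
      unfolding elem_integral_def ca_def by (rule sum_PiE_fibres[OF J nA])
    moreover have "elem_integral S k m' B b \<omega> = (\<Sum>t\<in>idx k J. cb t * (\<Prod>j<k. real (npoints S (C (t j)) \<omega>)))"
      unfolding elem_integral_def cb_def by (rule sum_PiE_fibres[OF J nB])
    ultimately show ?case by (simp add: sum_subtractf left_diff_distrib)
  qed
  then have "L1dist P (elem_integral S k m A a) (elem_integral S k m' B b) =
     (\<integral>\<^sup>+\<omega>. ennreal \<bar>\<Sum>t\<in>idx k J. (ca t - cb t) * (\<Prod>j<k. real (npoints S (C (t j)) \<omega>))\<bar> \<partial>P)"
    by (rule nn_integral_cong_AE)
  also have "\<dots> \<le> (\<Sum>i\<in>idx k J. ennreal \<bar>ca i - cb i\<bar> * (\<Prod>j<k. emeasure lborel (C (i j))))"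
  proof (rule nn_integral_multilinear[OF J Cs(1) Cs(2) Cf Cd])
    fix i assume i: "i \<in> idx k J" "\<not> inj_on i {..<k}"
    then obtain u v where uv: "u < k" "v < k" "u \<noteq> v" "i u = i v" by (auto simp: inj_on_def)
    \<comment> \<open>A repeated fine piece lies in a repeated coarse piece, where the coefficients
      vanish by assumption.\<close>
    have "ca i = 0"
    proof (cases "\<forall>j<k. fst (i j) < m")
      case True
      have "\<not> inj_on (\<lambda>j\<in>{..<k}. fst (i j)) {..<k}" using uv inj_onD[of _ "{..<k}" u v] by fastforce
      then have "a (\<lambda>j\<in>{..<k}. fst (i j)) = 0" using True by (intro A'(5)) auto
      then show ?thesis by (simp add: ca_def)
    qed (auto simp: ca_def)
    moreover have "cb i = 0"
    proof (cases "\<forall>j<k. snd (i j) < m'")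
      case True
      have "\<not> inj_on (\<lambda>j\<in>{..<k}. snd (i j)) {..<k}" using uv inj_onD[of _ "{..<k}" u v] by fastforce
      then have "b (\<lambda>j\<in>{..<k}. snd (i j)) = 0" using True by (intro B'(5)) auto
      then show ?thesis by (simp add: cb_def)
    qed (auto simp: cb_def)
    ultimately show "ca i - cb i = 0" by simp
  qed
  also have "\<dots> = L1dist (orthant k) (elem_fun k m A a) (elem_fun k m' B b)"
    unfolding fun_diff by (rule nn_integral_orthant_elem[OF J Cs(1) Cs(2) Cd, symmetric])
  finally show ?thesis .
qed

text \<open>In a term with non-zero coefficient a piece of infinite measure is accompanied by a null
  piece, for otherwise this term alone would make the norm infinite. The null piece almost surely
  carries no point and almost everywhere no coordinate of the argument, so emptying the infinite
  pieces changes neither the integral nor the function.\<close>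

lemma elementary_finite_version:
  assumes el: "elementary k m A a"
  obtains B where "fin_elem k m B a"
    "AE \<omega> in P. elem_integral S k m A a \<omega> = elem_integral S k m B a \<omega>"
    "AE x in orthant k. elem_fun k m A a x = elem_fun k m B a x"
proof -
  have A: "\<And>i. i < m \<Longrightarrow> A i \<in> sets borel" "\<And>i. i < m \<Longrightarrow> A i \<subseteq> {0..}" "disjoint_family_on A {..<m}"
     "\<And>i. i \<in> idx k {..<m} \<Longrightarrow> \<not> inj_on i {..<k} \<Longrightarrow> a i = 0" "integrable (orthant k) (elem_fun k m A a)"
    using el unfolding elementary_def by blast+
  define B where "B i = (if emeasure lborel (A i) < \<infinity> then A i else {})" for i
  let ?e = "\<lambda>i. \<Prod>j<k. emeasure lborel (A (i j))"
  have fin: "finite (idx k {..<m})" by (intro finite_PiE) auto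
  have "(\<Sum>i\<in>idx k {..<m}. ennreal \<bar>a i\<bar> * ?e i) = (\<integral>\<^sup>+x. ennreal \<bar>elem_fun k m A a x\<bar> \<partial>orthant k)"
    unfolding elem_fun_def using A(1-3) by (intro nn_integral_orthant_elem[symmetric]) auto
  also have "\<dots> < \<infinity>" using A(5) by (simp add: integrable_iff_bounded)
  finally have tot: "(\<Sum>i\<in>idx k {..<m}. ennreal \<bar>a i\<bar> * ?e i) < \<infinity>" .
  have null: "\<exists>j1<k. emeasure lborel (A (i j1)) = 0"
    if i: "i \<in> idx k {..<m}" "a i \<noteq> 0" "j < k" "\<not> emeasure lborel (A (i j)) < \<infinity>" for i j
  proof (rule ccontr)
    assume no: "\<not> (\<exists>j1<k. emeasure lborel (A (i j1)) = 0)"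
    have "?e i = \<top>"
    proof -
      have "emeasure lborel (A (i j)) = \<top>" using i(4) by (simp add: less_top[symmetric])
      then show ?thesis using no i(3) by (auto simp: ennreal_prod_eq_top)
    qed
    then have "ennreal \<bar>a i\<bar> * ?e i = \<top>"
      using i(2) by (simp add: ennreal_mult_eq_top_iff)
    moreover have "ennreal \<bar>a i\<bar> * ?e i \<le> (\<Sum>i\<in>idx k {..<m}. ennreal \<bar>a i\<bar> * ?e i)"
      using i(1) fin by (intro member_le_sum) auto
    ultimately show False using tot by (simp add: top_unique)
  qed
  have cas: "a i = 0 \<or> (\<forall>j<k. B (i j) = A (i j)) \<or> (\<exists>j1<k. emeasure lborel (A (i j1)) = 0)" if "i \<in> idx k {..<m}" for i
    using null[OF that] unfolding B_def by metis
  have AE0: "AE \<omega> in P. \<forall>i\<in>{i. i < m \<and> emeasure lborel (A i) = 0}. npoints S (A i) \<omega> = 0"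
  proof (intro AE_finite_allI)
    fix i assume i: "i \<in> {i. i < m \<and> emeasure lborel (A i) = 0}"
    then have f: "emeasure lborel (A i) < \<infinity>" by simp
    have "(\<integral>\<^sup>+\<omega>. ennreal (real (npoints S (A i) \<omega>)) \<partial>P) = 0"
      using i A(1,2) f by (subst nn_integral_npoints) auto
    then have "AE \<omega> in P. ennreal (real (npoints S (A i) \<omega>)) = 0"
      using npoints_real_measurable[OF A(1) A(2) f] i by (subst (asm) nn_integral_0_iff_AE) auto
    then show "AE \<omega> in P. npoints S (A i) \<omega> = 0" by eventually_elim simp
  qed simp
  have 1: "AE \<omega> in P. elem_integral S k m A a \<omega> = elem_integral S k m B a \<omega>"
    using AE0
  proof eventually_elim
    case (elim \<omega>)
    show ?case unfolding elem_integral_def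
    proof (intro sum.cong refl)
      fix i assume i: "i \<in> idx k {..<m}"
      consider "a i = 0" | "\<forall>j<k. B (i j) = A (i j)" | j1 where "j1 < k" "emeasure lborel (A (i j1)) = 0"
        using cas[OF i] by blast
      then show "a i * (\<Prod>j<k. real (npoints S (A (i j)) \<omega>)) = a i * (\<Prod>j<k. real (npoints S (B (i j)) \<omega>))"
      proof cases
        case 3
        then have "npoints S (A (i j1)) \<omega> = 0" "B (i j1) = A (i j1)" using elim i by (auto simp: B_def)
        then have "(\<Prod>j<k. real (npoints S (A (i j)) \<omega>)) = 0" "(\<Prod>j<k. real (npoints S (B (i j)) \<omega>)) = 0"
          using 3(1) by (auto intro!: prod_zero bexI[of _ j1])
        then show ?thesis by (simp only:)
      qed auto
    qed
  qed
  have "AE x in orthant k. \<forall>z\<in>{..<k} \<times> {i. i < m \<and> emeasure lborel (A i) = 0}. x (fst z) \<notin> A (snd z)"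
  proof (intro AE_finite_allI)
    fix z assume z: "z \<in> {..<k} \<times> {i. i < m \<and> emeasure lborel (A i) = 0}"
    then have s: "A (snd z) \<in> sets lborel" "A (snd z) \<subseteq> {0..}" "emeasure lborel (A (snd z)) = 0"
      using A(1)[of "snd z"] A(2)[of "snd z"] z by auto
    interpret product_sigma_finite "\<lambda>_::nat. restrict_space lborel {0::real..}"
      unfolding product_sigma_finite_def
      by (intro allI sigma_finite_measure_restrict_space sigma_finite_lborel) simp
    have m1: "(indicator (A (snd z)) :: real \<Rightarrow> ennreal) \<in> borel_measurable (restrict_space lborel {0..})"
      using s(1) by (intro measurable_restrict_space1 borel_measurable_indicator) auto
    have "(\<integral>\<^sup>+x. (\<Prod>j<k. (if j = fst z then indicator (A (snd z)) else (\<lambda>_. 1)) (x j)) \<partial>orthant k)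
      = (\<Prod>j<k. \<integral>\<^sup>+y. (if j = fst z then indicator (A (snd z)) else (\<lambda>_. 1)) y \<partial>restrict_space lborel {0..})"
      unfolding orthant_def using m1 by (intro product_nn_integral_prod) auto
    \<comment> \<open>The other coordinates contribute the infinite measure of the half line, but 0
      times infinity is 0 in the extended non-negative reals.\<close>
    also have "\<dots> = 0"
    proof -
      have "A (snd z) \<in> sets (restrict_space lborel {0..})"
        using s by (subst sets_restrict_space_iff) auto
      moreover have "emeasure (restrict_space lborel {0..}) (A (snd z)) = 0"
        using s by (subst emeasure_restrict_space) auto
      ultimately show ?thesis using z by (intro prod_zero) (auto intro!: bexI[of _ "fst z"])
    qed
    also have "(\<lambda>x::nat \<Rightarrow> real. \<Prod>j<k. (if j = fst z then indicator (A (snd z)) else (\<lambda>_. 1)) (x j)) = (\<lambda>x. indicator (A (snd z)) (x (fst z)) :: ennreal)"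
    proof
      fix x :: "nat \<Rightarrow> real"
      have "(\<Prod>j<k. (if j = fst z then indicator (A (snd z)) else (\<lambda>_. 1)) (x j)) = (\<Prod>j<k. if j = fst z then indicator (A (snd z)) (x (fst z)) else (1::ennreal))"
        by (intro prod.cong) auto
      then show "(\<Prod>j<k. (if j = fst z then indicator (A (snd z)) else (\<lambda>_. 1)) (x j)) = (indicator (A (snd z)) (x (fst z)) :: ennreal)"
        using z by (auto simp: prod.delta)
    qed
    finally have "(\<integral>\<^sup>+x. indicator (A (snd z)) (x (fst z)) \<partial>orthant k) = 0" .
    moreover have "(\<lambda>x. indicator (A (snd z)) (x (fst z)) :: ennreal) \<in> borel_measurable (orthant k)"
      unfolding orthant_def using z m1 by (intro measurable_compose[OF measurable_component_singleton[of "fst z"]]) auto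
    ultimately have "AE x in orthant k. (indicator (A (snd z)) (x (fst z)) :: ennreal) = 0"
      by (subst (asm) nn_integral_0_iff_AE) auto
    then show "AE x in orthant k. x (fst z) \<notin> A (snd z)" by eventually_elim (simp add: indicator_def split: if_splits)
  qed auto
  then have 2: "AE x in orthant k. elem_fun k m A a x = elem_fun k m B a x"
  proof eventually_elim
    case (elim x)
    show ?case unfolding elem_fun_def
    proof (intro sum.cong refl)
      fix i assume i: "i \<in> idx k {..<m}"
      consider "a i = 0" | "\<forall>j<k. B (i j) = A (i j)" | j1 where "j1 < k" "emeasure lborel (A (i j1)) = 0"
        using cas[OF i] by blast
      then show "a i * (\<Prod>j<k. indicator (A (i j)) (x j)) = a i * (\<Prod>j<k. indicator (B (i j)) (x j))"
      proof cases
        case 3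
        then have "x j1 \<notin> A (i j1)" "B (i j1) = A (i j1)" using elim i by (auto simp: B_def)
        then have "(\<Prod>j<k. indicator (A (i j)) (x j) :: real) = 0" "(\<Prod>j<k. indicator (B (i j)) (x j) :: real) = 0"
          using 3(1) by (auto intro!: prod_zero bexI[of _ j1] simp: indicator_def)
        then show ?thesis by (simp only:)
      qed auto
    qed
  qed
  have "B i \<in> sets borel" "B i \<subseteq> {0..}" if "i < m" for i using A(1,2)[OF that] by (auto simp: B_def)
  moreover have "disjoint_family_on B {..<m}" using A(3) by (auto simp: disjoint_family_on_def B_def)
  moreover have "integrable (orthant k) (elem_fun k m B a)"
    using A(5) by (rule integrable_cong_AE_imp) (use 2 A(1) in \<open>auto intro!: elem_fun_measurable simp: B_def\<close>)
  ultimately have "fin_elem k m B a"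
    using A(4) unfolding fin_elem_def elementary_def by (auto simp: B_def)
  then show ?thesis using 1 2 by (rule that)
qed

lemma elementary_dist:
  assumes A: "elementary k m A a" and B: "elementary k m' B b"
  shows "L1dist P (elem_integral S k m A a) (elem_integral S k m' B b) \<le>
    L1dist (orthant k) (elem_fun k m A a) (elem_fun k m' B b)"
proof -
  obtain A' where A': "fin_elem k m A' a"
    "AE \<omega> in P. elem_integral S k m A a \<omega> = elem_integral S k m A' a \<omega>"
    "AE x in orthant k. elem_fun k m A a x = elem_fun k m A' a x"
    by (rule elementary_finite_version[OF A])
  obtain B' where B': "fin_elem k m' B' b"
    "AE \<omega> in P. elem_integral S k m' B b \<omega> = elem_integral S k m' B' b \<omega>"
    "AE x in orthant k. elem_fun k m' B b x = elem_fun k m' B' b x"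
    by (rule elementary_finite_version[OF B])
  have "L1dist P (elem_integral S k m A a) (elem_integral S k m' B b)
    = L1dist P (elem_integral S k m A' a) (elem_integral S k m' B' b)"
    by (rule nn_integral_abs_cong_AE[OF A'(2) B'(2)])
  also have "\<dots> \<le> L1dist (orthant k) (elem_fun k m A' a) (elem_fun k m' B' b)"
    by (rule fin_elem_dist[OF A'(1) B'(1)])
  also have "\<dots> = L1dist (orthant k) (elem_fun k m A a) (elem_fun k m' B b)"
    by (rule nn_integral_abs_cong_AE[symmetric, OF A'(3) B'(3)])
  finally show ?thesis .
qed

end

lemma nn_integral_abs_triangle:
  fixes f g h :: "'c \<Rightarrow> real"
  assumes [measurable]: "f \<in> borel_measurable M" "g \<in> borel_measurable M" "h \<in> borel_measurable M"
  shows "L1dist M f h \<le> L1dist M f g + L1dist M g h"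
proof -
  have "L1dist M f h \<le> (\<integral>\<^sup>+x. ennreal \<bar>f x - g x\<bar> + ennreal \<bar>g x - h x\<bar> \<partial>M)"
    by (intro nn_integral_mono) (auto simp flip: ennreal_plus intro!: ennreal_leI)
  also have "\<dots> = L1dist M f g + L1dist M g h"
    by (intro nn_integral_add) auto
  finally show ?thesis .
qed

section \<open>Extension from elementary to integrable functions\<close>

context pois_proc
begin

text \<open>The contraction inequality between two elementary integrals, passed to the limit along
  the sequence which defines \<open>Z\<close>. That sequence disappears from the result, so any
  other approximation may be used to estimate \<open>Z\<close>.\<close>

lemma stoch_integral_dist:
  assumes Z: "has_stoch_integral P S k f Z" and A: "elementary k m A a"
  shows "L1dist P (elem_integral S k m A a) Z \<le> L1dist (orthant k) (elem_fun k m A a) f"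
proof -
  obtain mm AA aa where el: "\<And>l. elementary k (mm l) (AA l) (aa l)"
    and cf: "(\<lambda>l. L1dist (orthant k) (elem_fun k (mm l) (AA l) (aa l)) f) \<longlonglongrightarrow> 0"
    and cZ: "(\<lambda>l. L1dist P (elem_integral S k (mm l) (AA l) (aa l)) Z) \<longlonglongrightarrow> 0"
    and f: "f \<in> borel_measurable (orthant k)" and Zm: "Z \<in> borel_measurable P"
    using Z unfolding has_stoch_integral_def by auto
  obtain A' where A': "fin_elem k m A' a"
    "AE \<omega> in P. elem_integral S k m A a \<omega> = elem_integral S k m A' a \<omega>"
    "AE x in orthant k. elem_fun k m A a x = elem_fun k m A' a x"
    by (rule elementary_finite_version[OF A])
  let ?I = "elem_integral S k m A' a" and ?f = "elem_fun k m A a"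
  let ?F = "\<lambda>l. elem_fun k (mm l) (AA l) (aa l)"
  let ?J = "\<lambda>l. elem_integral S k (mm l) (AA l) (aa l)"
  have fm: "?f \<in> borel_measurable (orthant k)" "?F l \<in> borel_measurable (orthant k)" for l
    using A el[of l] by (auto simp: elementary_def)
  have bd: "L1dist P (elem_integral S k m A a) Z \<le>
     (L1dist (orthant k) ?f f + L1dist (orthant k) (?F l) f)
      + L1dist P (?J l) Z" for l
  proof -
    obtain B where B: "fin_elem k (mm l) B (aa l)"
      "AE \<omega> in P. ?J l \<omega> = elem_integral S k (mm l) B (aa l) \<omega>"
      by (rule elementary_finite_version[OF el[of l]])
    have "L1dist P (elem_integral S k m A a) Z = L1dist P ?I Z"
      by (rule nn_integral_abs_cong_AE[OF A'(2)]) simp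
    also have "\<dots> \<le> L1dist P ?I (elem_integral S k (mm l) B (aa l)) + L1dist P (elem_integral S k (mm l) B (aa l)) Z"
      using elem_integral_measurable A'(1) B(1) Zm by (intro nn_integral_abs_triangle)
    also have "L1dist P (elem_integral S k (mm l) B (aa l)) Z = L1dist P (?J l) Z"
      by (rule nn_integral_abs_cong_AE[symmetric, OF B(2)]) simp
    also have "L1dist P ?I (elem_integral S k (mm l) B (aa l)) = L1dist P (elem_integral S k m A a) (?J l)"
      by (rule nn_integral_abs_cong_AE[symmetric, OF A'(2) B(2)])
    also have "\<dots> \<le> L1dist (orthant k) ?f (?F l)"
      by (rule elementary_dist[OF A el])
    also have "\<dots> \<le> L1dist (orthant k) ?f f + L1dist (orthant k) f (?F l)"
      using fm f by (intro nn_integral_abs_triangle)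
    finally show ?thesis by (simp add: abs_minus_commute add_mono)
  qed
  have "(\<lambda>l. (L1dist (orthant k) ?f f + L1dist (orthant k) (?F l) f)
      + L1dist P (?J l) Z) \<longlonglongrightarrow> (L1dist (orthant k) ?f f + 0) + 0"
    by (intro tendsto_add tendsto_const cf cZ)
  then have "L1dist P (elem_integral S k m A a) Z \<le> (L1dist (orthant k) ?f f + 0) + 0"
    by (rule tendsto_lowerbound) (auto intro!: always_eventually bd)
  then show ?thesis by simp
qed

text \<open>Compared with the elementary function without pieces, whose integral is 0, the
  contraction inequality becomes a bound for the norm.\<close>

lemma elem_integral_integrable:
  assumes A: "fin_elem k m A a" shows "integrable P (elem_integral S k m A a)"
proof -
  define Z where "Z = fin_elem k 0 (\<lambda>_. {}) (\<lambda>_. 0)"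
  have z: "elementary k 0 (\<lambda>_. {}) (\<lambda>_. 0)"
    by (auto simp: elementary_def elem_fun_def[abs_def] disjoint_family_on_def)
  have "L1dist P (elem_integral S k m A a) (elem_integral S k 0 (\<lambda>_. {}) (\<lambda>_. 0))
      \<le> L1dist (orthant k) (elem_fun k m A a) (elem_fun k 0 (\<lambda>_. {}) (\<lambda>_. 0))"
    using A z by (intro elementary_dist) (auto simp: fin_elem_def)
  also have "\<dots> < \<infinity>"
    using A by (simp add: elem_fun_def[of _ 0] fin_elem_def elementary_def integrable_iff_bounded)
  finally show ?thesis
    using elem_integral_measurable[OF A] by (simp add: elem_integral_def[of _ _ 0] integrable_iff_bounded)
qed

text \<open>Completeness of \<open>L\<^sub>1\<close> along a rapidly converging subsequence.\<close>

lemma has_stoch_integral_exists: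
  assumes f: "integrable (orthant k) f"
    and el: "\<And>l. elementary k (m l) (A l) (a l)"
    and cf: "(\<lambda>l. L1dist (orthant k) (elem_fun k (m l) (A l) (a l)) f) \<longlonglongrightarrow> 0"
  shows "\<exists>Z. has_stoch_integral P S k f Z"
proof -
  have "\<exists>n. L1dist (orthant k) (elem_fun k (m n) (A n) (a n)) f < ennreal ((1/2) ^ l)" for l
    using order_tendstoD(2)[OF cf, of "ennreal ((1/2) ^ l)"] by (auto simp: eventually_sequentially)
  then obtain n where n: "\<And>l. L1dist (orthant k) (elem_fun k (m (n l)) (A (n l)) (a (n l))) f < ennreal ((1/2) ^ l)"
    by metis
  have "\<forall>l. \<exists>B. fin_elem k (m (n l)) B (a (n l)) \<and> (AE x in orthant k. elem_fun k (m (n l)) (A (n l)) (a (n l)) x = elem_fun k (m (n l)) B (a (n l)) x)"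
    using elementary_finite_version[OF el] by metis
  then obtain B where B: "\<And>l. fin_elem k (m (n l)) (B l) (a (n l))"
    "\<And>l. AE x in orthant k. elem_fun k (m (n l)) (A (n l)) (a (n l)) x = elem_fun k (m (n l)) (B l) (a (n l)) x"
    by metis
  define g where "g l = elem_fun k (m (n l)) (B l) (a (n l))" for l
  define I where "I l = elem_integral S k (m (n l)) (B l) (a (n l))" for l
  have elB: "elementary k (m (n l)) (B l) (a (n l))" for l using B(1)[of l] by (simp add: fin_elem_def)
  have [measurable]: "I l \<in> borel_measurable P" for l unfolding I_def by (rule elem_integral_measurable[OF B(1)])
  have gm: "g l \<in> borel_measurable (orthant k)" for l unfolding g_def using elB[of l] by (auto simp: elementary_def)
  have fm: "f \<in> borel_measurable (orthant k)" using f by auto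
  have gf: "L1dist (orthant k) (g l) f \<le> ennreal ((1/2) ^ l)" for l
  proof -
    have "L1dist (orthant k) (g l) f = L1dist (orthant k) (elem_fun k (m (n l)) (A (n l)) (a (n l))) f"
      unfolding g_def by (rule nn_integral_abs_cong_AE[symmetric, OF B(2)]) simp
    then show ?thesis using n[of l] by simp
  qed
  have gg: "L1dist P (I l) (I l') \<le> ennreal ((1/2) ^ l) + ennreal ((1/2) ^ l')" for l l'
  proof -
    have "L1dist P (I l) (I l') \<le> L1dist (orthant k) (g l) (g l')"
      unfolding I_def g_def by (rule elementary_dist[OF elB elB])
    also have "\<dots> \<le> L1dist (orthant k) (g l) f + L1dist (orthant k) f (g l')"
      using gm fm by (intro nn_integral_abs_triangle)
    also have "\<dots> \<le> ennreal ((1/2) ^ l) + ennreal ((1/2) ^ l')"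
      using gf[of l] gf[of l'] by (intro add_mono) (simp_all add: abs_minus_commute)
    finally show ?thesis .
  qed
  have "(\<integral>\<^sup>+\<omega>. (\<Sum>l. ennreal \<bar>I (Suc l) \<omega> - I l \<omega>\<bar>) \<partial>P) = (\<Sum>l. L1dist P (I (Suc l)) (I l))"
    by (intro nn_integral_suminf) auto
  also have "\<dots> \<le> (\<Sum>l. ennreal (2 * (1/2) ^ l))"
  proof (intro suminf_le)
    fix l
    have "L1dist P (I (Suc l)) (I l) \<le> ennreal ((1/2) ^ Suc l + (1/2) ^ l)"
      using gg[of "Suc l" l] by (subst ennreal_plus) auto
    also have "\<dots> \<le> ennreal (2 * (1/2) ^ l)" by (intro ennreal_leI) simp
    finally show "L1dist P (I (Suc l)) (I l) \<le> ennreal (2 * (1/2) ^ l)" .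
  qed auto
  also have "\<dots> = ennreal (\<Sum>l. 2 * (1/2) ^ l)"
    by (intro suminf_ennreal2 summable_mult summable_geometric) auto
  finally have "(\<integral>\<^sup>+\<omega>. (\<Sum>l. ennreal \<bar>I (Suc l) \<omega> - I l \<omega>\<bar>) \<partial>P) \<noteq> \<infinity>" by (auto simp: top_unique)
  then have "AE \<omega> in P. (\<Sum>l. ennreal \<bar>I (Suc l) \<omega> - I l \<omega>\<bar>) \<noteq> \<infinity>"
    by (intro nn_integral_PInf_AE) auto
  then have conv: "AE \<omega> in P. convergent (\<lambda>l. I l \<omega>)"
  proof eventually_elim
    case (elim \<omega>)
    have "summable (\<lambda>l. \<bar>I (Suc l) \<omega> - I l \<omega>\<bar>)"
      using elim by (intro summable_suminf_not_top) auto
    then have "summable (\<lambda>l. I (Suc l) \<omega> - I l \<omega>)" by (rule summable_rabs_cancel)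
    then have "convergent (\<lambda>L. \<Sum>l<L. (I (Suc l) \<omega> - I l \<omega>))" by (simp add: summable_iff_convergent)
    then have "convergent (\<lambda>L. I L \<omega> - I 0 \<omega>)" by (simp only: sum_lessThan_telescope[of "\<lambda>l. I l \<omega>"])
    then have "convergent (\<lambda>L. (I L \<omega> - I 0 \<omega>) + I 0 \<omega>)" by (intro convergent_add convergent_const)
    then show ?case by simp
  qed
  define Z where "Z \<omega> = lim (\<lambda>l. I l \<omega>)" for \<omega>
  have Zm [measurable]: "Z \<in> borel_measurable P" unfolding Z_def by measurable
  \<comment> \<open>Fatou's lemma in the second index of the Cauchy estimate.\<close>
  have IZ: "L1dist P (I l) Z \<le> ennreal ((1/2) ^ l)" for l
  proof -
    have "L1dist P (I l) Z = (\<integral>\<^sup>+\<omega>. liminf (\<lambda>j. ennreal \<bar>I l \<omega> - I j \<omega>\<bar>) \<partial>P)"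
    proof (rule nn_integral_cong_AE, use conv in eventually_elim)
      case (elim \<omega>)
      then have "(\<lambda>j. I j \<omega>) \<longlonglongrightarrow> Z \<omega>" unfolding Z_def by (simp add: convergent_LIMSEQ_iff)
      then have "(\<lambda>j. ennreal \<bar>I l \<omega> - I j \<omega>\<bar>) \<longlonglongrightarrow> ennreal \<bar>I l \<omega> - Z \<omega>\<bar>"
        by (intro tendsto_ennrealI tendsto_intros)
      then show ?case by (rule lim_imp_Liminf[OF sequentially_bot, symmetric])
    qed
    also have "\<dots> \<le> liminf (\<lambda>j. L1dist P (I l) (I j))"
      by (intro nn_integral_liminf) auto
    also have "\<dots> \<le> liminf (\<lambda>j. ennreal ((1/2) ^ l) + ennreal ((1/2) ^ j))"
      by (intro Liminf_mono always_eventually allI gg)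
    also have "\<dots> = ennreal ((1/2) ^ l)"
    proof -
      have "(\<lambda>j. ennreal ((1/2) ^ j)) \<longlonglongrightarrow> ennreal 0" by (intro tendsto_ennrealI LIMSEQ_realpow_zero) auto
      then have "(\<lambda>j. ennreal ((1/2) ^ l) + ennreal ((1/2) ^ j)) \<longlonglongrightarrow> ennreal ((1/2) ^ l) + ennreal 0" by (intro tendsto_add tendsto_const)
      then have "liminf (\<lambda>j. ennreal ((1/2) ^ l) + ennreal ((1/2) ^ j)) = ennreal ((1/2) ^ l) + ennreal 0"
        by (rule lim_imp_Liminf[OF sequentially_bot])
      then show ?thesis by simp
    qed
    finally show ?thesis .
  qed
  have null: "(\<lambda>l. ennreal ((1/2) ^ l)) \<longlonglongrightarrow> 0"
    using tendsto_ennrealI[OF LIMSEQ_realpow_zero[of "1/2"]] by simp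
  have "integrable P Z"
  proof -
    have "L1dist P (I 0) Z < \<infinity>" using IZ[of 0] by (auto intro: le_less_trans)
    then have "integrable P (\<lambda>\<omega>. I 0 \<omega> - Z \<omega>)" by (auto simp: integrable_iff_bounded)
    moreover have "integrable P (I 0)" unfolding I_def by (rule elem_integral_integrable[OF B(1)])
    ultimately have "integrable P (\<lambda>\<omega>. I 0 \<omega> - (I 0 \<omega> - Z \<omega>))" by (rule Bochner_Integration.integrable_diff[rotated])
    then show ?thesis by simp
  qed
  moreover have "(\<lambda>l. L1dist (orthant k) (g l) f) \<longlonglongrightarrow> 0"
    by (rule tendsto_sandwich[OF _ _ tendsto_const null]) (auto intro!: always_eventually gf)
  moreover have "(\<lambda>l. L1dist P (I l) Z) \<longlonglongrightarrow> 0"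
    by (rule tendsto_sandwich[OF _ _ tendsto_const null]) (auto intro!: always_eventually IZ)
  ultimately have "has_stoch_integral P S k f Z"
    unfolding has_stoch_integral_def I_def g_def using f elB
    by (intro conjI exI[of _ "\<lambda>l. m (n l)"] exI[of _ B] exI[of _ "\<lambda>l. a (n l)"] allI)
  then show ?thesis by blast
qed

lemma stoch_integral:
  assumes "integrable (orthant k) f" "\<And>l. elementary k (m l) (A l) (a l)"
    "(\<lambda>l. L1dist (orthant k) (elem_fun k (m l) (A l) (a l)) f) \<longlonglongrightarrow> 0"
  shows "has_stoch_integral P S k f (stoch_integral P S k f)"
  unfolding stoch_integral_def by (rule someI_ex[OF has_stoch_integral_exists[OF assms]])

end

section \<open>Step kernels and the Poisson process\<close>

lemma bern_image:
  assumes "finite V" "inj_on g V"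
  shows "bern (g ` V) p f = bern V p (\<lambda>A. f (g ` A))"
  using assms
proof (induction V arbitrary: f rule: finite_induct)
  case (insert v V)
  then have "g v \<notin> g ` V" by auto
  then show ?case using insert by (simp add: bern_insert)
qed simp

definition grid :: "real \<Rightarrow> nat \<Rightarrow> real set" where
  "grid h i = {real i * h..<real (Suc i) * h}"

definition cell :: "real \<Rightarrow> real \<Rightarrow> nat" where
  "cell h x = nat \<lfloor>x / h\<rfloor>"

lemma grid_cell: "h > 0 \<Longrightarrow> x \<ge> 0 \<Longrightarrow> x \<in> grid h i \<longleftrightarrow> cell h x = i"
proof -
  assume h: "h > 0" "x \<ge> 0"
  have "x \<in> grid h i \<longleftrightarrow> real i \<le> x / h \<and> x / h < real i + 1"
    using h by (auto simp: grid_def pos_le_divide_eq pos_divide_less_eq algebra_simps)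
  also have "\<dots> \<longleftrightarrow> \<lfloor>x / h\<rfloor> = int i" by (simp add: floor_eq_iff)
  also have "\<dots> \<longleftrightarrow> cell h x = i" using h by (auto simp: cell_def)
  finally show ?thesis .
qed

lemma grid_nonneg: "h > 0 \<Longrightarrow> x \<in> grid h i \<Longrightarrow> x \<ge> 0"
  by (auto simp: grid_def intro: order_trans[rotated])

lemma sets_grid [measurable]: "grid h i \<in> sets borel"
  by (simp add: grid_def)

lemma emeasure_grid: "h > 0 \<Longrightarrow> emeasure lborel (grid h i) = ennreal h"
  by (simp add: grid_def algebra_simps)

lemma disjoint_grid: "h > 0 \<Longrightarrow> disjoint_family_on (grid h) I"
  unfolding disjoint_family_on_def by (metis disjoint_iff grid_cell grid_nonneg)

lemma sum_PiE_two: "(\<Sum>i\<in>{..<2::nat} \<rightarrow>\<^sub>E {..<m::nat}. F (i 0) (i 1)) = (\<Sum>i<m. \<Sum>j<m. F i j :: real)"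
proof -
  have "(\<Sum>i\<in>{..<2::nat} \<rightarrow>\<^sub>E {..<m}. F (i 0) (i 1)) = (\<Sum>(i, j)\<in>{..<m} \<times> {..<m}. F i j)"
    by (rule sum.reindex_bij_witness[of _ "\<lambda>(a, b). \<lambda>k\<in>{..<2}. if k = 0 then a else b" "\<lambda>i. (i 0, i 1)"])
       (auto simp: fun_eq_iff PiE_def extensional_def Pi_def less_2_cases_iff)
  then show ?thesis by (simp add: sum.cartesian_product)
qed

lemma sum_PiE_one: "(\<Sum>i\<in>{..<1::nat} \<rightarrow>\<^sub>E {..<m::nat}. F (i 0)) = (\<Sum>i<m. F i :: real)"
  by (rule sum.reindex_bij_witness[of _ "\<lambda>a. \<lambda>k\<in>{..<1}. a" "\<lambda>i. i 0"])
     (auto simp: fun_eq_iff PiE_def extensional_def Pi_def)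

lemma sum_by_cells:
  fixes c :: "'v \<Rightarrow> nat" and g :: "nat \<Rightarrow> real"
  assumes "finite A" "\<And>i. i \<ge> m \<Longrightarrow> g i = 0"
  shows "(\<Sum>u\<in>A. g (c u)) = (\<Sum>i<m. real (card {u \<in> A. c u = i}) * g i)"
proof -
  have "(\<Sum>u\<in>A. g (c u)) = (\<Sum>u\<in>A. \<Sum>i<m. if c u = i then g i else 0)"
    using assms(2) by (intro sum.cong refl) (auto simp: sum.delta not_less)
  also have "\<dots> = (\<Sum>i<m. \<Sum>u\<in>A. if c u = i then g i else 0)" by (rule sum.swap)
  also have "\<dots> = (\<Sum>i<m. real (card {u \<in> A. c u = i}) * g i)"
    using assms(1) by (simp add: sum.If_cases Int_def)
  finally show ?thesis .
qed

text \<open>With the Poisson counts of the cells for \<open>N\<close> this is the exponential of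
  elementary stochastic integrals, \<open>ln (1 - s1 * w i j)\<close> being the value of
  \<open>phi\<close> for \<open>s1 = 1 - exp (- t1)\<close>. With the numbers of chosen vertices per
  cell it is the weight \<open>Psi\<close> of a step kernel.\<close>

definition step_exp :: "nat \<Rightarrow> (nat \<Rightarrow> nat \<Rightarrow> real) \<Rightarrow> (nat \<Rightarrow> real) \<Rightarrow> real \<Rightarrow> real \<Rightarrow> (nat \<Rightarrow> nat) \<Rightarrow> real" where
  "step_exp m w \<eta> s1 s2 N = exp (1/2 * (\<Sum>i<m. \<Sum>j<m. ln (1 - s1 * w i j) * (real (N i) * real (N j))) - s2 * (\<Sum>i<m. \<eta> i * real (N i)))"

lemma step_exp_le_1:
  assumes "\<And>i j. 0 \<le> w i j \<and> w i j \<le> 1" "\<And>i. \<eta> i \<ge> 0" "0 \<le> s1" "s1 < 1" "0 \<le> s2"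
  shows "step_exp m w \<eta> s1 s2 N \<le> 1"
proof -
  have l: "ln (1 - s1 * w i j) \<le> 0" for i j
  proof -
    have "s1 * w i j \<le> s1 * 1" using assms by (intro mult_left_mono) auto
    then have "0 < 1 - s1 * w i j" "1 - s1 * w i j \<le> 1" using assms(1)[of i j] assms(3,4) by auto
    then show ?thesis by simp
  qed
  have "(\<Sum>i<m. \<Sum>j<m. ln (1 - s1 * w i j) * (real (N i) * real (N j))) \<le> 0"
    using l by (intro sum_nonpos mult_nonpos_nonneg) auto
  moreover have "0 \<le> s2 * (\<Sum>i<m. \<eta> i * real (N i))"
    using assms by (intro mult_nonneg_nonneg sum_nonneg) auto
  ultimately show ?thesis by (simp add: step_exp_def)
qed

text \<open>Two vertices of one cell contribute the factor 1, because \<open>w i i = 0\<close>. So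
  the sum over pairs of distinct vertices is half of a full double sum, a quadratic form in the cell
  counts without corrections of the form \<open>N (N - 1)\<close>.\<close>

lemma Psi_step:
  assumes A: "finite A" and w: "\<And>i j. 0 \<le> w i j \<and> w i j \<le> 1" "\<And>i j. w i j = w j i" "\<And>i. w i i = 0"
    "\<And>i j. i \<ge> m \<Longrightarrow> w i j = 0" "\<And>i. i \<ge> m \<Longrightarrow> \<eta> i = 0" and s: "0 \<le> s1" "s1 < 1"
  shows "Psi s1 (\<lambda>u v. w (c u) (c v)) (\<lambda>u. exp (- s2 * \<eta> (c u))) A = step_exp m w \<eta> s1 s2 (\<lambda>i. card {u \<in> A. c u = i})"
proof -
  let ?L = "\<lambda>i j. ln (1 - s1 * w i j)"
  have pos: "0 < 1 - s1 * w i j" for i j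
  proof -
    have "s1 * w i j \<le> s1 * 1" using w(1) s by (intro mult_left_mono) auto
    then show ?thesis using s by linarith
  qed
  have "(\<Prod>(u, v)\<in>pairs A. 1 - s1 * w (c u) (c v)) = exp (\<Sum>(u, v)\<in>pairs A. ?L (c u) (c v))"
    using A pos by (simp add: exp_sum case_prod_unfold)
  also have "(\<Sum>(u, v)\<in>pairs A. ?L (c u) (c v)) = 1/2 * (\<Sum>u\<in>A. \<Sum>v\<in>A. ?L (c u) (c v))"
    by (subst sum_pairs_sym[OF A]) (use w(2,3) in auto)
  also have "(\<Sum>u\<in>A. \<Sum>v\<in>A. ?L (c u) (c v)) = (\<Sum>u\<in>A. \<Sum>j<m. real (card {u \<in> A. c u = j}) * ?L (c u) j)"
  proof (rule sum.cong[OF refl])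
    fix u assume "u \<in> A"
    have "w (c u) j = 0" if "m \<le> j" for j using w(4)[of j "c u"] w(2)[of "c u" j] that by simp
    then show "(\<Sum>v\<in>A. ?L (c u) (c v)) = (\<Sum>j<m. real (card {u \<in> A. c u = j}) * ?L (c u) j)"
      by (intro sum_by_cells[OF A]) simp
  qed
  also have "\<dots> = (\<Sum>j<m. \<Sum>u\<in>A. real (card {u \<in> A. c u = j}) * ?L (c u) j)" by (rule sum.swap)
  also have "\<dots> = (\<Sum>j<m. \<Sum>i<m. real (card {u \<in> A. c u = i}) * (real (card {u \<in> A. c u = j}) * ?L i j))"
    using w(4) by (intro sum.cong refl sum_by_cells[OF A]) simp
  also have "\<dots> = (\<Sum>i<m. \<Sum>j<m. ?L i j * (real (card {u \<in> A. c u = i}) * real (card {u \<in> A. c u = j})))"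
    by (subst sum.swap) (simp add: mult_ac)
  finally have 1: "(\<Prod>(u, v)\<in>pairs A. 1 - s1 * w (c u) (c v)) = exp (1/2 * (\<Sum>i<m. \<Sum>j<m. ?L i j * (real (card {u \<in> A. c u = i}) * real (card {u \<in> A. c u = j}))))" .
  have "(\<Prod>u\<in>A. exp (- s2 * \<eta> (c u))) = exp (\<Sum>u\<in>A. - s2 * \<eta> (c u))"
    using A by (simp add: exp_sum)
  also have "(\<Sum>u\<in>A. - s2 * \<eta> (c u)) = - s2 * (\<Sum>u\<in>A. \<eta> (c u))" by (simp only: sum_distrib_left)
  also have "(\<Sum>u\<in>A. \<eta> (c u)) = (\<Sum>i<m. \<eta> i * real (card {u \<in> A. c u = i}))"
    using sum_by_cells[OF A, where m = m and g = \<eta> and c = c] w(5) by (simp add: mult.commute)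
  finally have 2: "(\<Prod>u\<in>A. exp (- s2 * \<eta> (c u))) = exp (- s2 * (\<Sum>i<m. \<eta> i * real (card {u \<in> A. c u = i})))" .
  show ?thesis unfolding Psi_def 1 2 step_exp_def by (simp add: exp_add[symmetric])
qed

context pois_proc
begin

lemma elem_integral_grid2:
  "elem_integral S 2 m (grid h) (\<lambda>i. F (i 0) (i 1)) \<omega> = (\<Sum>i<m. \<Sum>j<m. F i j * (real (npoints S (grid h i) \<omega>) * real (npoints S (grid h j) \<omega>)))"
  unfolding elem_integral_def sum_PiE_two[of "\<lambda>a b. F a b * (real (npoints S (grid h a) \<omega>) * real (npoints S (grid h b) \<omega>))", symmetric]
  by (simp add: lessThan_nat_numeral lessThan_Suc numeral_2_eq_2 mult_ac)

lemma elem_integral_grid1: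
  "elem_integral S 1 m (grid h) (\<lambda>i. F (i 0)) \<omega> = (\<Sum>i<m. F i * real (npoints S (grid h i) \<omega>))"
  unfolding elem_integral_def sum_PiE_one[of "\<lambda>a. F a * real (npoints S (grid h a) \<omega>)", symmetric]
  by simp

text \<open>A cell of length \<open>- ln (1 - p)\<close> contains a point with probability exactly \<open>p\<close>.\<close>

lemma expectation_occupied_cells:
  assumes p: "0 < p" "p < 1"
  defines "\<rho> \<equiv> - ln (1 - p)"
  shows "expectation (\<lambda>\<omega>. f {u \<in> {1..N}. S \<omega> \<inter> {(real u - 1) * \<rho>..<real u * \<rho>} \<noteq> {}}) = bern {1..N} p f"
    and "(\<lambda>\<omega>. f {u \<in> {1..N}. S \<omega> \<inter> {(real u - 1) * \<rho>..<real u * \<rho>} \<noteq> {}}) \<in> borel_measurable P"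
proof -
  let ?A = "\<lambda>\<omega>. {u \<in> {1..N}. S \<omega> \<inter> {(real u - 1) * \<rho>..<real u * \<rho>} \<noteq> {}}"
  have \<rho>: "\<rho> > 0" using p by (simp add: \<rho>_def)
  define Y where "Y i \<omega> \<longleftrightarrow> npoints S (grid \<rho> i) \<omega> \<ge> 1" for i \<omega>
  have g: "grid \<rho> i \<subseteq> {0..}" "emeasure lborel (grid \<rho> i) < \<infinity>" for i
    using grid_nonneg[OF \<rho>] emeasure_grid[OF \<rho>] by auto
  have "indep_vars (\<lambda>_. count_space UNIV) (\<lambda>i. npoints S (grid \<rho> i)) {..<N}"
    using pp[unfolded poisson_process_def, THEN conjunct2, THEN conjunct2, THEN conjunct2, rule_format, of N "grid \<rho>"]
      g disjoint_grid[OF \<rho>] sets_grid by auto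
  then have ind: "indep_vars (\<lambda>_. count_space UNIV) Y {..<N}"
    unfolding Y_def by (rule indep_vars_compose2) auto
  have pr: "prob {\<omega> \<in> space P. Y i \<omega>} = p" for i
  proof -
    have m: "npoints S (grid \<rho> i) \<in> measurable P (count_space UNIV)" by (intro npoints_measurable g) simp
    have "prob {\<omega> \<in> space P. Y i \<omega>} = measure (distr P (count_space UNIV) (npoints S (grid \<rho> i))) {1..}"
      using m by (subst measure_distr) (auto simp: Y_def intro!: arg_cong[where f = prob])
    also have "\<dots> = measure (measure_pmf (pois \<rho>)) {1..}"
      using npoints_distr[OF _ g(1) g(2), of i] \<rho> by (simp add: measure_def emeasure_grid)
    also have "{1..} = UNIV - {0::nat}" by auto
    also have "measure (measure_pmf (pois \<rho>)) (UNIV - {0}) = 1 - pmf (pois \<rho>) 0"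
      by (subst measure_pmf.prob_compl[of "{0}" "pois \<rho>", simplified]) (simp add: pmf.rep_eq)
    also have "\<dots> = p" using \<rho> p by (simp add: pois_def) (simp add: \<rho>_def)
    finally show ?thesis .
  qed
  \<comment> \<open>Vertex \<open>u\<close> owns the grid cell \<open>u - 1\<close>: vertices are
    counted from 1 and cells from 0.\<close>
  have eq: "?A \<omega> = Suc ` {i \<in> {..<N}. Y i \<omega>}" if "\<omega> \<in> space P" for \<omega>
  proof -
    have Yi: "Y i \<omega> \<longleftrightarrow> S \<omega> \<inter> grid \<rho> i \<noteq> {}" for i
    proof -
      have "finite (S \<omega> \<inter> grid \<rho> i)"
        by (rule finite_subset[OF _ S_finite[OF that, of "real (Suc i) * \<rho>"]]) (use grid_nonneg[OF \<rho>] in \<open>auto simp: grid_def\<close>)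
      then show ?thesis unfolding Y_def npoints_def by (simp add: Suc_le_eq card_gt_0_iff)
    qed
    have "u \<in> ?A \<omega> \<longleftrightarrow> u \<in> Suc ` {i \<in> {..<N}. Y i \<omega>}" for u
      by (cases u) (auto simp: Yi grid_def image_iff add.commute)
    then show ?thesis by blast
  qed
  have im: "{1..N} = Suc ` {..<N}" by (simp add: image_Suc_lessThan)
  have "expectation (\<lambda>\<omega>. f (?A \<omega>)) = expectation (\<lambda>\<omega>. f (Suc ` {i \<in> {..<N}. Y i \<omega>}))"
    by (intro Bochner_Integration.integral_cong refl) (simp only: eq)
  also have "\<dots> = bern {..<N} p (\<lambda>A. f (Suc ` A))"
    by (rule expectation_bern(1)[OF _ ind pr]) simp
  also have "\<dots> = bern {1..N} p f" unfolding im by (intro bern_image[symmetric]) auto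
  finally show "expectation (\<lambda>\<omega>. f (?A \<omega>)) = bern {1..N} p f" .
  have "(\<lambda>\<omega>. f (Suc ` {i \<in> {..<N}. Y i \<omega>})) \<in> borel_measurable P"
    by (rule expectation_bern(2)[OF _ ind pr]) simp
  then show "(\<lambda>\<omega>. f (?A \<omega>)) \<in> borel_measurable P"
    by (subst measurable_cong[OF arg_cong[where f = f, OF eq]])
qed

text \<open>Single points are null sets. Away from the cell boundaries the cell of a point is stable
  under small shifts, which the coupling with the vertices needs.\<close>

lemma AE_no_grid_points: "AE \<omega> in P. \<forall>i::nat. real i * h \<notin> S \<omega> \<or> real i * h < 0"
proof (subst AE_all_countable, intro allI)
  fix i :: nat
  show "AE \<omega> in P. real i * h \<notin> S \<omega> \<or> real i * h < 0"
  proof (cases "real i * h < 0")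
    case False
    have s: "{real i * h} \<in> sets borel" "{real i * h} \<subseteq> {0..}" "emeasure lborel {real i * h} < \<infinity>" using False by auto
    have "(\<integral>\<^sup>+\<omega>. ennreal (real (npoints S {real i * h} \<omega>)) \<partial>P) = 0"
      using nn_integral_npoints[OF s] by simp
    then have "AE \<omega> in P. ennreal (real (npoints S {real i * h} \<omega>)) = 0"
      using npoints_real_measurable[OF s] by (subst (asm) nn_integral_0_iff_AE) auto
    then show ?thesis by eventually_elim (auto simp: npoints_def card_eq_0_iff)
  qed simp
qed

end

text \<open>Everything follows from \<open>ln x \<le> x - 1\<close>, taken at \<open>1 - p\<close>
  and at \<open>1 / (1 - p)\<close>: the interval that decides about a vertex is at least as long as
  \<open>p\<close> and asymptotically equal to it.\<close>

lemma rho_over_p: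
  fixes p :: "nat \<Rightarrow> real"
  assumes "p \<longlonglongrightarrow> 0" "\<forall>\<^sub>F n in sequentially. 0 < p n"
  shows "(\<lambda>n. p n / (- ln (1 - p n))) \<longlonglongrightarrow> 1" "(\<lambda>n. - ln (1 - p n)) \<longlonglongrightarrow> 0"
    "\<forall>\<^sub>F n in sequentially. p n \<le> - ln (1 - p n)"
proof -
  have lt: "\<forall>\<^sub>F n in sequentially. p n < 1" using order_tendstoD(2)[OF assms(1), of 1] by simp
  show "(\<lambda>n. - ln (1 - p n)) \<longlonglongrightarrow> 0"
    using tendsto_minus[OF tendsto_ln[OF tendsto_diff[OF tendsto_const[of 1] assms(1)]]] by simp
  have b: "\<forall>\<^sub>F n in sequentially. p n \<le> - ln (1 - p n) \<and> - ln (1 - p n) \<le> p n / (1 - p n) \<and> 0 < p n \<and> p n < 1"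
    using lt assms(2)
  proof eventually_elim
    case (elim n)
    have "ln (1 - p n) \<le> - p n" using ln_le_minus_one[of "1 - p n"] elim by simp
    moreover have "ln (1 / (1 - p n)) \<le> 1 / (1 - p n) - 1" using elim by (intro ln_le_minus_one) simp
    moreover have "ln (1 / (1 - p n)) = - ln (1 - p n)" using elim by (simp add: ln_div)
    moreover have "1 / (1 - p n) - 1 = p n / (1 - p n)" using elim by (simp add: field_simps)
    ultimately show ?case using elim by auto
  qed
  then show "\<forall>\<^sub>F n in sequentially. p n \<le> - ln (1 - p n)" by eventually_elim simp
  have l: "(\<lambda>n. 1 - p n) \<longlonglongrightarrow> 1" using tendsto_diff[OF tendsto_const[of 1] assms(1)] by simp
  show "(\<lambda>n. p n / (- ln (1 - p n))) \<longlonglongrightarrow> 1"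
  proof (rule tendsto_sandwich[OF _ _ l tendsto_const])
    show "\<forall>\<^sub>F n in sequentially. 1 - p n \<le> p n / (- ln (1 - p n))"
      using b
    proof eventually_elim
      case (elim n)
      then have "(1 - p n) * (- ln (1 - p n)) \<le> (1 - p n) * (p n / (1 - p n))" by (intro mult_left_mono) auto
      then have "(1 - p n) * (- ln (1 - p n)) \<le> p n" using elim by simp
      then show ?case using elim by (subst pos_le_divide_eq) linarith+
    qed
    show "\<forall>\<^sub>F n in sequentially. p n / (- ln (1 - p n)) \<le> 1"
      using b by eventually_elim (subst pos_divide_le_eq, linarith+)
  qed
qed

lemma eventually_floor_eq:
  fixes f :: "nat \<Rightarrow> real"
  assumes "f \<longlonglongrightarrow> x" "x \<notin> \<int>"
  shows "\<forall>\<^sub>F n in sequentially. \<lfloor>f n\<rfloor> = \<lfloor>x\<rfloor>"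
proof -
  have "of_int \<lfloor>x\<rfloor> < x" using assms(2) by (metis Ints_of_int of_int_floor_le order_le_less)
  moreover have "x < of_int \<lfloor>x\<rfloor> + 1" by linarith
  ultimately have "\<forall>\<^sub>F n in sequentially. of_int \<lfloor>x\<rfloor> < f n" "\<forall>\<^sub>F n in sequentially. f n < of_int \<lfloor>x\<rfloor> + 1"
    using order_tendstoD[OF assms(1)] by auto
  then show ?thesis by eventually_elim (simp add: floor_eq_iff)
qed

section \<open>Coupling of the chosen vertices with the Poisson points\<close>

context pois_proc
begin

text \<open>A path has finitely many points in a bounded window. Once \<open>\<rho> n\<close> is
  below their smallest distance, each occupies an interval of its own, with vertex
  \<open>g n x\<close>. The position \<open>g n x * p n\<close> tends to \<open>x\<close>, because
  \<open>p n / \<rho> n\<close> tends to 1, and finally lies in the same cell, since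
  \<open>x\<close> is no cell boundary.\<close>

lemma occupied_cells_eventually:
  fixes p :: "nat \<Rightarrow> real"
  assumes p: "p \<longlonglongrightarrow> 0" "\<forall>\<^sub>F n in sequentially. 0 < p n" and h: "h > 0" and K: "K > real m * h"
    and \<omega>: "\<omega> \<in> space P" and bd: "\<And>i::nat. real i * h \<notin> S \<omega>"
  defines "\<rho> \<equiv> \<lambda>n. - ln (1 - p n)"
  shows "\<forall>\<^sub>F n in sequentially. \<forall>i<m. card {u \<in> {u \<in> {1..nat \<lfloor>K / p n\<rfloor>}. S \<omega> \<inter> {(real u - 1) * \<rho> n..<real u * \<rho> n} \<noteq> {}}.
     cell h (real u * p n) = i} = npoints S (grid h i) \<omega>"
proof -
  \<comment> \<open>The margin 1 allows for the ratio of \<open>\<rho> n\<close> to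
    \<open>p n\<close>: a vertex \<open>u\<close> with \<open>u * p n \<le> m * h\<close> may be
    occupied by a point close to \<open>u * \<rho> n\<close>, which may exceed
    \<open>m * h\<close>.\<close>
  define F where "F = S \<omega> \<inter> {0..real m * h + 1}"
  have F: "finite F" unfolding F_def by (rule S_finite[OF \<omega>])
  define g where "g n x = Suc (nat \<lfloor>x / \<rho> n\<rfloor>)" for n x
  have \<rho>: "(\<lambda>n. p n / \<rho> n) \<longlonglongrightarrow> 1" "\<rho> \<longlonglongrightarrow> 0" "\<forall>\<^sub>F n in sequentially. p n \<le> \<rho> n"
    using rho_over_p[OF p] unfolding \<rho>_def by auto
  have \<rho>pos: "\<forall>\<^sub>F n in sequentially. 0 < \<rho> n" using \<rho>(3) p(2) by eventually_elim linarith
  have gb: "(real (g n x) - 1) * \<rho> n \<le> x \<and> x < real (g n x) * \<rho> n" if "0 < \<rho> n" "x \<ge> 0" for n x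
  proof -
    have "real (nat \<lfloor>x / \<rho> n\<rfloor>) \<le> x / \<rho> n" "x / \<rho> n < real (nat \<lfloor>x / \<rho> n\<rfloor>) + 1" using that by auto
    then have "real (nat \<lfloor>x / \<rho> n\<rfloor>) * \<rho> n \<le> x" "x < (real (nat \<lfloor>x / \<rho> n\<rfloor>) + 1) * \<rho> n"
      using that(1) by (simp_all only: pos_le_divide_eq pos_divide_less_eq)
    moreover define k where "k = nat \<lfloor>x / \<rho> n\<rfloor>"
    ultimately have "real k * \<rho> n \<le> x \<and> x < (real k + 1) * \<rho> n" by simp
    then show ?thesis unfolding g_def k_def[symmetric] by (simp add: add.commute)
  qed
  have gu: "u = g n x" if "0 < \<rho> n" "x \<ge> 0" "u \<ge> 1" "(real u - 1) * \<rho> n \<le> x" "x < real u * \<rho> n" for n x u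
  proof -
    have "real (u - 1) \<le> x / \<rho> n" "x / \<rho> n < real (u - 1) + 1"
      using that by (auto simp: pos_le_divide_eq pos_divide_less_eq of_nat_diff)
    then have "\<lfloor>x / \<rho> n\<rfloor> = int (u - 1)" by (simp add: floor_eq_iff)
    then show ?thesis using that(3) by (simp add: g_def)
  qed
  have inj: "\<forall>\<^sub>F n in sequentially. \<forall>x\<in>F. \<forall>y\<in>F. x < y \<longrightarrow> g n x \<noteq> g n y"
  proof (intro eventually_ball_finite[OF F] ballI)
    fix x y assume xy: "x \<in> F" "y \<in> F"
    show "\<forall>\<^sub>F n in sequentially. x < y \<longrightarrow> g n x \<noteq> g n y"
    proof (cases "x < y")
      case True
      then have "\<forall>\<^sub>F n in sequentially. \<rho> n < y - x" using order_tendstoD(2)[OF \<rho>(2)] by simp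
      then show ?thesis using \<rho>pos
      proof eventually_elim
        case (elim n)
        show ?case
        proof (intro impI notI)
          assume eq: "g n x = g n y"
          have "x \<ge> 0" "y \<ge> 0" using xy by (auto simp: F_def)
          then have "y < real (g n x) * \<rho> n" "(real (g n x) - 1) * \<rho> n \<le> x" using gb elim eq by metis+
          then show False using elim by (simp add: algebra_simps)
        qed
      qed
    qed simp
  qed
  have cel: "\<forall>\<^sub>F n in sequentially. \<forall>x\<in>F. cell h (real (g n x) * p n) = cell h x"
  proof (intro eventually_ball_finite[OF F] ballI)
    fix x assume x: "x \<in> F"
    then have x0: "x \<ge> 0" by (auto simp: F_def)
    have "(\<lambda>n. real (g n x) * p n) \<longlonglongrightarrow> x"
    proof (rule tendsto_sandwich)
      show "\<forall>\<^sub>F n in sequentially. x * (p n / \<rho> n) \<le> real (g n x) * p n"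
        using \<rho>pos p(2)
      proof eventually_elim
        case (elim n)
        have "x * (p n / \<rho> n) \<le> (real (g n x) * \<rho> n) * (p n / \<rho> n)"
          using gb[OF elim(1) x0] elim by (intro mult_right_mono) auto
        then show ?case using elim by simp
      qed
      show "\<forall>\<^sub>F n in sequentially. real (g n x) * p n \<le> (x + \<rho> n) * (p n / \<rho> n)"
        using \<rho>pos p(2)
      proof eventually_elim
        case (elim n)
        have "(real (g n x) * \<rho> n) * (p n / \<rho> n) \<le> (x + \<rho> n) * (p n / \<rho> n)"
          using gb[OF elim(1) x0] elim by (intro mult_right_mono) (auto simp: algebra_simps)
        then show ?case using elim by simp
      qed
      show "(\<lambda>n. x * (p n / \<rho> n)) \<longlonglongrightarrow> x" using tendsto_mult[OF tendsto_const[of x] \<rho>(1)] by simp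
      show "(\<lambda>n. (x + \<rho> n) * (p n / \<rho> n)) \<longlonglongrightarrow> x"
        using tendsto_mult[OF tendsto_add[OF tendsto_const[of x] \<rho>(2)] \<rho>(1)] by simp
    qed
    then have "(\<lambda>n. real (g n x) * p n / h) \<longlonglongrightarrow> x / h" using h by (intro tendsto_intros) auto
    moreover have "x / h \<notin> \<int>"
    proof
      assume "x / h \<in> \<int>"
      then obtain k where k: "x / h = of_int k" by (auto elim: Ints_cases)
      have "0 \<le> x / h" using x0 h by simp
      then have "x = real (nat k) * h" using k h by (simp add: field_simps)
      then show False using bd[of "nat k"] x by (simp add: F_def)
    qed
    ultimately show "\<forall>\<^sub>F n in sequentially. cell h (real (g n x) * p n) = cell h x"
      unfolding cell_def by (rule eventually_mono[OF eventually_floor_eq]) simp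
  qed
  \<comment> \<open>The strict inequality for \<open>K\<close> makes up for rounding
    \<open>K / p n\<close> down: all points in the first \<open>m\<close> cells belong to vertices
    of the head.\<close>
  have NK: "\<forall>\<^sub>F n in sequentially. real m * h < real (nat \<lfloor>K / p n\<rfloor>) * \<rho> n"
  proof -
    have "\<forall>\<^sub>F n in sequentially. p n < K - real m * h" using order_tendstoD(2)[OF p(1)] K by simp
    then show ?thesis using p(2) \<rho>(3)
    proof eventually_elim
      case (elim n)
      have "K / p n - 1 \<le> real (nat \<lfloor>K / p n\<rfloor>)" by linarith
      then have "(K / p n - 1) * p n \<le> real (nat \<lfloor>K / p n\<rfloor>) * p n" using elim by (intro mult_right_mono) auto
      also have "\<dots> \<le> real (nat \<lfloor>K / p n\<rfloor>) * \<rho> n" using elim by (intro mult_left_mono) auto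
      finally show ?case using elim by (simp add: algebra_simps)
    qed
  qed
  have ratio: "\<forall>\<^sub>F n in sequentially. real m * h * (\<rho> n / p n) \<le> real m * h + 1"
  proof -
    have "(\<lambda>n. real m * h * inverse (p n / \<rho> n)) \<longlonglongrightarrow> real m * h * inverse 1"
      by (intro tendsto_intros \<rho>(1)) simp
    then have "\<forall>\<^sub>F n in sequentially. real m * h * inverse (p n / \<rho> n) < real m * h + 1"
      by (rule order_tendstoD(2)) simp
    then show ?thesis by eventually_elim simp
  qed
  show ?thesis
    using inj cel NK ratio \<rho>pos p(2)
  proof eventually_elim
    case (elim n)
    let ?A = "{u \<in> {1..nat \<lfloor>K / p n\<rfloor>}. S \<omega> \<inter> {(real u - 1) * \<rho> n..<real u * \<rho> n} \<noteq> {}}"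
    show ?case
    proof (intro allI impI)
      fix i assume i: "i < m"
      have im: "real (Suc i) * h \<le> real m * h" using i h by (intro mult_right_mono) auto
      have sub: "S \<omega> \<inter> grid h i \<subseteq> F"
      proof
        fix x assume x: "x \<in> S \<omega> \<inter> grid h i"
        then have "x \<ge> 0" "x < real (Suc i) * h" using grid_nonneg[OF h] by (auto simp: grid_def)
        then show "x \<in> F" using x im by (auto simp: F_def)
      qed
      have "{u \<in> ?A. cell h (real u * p n) = i} = g n ` (S \<omega> \<inter> grid h i)"
      proof (intro set_eqI iffI)
        fix u assume u: "u \<in> {u \<in> ?A. cell h (real u * p n) = i}"
        then obtain x where x: "x \<in> S \<omega>" "(real u - 1) * \<rho> n \<le> x" "x < real u * \<rho> n" by auto
        have x0: "x \<ge> 0" using x(1) S_nonneg[OF \<omega>] by auto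
        have gx: "u = g n x" using gu[OF elim(5) x0 _ x(2,3)] u by auto
        have "real u * p n \<in> grid h i" using u elim(6) by (subst grid_cell[OF h]) auto
        then have "real u * p n \<le> real m * h" using im by (auto simp: grid_def)
        then have "real u * p n * (\<rho> n / p n) \<le> real m * h * (\<rho> n / p n)"
          using elim by (intro mult_right_mono) auto
        then have "real u * \<rho> n \<le> real m * h + 1" using elim by simp
        then have xF: "x \<in> F" using x x0 by (auto simp: F_def)
        then have "cell h x = i" using elim(2) u gx by auto
        then have "x \<in> grid h i" using grid_cell[OF h x0] by simp
        then show "u \<in> g n ` (S \<omega> \<inter> grid h i)" using x(1) gx by auto
      next
        fix u assume "u \<in> g n ` (S \<omega> \<inter> grid h i)"
        then obtain x where x: "x \<in> S \<omega>" "x \<in> grid h i" "u = g n x" by auto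
        have x0: "x \<ge> 0" by (rule grid_nonneg[OF h x(2)])
        have b: "(real u - 1) * \<rho> n \<le> x" "x < real u * \<rho> n" using gb[OF elim(5) x0] x(3) by auto
        have "x < real m * h" using x(2) im by (auto simp: grid_def)
        then have "(real u - 1) * \<rho> n < real (nat \<lfloor>K / p n\<rfloor>) * \<rho> n" using b elim(3) by linarith
        then have "real u - 1 < real (nat \<lfloor>K / p n\<rfloor>)" using elim(5) by simp
        then have "u \<le> nat \<lfloor>K / p n\<rfloor>" by linarith
        moreover have "u \<ge> 1" using x(3) by (simp add: g_def)
        moreover have "cell h (real u * p n) = i"
          using elim(2) x sub grid_cell[OF h x0, of i] by auto
        ultimately show "u \<in> {u \<in> ?A. cell h (real u * p n) = i}" using x(1) b by auto
      qed
      moreover have "inj_on (g n) (S \<omega> \<inter> grid h i)"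
      proof (rule inj_onI)
        fix x y assume xy: "x \<in> S \<omega> \<inter> grid h i" "y \<in> S \<omega> \<inter> grid h i" "g n x = g n y"
        then have "x \<in> F" "y \<in> F" using sub by auto
        then show "x = y" using elim(1)[rule_format, of x y] elim(1)[rule_format, of y x] xy(3) by linarith
      qed
      ultimately show "card {u \<in> ?A. cell h (real u * p n) = i} = npoints S (grid h i) \<omega>"
        by (simp add: card_image npoints_def)
    qed
  qed
qed

text \<open>For every \<open>n\<close> the random set is realised by occupied intervals on the one
  space of the Poisson process. In this coupling the functional almost surely equals its limit from
  some index on, and it is bounded by 1, so dominated convergence applies.\<close>

lemma bern_step_limit:
  fixes p :: "nat \<Rightarrow> real"
  assumes p: "p \<longlonglongrightarrow> 0" "\<forall>\<^sub>F n in sequentially. 0 < p n" and h: "h > 0" and K: "K > real m * h"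
    and w: "\<And>i j. 0 \<le> w i j \<and> w i j \<le> 1" "\<And>i j. w i j = w j i" "\<And>i. w i i = 0" "\<And>i j. i \<ge> m \<Longrightarrow> w i j = 0"
    and \<eta>: "\<And>i. i \<ge> m \<Longrightarrow> \<eta> i = 0" "\<And>i. \<eta> i \<ge> 0" and s: "0 \<le> s1" "s1 < 1" "0 \<le> s2"
  shows "(\<lambda>n. bern {1..nat \<lfloor>K / p n\<rfloor>} (p n)
      (Psi s1 (\<lambda>u v. w (cell h (real u * p n)) (cell h (real v * p n))) (\<lambda>u. exp (- s2 * \<eta> (cell h (real u * p n))))))
    \<longlonglongrightarrow> expectation (\<lambda>\<omega>. exp (1/2 * elem_integral S 2 m (grid h) (\<lambda>i. ln (1 - s1 * w (i 0) (i 1))) \<omega>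
        - s2 * elem_integral S 1 m (grid h) (\<lambda>i. \<eta> (i 0)) \<omega>))"
proof -
  define \<rho> where "\<rho> n = - ln (1 - p n)" for n
  define A where "A n \<omega> = {u \<in> {1..nat \<lfloor>K / p n\<rfloor>}. S \<omega> \<inter> {(real u - 1) * \<rho> n..<real u * \<rho> n} \<noteq> {}}" for n \<omega>
  define f where "f n = Psi s1 (\<lambda>u v. w (cell h (real u * p n)) (cell h (real v * p n))) (\<lambda>u. exp (- s2 * \<eta> (cell h (real u * p n))))" for n
  define G where "G \<omega> = step_exp m w \<eta> s1 s2 (\<lambda>i. npoints S (grid h i) \<omega>)" for \<omega>
  have fA: "f n (A n \<omega>) = step_exp m w \<eta> s1 s2 (\<lambda>i. card {u \<in> A n \<omega>. cell h (real u * p n) = i})" for n \<omega>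
    unfolding f_def by (rule Psi_step) (use w \<eta> s in \<open>auto simp: A_def\<close>)
  have lt: "\<forall>\<^sub>F n in sequentially. p n < 1" using order_tendstoD(2)[OF p(1), of 1] by simp
  have "\<forall>\<^sub>F n in sequentially. 0 < p n \<and> p n < 1" using p(2) lt by eventually_elim simp
  \<comment> \<open>Dominated convergence asks for measurability at every index, but
    \<open>p n\<close> lies strictly between 0 and 1 only eventually; so the sequence is
    shifted.\<close>
  then obtain n0 where n0: "\<And>n. n \<ge> n0 \<Longrightarrow> 0 < p n \<and> p n < 1" unfolding eventually_sequentially by auto
  have Geq: "G \<omega> = exp (1/2 * elem_integral S 2 m (grid h) (\<lambda>i. ln (1 - s1 * w (i 0) (i 1))) \<omega>
        - s2 * elem_integral S 1 m (grid h) (\<lambda>i. \<eta> (i 0)) \<omega>)" for \<omega>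
    unfolding elem_integral_grid2[of m h "\<lambda>a b. ln (1 - s1 * w a b)"] elem_integral_grid1[of m h \<eta>] G_def step_exp_def ..
  have "grid h i \<subseteq> {0..}" "emeasure lborel (grid h i) < \<infinity>" for i
    using grid_nonneg[OF h] emeasure_grid[OF h] by auto
  then have [measurable]: "(\<lambda>\<omega>. real (npoints S (grid h i) \<omega>)) \<in> borel_measurable P" for i
    by (intro npoints_real_measurable) auto
  have Gm: "G \<in> borel_measurable P" unfolding G_def step_exp_def by measurable
  have "(\<lambda>n. expectation (\<lambda>\<omega>. f (n + n0) (A (n + n0) \<omega>))) \<longlonglongrightarrow> expectation G"
  proof (rule integral_dominated_convergence[where w = "\<lambda>_. 1"])
    show "G \<in> borel_measurable P" by (rule Gm)
    show "(\<lambda>\<omega>. f (n + n0) (A (n + n0) \<omega>)) \<in> borel_measurable P" for n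
      unfolding A_def \<rho>_def using n0[of "n + n0"] by (intro expectation_occupied_cells(2)) auto
    show "AE \<omega> in P. (\<lambda>n. f (n + n0) (A (n + n0) \<omega>)) \<longlonglongrightarrow> G \<omega>"
      using AE_no_grid_points[of h] AE_space
    proof eventually_elim
      case (elim \<omega>)
      have bd: "real i * h \<notin> S \<omega>" for i using elim(1)[rule_format, of i] h by (auto simp: mult_less_0_iff)
      have "\<forall>\<^sub>F n in sequentially. f n (A n \<omega>) = G \<omega>"
        using occupied_cells_eventually[OF p h K elim(2) bd]
      proof eventually_elim
        case (elim n)
        then have "card {u \<in> A n \<omega>. cell h (real u * p n) = i} = npoints S (grid h i) \<omega>" if "i < m" for i
          using that unfolding A_def \<rho>_def by blast
        then show ?case unfolding fA G_def step_exp_def by simp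
      qed
      then have "(\<lambda>n. f n (A n \<omega>)) \<longlonglongrightarrow> G \<omega>" by (rule tendsto_eventually)
      then show ?case by (rule LIMSEQ_ignore_initial_segment)
    qed
    show "AE \<omega> in P. norm (f (n + n0) (A (n + n0) \<omega>)) \<le> 1" for n
      unfolding fA using step_exp_le_1[OF w(1) \<eta>(2) s] by (auto simp: step_exp_def)
  qed simp
  moreover have "expectation (\<lambda>\<omega>. f (n + n0) (A (n + n0) \<omega>)) = bern {1..nat \<lfloor>K / p (n + n0)\<rfloor>} (p (n + n0)) (f (n + n0))" for n
    unfolding A_def \<rho>_def using n0[of "n + n0"] by (intro expectation_occupied_cells(1)) auto
  ultimately have "(\<lambda>n. bern {1..nat \<lfloor>K / p (n + n0)\<rfloor>} (p (n + n0)) (f (n + n0))) \<longlonglongrightarrow> expectation G" by simp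
  then have "(\<lambda>n. bern {1..nat \<lfloor>K / p n\<rfloor>} (p n) (f n)) \<longlonglongrightarrow> expectation G"
    by (rule LIMSEQ_offset)
  moreover have "expectation G = expectation (\<lambda>\<omega>. exp (1/2 * elem_integral S 2 m (grid h) (\<lambda>i. ln (1 - s1 * w (i 0) (i 1))) \<omega>
        - s2 * elem_integral S 1 m (grid h) (\<lambda>i. \<eta> (i 0)) \<omega>))"
    by (rule Bochner_Integration.integral_cong[OF refl Geq])
  ultimately show ?thesis unfolding f_def by simp
qed

end

section \<open>Approximation by step functions\<close>

text \<open>\<open>c l\<close> maps a point to its cell at level \<open>l\<close>. An open set is the increasing limit of the union of the cells contained
  in it, and every Borel set of finite measure is almost an open set.\<close>

lemma L1_cell_approx:
  fixes f :: "'a::euclidean_space \<Rightarrow> real" and c :: "nat \<Rightarrow> 'a \<Rightarrow> 'i::countable"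
  assumes f: "integrable lborel f"
    and c: "\<And>l. c l \<in> measurable borel (count_space UNIV)"
    and shrink: "\<And>x U. open U \<Longrightarrow> x \<in> U \<Longrightarrow> \<forall>\<^sub>F l in sequentially. \<forall>y. c l y = c l x \<longrightarrow> y \<in> U"
    and e: "e > 0"
  shows "\<exists>g. \<forall>\<^sub>F l in sequentially. (\<integral>\<^sup>+x. ennreal \<bar>f x - g l (c l x)\<bar> \<partial>lborel) < ennreal e"
  using f e
proof (induction f arbitrary: e rule: integrable_induct)
  case (base A b)
  \<comment> \<open>Two errors of size \<open>e'\<close>, from \<open>A\<close> to \<open>U\<close>
    and from \<open>U\<close> to its cells, are multiplied by \<open>\<bar>b\<bar>\<close>; the
    \<open>+ 1\<close> covers \<open>b = 0\<close> and makes the final inequality strict.\<close>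
  define e' where "e' = e / (2 * (\<bar>b\<bar> + 1))"
  have e': "e' > 0" using base by (simp add: e'_def)
  obtain U where U: "open U" "A \<subseteq> U" "emeasure lborel (U - A) < ennreal e'"
    using outer_regular_lborel[OF _ e', of A] base by auto
  have Am: "A \<in> sets borel" using base by simp
  have Um: "U \<in> sets borel" using U by simp
  have "emeasure lborel U \<le> emeasure lborel A + emeasure lborel (U - A)"
    using Am Um U(2) by (metis Diff_disjoint Diff_partition emeasure_subadditive sets_lborel sets.Diff)
  also have "\<dots> < \<infinity>"
  proof -
    have "emeasure lborel (U - A) < \<top>" using U(3) by (rule less_trans) simp
    then show ?thesis using base by (simp add: less_top[symmetric])
  qed
  finally have Uf: "emeasure lborel U < \<infinity>" .
  define I where "I l i = (of_bool (\<forall>y. c l y = i \<longrightarrow> y \<in> U) :: real)" for l and i :: 'i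
  have Im: "(\<lambda>x. I l (c l x)) \<in> borel_measurable lborel" for l :: nat
    using measurable_compose[OF c, of "I l" borel l] by simp
  have lim: "(\<lambda>l. \<integral>\<^sup>+x. ennreal \<bar>indicator U x - I l (c l x)\<bar> \<partial>lborel) \<longlonglongrightarrow> (\<integral>\<^sup>+x. 0 \<partial>(lborel :: 'a measure))"
  proof (rule nn_integral_dominated_convergence[where w = "indicator U"])
    show "AE x in lborel. ennreal \<bar>indicator U x - I l (c l x)\<bar> \<le> indicator U x" for l
      by (auto simp: I_def indicator_def)
    show "(\<integral>\<^sup>+x. indicator U x \<partial>lborel) < \<infinity>" using Uf Um by simp
    show "AE x in lborel. (\<lambda>l. ennreal \<bar>indicator U x - I l (c l x)\<bar>) \<longlonglongrightarrow> 0"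
    proof (rule AE_I2)
      fix x
      have "\<forall>\<^sub>F l in sequentially. ennreal \<bar>indicator U x - I l (c l x)\<bar> = 0"
      proof (cases "x \<in> U")
        case True
        show ?thesis using shrink[OF U(1) True] by eventually_elim (use True in \<open>simp add: I_def\<close>)
      qed (intro always_eventually, auto simp: I_def)
      then show "(\<lambda>l. ennreal \<bar>indicator U x - I l (c l x)\<bar>) \<longlonglongrightarrow> 0" by (rule tendsto_eventually)
    qed
  qed (use Im Um in auto)
  show ?case
  proof (intro exI[of _ "\<lambda>l i. I l i * b"])
    have "\<forall>\<^sub>F l in sequentially. (\<integral>\<^sup>+x. ennreal \<bar>indicator U x - I l (c l x)\<bar> \<partial>lborel) < ennreal e'"
      using order_tendstoD(2)[OF lim, of "ennreal e'"] e' by simp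
    then show "\<forall>\<^sub>F l in sequentially. (\<integral>\<^sup>+x. ennreal \<bar>indicator A x *\<^sub>R b - I l (c l x) * b\<bar> \<partial>lborel) < ennreal e"
    proof eventually_elim
      case (elim l)
      have AU: "L1dist lborel (indicator A) (indicator U) = emeasure lborel (U - A)"
      proof -
        have "ennreal \<bar>indicator A x - indicator U x\<bar> = indicator (U - A) x" for x
          using U(2) by (auto simp: indicator_def)
        then show ?thesis using Am Um by simp
      qed
      have "(\<integral>\<^sup>+x. ennreal \<bar>indicator A x - I l (c l x)\<bar> \<partial>lborel) \<le> L1dist lborel (indicator A) (indicator U) + (\<integral>\<^sup>+x. ennreal \<bar>indicator U x - I l (c l x)\<bar> \<partial>lborel)"
        using Im Am Um by (intro nn_integral_abs_triangle) auto
      also have "\<dots> \<le> ennreal e' + ennreal e'" using AU U(3) elim by (intro add_mono) auto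
      also have "\<dots> = ennreal (2 * e')" using e' by (simp flip: ennreal_plus)
      finally have 1: "(\<integral>\<^sup>+x. ennreal \<bar>indicator A x - I l (c l x)\<bar> \<partial>lborel) \<le> ennreal (2 * e')" .
      have "(\<integral>\<^sup>+x. ennreal \<bar>indicator A x *\<^sub>R b - I l (c l x) * b\<bar> \<partial>lborel) = (\<integral>\<^sup>+x. ennreal \<bar>b\<bar> * ennreal \<bar>indicator A x - I l (c l x)\<bar> \<partial>lborel)"
        by (intro nn_integral_cong) (simp add: ennreal_mult[symmetric] abs_mult[symmetric] algebra_simps)
      also have "\<dots> = ennreal \<bar>b\<bar> * (\<integral>\<^sup>+x. ennreal \<bar>indicator A x - I l (c l x)\<bar> \<partial>lborel)"
        using Im Am by (intro nn_integral_cmult) auto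
      also have "\<dots> \<le> ennreal \<bar>b\<bar> * ennreal (2 * e')" using 1 by (rule mult_left_mono) simp
      also have "\<dots> = ennreal (\<bar>b\<bar> * (2 * e'))" using e' by (simp add: ennreal_mult)
      also have "\<dots> < ennreal e"
      proof (rule ennreal_lessI)
        have "\<bar>b\<bar> * (2 * e') = e * (\<bar>b\<bar> / (\<bar>b\<bar> + 1))" by (simp add: e'_def field_simps)
        also have "\<dots> < e * 1" using base by (intro mult_strict_left_mono) (auto simp: divide_less_eq)
        finally show "\<bar>b\<bar> * (2 * e') < e" by simp
      qed (use base in auto)
      finally show ?case .
    qed
  qed
next
  case (add f1 f2)
  have e2: "e/2 > 0" using add.prems by simp
  obtain g1 where g1: "\<forall>\<^sub>F l in sequentially. (\<integral>\<^sup>+x. ennreal \<bar>f1 x - g1 l (c l x)\<bar> \<partial>lborel) < ennreal (e/2)"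
    using add.IH(1)[OF e2] by blast
  obtain g2 where g2: "\<forall>\<^sub>F l in sequentially. (\<integral>\<^sup>+x. ennreal \<bar>f2 x - g2 l (c l x)\<bar> \<partial>lborel) < ennreal (e/2)"
    using add.IH(2)[OF e2] by blast
  note g = g1 g2
  have gm: "(\<lambda>x. g l (c l x)) \<in> borel_measurable lborel" for g :: "nat \<Rightarrow> 'i \<Rightarrow> real" and l
    using measurable_compose[OF c, of "g l" borel l] by simp
  show ?case
  proof (intro exI[of _ "\<lambda>l i. g1 l i + g2 l i"])
    show "\<forall>\<^sub>F l in sequentially. (\<integral>\<^sup>+x. ennreal \<bar>f1 x + f2 x - (g1 l (c l x) + g2 l (c l x))\<bar> \<partial>lborel) < ennreal e"
      using g
    proof eventually_elim
      case (elim l)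
      have "(\<integral>\<^sup>+x. ennreal \<bar>f1 x + f2 x - (g1 l (c l x) + g2 l (c l x))\<bar> \<partial>lborel) \<le> (\<integral>\<^sup>+x. ennreal \<bar>f1 x - g1 l (c l x)\<bar> + ennreal \<bar>f2 x - g2 l (c l x)\<bar> \<partial>lborel)"
        by (intro nn_integral_mono) (auto simp flip: ennreal_plus intro!: ennreal_leI)
      also have "\<dots> = (\<integral>\<^sup>+x. ennreal \<bar>f1 x - g1 l (c l x)\<bar> \<partial>lborel) + (\<integral>\<^sup>+x. ennreal \<bar>f2 x - g2 l (c l x)\<bar> \<partial>lborel)"
        using add.hyps gm by (intro nn_integral_add) auto
      also have "\<dots> < ennreal (e/2) + ennreal (e/2)" using elim by (intro add_strict_mono)
      also have "\<dots> = ennreal e" using add.prems by (simp flip: ennreal_plus)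
      finally show ?case .
    qed
  qed
next
  case (lim f s)
  have "(\<lambda>i. L1dist lborel f (s i)) \<longlonglongrightarrow> (\<integral>\<^sup>+x. 0 \<partial>(lborel :: 'a measure))"
  \<comment> \<open>The approximating functions are bounded by \<open>2 * \<bar>f x\<bar>\<close>,
    whence the factor 3.\<close>
  proof (rule nn_integral_dominated_convergence[where w = "\<lambda>x. ennreal (3 * \<bar>f x\<bar>)"])
    show "AE x in lborel. ennreal \<bar>f x - s i x\<bar> \<le> ennreal (3 * \<bar>f x\<bar>)" for i
    proof (intro AE_I2 ennreal_leI)
      fix x show "\<bar>f x - s i x\<bar> \<le> 3 * \<bar>f x\<bar>" using lim.hyps(3)[of x i] by simp
    qed
    have "(\<integral>\<^sup>+x. ennreal (3 * \<bar>f x\<bar>) \<partial>lborel) = ennreal 3 * (\<integral>\<^sup>+x. ennreal \<bar>f x\<bar> \<partial>lborel)"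
      using lim.hyps(4) by (subst nn_integral_cmult[symmetric]) (auto simp: ennreal_mult simp del: ennreal_numeral)
    also have "\<dots> < \<infinity>" using lim.hyps(4) by (simp add: integrable_iff_bounded ennreal_mult_less_top)
    finally show "(\<integral>\<^sup>+x. ennreal (3 * \<bar>f x\<bar>) \<partial>lborel) < \<infinity>" .
    show "AE x in lborel. (\<lambda>i. ennreal \<bar>f x - s i x\<bar>) \<longlonglongrightarrow> 0"
    proof (rule AE_I2)
      fix x
      have "(\<lambda>i. ennreal \<bar>f x - s i x\<bar>) \<longlonglongrightarrow> ennreal \<bar>f x - f x\<bar>"
        using lim.hyps(2)[of x] by (intro tendsto_ennrealI tendsto_intros) auto
      then show "(\<lambda>i. ennreal \<bar>f x - s i x\<bar>) \<longlonglongrightarrow> 0" by simp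
    qed
  qed (use lim.hyps(1,4) in auto)
  then have "\<forall>\<^sub>F i in sequentially. L1dist lborel f (s i) < ennreal (e/2)"
    using lim.prems by (intro order_tendstoD(2)) auto
  then obtain i where i: "L1dist lborel f (s i) < ennreal (e/2)" by (auto simp: eventually_sequentially)
  obtain g where g: "\<forall>\<^sub>F l in sequentially. (\<integral>\<^sup>+x. ennreal \<bar>s i x - g l (c l x)\<bar> \<partial>lborel) < ennreal (e/2)"
    using lim.IH[of "e/2" i] lim.prems by auto
  have gm: "(\<lambda>x. g l (c l x)) \<in> borel_measurable lborel" for l
    using measurable_compose[OF c, of "g l" borel l] by simp
  show ?case
  proof (intro exI[of _ g])
    show "\<forall>\<^sub>F l in sequentially. (\<integral>\<^sup>+x. ennreal \<bar>f x - g l (c l x)\<bar> \<partial>lborel) < ennreal e"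
      using g
    proof eventually_elim
      case (elim l)
      have "(\<integral>\<^sup>+x. ennreal \<bar>f x - g l (c l x)\<bar> \<partial>lborel) \<le> L1dist lborel f (s i) + (\<integral>\<^sup>+x. ennreal \<bar>s i x - g l (c l x)\<bar> \<partial>lborel)"
        using lim.hyps(1,4) gm by (intro nn_integral_abs_triangle) auto
      also have "\<dots> < ennreal (e/2) + ennreal (e/2)" using i elim by (intro add_strict_mono)
      also have "\<dots> = ennreal e" using lim.prems by (simp flip: ennreal_plus)
      finally show ?case .
    qed
  qed
qed

section \<open>Dyadic step kernels\<close>

lemma borel_measurable_floor_div [measurable]: "(\<lambda>x::real. \<lfloor>x / h\<rfloor>) \<in> measurable borel (count_space UNIV)"
  using measurable_compose[of "\<lambda>x::real. x / h" borel borel floor "count_space UNIV"] by measurable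

lemma dyadic_cells_shrink:
  fixes x :: real
  assumes "\<lfloor>y / (1/2)^l\<rfloor> = \<lfloor>x / (1/2)^l\<rfloor>"
  shows "\<bar>y - x\<bar> < (1/2)^l"
proof -
  have "\<bar>y / (1/2)^l - x / (1/2)^l\<bar> < 1" using assms by linarith
  then have "\<bar>(y - x) / (1/2)^l\<bar> < 1" by (simp add: diff_divide_distrib)
  then show ?thesis by (simp add: abs_divide divide_less_eq)
qed

text \<open>This makes it harmless to set a kernel to 0 on the diagonal blocks of a fine grid: the
  blocks shrink to a null set.\<close>

lemma AE_off_diagonal: "AE z in (lborel :: (real \<times> real) measure). fst z \<noteq> snd z"
proof -
  let ?D = "{z :: real \<times> real. fst z = snd z}"
  have m: "?D \<in> sets borel" by (intro borel_closed closed_Collect_eq continuous_intros)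
  have m': "?D \<in> sets (lborel \<Otimes>\<^sub>M lborel)" using m unfolding lborel_prod by simp
  have "emeasure (lborel \<Otimes>\<^sub>M lborel) ?D = (\<integral>\<^sup>+x. emeasure lborel (Pair x -` ?D) \<partial>lborel)"
    by (rule lborel.emeasure_pair_measure_alt[OF m'])
  also have "\<dots> = (\<integral>\<^sup>+x. 0 \<partial>(lborel :: real measure))"
  proof (rule nn_integral_cong)
    fix x :: real
    have "Pair x -` ?D = {x}" by auto
    then show "emeasure lborel (Pair x -` ?D) = 0" by simp
  qed
  finally have "emeasure lborel ?D = 0" by (simp add: lborel_prod)
  then show ?thesis using m by (intro AE_I[of _ _ "{z. fst z = snd z}"]) auto
qed

lemma measurable_swap_real: "(\<lambda>z :: real \<times> real. (snd z, fst z)) \<in> borel_measurable borel"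
  by (intro borel_measurable_continuous_onI continuous_intros)

lemma nn_integral_swap_lborel:
  fixes f :: "real \<times> real \<Rightarrow> ennreal"
  assumes [measurable]: "f \<in> borel_measurable borel"
  shows "(\<integral>\<^sup>+z. f (snd z, fst z) \<partial>lborel) = (\<integral>\<^sup>+z. f z \<partial>lborel)"
proof -
  have m: "f \<in> borel_measurable (lborel \<Otimes>\<^sub>M lborel)" by (simp add: lborel_prod)
  have m': "(\<lambda>z. f (snd z, fst z)) \<in> borel_measurable (lborel \<Otimes>\<^sub>M lborel)"
    using measurable_compose[OF measurable_swap_real assms] by (simp add: lborel_prod)
  have "(\<integral>\<^sup>+z. f z \<partial>(lborel \<Otimes>\<^sub>M lborel)) = (\<integral>\<^sup>+y. \<integral>\<^sup>+x. f (x, y) \<partial>lborel \<partial>lborel)"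
    using lborel_pair.nn_integral_snd[of f] m by simp
  also have "\<dots> = (\<integral>\<^sup>+z. f (snd z, fst z) \<partial>(lborel \<Otimes>\<^sub>M lborel))"
    using m' by (subst lborel.nn_integral_fst[symmetric]) simp_all
  finally show ?thesis by (simp add: lborel_prod)
qed

text \<open>Kernel and intensity live on the first \<open>m\<close> cells. The zero diagonal has two
  reasons: elementary functions vanish on repeated indices, and pairs of vertices within one cell
  must not contribute.\<close>

definition step_data :: "real \<Rightarrow> nat \<Rightarrow> (nat \<Rightarrow> nat \<Rightarrow> real) \<Rightarrow> (nat \<Rightarrow> real) \<Rightarrow> bool" where
  "step_data h m w \<eta> \<longleftrightarrow> h > 0 \<and> (\<forall>i j. 0 \<le> w i j \<and> w i j \<le> 1 \<and> w i j = w j i) \<and> (\<forall>i. w i i = 0) \<and> (\<forall>i j. i \<ge> m \<longrightarrow> w i j = 0)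
     \<and> (\<forall>i. \<eta> i \<ge> 0) \<and> (\<forall>i\<ge>m. \<eta> i = 0)"

definition stepW :: "real \<Rightarrow> (nat \<Rightarrow> nat \<Rightarrow> real) \<Rightarrow> real \<times> real \<Rightarrow> real" where
  "stepW h w z = (if fst z \<ge> 0 \<and> snd z \<ge> 0 then w (cell h (fst z)) (cell h (snd z)) else 0)"

definition stepD :: "real \<Rightarrow> (nat \<Rightarrow> real) \<Rightarrow> real \<Rightarrow> real" where
  "stepD h \<eta> x = (if x \<ge> 0 then \<eta> (cell h x) else 0)"

lemma measurable_cell [measurable]: "cell h \<in> measurable borel (count_space UNIV)"
  unfolding cell_def[abs_def] using measurable_compose[OF borel_measurable_floor_div[of h], of nat "count_space UNIV"] by simp

lemma stepD_measurable [measurable]: "stepD h \<eta> \<in> borel_measurable borel"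
  unfolding stepD_def[abs_def] using measurable_compose[OF measurable_cell[of h], of \<eta> borel] by measurable

lemma stepW_measurable [measurable]: "stepW h w \<in> borel_measurable borel"
proof -
  have "(\<lambda>z::real \<times> real. (cell h (fst z), cell h (snd z))) \<in> measurable borel (count_space UNIV \<Otimes>\<^sub>M count_space UNIV)"
    by (intro measurable_Pair measurable_compose[OF _ measurable_cell]) (auto simp: borel_prod[symmetric])
  then have "(\<lambda>z::real \<times> real. (cell h (fst z), cell h (snd z))) \<in> measurable borel (count_space UNIV)"
    by (simp add: pair_measure_countable)
  then have [measurable]: "(\<lambda>z. w (cell h (fst z)) (cell h (snd z))) \<in> borel_measurable borel"
    using measurable_compose[of "\<lambda>z::real \<times> real. (cell h (fst z), cell h (snd z))" borel "count_space UNIV" "\<lambda>(a, b). w a b" borel] by simp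
  have [measurable]: "{z :: real \<times> real. fst z \<ge> 0 \<and> snd z \<ge> 0} \<in> sets borel"
    by (intro borel_closed closed_Collect_conj closed_Collect_le continuous_intros)
  have "stepW h w = (\<lambda>z. indicator {z. fst z \<ge> 0 \<and> snd z \<ge> 0} z * w (cell h (fst z)) (cell h (snd z)))"
    by (auto simp: fun_eq_iff stepW_def indicator_def)
  then show ?thesis by simp
qed

text \<open>A cell function close to \<open>W0\<close> need be neither symmetric nor [0, 1]-valued
  nor zero on the diagonal blocks or far out. Averaging with its transpose and clipping do not
  increase the error; deleting the diagonal blocks and everything beyond \<open>l\<close> costs the
  mass of \<open>W0\<close> there, which vanishes as \<open>l\<close> grows.\<close>

lemma step_approximation:
  fixes W0 :: "real \<times> real \<Rightarrow> real" and D0 :: "real \<Rightarrow> real"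
  assumes W0: "integrable lborel W0" "W0 \<in> borel_measurable borel" "\<And>z. 0 \<le> W0 z \<and> W0 z \<le> 1" "\<And>x y. W0 (x, y) = W0 (y, x)"
      "\<And>z. fst z < 0 \<or> snd z < 0 \<Longrightarrow> W0 z = 0"
    and D0: "integrable lborel D0" "D0 \<in> borel_measurable borel" "AE x in lborel. D0 x \<ge> 0" "\<And>x. x < 0 \<Longrightarrow> D0 x = 0"
    and e: "e > 0"
  shows "\<exists>h m w \<eta>. step_data h m w \<eta> \<and> L1dist lborel (stepW h w) W0 < ennreal e
     \<and> L1dist lborel (stepD h \<eta>) D0 < ennreal e"
proof -
  define H where "H l = (1/2 :: real) ^ l" for l :: nat
  have Hpos: "H l > 0" for l by (simp add: H_def)
  have Hlim: "H \<longlonglongrightarrow> 0" unfolding H_def by (rule LIMSEQ_realpow_zero) auto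
  define c2 where "c2 l z = (\<lfloor>fst z / H l\<rfloor>, \<lfloor>snd z / H l\<rfloor>)" for l :: nat and z :: "real \<times> real"
  define c1 where "c1 l x = \<lfloor>x / H l\<rfloor>" for l :: nat and x :: real
  have c1m: "c1 l \<in> measurable borel (count_space UNIV)" for l unfolding c1_def[abs_def] by measurable
  have c2m: "c2 l \<in> measurable borel (count_space UNIV)" for l
  proof -
    have "c2 l \<in> measurable borel (count_space UNIV \<Otimes>\<^sub>M count_space UNIV)"
      unfolding c2_def[abs_def]
      by (intro measurable_Pair measurable_compose[OF _ borel_measurable_floor_div]) (auto simp: borel_prod[symmetric])
    then show ?thesis by (simp add: pair_measure_countable)
  qed
  have s1: "\<forall>\<^sub>F l in sequentially. \<forall>y. c1 l y = c1 l x \<longrightarrow> y \<in> U" if U: "open U" "x \<in> U" for x U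
  proof -
    obtain r where r: "r > 0" "ball x r \<subseteq> U" using U by (meson open_contains_ball)
    have "\<forall>\<^sub>F l in sequentially. H l < r" using order_tendstoD(2)[OF Hlim r(1)] .
    then show ?thesis
    proof eventually_elim
      case (elim l)
      have "\<bar>y - x\<bar> < H l" if "c1 l y = c1 l x" for y
        using dyadic_cells_shrink[of y l x] that by (simp add: c1_def H_def)
      then show ?case using elim r(2) by (force simp: dist_real_def)
    qed
  qed
  have s2: "\<forall>\<^sub>F l in sequentially. \<forall>y. c2 l y = c2 l x \<longrightarrow> y \<in> U" if U: "open U" "x \<in> U" for x U
  proof -
    obtain r where r: "r > 0" "ball x r \<subseteq> U" using U by (meson open_contains_ball)
    have "\<forall>\<^sub>F l in sequentially. H l < r / 2" using order_tendstoD(2)[OF Hlim, of "r / 2"] r(1) by simp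
    then show ?thesis
    proof eventually_elim
      case (elim l)
      have "y \<in> U" if "c2 l y = c2 l x" for y
      proof -
        have "\<bar>fst y - fst x\<bar> < H l" "\<bar>snd y - snd x\<bar> < H l"
          using dyadic_cells_shrink[of "fst y" l "fst x"] dyadic_cells_shrink[of "snd y" l "snd x"] that by (auto simp: c2_def H_def)
        moreover have "dist y x \<le> \<bar>fst y - fst x\<bar> + \<bar>snd y - snd x\<bar>"
          by (simp add: dist_prod_def dist_real_def sqrt_sum_squares_le_sum_abs)
        ultimately have "dist x y < r" using elim by (simp add: dist_commute)
        then show ?thesis using r(2) by auto
      qed
      then show ?case by blast
    qed
  qed
  obtain g2 where g2: "\<forall>\<^sub>F l in sequentially. (\<integral>\<^sup>+z. ennreal \<bar>W0 z - g2 l (c2 l z)\<bar> \<partial>lborel) < ennreal (e/2)"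
    using L1_cell_approx[OF W0(1) c2m s2, of "e/2"] e by auto
  obtain g1 where g1: "\<forall>\<^sub>F l in sequentially. (\<integral>\<^sup>+x. ennreal \<bar>D0 x - g1 l (c1 l x)\<bar> \<partial>lborel) < ennreal (e/2)"
    using L1_cell_approx[OF D0(1) c1m s1, of "e/2"] e by auto
  have g2m [measurable]: "(\<lambda>z. g2 l (c2 l z)) \<in> borel_measurable borel" for l
    using measurable_compose[OF c2m, of "g2 l" borel l] by simp
  have g1m [measurable]: "(\<lambda>z. g1 l (c1 l z)) \<in> borel_measurable borel" for l
    using measurable_compose[OF c1m, of "g1 l" borel l] by simp
  note W0(2)[measurable] D0(2)[measurable]
  \<comment> \<open>A closed set that contains the deleted region: two numbers of a common cell are
    closer than \<open>H l\<close>.\<close>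
  define B2 where "B2 l = {z :: real \<times> real. \<bar>fst z - snd z\<bar> \<le> H l \<or> fst z \<ge> real l \<or> snd z \<ge> real l}" for l
  have B2m [measurable]: "B2 l \<in> sets borel" for l unfolding B2_def
    by (intro borel_closed closed_Collect_disj closed_Collect_le continuous_intros)
  have "(\<lambda>l. \<integral>\<^sup>+z. ennreal (W0 z) * indicator (B2 l) z \<partial>lborel) \<longlonglongrightarrow> (\<integral>\<^sup>+z. 0 \<partial>(lborel :: (real \<times> real) measure))"
  proof (rule nn_integral_dominated_convergence[where w = "\<lambda>z. ennreal (W0 z)"])
    show "AE z in lborel. ennreal (W0 z) * indicator (B2 l) z \<le> ennreal (W0 z)" for l by (auto simp: indicator_def)
    show "(\<integral>\<^sup>+z. ennreal (W0 z) \<partial>lborel) < \<infinity>" using W0(1,3) by (simp add: integrable_iff_bounded)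
    show "AE z in lborel. (\<lambda>l. ennreal (W0 z) * indicator (B2 l) z) \<longlonglongrightarrow> 0"
      using AE_off_diagonal
    proof eventually_elim
      case (elim z)
      have "\<forall>\<^sub>F l in sequentially. H l < \<bar>fst z - snd z\<bar>" using order_tendstoD(2)[OF Hlim, of "\<bar>fst z - snd z\<bar>"] elim by simp
      moreover have "\<forall>\<^sub>F l in sequentially. fst z < real l" "\<forall>\<^sub>F l in sequentially. snd z < real l"
        using filterlim_real_sequentially by (auto simp: filterlim_at_top_dense)
      ultimately have "\<forall>\<^sub>F l in sequentially. ennreal (W0 z) * indicator (B2 l) z = 0"
        by eventually_elim (simp add: B2_def)
      then show ?case by (rule tendsto_eventually)
    qed
  qed measurable
  then have b2: "\<forall>\<^sub>F l in sequentially. (\<integral>\<^sup>+z. ennreal (W0 z) * indicator (B2 l) z \<partial>lborel) < ennreal (e/2)"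
    using e by (intro order_tendstoD(2)) auto
  have "(\<lambda>l. \<integral>\<^sup>+x. ennreal \<bar>D0 x\<bar> * indicator {real l..} x \<partial>lborel) \<longlonglongrightarrow> (\<integral>\<^sup>+z. 0 \<partial>(lborel :: real measure))"
  proof (rule nn_integral_dominated_convergence[where w = "\<lambda>x. ennreal \<bar>D0 x\<bar>"])
    show "AE x in lborel. ennreal \<bar>D0 x\<bar> * indicator {real l..} x \<le> ennreal \<bar>D0 x\<bar>" for l by (auto simp: indicator_def)
    show "(\<integral>\<^sup>+x. ennreal \<bar>D0 x\<bar> \<partial>lborel) < \<infinity>" using D0(1) by (simp add: integrable_iff_bounded)
    show "AE x in lborel. (\<lambda>l. ennreal \<bar>D0 x\<bar> * indicator {real l..} x) \<longlonglongrightarrow> 0"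
    proof (rule AE_I2)
      fix x :: real
      have "\<forall>\<^sub>F l in sequentially. x < real l" using filterlim_real_sequentially by (auto simp: filterlim_at_top_dense)
      then have "\<forall>\<^sub>F l in sequentially. ennreal \<bar>D0 x\<bar> * indicator {real l..} x = 0" by eventually_elim simp
      then show "(\<lambda>l. ennreal \<bar>D0 x\<bar> * indicator {real l..} x) \<longlonglongrightarrow> 0" by (rule tendsto_eventually)
    qed
  qed measurable
  then have b1: "\<forall>\<^sub>F l in sequentially. (\<integral>\<^sup>+x. ennreal \<bar>D0 x\<bar> * indicator {real l..} x \<partial>lborel) < ennreal (e/2)"
    using e by (intro order_tendstoD(2)) auto
  have "\<forall>\<^sub>F l in sequentially. (\<integral>\<^sup>+z. ennreal \<bar>W0 z - g2 l (c2 l z)\<bar> \<partial>lborel) < ennreal (e/2)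
     \<and> (\<integral>\<^sup>+x. ennreal \<bar>D0 x - g1 l (c1 l x)\<bar> \<partial>lborel) < ennreal (e/2)
     \<and> (\<integral>\<^sup>+z. ennreal (W0 z) * indicator (B2 l) z \<partial>lborel) < ennreal (e/2)
     \<and> (\<integral>\<^sup>+x. ennreal \<bar>D0 x\<bar> * indicator {real l..} x \<partial>lborel) < ennreal (e/2)"
    using g2 g1 b2 b1 by eventually_elim simp
  then obtain l where l: "(\<integral>\<^sup>+z. ennreal \<bar>W0 z - g2 l (c2 l z)\<bar> \<partial>lborel) < ennreal (e/2)"
     "(\<integral>\<^sup>+x. ennreal \<bar>D0 x - g1 l (c1 l x)\<bar> \<partial>lborel) < ennreal (e/2)"
     "(\<integral>\<^sup>+z. ennreal (W0 z) * indicator (B2 l) z \<partial>lborel) < ennreal (e/2)"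
     "(\<integral>\<^sup>+x. ennreal \<bar>D0 x\<bar> * indicator {real l..} x \<partial>lborel) < ennreal (e/2)"
    unfolding eventually_sequentially by blast
  \<comment> \<open>With cells of width \<open>(1/2) ^ l\<close>, these \<open>m\<close> cells cover
    exactly the numbers from 0 up to \<open>l\<close>.\<close>
  define m where "m = l * 2 ^ l"
  define w where "w i j = (if i < m \<and> j < m \<and> i \<noteq> j then max 0 (min 1 ((g2 l (int i, int j) + g2 l (int j, int i)) / 2)) else 0)" for i j
  define \<eta> where "\<eta> i = (if i < m then max 0 (g1 l (int i)) else 0)" for i
  have sd: "step_data (H l) m w \<eta>"
    unfolding step_data_def using Hpos by (auto simp: w_def \<eta>_def add.commute)
  have mH: "real m * H l = real l" by (simp add: m_def H_def power_one_over)
  have cellm: "cell (H l) x < m \<longleftrightarrow> x < real l" if "x \<ge> 0" for x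
  proof -
    have "0 \<le> x / H l" using that Hpos[of l] by simp
    then have "cell (H l) x < m \<longleftrightarrow> x / H l < real m" unfolding cell_def by linarith
    also have "\<dots> \<longleftrightarrow> x < real l" using Hpos[of l] by (subst pos_divide_less_eq) (auto simp: mH)
    finally show ?thesis .
  qed
  have cellc: "int (cell (H l) x) = c1 l x" if "x \<ge> 0" for x
    using that Hpos[of l] by (simp add: cell_def c1_def)
  have ptW: "ennreal \<bar>stepW (H l) w z - W0 z\<bar> \<le> (ennreal (1/2) * ennreal \<bar>W0 z - g2 l (c2 l z)\<bar> + ennreal (1/2) * ennreal \<bar>W0 (snd z, fst z) - g2 l (c2 l (snd z, fst z))\<bar>)
       + ennreal (W0 z) * indicator (B2 l) z" for z
  proof (cases "fst z \<ge> 0 \<and> snd z \<ge> 0")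
    case False
    then have "W0 z = 0" "stepW (H l) w z = 0" using W0(5)[of z] by (auto simp: stepW_def)
    then show ?thesis by simp
  next
    case True
    show ?thesis
    proof (cases "fst z < real l \<and> snd z < real l \<and> cell (H l) (fst z) \<noteq> cell (H l) (snd z)")
      case good: True
      let ?a = "g2 l (c2 l z)" and ?b = "g2 l (c2 l (snd z, fst z))"
      have "stepW (H l) w z = max 0 (min 1 ((?a + ?b) / 2))"
        using True good cellm cellc[of "fst z"] cellc[of "snd z"] by (simp add: stepW_def w_def c2_def c1_def)
      moreover have "W0 (snd z, fst z) = W0 z" using W0(4)[of "fst z" "snd z"] by simp
      moreover have "\<bar>max 0 (min 1 ((?a + ?b) / 2)) - W0 z\<bar> \<le> 1/2 * \<bar>W0 z - ?a\<bar> + 1/2 * \<bar>W0 z - ?b\<bar>"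
        using W0(3)[of z] by (simp add: max_def min_def abs_if field_simps split: if_splits)
      ultimately have "ennreal \<bar>stepW (H l) w z - W0 z\<bar> \<le> ennreal (1/2 * \<bar>W0 z - ?a\<bar> + 1/2 * \<bar>W0 (snd z, fst z) - ?b\<bar>)"
        by (intro ennreal_leI) simp
      also have "\<dots> = ennreal (1/2) * ennreal \<bar>W0 z - ?a\<bar> + ennreal (1/2) * ennreal \<bar>W0 (snd z, fst z) - ?b\<bar>"
        by (subst ennreal_plus) (auto simp only: ennreal_mult[symmetric], auto)
      finally show ?thesis by (rule order_trans) simp
    next
      case bad: False
      have "z \<in> B2 l"
      proof (cases "cell (H l) (fst z) = cell (H l) (snd z)")
        case eq: True
        then have "c1 l (fst z) = c1 l (snd z)" using True cellc by metis
        then have "\<bar>fst z - snd z\<bar> < H l" using dyadic_cells_shrink[of "fst z" l "snd z"] by (simp add: c1_def H_def)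
        then show ?thesis by (simp add: B2_def)
      qed (use bad in \<open>auto simp: B2_def\<close>)
      moreover have "stepW (H l) w z = 0"
        using True bad cellm by (auto simp: stepW_def w_def)
      ultimately show ?thesis using W0(3)[of z] by simp
    qed
  qed
  have W: "L1dist lborel (stepW (H l) w) W0 < ennreal e"
  proof -
    let ?F = "\<lambda>z. ennreal \<bar>W0 z - g2 l (c2 l z)\<bar>"
    have Fm: "?F \<in> borel_measurable borel" by measurable
    have Fm': "(\<lambda>z. ?F (snd z, fst z)) \<in> borel_measurable borel"
      by (rule measurable_compose[OF measurable_swap_real Fm])
    have "L1dist lborel (stepW (H l) w) W0 \<le>
       (\<integral>\<^sup>+z. (ennreal (1/2) * ?F z + ennreal (1/2) * ?F (snd z, fst z)) + ennreal (W0 z) * indicator (B2 l) z \<partial>lborel)"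
      by (intro nn_integral_mono ptW)
    also have "\<dots> = (ennreal (1/2) * (\<integral>\<^sup>+z. ?F z \<partial>lborel) + ennreal (1/2) * (\<integral>\<^sup>+z. ?F (snd z, fst z) \<partial>lborel)) + (\<integral>\<^sup>+z. ennreal (W0 z) * indicator (B2 l) z \<partial>lborel)"
      using Fm Fm' by (simp add: nn_integral_add nn_integral_cmult)
    also have "(\<integral>\<^sup>+z. ?F (snd z, fst z) \<partial>lborel) = (\<integral>\<^sup>+z. ?F z \<partial>lborel)"
      using nn_integral_swap_lborel[OF Fm] by simp
    also have "ennreal (1/2) * (\<integral>\<^sup>+z. ?F z \<partial>lborel) + ennreal (1/2) * (\<integral>\<^sup>+z. ?F z \<partial>lborel) = (\<integral>\<^sup>+z. ?F z \<partial>lborel)"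
    proof -
      have "ennreal (1/2) + ennreal (1/2) = ennreal (1/2 + 1/2)" by (rule ennreal_plus[symmetric]) auto
      then show ?thesis by (simp only: distrib_right[symmetric]) simp
    qed
    also have "(\<integral>\<^sup>+z. ?F z \<partial>lborel) + (\<integral>\<^sup>+z. ennreal (W0 z) * indicator (B2 l) z \<partial>lborel) < ennreal (e/2) + ennreal (e/2)"
      using l by (intro add_strict_mono) auto
    also have "\<dots> = ennreal e" using e by (simp flip: ennreal_plus)
    finally show ?thesis .
  qed
  have D: "L1dist lborel (stepD (H l) \<eta>) D0 < ennreal e"
  proof -
    have "L1dist lborel (stepD (H l) \<eta>) D0 \<le> (\<integral>\<^sup>+x. ennreal \<bar>D0 x - g1 l (c1 l x)\<bar> + ennreal \<bar>D0 x\<bar> * indicator {real l..} x \<partial>lborel)"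
    proof (rule nn_integral_mono_AE, use D0(3) in eventually_elim)
      case (elim x)
      consider "x < 0" | "x \<ge> 0" "x < real l" | "x \<ge> real l" by linarith
      then show ?case
      proof cases
        case 1
        then show ?thesis using D0(4)[of x] by (simp add: stepD_def)
      next
        case 2
        then have "stepD (H l) \<eta> x = max 0 (g1 l (c1 l x))" using cellm cellc[of x] by (simp add: stepD_def \<eta>_def)
        then have "\<bar>stepD (H l) \<eta> x - D0 x\<bar> \<le> \<bar>D0 x - g1 l (c1 l x)\<bar>" using elim by (auto simp: max_def abs_if)
        then show ?thesis by (intro add_increasing2 ennreal_leI) auto
      next
        case 3
        then have "x \<ge> 0" by linarith
        then have "stepD (H l) \<eta> x = 0" using 3 cellm by (simp add: stepD_def \<eta>_def)
        then show ?thesis using 3 by simp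
      qed
    qed
    also have "\<dots> = (\<integral>\<^sup>+x. ennreal \<bar>D0 x - g1 l (c1 l x)\<bar> \<partial>lborel) + (\<integral>\<^sup>+x. ennreal \<bar>D0 x\<bar> * indicator {real l..} x \<partial>lborel)"
      by (intro nn_integral_add) measurable
    also have "\<dots> < ennreal (e/2) + ennreal (e/2)" using l by (intro add_strict_mono) auto
    also have "\<dots> = ennreal e" using e by (simp flip: ennreal_plus)
    finally show ?thesis .
  qed
  show ?thesis using sd W D by blast
qed

section \<open>The limiting Laplace transform\<close>

interpretation half_line: product_sigma_finite "\<lambda>_::nat. restrict_space lborel {0::real..}"
  unfolding product_sigma_finite_def
  by (intro allI sigma_finite_measure_restrict_space sigma_finite_lborel) simp

lemma space_orthant: "x \<in> space (orthant k) \<Longrightarrow> j < k \<Longrightarrow> x j \<ge> 0"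
  by (auto simp: orthant_def space_PiM space_restrict_space PiE_def Pi_def)

lemma measurable_orthant_comp: "j < k \<Longrightarrow> (\<lambda>x. x j) \<in> borel_measurable (orthant k)"
proof -
  assume j: "j < k"
  have 1: "(\<lambda>x. x j) \<in> measurable (orthant k) (restrict_space lborel {0..})"
    unfolding orthant_def using j by (intro measurable_component_singleton) auto
  have 2: "(\<lambda>x. x) \<in> measurable (restrict_space lborel {0::real..}) borel"
    by (intro measurable_restrict_space1) simp
  show ?thesis using measurable_compose[OF 1 2] .
qed

lemma nn_integral_orthant1:
  assumes [measurable]: "F \<in> borel_measurable borel"
  shows "(\<integral>\<^sup>+x. F (x 0) \<partial>orthant 1) = (\<integral>\<^sup>+x. F x * indicator {0..} x \<partial>lborel)"
proof -
  have e: "{..<1::nat} = {0}" by auto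
  have "(\<integral>\<^sup>+x. F (x 0) \<partial>orthant 1) = (\<integral>\<^sup>+x. F x \<partial>restrict_space lborel {0..})"
    unfolding orthant_def e by (intro half_line.product_nn_integral_singleton measurable_restrict_space1) simp
  also have "\<dots> = (\<integral>\<^sup>+x. F x * indicator {0..} x \<partial>lborel)"
    by (intro nn_integral_restrict_space) simp
  finally show ?thesis .
qed

lemma nn_integral_orthant2:
  assumes F: "F \<in> borel_measurable borel"
  shows "(\<integral>\<^sup>+x. F (x 0, x 1) \<partial>orthant 2) = (\<integral>\<^sup>+z. F z * indicator ({0..} \<times> {0..}) z \<partial>lborel)"
proof -
  let ?R = "restrict_space lborel {0::real..}"
  have sf: "sigma_finite_measure ?R"
    by (intro sigma_finite_measure_restrict_space sigma_finite_lborel) simp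
  have e: "{..<2::nat} = {0, 1}" by auto
  have fs: "(\<lambda>z::real \<times> real. z) \<in> measurable (?R \<Otimes>\<^sub>M ?R) (borel \<Otimes>\<^sub>M borel)"
  proof -
    have i: "(\<lambda>x. x) \<in> measurable ?R borel" by (intro measurable_restrict_space1) simp
    have "(\<lambda>z. (fst z, snd z)) \<in> measurable (?R \<Otimes>\<^sub>M ?R) (borel \<Otimes>\<^sub>M borel)"
      by (intro measurable_Pair measurable_compose[OF measurable_fst i] measurable_compose[OF measurable_snd i])
    then show ?thesis by simp
  qed
  have FR: "F \<in> borel_measurable (?R \<Otimes>\<^sub>M ?R)"
    using measurable_compose[OF fs, of F borel] F by (simp add: borel_prod)
  have m: "(\<lambda>z. F z * indicator ({0..} \<times> {0..}) z) \<in> borel_measurable (lborel \<Otimes>\<^sub>M lborel)"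
  proof -
    have "{0::real..} \<times> {0::real..} \<in> sets borel" by (intro borel_closed closed_Times) auto
    then show ?thesis using F by (simp add: lborel_prod)
  qed
  have "(\<integral>\<^sup>+x. F (x 0, x 1) \<partial>orthant 2) = (\<integral>\<^sup>+z. F (fst z, snd z) \<partial>(?R \<Otimes>\<^sub>M ?R))"
    unfolding orthant_def e using FR by (intro half_line.product_nn_integral_pair) auto
  also have "\<dots> = (\<integral>\<^sup>+x. \<integral>\<^sup>+y. F (x, y) \<partial>?R \<partial>?R)"
    using FR by (subst sigma_finite_measure.nn_integral_fst[OF sf]) auto
  also have "\<dots> = (\<integral>\<^sup>+x. (\<integral>\<^sup>+y. F (x, y) * indicator {0..} y \<partial>lborel) * indicator {0..} x \<partial>lborel)"
    by (simp add: nn_integral_restrict_space)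
  also have "\<dots> = (\<integral>\<^sup>+x. \<integral>\<^sup>+y. F (x, y) * indicator ({0..} \<times> {0..}) (x, y) \<partial>lborel \<partial>lborel)"
    by (intro nn_integral_cong) (auto simp: indicator_def)
  also have "\<dots> = (\<integral>\<^sup>+z. F z * indicator ({0..} \<times> {0..}) z \<partial>(lborel \<Otimes>\<^sub>M lborel))"
    using m by (rule lborel.nn_integral_fst)
  finally show ?thesis by (simp add: lborel_prod)
qed

text \<open>All arguments of the logarithm are at least \<open>exp (- t)\<close>, where its slope is
  at most \<open>exp t\<close>, and the factor \<open>1 - exp (- t)\<close> is at most 1.\<close>

lemma ln_lipschitz:
  fixes a b t :: real
  assumes "0 \<le> a" "a \<le> 1" "0 \<le> b" "b \<le> 1" "0 \<le> t"
  shows "\<bar>ln (1 - (1 - exp (- t)) * a) - ln (1 - (1 - exp (- t)) * b)\<bar> \<le> exp t * \<bar>a - b\<bar>"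
proof -
  define s where "s = 1 - exp (- t)"
  have s: "0 \<le> s" "s \<le> 1" using assms by (auto simp: s_def)
  have lower: "exp (- t) \<le> 1 - s * a" if "0 \<le> a" "a \<le> 1" for a
  proof -
    have "s * a \<le> s * 1" using s that by (intro mult_left_mono) auto
    then show ?thesis by (simp add: s_def)
  qed
  have one: "ln (1 - s * a) - ln (1 - s * b) \<le> exp t * \<bar>a - b\<bar>" if "0 \<le> a" "a \<le> 1" "0 \<le> b" "b \<le> 1" for a b
  proof -
    have pos: "0 < 1 - s * a" "0 < 1 - s * b" using lower[OF that(1,2)] lower[OF that(3,4)] exp_gt_zero[of "- t"] by linarith+
    have "ln (1 - s * a) - ln (1 - s * b) \<le> ((1 - s * a) - (1 - s * b)) / (1 - s * b)"
    proof -
      have "ln (1 - s * a) - ln (1 - s * b) = ln ((1 - s * a) / (1 - s * b))" using pos by (simp add: ln_div)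
      also have "\<dots> \<le> (1 - s * a) / (1 - s * b) - 1" using pos by (intro ln_le_minus_one) simp
      also have "\<dots> = ((1 - s * a) - (1 - s * b)) / (1 - s * b)" using pos by (simp add: field_simps)
      finally show ?thesis .
    qed
    also have "\<dots> \<le> \<bar>a - b\<bar> / (1 - s * b)"
    proof (rule divide_right_mono)
      have "(1 - s * a) - (1 - s * b) = s * (b - a)" by (simp add: algebra_simps)
      also have "\<dots> \<le> s * \<bar>a - b\<bar>" using s by (intro mult_left_mono) auto
      also have "\<dots> \<le> 1 * \<bar>a - b\<bar>" using s by (intro mult_right_mono) auto
      finally show "(1 - s * a) - (1 - s * b) \<le> \<bar>a - b\<bar>" by simp
    qed (use pos in auto)
    also have "\<dots> \<le> \<bar>a - b\<bar> / exp (- t)"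
      using lower[OF that(3,4)] pos by (intro divide_left_mono) auto
    finally show ?thesis by (simp add: exp_minus field_simps)
  qed
  show ?thesis using one[of a b] one[of b a] assms unfolding s_def[symmetric] by (simp add: abs_le_iff abs_minus_commute)
qed

text \<open>A function on the quadrant is represented with arbitrary values elsewhere; extension by
  0 makes it a function on the plane to which Lebesgue measure and Fubini apply directly.\<close>

definition ext2 :: "(real \<Rightarrow> real \<Rightarrow> real) \<Rightarrow> real \<times> real \<Rightarrow> real" where
  "ext2 W z = (if fst z \<ge> 0 \<and> snd z \<ge> 0 then W (fst z) (snd z) else 0)"

definition ext1 :: "(real \<Rightarrow> real) \<Rightarrow> real \<Rightarrow> real" where
  "ext1 f x = (if x \<ge> 0 then f x else 0)"

lemma ext2_graphon:
  assumes "graphon W"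
  shows "ext2 W \<in> borel_measurable borel" "0 \<le> ext2 W z \<and> ext2 W z \<le> 1" "ext2 W (x, y) = ext2 W (y, x)"
    "fst z < 0 \<or> snd z < 0 \<Longrightarrow> ext2 W z = 0"
proof -
  have m: "(\<lambda>(x, y). W x y) \<in> borel_measurable (restrict_space borel ({0..} \<times> {0..}))" using assms by (simp add: graphon_def)
  have c: "{0::real..} \<times> {0::real..} \<in> sets borel" by (intro borel_closed closed_Times) auto
  have "(\<lambda>z. (case z of (x, y) \<Rightarrow> W x y) * indicator ({0..} \<times> {0..}) z) \<in> borel_measurable borel"
    using m c by (subst (asm) borel_measurable_restrict_space_iff) (auto simp: mult.commute)
  moreover have "(\<lambda>z. (case z of (x, y) \<Rightarrow> W x y) * indicator ({0..} \<times> {0..}) z) = ext2 W"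
    by (auto simp: fun_eq_iff ext2_def indicator_def)
  ultimately show "ext2 W \<in> borel_measurable borel" by simp
  show "0 \<le> ext2 W z \<and> ext2 W z \<le> 1" "ext2 W (x, y) = ext2 W (y, x)"
    using assms by (auto simp: ext2_def graphon_def)
  show "fst z < 0 \<or> snd z < 0 \<Longrightarrow> ext2 W z = 0" by (auto simp: ext2_def)
qed

lemma phi_ext2: "x \<ge> 0 \<Longrightarrow> y \<ge> 0 \<Longrightarrow> phi W t x y = ln (1 - (1 - exp (- t)) * ext2 W (x, y))"
  by (simp add: phi_def ext2_def algebra_simps)

lemma measurable_orthant_pair:
  assumes "F \<in> borel_measurable borel"
  shows "(\<lambda>x. F (x 0, x 1)) \<in> borel_measurable (orthant 2)"
proof -
  have "(\<lambda>x. (x 0, x 1)) \<in> measurable (orthant 2) (borel \<Otimes>\<^sub>M borel)"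
    by (intro measurable_Pair measurable_orthant_comp) auto
  then show ?thesis using assms by (intro measurable_compose[of "\<lambda>x. (x 0, x 1)" _ borel F]) (auto simp: borel_prod)
qed

text \<open>Comparison with the kernel 0 gives
  \<open>\<bar>phi W t x y\<bar> \<le> exp t * W x y\<close>.\<close>

lemma integrable_phi:
  assumes W: "graphon W" and int: "integrable lborel (ext2 W)" and t: "t \<ge> 0"
  shows "integrable (orthant 2) (\<lambda>x. phi W t (x 0) (x 1))"
proof -
  let ?l = "\<lambda>x::nat \<Rightarrow> real. ln (1 - (1 - exp (- t)) * ext2 W (x 0, x 1))"
  note W' = ext2_graphon[OF W]
  have m1: "(\<lambda>z. ln (1 - (1 - exp (- t)) * ext2 W z)) \<in> borel_measurable borel" using W'(1) by measurable
  have eq: "phi W t (x 0) (x 1) = ?l x" if "x \<in> space (orthant 2)" for x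
    using space_orthant[OF that] by (intro phi_ext2) auto
  have "integrable (orthant 2) (\<lambda>x. ?l x)"
  proof (rule integrableI_bounded)
    show "(\<lambda>x. ?l x) \<in> borel_measurable (orthant 2)"
      by (rule measurable_orthant_pair[OF m1])
    have "(\<integral>\<^sup>+x. ennreal (norm (?l x)) \<partial>orthant 2)
       \<le> (\<integral>\<^sup>+x. ennreal (exp t * ext2 W (x 0, x 1)) \<partial>orthant 2)"
    proof (intro nn_integral_mono ennreal_leI)
      fix x :: "nat \<Rightarrow> real"
      show "norm (?l x) \<le> exp t * ext2 W (x 0, x 1)"
        using ln_lipschitz[of "ext2 W (x 0, x 1)" 0 t] W'(2)[of "(x 0, x 1)"] t by simp
    qed
    also have "\<dots> = (\<integral>\<^sup>+z. ennreal (exp t * ext2 W z) * indicator ({0..} \<times> {0..}) z \<partial>lborel)"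
      using W'(1) by (intro nn_integral_orthant2[of "\<lambda>z. ennreal (exp t * ext2 W z)"]) measurable
    also have "\<dots> \<le> (\<integral>\<^sup>+z. ennreal (norm (exp t * ext2 W z)) \<partial>lborel)"
      using W'(2) by (intro nn_integral_mono) (auto simp: indicator_def)
    also have "\<dots> < \<infinity>"
    proof -
      have "integrable lborel (\<lambda>z. exp t * ext2 W z)" using int by simp
      then show ?thesis unfolding integrable_iff_bounded by simp
    qed
    finally show "(\<integral>\<^sup>+x. ennreal (norm (?l x)) \<partial>orthant 2) < \<infinity>" .
  qed
  then show ?thesis by (subst Bochner_Integration.integrable_cong[OF refl eq])
qed

lemma integrable_orthant1:
  assumes int: "integrable lborel (ext1 f)"
  shows "integrable (orthant 1) (\<lambda>x. f (x 0))"
proof -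
  have m: "ext1 f \<in> borel_measurable borel" using int by auto
  have "integrable (orthant 1) (\<lambda>x. ext1 f (x 0))"
  proof (rule integrableI_bounded)
    show "(\<lambda>x. ext1 f (x 0)) \<in> borel_measurable (orthant 1)"
      by (rule measurable_compose[OF measurable_orthant_comp m]) simp
    have "(\<integral>\<^sup>+x. ennreal (norm (ext1 f (x 0))) \<partial>orthant 1) = (\<integral>\<^sup>+x. ennreal (norm (ext1 f x)) * indicator {0..} x \<partial>lborel)"
      using m by (intro nn_integral_orthant1[of "\<lambda>x. ennreal (norm (ext1 f x))"]) measurable
    also have "\<dots> \<le> (\<integral>\<^sup>+x. ennreal (norm (ext1 f x)) \<partial>lborel)"
      by (intro nn_integral_mono) (auto simp: indicator_def)
    also have "\<dots> < \<infinity>" using int unfolding integrable_iff_bounded by simp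
    finally show "(\<integral>\<^sup>+x. ennreal (norm (ext1 f (x 0))) \<partial>orthant 1) < \<infinity>" .
  qed
  moreover have "f (x 0) = ext1 f (x 0)" if "x \<in> space (orthant 1)" for x
    using space_orthant[OF that] by (simp add: ext1_def)
  ultimately show ?thesis by (subst Bochner_Integration.integrable_cong[OF refl])
qed

lemma elem_fun_grid2:
  assumes h: "h > 0" and x: "x 0 \<ge> 0" "x 1 \<ge> 0" and F: "\<And>i j. i \<ge> m \<or> j \<ge> m \<Longrightarrow> F i j = 0"
  shows "elem_fun 2 m (grid h) (\<lambda>i. F (i 0) (i 1)) x = F (cell h (x 0)) (cell h (x 1))"
proof -
  have "elem_fun 2 m (grid h) (\<lambda>i. F (i 0) (i 1)) x = (\<Sum>i\<in>{..<2::nat} \<rightarrow>\<^sub>E {..<m}. F (i 0) (i 1) * (indicator (grid h (i 0)) (x 0) * indicator (grid h (i 1)) (x 1)))"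
    unfolding elem_fun_def by (simp add: lessThan_nat_numeral lessThan_Suc numeral_2_eq_2 mult_ac)
  also have "\<dots> = (\<Sum>i<m. \<Sum>j<m. F i j * (indicator (grid h i) (x 0) * indicator (grid h j) (x 1)))"
    by (rule sum_PiE_two[of "\<lambda>a b. F a b * (indicator (grid h a) (x 0) * indicator (grid h b) (x 1))"])
  also have "\<dots> = (\<Sum>i<m. \<Sum>j<m. if j = cell h (x 1) then (if i = cell h (x 0) then F i j else 0) else 0)"
    using grid_cell[OF h x(1)] grid_cell[OF h x(2)] by (intro sum.cong refl) (auto simp: indicator_def)
  also have "\<dots> = F (cell h (x 0)) (cell h (x 1))"
    using F by (cases "cell h (x 0) < m"; cases "cell h (x 1) < m") (simp_all add: sum.delta not_less)
  finally show ?thesis .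
qed

lemma elem_fun_grid1:
  assumes h: "h > 0" and x: "x 0 \<ge> 0" and F: "\<And>i. i \<ge> m \<Longrightarrow> F i = 0"
  shows "elem_fun 1 m (grid h) (\<lambda>i. F (i 0)) x = F (cell h (x 0))"
proof -
  have "elem_fun 1 m (grid h) (\<lambda>i. F (i 0)) x = (\<Sum>i\<in>{..<1::nat} \<rightarrow>\<^sub>E {..<m}. F (i 0) * indicator (grid h (i 0)) (x 0))"
    unfolding elem_fun_def by simp
  also have "\<dots> = (\<Sum>i<m. F i * indicator (grid h i) (x 0))"
    by (rule sum_PiE_one[of "\<lambda>a. F a * indicator (grid h a) (x 0)"])
  also have "\<dots> = (\<Sum>i<m. if i = cell h (x 0) then F i else 0)"
    using grid_cell[OF h x] by (intro sum.cong refl) (auto simp: indicator_def)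
  also have "\<dots> = F (cell h (x 0))" using F by (simp add: sum.delta not_less)
  finally show ?thesis .
qed

lemma elementary_grid:
  assumes h: "h > 0" and a: "\<And>i. i \<in> idx k {..<m} \<Longrightarrow> \<not> inj_on i {..<k} \<Longrightarrow> a i = 0"
  shows "elementary k m (grid h) a"
proof -
  have g: "grid h i \<in> sets borel" "grid h i \<subseteq> {0..}" for i using grid_nonneg[OF h] by auto
  have "integrable (orthant k) (elem_fun k m (grid h) a)"
  proof (rule integrableI_bounded)
    show "elem_fun k m (grid h) a \<in> borel_measurable (orthant k)" by (intro elem_fun_measurable g)
    have "(\<integral>\<^sup>+x. ennreal (norm (elem_fun k m (grid h) a x)) \<partial>orthant k) = (\<Sum>i\<in>idx k {..<m}. ennreal \<bar>a i\<bar> * (\<Prod>j<k. emeasure lborel (grid h (i j))))"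
      unfolding elem_fun_def real_norm_def by (intro nn_integral_orthant_elem g disjoint_grid[OF h]) simp
    also have "\<dots> < \<infinity>" unfolding emeasure_grid[OF h]
      using finite_PiE[of "{..<k}" "\<lambda>_. {..<m}"] by (simp add: ennreal_mult_less_top power_less_top_ennreal)
    finally show "(\<integral>\<^sup>+x. ennreal (norm (elem_fun k m (grid h) a x)) \<partial>orthant k) < \<infinity>" .
  qed
  then show ?thesis using g disjoint_grid[OF h] a by (auto simp: elementary_def)
qed

lemma step_dataD:
  assumes "step_data h m w \<eta>"
  shows "h > 0" "0 \<le> w i j \<and> w i j \<le> 1" "w i j = w j i" "w i i = 0" "i \<ge> m \<Longrightarrow> w i j = 0" "j \<ge> m \<Longrightarrow> w i j = 0"
    "\<eta> i \<ge> 0" "i \<ge> m \<Longrightarrow> \<eta> i = 0"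
proof -
  note * = assms[unfolded step_data_def]
  show "h > 0" "0 \<le> w i j \<and> w i j \<le> 1" "w i j = w j i" "w i i = 0" "\<eta> i \<ge> 0" using * by blast+
  show "i \<ge> m \<Longrightarrow> w i j = 0" "i \<ge> m \<Longrightarrow> \<eta> i = 0" using * by blast+
  have "w i j = w j i" using * by blast
  moreover have "w j i = 0" if "j \<ge> m" using * that by blast
  ultimately show "j \<ge> m \<Longrightarrow> w i j = 0" by simp
qed

text \<open>On a repeated index the kernel is 0 and \<open>ln 1 = 0\<close>; in one variable no
  index is repeated.\<close>

lemma elementary_step:
  assumes sd: "step_data h m w \<eta>"
  shows "elementary 2 m (grid h) (\<lambda>i. ln (1 - s * w (i 0) (i 1)))" "elementary 1 m (grid h) (\<lambda>i. \<eta> (i 0))"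
proof -
  show "elementary 2 m (grid h) (\<lambda>i. ln (1 - s * w (i 0) (i 1)))"
  proof (rule elementary_grid[OF step_dataD(1)[OF sd]])
    fix i :: "nat \<Rightarrow> nat" assume "\<not> inj_on i {..<2}"
    moreover have "inj_on i {..<2}" if "i 0 \<noteq> i 1"
      using that unfolding inj_on_def by (metis One_nat_def lessThan_iff less_2_cases)
    ultimately have "i 0 = i 1" by blast
    then show "ln (1 - s * w (i 0) (i 1)) = 0" using step_dataD(4)[OF sd] by simp
  qed
  show "elementary 1 m (grid h) (\<lambda>i. \<eta> (i 0))"
    by (rule elementary_grid[OF step_dataD(1)[OF sd]]) (simp add: inj_on_def)
qed

lemma stepW_bounds: "step_data h m w \<eta> \<Longrightarrow> 0 \<le> stepW h w z \<and> stepW h w z \<le> 1"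
  using step_dataD(2) by (auto simp: stepW_def)

lemma step_phi_dist:
  assumes W: "graphon W" and sd: "step_data h m w \<eta>" and t: "t \<ge> 0"
  shows "(\<integral>\<^sup>+x. ennreal \<bar>elem_fun 2 m (grid h) (\<lambda>i. ln (1 - (1 - exp (- t)) * w (i 0) (i 1))) x - phi W t (x 0) (x 1)\<bar> \<partial>orthant 2)
    \<le> ennreal (exp t) * L1dist lborel (stepW h w) (ext2 W)"
proof -
  let ?l = "\<lambda>i::nat \<Rightarrow> nat. ln (1 - (1 - exp (- t)) * w (i 0) (i 1))"
  note W' = ext2_graphon[OF W]
  note [measurable] = W'(1)
  have "(\<integral>\<^sup>+x. ennreal \<bar>elem_fun 2 m (grid h) ?l x - phi W t (x 0) (x 1)\<bar> \<partial>orthant 2)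
    \<le> (\<integral>\<^sup>+x. ennreal (exp t * \<bar>stepW h w (x 0, x 1) - ext2 W (x 0, x 1)\<bar>) \<partial>orthant 2)"
  proof (intro nn_integral_mono ennreal_leI)
    fix x assume x: "x \<in> space (orthant 2)"
    have x0: "x 0 \<ge> 0" "x 1 \<ge> 0" using space_orthant[OF x] by auto
    have "elem_fun 2 m (grid h) ?l x = ln (1 - (1 - exp (- t)) * w (cell h (x 0)) (cell h (x 1)))"
      by (rule elem_fun_grid2[OF step_dataD(1)[OF sd] x0, of m "\<lambda>a b. ln (1 - (1 - exp (- t)) * w a b)"])
         (use step_dataD(5,6)[OF sd] in auto)
    also have "\<dots> = ln (1 - (1 - exp (- t)) * stepW h w (x 0, x 1))" using x0 by (simp add: stepW_def)
    finally have eq: "elem_fun 2 m (grid h) ?l x = ln (1 - (1 - exp (- t)) * stepW h w (x 0, x 1))" .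
    show "\<bar>elem_fun 2 m (grid h) ?l x - phi W t (x 0) (x 1)\<bar>
        \<le> exp t * \<bar>stepW h w (x 0, x 1) - ext2 W (x 0, x 1)\<bar>"
      unfolding phi_ext2[OF x0] eq
      by (rule ln_lipschitz) (use stepW_bounds[OF sd, of "(x 0, x 1)"] W'(2)[of "(x 0, x 1)"] t in auto)
  qed
  also have "\<dots> = (\<integral>\<^sup>+z. ennreal (exp t * \<bar>stepW h w z - ext2 W z\<bar>) * indicator ({0..} \<times> {0..}) z \<partial>lborel)"
    by (rule nn_integral_orthant2[of "\<lambda>z. ennreal (exp t * \<bar>stepW h w z - ext2 W z\<bar>)"]) measurable
  also have "\<dots> \<le> (\<integral>\<^sup>+z. ennreal (exp t) * ennreal \<bar>stepW h w z - ext2 W z\<bar> \<partial>lborel)"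
    by (intro nn_integral_mono) (auto simp: indicator_def ennreal_mult)
  also have "\<dots> = ennreal (exp t) * L1dist lborel (stepW h w) (ext2 W)"
    by (rule nn_integral_cmult) measurable
  finally show ?thesis .
qed

lemma step_Delta_dist:
  assumes sd: "step_data h m w \<eta>" and [measurable]: "ext1 f \<in> borel_measurable borel"
  shows "(\<integral>\<^sup>+x. ennreal \<bar>elem_fun 1 m (grid h) (\<lambda>i. \<eta> (i 0)) x - f (x 0)\<bar> \<partial>orthant 1)
    \<le> L1dist lborel (stepD h \<eta>) (ext1 f)"
proof -
  have "(\<integral>\<^sup>+x. ennreal \<bar>elem_fun 1 m (grid h) (\<lambda>i. \<eta> (i 0)) x - f (x 0)\<bar> \<partial>orthant 1)
    = (\<integral>\<^sup>+x. ennreal \<bar>stepD h \<eta> (x 0) - ext1 f (x 0)\<bar> \<partial>orthant 1)"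
  proof (intro nn_integral_cong)
    fix x assume x: "x \<in> space (orthant 1)"
    have x0: "x 0 \<ge> 0" using space_orthant[OF x] by auto
    have "elem_fun 1 m (grid h) (\<lambda>i. \<eta> (i 0)) x = stepD h \<eta> (x 0)"
      using elem_fun_grid1[where h = h and x = x and m = m and F = \<eta>] step_dataD(1)[OF sd] step_dataD(8)[OF sd] x0 by (simp add: stepD_def)
    then show "ennreal \<bar>elem_fun 1 m (grid h) (\<lambda>i. \<eta> (i 0)) x - f (x 0)\<bar> = ennreal \<bar>stepD h \<eta> (x 0) - ext1 f (x 0)\<bar>"
      using x0 by (simp add: ext1_def)
  qed
  also have "\<dots> = (\<integral>\<^sup>+x. ennreal \<bar>stepD h \<eta> x - ext1 f x\<bar> * indicator {0..} x \<partial>lborel)"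
    by (rule nn_integral_orthant1[of "\<lambda>x. ennreal \<bar>stepD h \<eta> x - ext1 f x\<bar>"]) measurable
  also have "\<dots> \<le> L1dist lborel (stepD h \<eta>) (ext1 f)"
    by (intro nn_integral_mono) (auto simp: indicator_def)
  finally show ?thesis .
qed

lemma exp_lipschitz: "x \<le> 0 \<Longrightarrow> y \<le> 0 \<Longrightarrow> \<bar>exp x - exp y\<bar> \<le> \<bar>x - y\<bar>" for x y :: real
proof -
  assume xy: "x \<le> 0" "y \<le> 0"
  have one: "exp x - exp y \<le> x - y" if "y \<le> x" "x \<le> 0" for x y :: real
  proof -
    have "exp x - exp y = exp x * (1 - exp (y - x))" by (simp add: algebra_simps exp_diff)
    also have "\<dots> \<le> 1 * (1 - exp (y - x))" using that by (intro mult_right_mono) auto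
    also have "1 * (1 - exp (y - x)) \<le> x - y"
    proof -
      have "1 - exp (y - x) \<le> x - y" using exp_ge_add_one_self[of "y - x"] by linarith
      then show ?thesis by (simp only: mult_1)
    qed
    finally show ?thesis .
  qed
  show ?thesis
  proof (cases "y \<le> x")
    case True then show ?thesis using one[of y x] xy by simp
  next
    case False then show ?thesis using one[of x y] xy by simp
  qed
qed

section \<open>Stability of the limiting Laplace transform\<close>

context pois_proc
begin

text \<open>The negative part of \<open>Z\<close> is at most its distance from any non-negative
  function. So signs pass from elementary integrals to stochastic integrals, which are defined only
  as limits in norm.\<close>

lemma AE_limit_nonneg:
  assumes "Z \<in> borel_measurable P"
    and small: "\<And>e. e > 0 \<Longrightarrow> \<exists>I. (\<forall>\<omega>. I \<omega> \<ge> (0::real)) \<and> L1dist P I Z \<le> ennreal e"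
  shows "AE \<omega> in P. Z \<omega> \<ge> 0"
proof -
  have small': "(\<integral>\<^sup>+\<omega>. ennreal (max 0 (- Z \<omega>)) \<partial>P) \<le> ennreal e" if e: "e > 0" for e
  proof -
    obtain I where I: "\<And>\<omega>. I \<omega> \<ge> 0" "L1dist P I Z \<le> ennreal e" using small[OF e] by blast
    have "(\<integral>\<^sup>+\<omega>. ennreal (max 0 (- Z \<omega>)) \<partial>P) \<le> L1dist P I Z"
    proof (intro nn_integral_mono ennreal_leI)
      fix \<omega> show "max 0 (- Z \<omega>) \<le> \<bar>I \<omega> - Z \<omega>\<bar>" using I(1)[of \<omega>] by auto
    qed
    then show ?thesis using I(2) by (rule order_trans)
  qed
  have "(\<integral>\<^sup>+\<omega>. ennreal (max 0 (- Z \<omega>)) \<partial>P) \<le> 0"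
  proof (rule ennreal_le_epsilon)
    fix e :: real assume "0 < e"
    then show "(\<integral>\<^sup>+\<omega>. ennreal (max 0 (- Z \<omega>)) \<partial>P) \<le> 0 + ennreal e"
      using small' by simp
  qed
  then have "AE \<omega> in P. ennreal (max 0 (- Z \<omega>)) = 0"
    using assms(1) by (subst nn_integral_0_iff_AE[symmetric]) auto
  then show ?thesis by eventually_elim (auto simp: max_def split: if_splits)
qed

context
  fixes W :: "real \<Rightarrow> real \<Rightarrow> real" and D :: "real \<Rightarrow> real"
  assumes W: "graphon W" and intW: "integrable lborel (ext2 W)"
    and intD: "integrable lborel (ext1 D)" and Dpos: "AE x in lborel. ext1 D x \<ge> 0"
begin

lemma step_approx_ex:
  assumes "e > 0"
  obtains h m w \<eta> where "step_data h m w \<eta>" "L1dist lborel (stepW h w) (ext2 W) < ennreal e"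
    "L1dist lborel (stepD h \<eta>) (ext1 D) < ennreal e"
proof -
  have m: "ext1 D \<in> borel_measurable borel" using intD by auto
  have z: "ext1 D x = 0" if "x < 0" for x using that by (simp add: ext1_def)
  show ?thesis
    using step_approximation[OF intW ext2_graphon(1)[OF W] ext2_graphon(2)[OF W] ext2_graphon(3)[OF W] ext2_graphon(4)[OF W] intD m Dpos z assms] that
    by blast
qed

lemma stoch_integral_phi_Delta:
  shows "t \<ge> 0 \<Longrightarrow> has_stoch_integral P S 2 (\<lambda>x. phi W t (x 0) (x 1)) (stoch_integral P S 2 (\<lambda>x. phi W t (x 0) (x 1)))"
    and "has_stoch_integral P S 1 (\<lambda>x. D (x 0)) (stoch_integral P S 1 (\<lambda>x. D (x 0)))"
proof -
  have "\<forall>l. \<exists>h m w \<eta>. step_data h m w \<eta> \<and> L1dist lborel (stepW h w) (ext2 W) < ennreal (1 / real (Suc l))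
      \<and> L1dist lborel (stepD h \<eta>) (ext1 D) < ennreal (1 / real (Suc l))"
  proof
    fix l :: nat
    have "1 / real (Suc l) > 0" by simp
    then obtain h m w \<eta> where "step_data h m w \<eta>" "L1dist lborel (stepW h w) (ext2 W) < ennreal (1 / real (Suc l))"
      "L1dist lborel (stepD h \<eta>) (ext1 D) < ennreal (1 / real (Suc l))"
      by (rule step_approx_ex)
    then show "\<exists>h m w \<eta>. step_data h m w \<eta> \<and> L1dist lborel (stepW h w) (ext2 W) < ennreal (1 / real (Suc l))
      \<and> L1dist lborel (stepD h \<eta>) (ext1 D) < ennreal (1 / real (Suc l))" by blast
  qed
  then obtain h m w \<eta> where s': "\<forall>l. step_data (h l) (m l) (w l) (\<eta> l) \<and> L1dist lborel (stepW (h l) (w l)) (ext2 W) < ennreal (1 / real (Suc l))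
      \<and> L1dist lborel (stepD (h l) (\<eta> l)) (ext1 D) < ennreal (1 / real (Suc l))"
    unfolding choice_iff by blast
  have s: "step_data (h l) (m l) (w l) (\<eta> l)"
    "L1dist lborel (stepW (h l) (w l)) (ext2 W) < ennreal (1 / real (Suc l))"
    "L1dist lborel (stepD (h l) (\<eta> l)) (ext1 D) < ennreal (1 / real (Suc l))" for l
    using s' by blast+
  have l0: "(\<lambda>l. 1 / real (Suc l)) \<longlonglongrightarrow> 0" using LIMSEQ_inverse_real_of_nat by (simp add: inverse_eq_divide)
  {
    assume t: "t \<ge> 0"
    show "has_stoch_integral P S 2 (\<lambda>x. phi W t (x 0) (x 1)) (stoch_integral P S 2 (\<lambda>x. phi W t (x 0) (x 1)))"
    proof (rule stoch_integral)
      show "integrable (orthant 2) (\<lambda>x. phi W t (x 0) (x 1))" by (rule integrable_phi[OF W intW t])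
      show "elementary 2 (m l) (grid (h l)) (\<lambda>i. ln (1 - (1 - exp (- t)) * w l (i 0) (i 1)))" for l
        by (rule elementary_step(1)[OF s(1)])
      have b: "(\<integral>\<^sup>+x. ennreal \<bar>elem_fun 2 (m l) (grid (h l)) (\<lambda>i. ln (1 - (1 - exp (- t)) * w l (i 0) (i 1))) x - phi W t (x 0) (x 1)\<bar> \<partial>orthant 2)
         \<le> ennreal (exp t * (1 / real (Suc l)))" for l
      proof -
        note step_phi_dist[OF W s(1) t]
        also have "ennreal (exp t) * L1dist lborel (stepW (h l) (w l)) (ext2 W) \<le> ennreal (exp t) * ennreal (1 / real (Suc l))"
          using s(2)[of l] by (intro mult_left_mono) auto
        also have "\<dots> = ennreal (exp t * (1 / real (Suc l)))" by (rule ennreal_mult[symmetric]) auto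
        finally show ?thesis .
      qed
      have "(\<lambda>l. ennreal (exp t * (1 / real (Suc l)))) \<longlonglongrightarrow> ennreal (exp t * 0)"
        by (intro tendsto_ennrealI tendsto_mult tendsto_const l0)
      then have l1: "(\<lambda>l. ennreal (exp t * (1 / real (Suc l)))) \<longlonglongrightarrow> 0" by simp
      show "(\<lambda>l. \<integral>\<^sup>+x. ennreal \<bar>elem_fun 2 (m l) (grid (h l)) (\<lambda>i. ln (1 - (1 - exp (- t)) * w l (i 0) (i 1))) x - phi W t (x 0) (x 1)\<bar> \<partial>orthant 2) \<longlonglongrightarrow> 0"
        by (rule tendsto_sandwich[OF _ _ tendsto_const l1]; intro always_eventually allI b zero_le)
    qed
  }
  show "has_stoch_integral P S 1 (\<lambda>x. D (x 0)) (stoch_integral P S 1 (\<lambda>x. D (x 0)))"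
  proof (rule stoch_integral)
    show "integrable (orthant 1) (\<lambda>x. D (x 0))" by (rule integrable_orthant1[OF intD])
    show "elementary 1 (m l) (grid (h l)) (\<lambda>i. \<eta> l (i 0))" for l
      by (rule elementary_step(2)[OF s(1)])
    have b: "(\<integral>\<^sup>+x. ennreal \<bar>elem_fun 1 (m l) (grid (h l)) (\<lambda>i. \<eta> l (i 0)) x - D (x 0)\<bar> \<partial>orthant 1) \<le> ennreal (1 / real (Suc l))" for l
      using order_trans[OF step_Delta_dist[OF s(1)] less_imp_le[OF s(3)]] intD by auto
    have l1: "(\<lambda>l. ennreal (1 / real (Suc l))) \<longlonglongrightarrow> 0" using tendsto_ennrealI[OF l0] by simp
    show "(\<lambda>l. \<integral>\<^sup>+x. ennreal \<bar>elem_fun 1 (m l) (grid (h l)) (\<lambda>i. \<eta> l (i 0)) x - D (x 0)\<bar> \<partial>orthant 1) \<longlonglongrightarrow> 0"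
      by (rule tendsto_sandwich[OF _ _ tendsto_const l1]; intro always_eventually allI b zero_le)
  qed
qed

text \<open>Both exponents are almost surely non-positive, where \<open>exp\<close> has Lipschitz
  constant 1, and the factors \<open>1/2\<close> and \<open>1 - exp (- t2)\<close> are at most 1.
  The constant \<open>exp t1\<close> is the Lipschitz constant of the logarithm in
  \<open>phi\<close>, and the summand 1 belongs to the single integral.\<close>

lemma step_laplace_dist:
  assumes t: "t1 \<ge> 0" "t2 \<ge> 0" and e: "e > 0" and sd: "step_data h m w \<eta>"
    and dW: "L1dist lborel (stepW h w) (ext2 W) < ennreal e"
    and dD: "L1dist lborel (stepD h \<eta>) (ext1 D) < ennreal e"
  shows "\<bar>expectation (\<lambda>\<omega>. exp (1/2 * elem_integral S 2 m (grid h) (\<lambda>i. ln (1 - (1 - exp (- t1)) * w (i 0) (i 1))) \<omega>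
        - (1 - exp (- t2)) * elem_integral S 1 m (grid h) (\<lambda>i. \<eta> (i 0)) \<omega>))
     - expectation (\<lambda>\<omega>. exp (1/2 * stoch_integral P S 2 (\<lambda>x. phi W t1 (x 0) (x 1)) \<omega> - (1 - exp (- t2)) * stoch_integral P S 1 (\<lambda>x. D (x 0)) \<omega>))\<bar>
    \<le> (exp t1 + 1) * e"
proof -
  define Z2 where "Z2 = stoch_integral P S 2 (\<lambda>x. phi W t1 (x 0) (x 1))"
  define Z1 where "Z1 = stoch_integral P S 1 (\<lambda>x. D (x 0))"
  define I2 where "I2 m h w = elem_integral S 2 m (grid h) (\<lambda>i. ln (1 - (1 - exp (- t1)) * w (i 0) (i 1)))" for m h and w :: "nat \<Rightarrow> nat \<Rightarrow> real"
  define I1 where "I1 m h \<eta> = elem_integral S 1 m (grid h) (\<lambda>i. \<eta> (i 0))" for m h and \<eta> :: "nat \<Rightarrow> real"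
  have hZ: "has_stoch_integral P S 2 (\<lambda>x. phi W t1 (x 0) (x 1)) Z2" "has_stoch_integral P S 1 (\<lambda>x. D (x 0)) Z1"
    unfolding Z2_def Z1_def using stoch_integral_phi_Delta t by auto
  have Zint: "integrable P Z2" "integrable P Z1" using hZ by (auto simp: has_stoch_integral_def)
  have mD: "ext1 D \<in> borel_measurable borel" using intD by auto
  have d2: "L1dist P (I2 m h w) Z2 \<le> ennreal (exp t1 * e)"
    if sd: "step_data h m w \<eta>" and dW: "L1dist lborel (stepW h w) (ext2 W) < ennreal e" and e: "e > 0" for h m w \<eta> e
  proof -
    have "L1dist P (I2 m h w) Z2 \<le> ennreal (exp t1) * L1dist lborel (stepW h w) (ext2 W)"
      unfolding I2_def by (rule order_trans[OF stoch_integral_dist[OF hZ(1) elementary_step(1)[OF sd]] step_phi_dist[OF W sd t(1)]])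
    also have "\<dots> \<le> ennreal (exp t1) * ennreal e" using dW by (intro mult_left_mono) auto
    also have "\<dots> = ennreal (exp t1 * e)" using e by (simp add: ennreal_mult)
    finally show ?thesis .
  qed
  have d1: "L1dist P (I1 m h \<eta>) Z1 \<le> ennreal e"
    if sd: "step_data h m w \<eta>" and dD: "L1dist lborel (stepD h \<eta>) (ext1 D) < ennreal e" for h m w \<eta> e
    unfolding I1_def
    by (rule order_trans[OF stoch_integral_dist[OF hZ(2) elementary_step(2)[OF sd]] order_trans[OF step_Delta_dist[OF sd mD] less_imp_le[OF dD]]])
  have I2neg: "I2 m h w \<omega> \<le> 0" if sd: "step_data h m w \<eta>" for h m w \<eta> \<omega>
  proof -
    have "ln (1 - (1 - exp (- t1)) * w i j) \<le> 0" for i j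
    proof -
      have "(1 - exp (- t1)) * w i j \<le> (1 - exp (- t1)) * 1" using step_dataD(2)[OF sd, of i j] t by (intro mult_left_mono) auto
      then have "(1 - exp (- t1)) * w i j \<le> 1 - exp (- t1)" by simp
      then have "0 < 1 - (1 - exp (- t1)) * w i j" using exp_gt_zero[of "- t1"] by linarith
      moreover have "0 \<le> (1 - exp (- t1)) * w i j" using step_dataD(2)[OF sd, of i j] t by (intro mult_nonneg_nonneg) auto
      ultimately show ?thesis by simp
    qed
    then show ?thesis unfolding I2_def elem_integral_grid2[of m h "\<lambda>a b. ln (1 - (1 - exp (- t1)) * w a b)"]
      by (intro sum_nonpos mult_nonpos_nonneg) auto
  qed
  have I1pos: "I1 m h \<eta> \<omega> \<ge> 0" if sd: "step_data h m w \<eta>" for h m w \<eta> \<omega>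
    unfolding I1_def elem_integral_grid1[of m h \<eta>] using step_dataD(7)[OF sd] by (intro sum_nonneg mult_nonneg_nonneg) auto
  have Z1pos: "AE \<omega> in P. Z1 \<omega> \<ge> 0"
  proof (rule AE_limit_nonneg)
    fix e :: real assume e: "e > 0"
    obtain h m w \<eta> where s: "step_data h m w \<eta>" "L1dist lborel (stepW h w) (ext2 W) < ennreal e"
      "L1dist lborel (stepD h \<eta>) (ext1 D) < ennreal e" by (rule step_approx_ex[OF e])
    show "\<exists>I. (\<forall>\<omega>. I \<omega> \<ge> (0::real)) \<and> L1dist P I Z1 \<le> ennreal e"
      using I1pos[OF s(1)] d1[OF s(1,3)] by blast
  qed (use Zint in auto)
  have "AE \<omega> in P. - Z2 \<omega> \<ge> 0"
  proof (rule AE_limit_nonneg)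
    fix e :: real assume e: "e > 0"
    then have e': "e / exp t1 > 0" by simp
    obtain h m w \<eta> where s: "step_data h m w \<eta>" "L1dist lborel (stepW h w) (ext2 W) < ennreal (e / exp t1)"
      "L1dist lborel (stepD h \<eta>) (ext1 D) < ennreal (e / exp t1)" by (rule step_approx_ex[OF e'])
    show "\<exists>I. (\<forall>\<omega>. I \<omega> \<ge> (0::real)) \<and> (\<integral>\<^sup>+\<omega>. ennreal \<bar>I \<omega> - - Z2 \<omega>\<bar> \<partial>P) \<le> ennreal e"
      using I2neg[OF s(1)] d2[OF s(1,2) e'] by (intro exI[of _ "\<lambda>\<omega>. - I2 m h w \<omega>"]) (simp add: abs_minus_commute)
  qed (use Zint in auto)
  then have Z2neg: "AE \<omega> in P. Z2 \<omega> \<le> 0" by eventually_elim simp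
  have fe: "fin_elem 2 m (grid h) (\<lambda>i. ln (1 - (1 - exp (- t1)) * w (i 0) (i 1)))" "fin_elem 1 m (grid h) (\<lambda>i. \<eta> (i 0))"
    using elementary_step[OF sd] emeasure_grid[OF step_dataD(1)[OF sd]] by (auto simp: fin_elem_def)
  have Iint: "integrable P (I2 m h w)" "integrable P (I1 m h \<eta>)"
    unfolding I2_def I1_def by (intro elem_integral_integrable fe)+
  define s2 where "s2 = 1 - exp (- t2)"
  have s2: "0 \<le> s2" "s2 \<le> 1" using t by (auto simp: s2_def)
  have expint: "integrable P (\<lambda>\<omega>. exp (1/2 * A \<omega> - s2 * B \<omega>))"
    if "integrable P A" "integrable P B" "AE \<omega> in P. A \<omega> \<le> 0" "AE \<omega> in P. B \<omega> \<ge> 0" for A B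
  proof (rule integrable_const_bound[where B = 1])
    show "AE \<omega> in P. norm (exp (1/2 * A \<omega> - s2 * B \<omega>)) \<le> 1"
      using that(3,4)
    proof eventually_elim
      case (elim \<omega>)
      then have "0 \<le> s2 * B \<omega>" using s2 by simp
      then show ?case using elim by simp
    qed
    have [measurable]: "A \<in> borel_measurable P" "B \<in> borel_measurable P" using that by auto
    show "(\<lambda>\<omega>. exp (1/2 * A \<omega> - s2 * B \<omega>)) \<in> borel_measurable P" by measurable
  qed
  have e1: "integrable P (\<lambda>\<omega>. exp (1/2 * I2 m h w \<omega> - s2 * I1 m h \<eta> \<omega>))"
    using Iint I2neg[OF sd] I1pos[OF sd] by (intro expint) auto
  have e2: "integrable P (\<lambda>\<omega>. exp (1/2 * Z2 \<omega> - s2 * Z1 \<omega>))"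
    using Zint Z1pos Z2neg by (intro expint) auto
  have "\<bar>expectation (\<lambda>\<omega>. exp (1/2 * I2 m h w \<omega> - s2 * I1 m h \<eta> \<omega>)) - expectation (\<lambda>\<omega>. exp (1/2 * Z2 \<omega> - s2 * Z1 \<omega>))\<bar>
     = \<bar>expectation (\<lambda>\<omega>. exp (1/2 * I2 m h w \<omega> - s2 * I1 m h \<eta> \<omega>) - exp (1/2 * Z2 \<omega> - s2 * Z1 \<omega>))\<bar>"
    using e1 e2 by simp
  also have "\<dots> \<le> expectation (\<lambda>\<omega>. \<bar>exp (1/2 * I2 m h w \<omega> - s2 * I1 m h \<eta> \<omega>) - exp (1/2 * Z2 \<omega> - s2 * Z1 \<omega>)\<bar>)"
    by (rule integral_abs_bound)
  also have "\<dots> \<le> expectation (\<lambda>\<omega>. \<bar>I2 m h w \<omega> - Z2 \<omega>\<bar> + \<bar>I1 m h \<eta> \<omega> - Z1 \<omega>\<bar>)"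
  proof (rule integral_mono_AE)
    show "AE \<omega> in P. \<bar>exp (1/2 * I2 m h w \<omega> - s2 * I1 m h \<eta> \<omega>) - exp (1/2 * Z2 \<omega> - s2 * Z1 \<omega>)\<bar> \<le> \<bar>I2 m h w \<omega> - Z2 \<omega>\<bar> + \<bar>I1 m h \<eta> \<omega> - Z1 \<omega>\<bar>"
      using Z1pos Z2neg
    proof eventually_elim
      case (elim \<omega>)
      have "0 \<le> s2 * Z1 \<omega>" "0 \<le> s2 * I1 m h \<eta> \<omega>" using elim s2 I1pos[OF sd] by auto
      then have "\<bar>exp (1/2 * I2 m h w \<omega> - s2 * I1 m h \<eta> \<omega>) - exp (1/2 * Z2 \<omega> - s2 * Z1 \<omega>)\<bar>
         \<le> \<bar>(1/2 * I2 m h w \<omega> - s2 * I1 m h \<eta> \<omega>) - (1/2 * Z2 \<omega> - s2 * Z1 \<omega>)\<bar>"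
        using elim I2neg[OF sd, of \<omega>] by (intro exp_lipschitz) auto
      also have "\<dots> = \<bar>1/2 * (I2 m h w \<omega> - Z2 \<omega>) - s2 * (I1 m h \<eta> \<omega> - Z1 \<omega>)\<bar>" by (simp add: algebra_simps)
      also have "\<dots> \<le> \<bar>1/2 * (I2 m h w \<omega> - Z2 \<omega>)\<bar> + \<bar>s2 * (I1 m h \<eta> \<omega> - Z1 \<omega>)\<bar>" by (rule abs_triangle_ineq4)
      also have "\<dots> = 1/2 * \<bar>I2 m h w \<omega> - Z2 \<omega>\<bar> + s2 * \<bar>I1 m h \<eta> \<omega> - Z1 \<omega>\<bar>" using s2 by (simp add: abs_mult)
      also have "\<dots> \<le> 1 * \<bar>I2 m h w \<omega> - Z2 \<omega>\<bar> + 1 * \<bar>I1 m h \<eta> \<omega> - Z1 \<omega>\<bar>" using s2 by (intro add_mono mult_right_mono) auto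
      finally show ?case by simp
    qed
  qed (use e1 e2 Iint Zint in auto)
  also have "\<dots> = expectation (\<lambda>\<omega>. \<bar>I2 m h w \<omega> - Z2 \<omega>\<bar>) + expectation (\<lambda>\<omega>. \<bar>I1 m h \<eta> \<omega> - Z1 \<omega>\<bar>)"
    using Iint Zint by (intro Bochner_Integration.integral_add) auto
  also have "\<dots> \<le> exp t1 * e + e"
  proof (rule add_mono)
    have "ennreal (expectation (\<lambda>\<omega>. \<bar>I2 m h w \<omega> - Z2 \<omega>\<bar>)) = L1dist P (I2 m h w) Z2"
      using Iint Zint by (intro nn_integral_eq_integral[symmetric]) auto
    then have "ennreal (expectation (\<lambda>\<omega>. \<bar>I2 m h w \<omega> - Z2 \<omega>\<bar>)) \<le> ennreal (exp t1 * e)" using d2[OF sd dW e] by simp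
    then show "expectation (\<lambda>\<omega>. \<bar>I2 m h w \<omega> - Z2 \<omega>\<bar>) \<le> exp t1 * e" using e by (subst (asm) ennreal_le_iff) auto
    have "ennreal (expectation (\<lambda>\<omega>. \<bar>I1 m h \<eta> \<omega> - Z1 \<omega>\<bar>)) = L1dist P (I1 m h \<eta>) Z1"
      using Iint Zint by (intro nn_integral_eq_integral[symmetric]) auto
    then have "ennreal (expectation (\<lambda>\<omega>. \<bar>I1 m h \<eta> \<omega> - Z1 \<omega>\<bar>)) \<le> ennreal e" using d1[OF sd dD] by simp
    then show "expectation (\<lambda>\<omega>. \<bar>I1 m h \<eta> \<omega> - Z1 \<omega>\<bar>) \<le> e" using e by (subst (asm) ennreal_le_iff) auto
  qed
  finally show ?thesis unfolding I2_def I1_def Z2_def Z1_def s2_def by (simp add: algebra_simps)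
qed

end

end

section \<open>Limits of laws on the natural numbers\<close>

text \<open>The filter of the double limit: first \<open>n\<close>, then \<open>K\<close>.\<close>

definition iter_filter :: "(real \<times> nat) filter" where
  "iter_filter = Abs_filter (\<lambda>P. \<forall>\<^sub>F K in at_top. \<forall>\<^sub>F n in sequentially. P (K, n))"

lemma eventually_iter_filter: "eventually P iter_filter \<longleftrightarrow> (\<forall>\<^sub>F K in at_top. \<forall>\<^sub>F n in sequentially. P (K, n))"
  unfolding iter_filter_def
proof (rule eventually_Abs_filter, rule is_filter.intro)
  show "\<forall>\<^sub>F K in at_top. \<forall>\<^sub>F n in sequentially. True" by simp
next
  fix P Q :: "real \<times> nat \<Rightarrow> bool"
  assume "\<forall>\<^sub>F K in at_top. \<forall>\<^sub>F n in sequentially. P (K, n)" "\<forall>\<^sub>F K in at_top. \<forall>\<^sub>F n in sequentially. Q (K, n)"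
  then show "\<forall>\<^sub>F K in at_top. \<forall>\<^sub>F n in sequentially. P (K, n) \<and> Q (K, n)"
    by eventually_elim (rule eventually_conj)
next
  fix P Q :: "real \<times> nat \<Rightarrow> bool"
  assume "\<forall>x. P x \<longrightarrow> Q x" "\<forall>\<^sub>F K in at_top. \<forall>\<^sub>F n in sequentially. P (K, n)"
  then show "\<forall>\<^sub>F K in at_top. \<forall>\<^sub>F n in sequentially. Q (K, n)"
    by (auto elim!: eventually_mono)
qed

lemma iter_filter_neq_bot: "iter_filter \<noteq> bot"
  unfolding trivial_limit_def eventually_iter_filter by simp

text \<open>The mass functions live in a product of compact intervals, which gives a limit point in
  the product topology, and tightness keeps mass from escaping. A finer filter takes the place of a
  subsequence, since the double limit is a filter and not a sequence.\<close>

lemma pmf_subfilter_limit: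
  fixes q :: "'i \<Rightarrow> nat pmf"
  assumes F: "F \<noteq> bot"
    and tight: "\<And>e. e > 0 \<Longrightarrow> \<exists>R. \<forall>\<^sub>F i in F. 1 - e \<le> measure_pmf.prob (q i) {..<R}"
  obtains F' q' where "F' \<le> F" "F' \<noteq> bot" "\<And>k. ((\<lambda>i. pmf (q i) k) \<longlongrightarrow> pmf q' k) F'"
proof -
  define U where "U = (PiE UNIV (\<lambda>_. {0..1}) :: (nat \<Rightarrow> real) set)"
  have "compactin (product_topology (\<lambda>_. euclidean) UNIV) U"
    unfolding U_def compactin_PiE by simp
  then have U: "compact U" by (simp add: euclidean_product_topology)
  define f where "f i = pmf (q i)" for i
  have fU: "f i \<in> U" for i by (auto simp: U_def f_def pmf_le_1)
  have "filtermap f F \<noteq> bot" using F by (simp add: filtermap_bot_iff)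
  moreover have "eventually (\<lambda>x. x \<in> U) (filtermap f F)" using fU by (simp add: eventually_filtermap)
  ultimately obtain x where x: "x \<in> U" "inf (nhds x) (filtermap f F) \<noteq> bot"
    using U unfolding compact_filter by blast
  \<comment> \<open>The trace on \<open>F\<close> of the neighbourhoods of \<open>x\<close>; it is
    proper because \<open>x\<close> is a cluster point.\<close>
  define F' where "F' = inf F (filtercomap f (nhds x))"
  have F': "F' \<le> F" by (simp add: F'_def)
  have nb: "F' \<noteq> bot"
  proof
    assume "F' = bot"
    then have "eventually (\<lambda>_. False) F'" by simp
    then obtain P Q where PQ: "eventually P F" "eventually Q (nhds x)" "\<And>i. P i \<Longrightarrow> Q (f i) \<Longrightarrow> False"
      unfolding F'_def eventually_inf eventually_filtercomap by blast
    have "eventually (\<lambda>y. \<not> Q y) (filtermap f F)"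
      unfolding eventually_filtermap using PQ(1) by eventually_elim (use PQ(3) in blast)
    then have "eventually (\<lambda>_. False) (inf (nhds x) (filtermap f F))"
      unfolding eventually_inf using PQ(2) by blast
    then show False using x(2) by (simp add: trivial_limit_def)
  qed
  have lim: "(f \<longlongrightarrow> x) F'" unfolding filterlim_iff_le_filtercomap F'_def by simp
  have limk: "((\<lambda>i. pmf (q i) k) \<longlongrightarrow> x k) F'" for k
  proof -
    have "continuous_on UNIV (\<lambda>x :: nat \<Rightarrow> real. x k)" by (rule continuous_on_product_coordinates)
    then have "((\<lambda>x :: nat \<Rightarrow> real. x k) \<longlongrightarrow> x k) (at x)" by (simp add: continuous_on_def)
    then have "((\<lambda>x :: nat \<Rightarrow> real. x k) \<longlongrightarrow> x k) (nhds x)"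
      by (rule tendsto_at_iff_tendsto_nhds[of "\<lambda>x. x k" x, THEN iffD1])
    then have "((\<lambda>i. f i k) \<longlongrightarrow> x k) F'" using lim by (rule filterlim_compose)
    then show ?thesis by (simp add: f_def)
  qed
  have x0: "0 \<le> x k" "x k \<le> 1" for k using x(1) by (auto simp: U_def PiE_def Pi_def)
  have prob: "measure_pmf.prob (q i) {..<R} = (\<Sum>k<R. pmf (q i) k)" for i R
    by (simp add: measure_measure_pmf_finite)
  have sumlim: "((\<lambda>i. measure_pmf.prob (q i) {..<R}) \<longlongrightarrow> (\<Sum>k<R. x k)) F'" for R
    unfolding prob by (intro tendsto_sum limk)
  have le1: "(\<Sum>k<R. x k) \<le> 1" for R
    by (rule tendsto_upperbound[OF sumlim _ nb]) (auto intro: always_eventually)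
  have sm: "summable x" using x0(1) le1 by (rule summableI_nonneg_bounded)
  have "(\<Sum>k. x k) \<le> 1" using sm le1 by (intro suminf_le_const)
  moreover have "1 \<le> (\<Sum>k. x k) + e" if "e > 0" for e
  proof -
    have "\<exists>R. \<forall>\<^sub>F i in F. 1 - e \<le> measure_pmf.prob (q i) {..<R}" using that by (rule tight)
    then obtain R where "\<forall>\<^sub>F i in F. 1 - e \<le> measure_pmf.prob (q i) {..<R}" ..
    then have "\<forall>\<^sub>F i in F'. 1 - e \<le> measure_pmf.prob (q i) {..<R}" using F' by (rule filter_leD[rotated])
    then have "1 - e \<le> (\<Sum>k<R. x k)" by (rule tendsto_lowerbound[OF sumlim _ nb])
    also have "\<dots> \<le> (\<Sum>k. x k)" using sm x0 by (intro sum_le_suminf) auto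
    finally show ?thesis by simp
  qed
  ultimately have "(\<Sum>k. x k) = 1" by (meson antisym field_le_epsilon)
  then have "(\<integral>\<^sup>+k. ennreal (x k) \<partial>count_space UNIV) = 1"
    using sm x0 by (simp add: nn_integral_count_space_nat suminf_ennreal2)
  then have "pmf (embed_pmf x) k = x k" for k using x0 by (intro pmf_embed_pmf) auto
  then show ?thesis using that[of F' "embed_pmf x"] F' nb limk by simp
qed

text \<open>The limit has total mass 1, so no mass is left for the tails: a finite set carrying
  almost all of \<open>q'\<close> eventually carries almost all of \<open>q i\<close>, and outside
  it a bounded function contributes little.\<close>

lemma pmf_expectation_tendsto:
  fixes q :: "'i \<Rightarrow> nat pmf" and h :: "nat \<Rightarrow> real"
  assumes lim: "\<And>k. ((\<lambda>i. pmf (q i) k) \<longlongrightarrow> pmf q' k) F" and h: "\<And>k. \<bar>h k\<bar> \<le> 1"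
  shows "((\<lambda>i. measure_pmf.expectation (q i) h) \<longlongrightarrow> measure_pmf.expectation q' h) F"
proof (rule tendstoI)
  fix e :: real assume e: "e > 0"
  have "(\<lambda>R. measure_pmf.prob q' {..<R}) \<longlonglongrightarrow> measure_pmf.prob q' (\<Union>R. {..<R})"
    by (intro measure_pmf.finite_Lim_measure_incseq) (auto simp: incseq_def)
  moreover have "(\<Union>R. {..<R}) = (UNIV :: nat set)" by auto
  ultimately have "(\<lambda>R. measure_pmf.prob q' {..<R}) \<longlonglongrightarrow> 1" by simp
  then have "\<forall>\<^sub>F R in sequentially. 1 - e/4 < measure_pmf.prob q' {..<R}"
    using e by (intro order_tendstoD(1)) auto
  then obtain R where R: "1 - e/4 < measure_pmf.prob q' {..<R}" by (auto simp: eventually_sequentially)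
  have prob: "measure_pmf.prob p {..<R} = (\<Sum>k<R. pmf p k)" for p :: "nat pmf"
    by (simp add: measure_measure_pmf_finite)
  have tail: "\<bar>measure_pmf.expectation p h - (\<Sum>k<R. h k * pmf p k)\<bar> \<le> 1 - measure_pmf.prob p {..<R}" for p :: "nat pmf"
  proof -
    have int: "integrable (measure_pmf p) h"
      using h by (intro measure_pmf.integrable_const_bound[where B = 1]) auto
    have intk: "integrable (measure_pmf p) (\<lambda>x. h x * indicator A x)" for A
      using h by (intro measure_pmf.integrable_const_bound[where B = 1]) (auto simp: indicator_def)
    have "measure_pmf.expectation p h - measure_pmf.expectation p (\<lambda>x. h x * indicator {..<R} x) = measure_pmf.expectation p (\<lambda>x. h x * indicator (- {..<R}) x)"
      by (subst Bochner_Integration.integral_diff[symmetric, OF int intk]) (auto intro!: Bochner_Integration.integral_cong simp: indicator_def)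
    moreover have "measure_pmf.expectation p (\<lambda>x. h x * indicator {..<R} x) = (\<Sum>k<R. h k * pmf p k)"
      by (subst integral_measure_pmf_real[where A = "{..<R}"]) (auto simp: indicator_def)
    moreover have "\<bar>measure_pmf.expectation p (\<lambda>x. h x * indicator (- {..<R}) x)\<bar> \<le> measure_pmf.expectation p (indicator (- {..<R}))"
      using h by (intro order_trans[OF integral_abs_bound] integral_mono intk measure_pmf.integrable_const_bound[where B = 1])
        (auto simp: indicator_def)
    moreover have "measure_pmf.expectation p (indicator (- {..<R})) = 1 - measure_pmf.prob p {..<R}"
      using measure_pmf.prob_compl[of "{..<R}" p] by (simp add: Compl_eq_Diff_UNIV)
    ultimately show ?thesis by linarith
  qed
  have "((\<lambda>i. \<Sum>k<R. pmf (q i) k) \<longlongrightarrow> (\<Sum>k<R. pmf q' k)) F" by (intro tendsto_sum lim)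
  then have "\<forall>\<^sub>F i in F. 1 - e/4 < (\<Sum>k<R. pmf (q i) k)" using R unfolding prob by (intro order_tendstoD(1)) auto
  moreover have "((\<lambda>i. \<Sum>k<R. h k * pmf (q i) k) \<longlongrightarrow> (\<Sum>k<R. h k * pmf q' k)) F" by (intro tendsto_sum tendsto_mult tendsto_const lim)
  then have "\<forall>\<^sub>F i in F. dist (\<Sum>k<R. h k * pmf (q i) k) (\<Sum>k<R. h k * pmf q' k) < e/2" using e by (intro tendstoD) auto
  ultimately show "\<forall>\<^sub>F i in F. dist (measure_pmf.expectation (q i) h) (measure_pmf.expectation q' h) < e"
  proof eventually_elim
    case (elim i)
    then show ?case using tail[of "q i"] tail[of q'] R unfolding prob dist_real_def by linarith
  qed
qed

text \<open>Subtracting the lower terms and dividing by \<open>z ^ k\<close> isolates coefficient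
  \<open>k\<close>; the higher terms together are at most \<open>z ^ Suc k\<close>, because the
  masses sum to 1. A fixed small \<open>z\<close> thus recovers coefficients without derivatives or
  analytic functions.\<close>

lemma pgf_coefficient_bound:
  fixes p :: "nat pmf" and z :: real
  assumes z: "0 < z" "z < 1"
  shows "\<bar>(measure_pmf.expectation p (\<lambda>x. z ^ x) - (\<Sum>j<k. pmf p j * z ^ j)) / z ^ k - pmf p k\<bar> \<le> z"
proof -
  have b: "norm (z ^ x) \<le> 1" for x using z by (simp add: power_le_one)
  have int: "integrable (measure_pmf p) (\<lambda>x. z ^ x * indicator A x)" for A
    using b by (intro measure_pmf.integrable_const_bound[where B = 1]) (auto simp: indicator_def)
  have int1: "integrable (measure_pmf p) (\<lambda>x. z ^ x)"
    using b by (intro measure_pmf.integrable_const_bound[where B = 1]) auto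
  have "measure_pmf.expectation p (\<lambda>x. z ^ x) - measure_pmf.expectation p (\<lambda>x. z ^ x * indicator {..<Suc k} x) = measure_pmf.expectation p (\<lambda>x. z ^ x * indicator (- {..<Suc k}) x)"
    by (subst Bochner_Integration.integral_diff[symmetric, OF int1 int]) (auto intro!: Bochner_Integration.integral_cong simp: indicator_def)
  moreover have "measure_pmf.expectation p (\<lambda>x. z ^ x * indicator {..<Suc k} x) = (\<Sum>j<Suc k. z ^ j * pmf p j)"
    by (subst integral_measure_pmf_real[where A = "{..<Suc k}"]) (auto simp: indicator_def)
  moreover have "0 \<le> measure_pmf.expectation p (\<lambda>x. z ^ x * indicator (- {..<Suc k}) x)"
    using z by (intro integral_nonneg_AE) auto
  moreover have "measure_pmf.expectation p (\<lambda>x. z ^ x * indicator (- {..<Suc k}) x) \<le> z ^ Suc k"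
  proof -
    have "z ^ x * indicator (- {..<Suc k}) x \<le> z ^ Suc k" for x
    proof (cases "x < Suc k")
      case False
      then have "z ^ x \<le> z ^ Suc k" using z by (intro power_decreasing) auto
      then show ?thesis using False by simp
    qed (use z in auto)
    then have "measure_pmf.expectation p (\<lambda>x. z ^ x * indicator (- {..<Suc k}) x) \<le> measure_pmf.expectation p (\<lambda>_. z ^ Suc k)"
      by (intro integral_mono int) auto
    then show ?thesis by simp
  qed
  ultimately have 1: "\<bar>measure_pmf.expectation p (\<lambda>x. z ^ x) - (\<Sum>j<k. pmf p j * z ^ j) - z ^ k * pmf p k\<bar> \<le> z ^ k * z"
    by (simp add: mult.commute)
  have "(measure_pmf.expectation p (\<lambda>x. z ^ x) - (\<Sum>j<k. pmf p j * z ^ j)) / z ^ k - pmf p k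
    = (measure_pmf.expectation p (\<lambda>x. z ^ x) - (\<Sum>j<k. pmf p j * z ^ j) - z ^ k * pmf p k) / z ^ k"
    using z by (simp add: field_simps)
  also have "\<bar>\<dots>\<bar> = \<bar>measure_pmf.expectation p (\<lambda>x. z ^ x) - (\<Sum>j<k. pmf p j * z ^ j) - z ^ k * pmf p k\<bar> / z ^ k"
    using z by (simp add: abs_divide)
  also have "\<dots> \<le> z" using 1 z by (simp add: pos_divide_le_eq mult.commute)
  finally show ?thesis .
qed

text \<open>The coefficients below \<open>k\<close> converge by induction, so for fixed
  \<open>z\<close> the isolating quotient converges. Its distance from coefficient \<open>k\<close>
  is at most \<open>z\<close>, uniformly in the law, and \<open>z \<le> e/4\<close> is chosen before
  the limit is taken.\<close>

lemma pgf_tendsto_imp_pmf_tendsto: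
  fixes q :: "'i \<Rightarrow> nat pmf"
  assumes pgf: "\<And>z::real. 0 < z \<Longrightarrow> z < 1 \<Longrightarrow> ((\<lambda>i. measure_pmf.expectation (q i) (\<lambda>x. z ^ x)) \<longlongrightarrow> measure_pmf.expectation q' (\<lambda>x. z ^ x)) F"
  shows "((\<lambda>i. pmf (q i) k) \<longlongrightarrow> pmf q' k) F"
proof (induction k rule: less_induct)
  case (less k)
  show ?case
  proof (rule tendstoI)
    fix e :: real assume e: "e > 0"
    define z where "z = min (e/4) (1/2)"
    have z: "0 < z" "z < 1" "z \<le> e/4" using e by (auto simp: z_def min_def)
    define D where "D p = (measure_pmf.expectation p (\<lambda>x. z ^ x) - (\<Sum>j<k. pmf p j * z ^ j)) / z ^ k" for p :: "nat pmf"
    have "((\<lambda>i. D (q i)) \<longlongrightarrow> D q') F"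
      unfolding D_def using z by (intro tendsto_divide tendsto_diff pgf tendsto_sum tendsto_mult tendsto_const less) auto
    then have "\<forall>\<^sub>F i in F. dist (D (q i)) (D q') < e/2" using e by (intro tendstoD) auto
    then show "\<forall>\<^sub>F i in F. dist (pmf (q i) k) (pmf q' k) < e"
    proof eventually_elim
      case (elim i)
      then show ?case using pgf_coefficient_bound[OF z(1,2), of "q i" k] pgf_coefficient_bound[OF z(1,2), of q' k] z(3)
        unfolding D_def[symmetric] dist_real_def by linarith
    qed
  qed
qed

text \<open>Below any \<open>x\<close> there are finitely many natural numbers, so the distribution
  functions are finite sums of point masses up to the probability that \<open>T\<close> and
  \<open>T'\<close> differ, and they converge at every \<open>x\<close>, continuity point or
  not.\<close>

lemma weak_conv_nat_valued:
  fixes M :: "nat \<Rightarrow> 'a measure" and T :: "nat \<Rightarrow> 'a \<Rightarrow> real" and T' :: "nat \<Rightarrow> 'a \<Rightarrow> nat"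
  assumes prob: "\<And>n. n \<ge> 1 \<Longrightarrow> prob_space (M n)"
    and T: "\<And>n. n \<ge> 1 \<Longrightarrow> T n \<in> borel_measurable (M n)"
    and T': "\<And>n. n \<ge> 1 \<Longrightarrow> T' n \<in> measurable (M n) (count_space UNIV)"
    and diff: "(\<lambda>n. measure (M n) {\<omega> \<in> space (M n). T n \<omega> \<noteq> real (T' n \<omega>)}) \<longlonglongrightarrow> 0"
    and lim: "\<And>k. (\<lambda>n. measure (M n) {\<omega> \<in> space (M n). T' n \<omega> = k}) \<longlonglongrightarrow> pmf q k"
  shows "weak_conv_m (\<lambda>n. distr (M n) borel (T n)) (distr (measure_pmf q) borel real)"
  unfolding weak_conv_m_def weak_conv_def
proof (intro allI impI)
  fix x :: real
  define A where "A = {k::nat. real k \<le> x}"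
  let ?E = "\<lambda>n k. {\<omega> \<in> space (M n). T' n \<omega> = k}"
  have A: "finite A"
  proof (rule finite_subset)
    show "A \<subseteq> {..nat \<lfloor>x\<rfloor>}" by (auto simp: A_def le_nat_floor)
  qed simp
  have cq: "cdf (distr (measure_pmf q) borel real) x = (\<Sum>k\<in>A. pmf q k)"
    unfolding cdf_def by (subst measure_distr) (auto simp: A_def[symmetric] vimage_def measure_measure_pmf_finite[OF A])
  have bd: "\<forall>\<^sub>F n in sequentially. \<bar>cdf (distr (M n) borel (T n)) x - (\<Sum>k\<in>A. measure (M n) (?E n k))\<bar>
      \<le> measure (M n) {\<omega> \<in> space (M n). T n \<omega> \<noteq> real (T' n \<omega>)}"
    using eventually_ge_at_top[of 1]
  proof eventually_elim
    case (elim n)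
    interpret prob_space "M n" by (rule prob[OF elim])
    note T[OF elim, measurable] T'[OF elim, measurable]
    have [measurable]: "(\<lambda>\<omega>. real (T' n \<omega>)) \<in> borel_measurable (M n)"
      using measurable_compose[OF T'[OF elim], of real borel] by simp
    let ?D = "{\<omega> \<in> space (M n). T n \<omega> \<noteq> real (T' n \<omega>)}"
    let ?P = "{\<omega> \<in> space (M n). T n \<omega> \<le> x}" and ?Q = "{\<omega> \<in> space (M n). real (T' n \<omega>) \<le> x}"
    have m: "?D \<in> events" "?P \<in> events" "?Q \<in> events" by measurable
    have c: "cdf (distr (M n) borel (T n)) x = prob ?P"
      unfolding cdf_def by (subst measure_distr) (auto intro!: arg_cong[where f = prob])
    have "?Q = (\<Union>k\<in>A. ?E n k)" by (auto simp: A_def)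
    moreover have "prob (\<Union>k\<in>A. ?E n k) = (\<Sum>k\<in>A. prob (?E n k))"
    proof (rule finite_measure_finite_Union[OF A])
      show "(\<lambda>k. ?E n k) ` A \<subseteq> events" by auto
    qed (auto simp: disjoint_family_on_def)
    ultimately have q: "prob ?Q = (\<Sum>k\<in>A. prob (?E n k))" by simp
    have "prob ?P \<le> prob (?Q \<union> ?D)" using m by (intro finite_measure_mono) auto
    also have "\<dots> \<le> prob ?Q + prob ?D" using m by (intro measure_Un_le)
    finally have 1: "prob ?P \<le> prob ?Q + prob ?D" .
    have "prob ?Q \<le> prob (?P \<union> ?D)" using m by (intro finite_measure_mono) auto
    also have "\<dots> \<le> prob ?P + prob ?D" using m by (intro measure_Un_le)
    finally show ?case using 1 by (simp add: c q[symmetric] abs_le_iff)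
  qed
  have "(\<lambda>n. cdf (distr (M n) borel (T n)) x - (\<Sum>k\<in>A. measure (M n) (?E n k))) \<longlonglongrightarrow> 0"
    by (rule Lim_null_comparison[OF _ diff]) (use bd in \<open>simp add: real_norm_def\<close>)
  moreover have "(\<lambda>n. \<Sum>k\<in>A. measure (M n) (?E n k)) \<longlonglongrightarrow> (\<Sum>k\<in>A. pmf q k)"
    by (intro tendsto_sum lim)
  ultimately show "(\<lambda>n. cdf (distr (M n) borel (T n)) x) \<longlonglongrightarrow> cdf (distr (measure_pmf q) borel real) x"
    unfolding cq using tendsto_add by fastforce
qed

section \<open>The generating function at finite n\<close>

lemma simple_graphD:
  assumes "simple_graph n E"
  shows "finite E" "\<And>e. e \<in> E \<Longrightarrow> card e = 2" "\<And>u v. {u, v} \<in> E \<Longrightarrow> u \<in> {1..n} \<and> v \<in> {1..n} \<and> u \<noteq> v"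
proof -
  have s: "E \<subseteq> {e. e \<subseteq> {1..n} \<and> card e = 2}" using assms by (simp add: simple_graph_def)
  show "finite E" by (rule finite_subset[OF s]) (auto intro: finite_subset[of _ "Pow {1..n}"])
  show "\<And>e. e \<in> E \<Longrightarrow> card e = 2" using s by auto
  show "\<And>u v. {u, v} \<in> E \<Longrightarrow> u \<in> {1..n} \<and> v \<in> {1..n} \<and> u \<noteq> v"
  proof -
    fix u v assume "{u, v} \<in> E"
    then have "{u, v} \<subseteq> {1..n}" "card {u, v} = 2" using s by auto
    then show "u \<in> {1..n} \<and> v \<in> {1..n} \<and> u \<noteq> v" by (cases "u = v") auto
  qed
qed

lemma nb_degree:
  assumes "simple_graph n E" shows "nb E {1..n} v = degree_in E v"
  unfolding nb_def degree_in_def using simple_graphD(3)[OF assms] by (intro arg_cong[where f = card]) auto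

lemma adj_sym: "adj E u v = adj E v u"
  by (simp add: adj_def insert_commute)

lemma adj_diag: "simple_graph n E \<Longrightarrow> adj E u u = 0"
  using simple_graphD(3)[of n E u u] by (auto simp: adj_def)

lemma ec_adj:
  assumes "simple_graph n E" "finite A"
  shows "2 * real (ec E A) = (\<Sum>u\<in>A. \<Sum>v\<in>A. adj E u v)"
proof -
  note g = simple_graphD[OF assms(1)]
  let ?S = "{(u, v) \<in> pairs A. {u, v} \<in> E}"
  have "(\<Sum>u\<in>A. \<Sum>v\<in>A. adj E u v) = 2 * (\<Sum>(u, v)\<in>pairs A. adj E u v)"
    by (rule sum_pairs_sym[OF assms(2)]) (rule adj_sym, rule adj_diag[OF assms(1)])
  also have "(\<Sum>(u, v)\<in>pairs A. adj E u v) = real (card ?S)"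
    using assms(2) by (simp add: adj_def case_prod_unfold sum.If_cases Int_def)
  also have "card ?S = ec E A"
    unfolding ec_def
  proof (rule bij_betw_same_card[of "\<lambda>(u, v). {u, v}"])
    show "bij_betw (\<lambda>(u, v). {u, v}) ?S {e \<in> E. e \<subseteq> A}"
      unfolding bij_betw_def
    proof
      show "inj_on (\<lambda>(u, v). {u, v}) ?S"
        by (auto simp: inj_on_def pairs_def doubleton_eq_iff)
      show "(\<lambda>(u, v). {u, v}) ` ?S = {e \<in> E. e \<subseteq> A}"
      proof (intro set_eqI iffI)
        fix e assume e: "e \<in> {e \<in> E. e \<subseteq> A}"
        then obtain a b where ab: "e = {a, b}" "a \<noteq> b" using g(2)[of e] by (auto simp: card_2_iff)
        show "e \<in> (\<lambda>(u, v). {u, v}) ` ?S"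
        proof (cases "a < b")
          case True
          then show ?thesis using e ab by (intro image_eqI[of _ _ "(a, b)"]) (auto simp: pairs_def)
        next
          case False
          then show ?thesis using e ab by (intro image_eqI[of _ _ "(b, a)"]) (auto simp: pairs_def insert_commute)
        qed
      qed (auto simp: pairs_def)
    qed
  qed
  finally show ?thesis by simp
qed

lemma sum_adj:
  assumes "simple_graph n E"
  shows "(\<Sum>u\<in>{1..n}. \<Sum>v\<in>{1..n}. adj E u v) = 2 * real (card E)"
proof -
  have "{e \<in> E. e \<subseteq> {1..n}} = E" using assms by (auto simp: simple_graph_def)
  then show ?thesis using ec_adj[OF assms, of "{1..n}"] by (simp add: ec_def)
qed

lemma Psi_adj:
  assumes "simple_graph n E" "finite A"
  shows "(\<Prod>(u, v)\<in>pairs A. 1 - s * adj E u v) = (1 - s) ^ ec E A"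
proof -
  have "(\<Prod>(u, v)\<in>pairs A. 1 - s * adj E u v) = (\<Prod>z\<in>pairs A. if {fst z, snd z} \<in> E then 1 - s else 1)"
    by (intro prod.cong) (auto simp: adj_def)
  also have "\<dots> = (1 - s) ^ card {z \<in> pairs A. {fst z, snd z} \<in> E}"
    using assms(2) by (simp add: prod.If_cases Int_def)
  also have "card {z \<in> pairs A. {fst z, snd z} \<in> E} = ec E A"
  proof -
    have "real (card {z \<in> pairs A. {fst z, snd z} \<in> E}) = (\<Sum>(u, v)\<in>pairs A. adj E u v)"
      using assms(2) by (simp add: adj_def case_prod_unfold sum.If_cases Int_def)
    also have "2 * \<dots> = (\<Sum>u\<in>A. \<Sum>v\<in>A. adj E u v)"
      by (rule sum_pairs_sym[OF assms(2), symmetric]) (rule adj_sym, rule adj_diag[OF assms(1)])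
    also have "\<dots> = 2 * real (ec E A)" by (rule ec_adj[OF assms, symmetric])
    finally show ?thesis by simp
  qed
  finally show ?thesis .
qed

lemma nb_swap:
  assumes "finite A" "finite R"
  shows "(\<Sum>v\<in>R. nb E A v) = (\<Sum>u\<in>A. nb E R u)"
proof -
  have "real (\<Sum>v\<in>R. nb E A v) = (\<Sum>v\<in>R. \<Sum>u\<in>A. of_bool ({u, v} \<in> E))"
    using assms by (simp only: of_nat_sum nb_real)
  also have "\<dots> = (\<Sum>u\<in>A. \<Sum>v\<in>R. of_bool ({v, u} \<in> E))" by (subst sum.swap) (simp add: insert_commute)
  also have "\<dots> = real (\<Sum>u\<in>A. nb E R u)" using assms by (simp only: of_nat_sum nb_real)
  finally show ?thesis by (simp only: of_nat_eq_iff)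
qed

lemma ec_nb:
  assumes "simple_graph n E" "finite A"
  shows "2 * real (ec E A) = (\<Sum>u\<in>A. real (nb E A u))"
proof -
  have "(\<Sum>v\<in>A. adj E u v) = real (nb E A u)" for u
    unfolding nb_real[OF assms(2)] by (intro sum.cong) (auto simp: adj_def insert_commute)
  then show ?thesis by (simp add: ec_adj[OF assms])
qed

lemma ec_split:
  assumes g: "simple_graph n E" and fin: "finite A" "finite B" "A \<inter> B = {}"
  shows "ec E (A \<union> B) = ec E A + (\<Sum>v\<in>B. nb E A v) + ec E B"
proof -
  have nbU: "real (nb E (A \<union> B) u) = real (nb E A u) + real (nb E B u)" for u
    using fin by (simp only: nb_real finite_Un sum.union_disjoint)
  have "2 * real (ec E (A \<union> B)) = (\<Sum>u\<in>A \<union> B. real (nb E (A \<union> B) u))"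
    using fin by (intro ec_nb[OF g]) simp
  also have "\<dots> = (\<Sum>u\<in>A. real (nb E A u) + real (nb E B u)) + (\<Sum>u\<in>B. real (nb E A u) + real (nb E B u))"
    using fin by (simp only: nbU sum.union_disjoint)
  also have "\<dots> = 2 * real (ec E A) + 2 * real (ec E B) + (\<Sum>u\<in>A. real (nb E B u)) + (\<Sum>v\<in>B. real (nb E A v))"
    using ec_nb[OF g fin(1)] ec_nb[OF g fin(2)] by (simp add: sum.distrib)
  also have "(\<Sum>u\<in>A. real (nb E B u)) = (\<Sum>v\<in>B. real (nb E A v))"
    using nb_swap[OF fin(1,2), of E] by (simp only: of_nat_sum[symmetric])
  finally have "real (ec E (A \<union> B)) = real (ec E A + (\<Sum>v\<in>B. nb E A v) + ec E B)" by simp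
  then show ?thesis by (simp only: of_nat_eq_iff)
qed

lemma sum_degrees:
  assumes "simple_graph n E" shows "(\<Sum>v\<in>{1..n}. real (nb E {1..n} v)) = 2 * real (card E)"
proof -
  have "{e \<in> E. e \<subseteq> {1..n}} = E" using assms by (auto simp: simple_graph_def)
  then show ?thesis using ec_nb[OF assms, of "{1..n}"] by (simp add: ec_def)
qed

text \<open>The vertices from 1 to \<open>v\<close> all have at least the degree of
  \<open>v\<close>, and the degrees add up to twice the number of edges. Through this bound the
  labelling by degrees enters.\<close>

lemma degree_rank_bound:
  assumes g: "simple_graph n E" and o: "degree_ordered n E"
  shows "real v * real (nb E {1..n} v) \<le> 2 * real (card E)"
proof (cases "v \<in> {1..n}")
  case True
  have "real v * real (nb E {1..n} v) = (\<Sum>u\<in>{1..v}. real (nb E {1..n} v))" by simp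
  also have "\<dots> \<le> (\<Sum>u\<in>{1..v}. real (nb E {1..n} u))"
  proof (intro sum_mono)
    fix u assume "u \<in> {1..v}"
    then show "real (nb E {1..n} v) \<le> real (nb E {1..n} u)"
      using o True unfolding degree_ordered_def nb_degree[OF g] by auto
  qed
  also have "\<dots> \<le> (\<Sum>u\<in>{1..n}. real (nb E {1..n} u))"
    using True by (intro sum_mono2) auto
  finally show ?thesis using sum_degrees[OF g] by simp
next
  case False
  then have "{u \<in> {1..n}. {u, v} \<in> E} = {}" using simple_graphD(3)[OF g, of _ v] by auto
  then have "nb E {1..n} v = 0" by (simp only: nb_def card.empty)
  then show ?thesis by simp
qed

text \<open>The number of edges of \<open>C\<close> between the head \<open>{..N}\<close> and the tail.\<close>

definition eHR :: "nat set set \<Rightarrow> nat \<Rightarrow> nat set \<Rightarrow> nat" where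
  "eHR E N C = (\<Sum>v\<in>C \<inter> {N<..}. nb E (C \<inter> {..N}) v)"

lemma abs_prod_diff_le:
  fixes f g :: "'b \<Rightarrow> real"
  assumes "finite A" "\<And>u. u \<in> A \<Longrightarrow> 0 \<le> f u \<and> f u \<le> 1" "\<And>u. u \<in> A \<Longrightarrow> 0 \<le> g u \<and> g u \<le> 1"
  shows "\<bar>(\<Prod>u\<in>A. f u) - (\<Prod>u\<in>A. g u)\<bar> \<le> (\<Sum>u\<in>A. \<bar>f u - g u\<bar>)"
  using norm_prod_diff[of A f g] assms by auto

text \<open>A change of \<open>th u\<close> matters only if \<open>u\<close> is chosen, which costs
  a factor \<open>p\<close>; the product over pairs is at most 1.\<close>

lemma bern_Psi_theta:
  assumes H: "finite H" and p: "0 \<le> p" "p \<le> 1" and s: "0 \<le> s" "s \<le> 1"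
    and w: "\<And>u v. u \<in> H \<Longrightarrow> v \<in> H \<Longrightarrow> 0 \<le> w u v \<and> w u v \<le> 1"
    and th: "\<And>u. u \<in> H \<Longrightarrow> 0 \<le> th u \<and> th u \<le> 1" and th': "\<And>u. u \<in> H \<Longrightarrow> 0 \<le> th' u \<and> th' u \<le> 1"
  shows "\<bar>bern H p (Psi s w th) - bern H p (Psi s w th')\<bar> \<le> p * (\<Sum>u\<in>H. \<bar>th u - th' u\<bar>)"
proof -
  have "\<bar>bern H p (Psi s w th) - bern H p (Psi s w th')\<bar> \<le> bern H p (\<lambda>A. \<bar>Psi s w th A - Psi s w th' A\<bar>)"
    unfolding bern_diff[symmetric] by (rule bern_abs[OF p])
  also have "\<dots> \<le> bern H p (\<lambda>A. \<Sum>u\<in>H. \<bar>th u - th' u\<bar> * of_bool (u \<in> A))"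
  proof (rule bern_mono[OF p])
    fix A assume A: "A \<subseteq> H"
    then have fA: "finite A" using H finite_subset by auto
    have q: "0 \<le> 1 - s * w u v \<and> 1 - s * w u v \<le> 1" if "u \<in> A" "v \<in> A" for u v
    proof -
      have "0 \<le> w u v" "w u v \<le> 1" using w[of u v] A that by auto
      then show ?thesis using s mult_le_one[of s "w u v"] by simp
    qed
    have 1: "0 \<le> (\<Prod>(u, v)\<in>pairs A. 1 - s * w u v)" "(\<Prod>(u, v)\<in>pairs A. 1 - s * w u v) \<le> 1"
      using q by (auto intro!: prod_nonneg prod_le_1 simp: pairs_def)
    have "\<bar>Psi s w th A - Psi s w th' A\<bar> = (\<Prod>(u, v)\<in>pairs A. 1 - s * w u v) * \<bar>(\<Prod>u\<in>A. th u) - (\<Prod>u\<in>A. th' u)\<bar>"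
      using 1 by (simp add: Psi_def right_diff_distrib[symmetric] abs_mult)
    also have "\<dots> \<le> 1 * (\<Sum>u\<in>A. \<bar>th u - th' u\<bar>)"
    proof (rule mult_mono)
      show "\<bar>(\<Prod>u\<in>A. th u) - (\<Prod>u\<in>A. th' u)\<bar> \<le> (\<Sum>u\<in>A. \<bar>th u - th' u\<bar>)"
        using th th' A by (intro abs_prod_diff_le fA) (simp_all add: subset_iff)
    qed (use 1 in auto)
    also have "(\<Sum>u\<in>A. \<bar>th u - th' u\<bar>) = (\<Sum>u\<in>H. \<bar>th u - th' u\<bar> * of_bool (u \<in> A))"
      using A H by (intro sum.mono_neutral_cong_left) auto
    finally show "\<bar>Psi s w th A - Psi s w th' A\<bar> \<le> (\<Sum>u\<in>H. \<bar>th u - th' u\<bar> * of_bool (u \<in> A))" by simp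
  qed
  also have "\<dots> = (\<Sum>u\<in>H. \<bar>th u - th' u\<bar> * p)"
    unfolding bern_sum bern_cmult using H by (intro sum.cong) (auto simp: bern_prob)
  finally show ?thesis by (simp add: sum_distrib_left mult.commute)
qed

text \<open>Given the chosen head vertices, the marks on head-tail and tail-tail edges are averaged
  as if these edges were Poisson; then \<open>p\<close> times the tail degree is replaced by
  \<open>\<eta>\<close>, and the adjacency by \<open>w\<close>. The three groups of errors in the
  bound belong to these replacements, in this order.\<close>

lemma generating_function_bound:
  fixes w :: "nat \<Rightarrow> nat \<Rightarrow> real" and \<eta> :: "nat \<Rightarrow> real"
  assumes g: "simple_graph n E" and o: "degree_ordered n E" and p: "0 < p" "p \<le> 1" and K: "K > 0"
    and s: "0 \<le> s1" "s1 \<le> 1" "0 \<le> s2" "s2 \<le> 1" "0 \<le> s3" "s3 \<le> 1"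
    and w: "\<And>u v. 0 \<le> w u v \<and> w u v \<le> 1 \<and> w u v = w v u \<and> w u u = 0" and \<eta>: "\<And>u. \<eta> u \<ge> 0"
    and cut: "\<And>f. (\<And>u. 0 \<le> f u \<and> f u \<le> 1) \<Longrightarrow>
        \<bar>p\<^sup>2 * (\<Sum>u\<in>{1..nat \<lfloor>K / p\<rfloor>}. \<Sum>v\<in>{1..nat \<lfloor>K / p\<rfloor>}. (w u v - adj E u v) * f u * f v)\<bar> \<le> \<kappa>"
  defines "N \<equiv> nat \<lfloor>K / p\<rfloor>" and "C \<equiv> real (card E) * p\<^sup>2"
  shows "\<bar>bern {1..n} p (\<lambda>A. (1 - s1) ^ ec E (A \<inter> {..N}) * (1 - s2) ^ eHR E N A * (1 - s3) ^ ec E (A \<inter> {N<..}))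
      - exp (- (s3 * (p\<^sup>2 * real (ec E {N<..n})))) * bern {1..N} p (Psi s1 w (\<lambda>u. exp (- s2 * \<eta> u)))\<bar>
    \<le> (4 * p * C + 16 * C\<^sup>2 / K) + p * (\<Sum>u\<in>{1..N}. min 1 \<bar>p * real (nb E {N<..n} u) - \<eta> u\<bar>) + (\<kappa> + 2 * p ^ 3 * (real N)\<^sup>2)"
proof -
  note gD = simple_graphD[OF g]
  define H where "H = {1..N}"
  define R where "R = {N<..n}"
  have HR: "finite H" "finite R" "H \<inter> R = {}" by (auto simp: H_def R_def)
  have p': "0 \<le> p" "p \<le> 1" using p by auto
  define F where "F A = (1 - s1) ^ ec E (A \<inter> {..N}) * (1 - s2) ^ eHR E N A * (1 - s3) ^ ec E (A \<inter> {N<..})" for A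
  define lam where "lam = p\<^sup>2 * real (ec E R)"
  define c where "c A v = nb E A v" for A v
  define D where "D v = real (nb E {1..n} v)" for v
  define err where "err A = p * (\<Sum>v\<in>R. real (c A v) * (p + (real (c A v) - 1) + p * nb E R v))
      + p\<^sup>2 * (\<Sum>v\<in>R. real (nb E R v) * (p + real (c A v) + p * nb E R v))" for A
  let ?P = "Psi s1 (adj E) (\<lambda>u. exp (- s2 * (p * real (nb E R u))))"
  let ?b = "\<lambda>A. bern R p (\<lambda>B. (1 - s2) ^ (\<Sum>v\<in>B. c A v) * (1 - s3) ^ ec E B)"
  let ?e = "\<lambda>A. exp (- (s2 * p * (\<Sum>v\<in>R. real (c A v)) + s3 * p\<^sup>2 * real (ec E R)))"
  let ?T = "\<lambda>u. exp (- s2 * \<eta> u)"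
  let ?P1 = "Psi s1 (adj E) ?T"
  let ?q = "\<lambda>v. p * (p + p * nb E R v) + p\<^sup>2 * real (nb E R v)"
  have ecn: "ec E (A \<inter> {1..n}) = ec E A" for A
  proof -
    have "{e \<in> E. e \<subseteq> A \<inter> {1..n}} = {e \<in> E. e \<subseteq> A}" using g by (auto simp: simple_graph_def)
    then show ?thesis by (simp add: ec_def)
  qed
  have nbn: "nb E (A \<inter> {1..n}) v = nb E A v" for A v
    unfolding nb_def using gD(3) by (intro arg_cong[where f = card]) auto
  have nb0: "nb E A v = 0" if "v \<notin> {1..n}" for A v
  proof -
    have "{u \<in> A. {u, v} \<in> E} = {}" using gD(3)[of _ v] that by auto
    then show ?thesis by (simp only: nb_def card.empty)
  qed
  \<comment> \<open>If \<open>K / p\<close> exceeds \<open>n\<close>, the head contains labels that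
    are no vertices; they have no edges, and adding them to the ground set changes nothing.\<close>
  have "bern {1..n} p F = bern (H \<union> R) p F"
  proof (rule bern_restrict[symmetric])
    fix A assume "A \<subseteq> H \<union> R"
    then have fA: "finite A" using HR finite_subset by blast
    have i: "A \<inter> {1..n} \<inter> {..N} = A \<inter> {..N} \<inter> {1..n}" "A \<inter> {1..n} \<inter> {N<..} = A \<inter> {N<..} \<inter> {1..n}" by auto
    have "eHR E N (A \<inter> {1..n}) = eHR E N A"
      unfolding eHR_def i nbn using nb0 fA by (intro sum.mono_neutral_left) auto
    then show "F A = F (A \<inter> {1..n})" unfolding F_def i ecn by simp
  qed (auto simp: H_def R_def)
  also have "\<dots> = bern H p (\<lambda>A. bern R p (\<lambda>B. F (A \<union> B)))" by (rule bern_union[OF HR])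
  also have "\<dots> = bern H p (\<lambda>A. (1 - s1) ^ ec E A * ?b A)"
    unfolding bern_cmult[symmetric]
  proof (intro bern_cong)
    fix A B assume AB: "A \<subseteq> H" "B \<subseteq> R"
    have "(A \<union> B) \<inter> {..N} = A" "(A \<union> B) \<inter> {N<..} = B" using AB by (auto simp: H_def R_def)
    then show "F (A \<union> B) = (1 - s1) ^ ec E A * ((1 - s2) ^ (\<Sum>v\<in>B. c A v) * (1 - s3) ^ ec E B)"
      by (simp add: F_def eHR_def c_def)
  qed
  finally have L: "bern {1..n} p F = bern H p (\<lambda>A. (1 - s1) ^ ec E A * ?b A)" by simp
  \<comment> \<open>The chosen head-tail edges, summed over tail vertices in the Poisson rate, are
    counted from the head end here, so that the exponential becomes a product of factors
    \<open>th u\<close> over the chosen head vertices.\<close>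
  have mid: "exp (- (s3 * lam)) * bern H p ?P =
     bern H p (\<lambda>A. (1 - s1) ^ ec E A * ?e A)"
    unfolding bern_cmult[symmetric]
  proof (rule bern_cong)
    fix A assume A: "A \<subseteq> H"
    then have fA: "finite A" using HR finite_subset by auto
    have "(\<Prod>u\<in>A. exp (- s2 * (p * real (nb E R u)))) = exp (- s2 * (p * (\<Sum>u\<in>A. real (nb E R u))))"
      using fA by (simp add: exp_sum[symmetric] sum_distrib_left)
    also have "(\<Sum>u\<in>A. real (nb E R u)) = (\<Sum>v\<in>R. real (c A v))"
      using nb_swap[OF fA HR(2), of E] unfolding c_def by (simp only: of_nat_sum[symmetric])
    finally have e: "(\<Prod>u\<in>A. exp (- s2 * (p * real (nb E R u)))) = exp (- s2 * (p * (\<Sum>v\<in>R. real (c A v))))" .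
    show "exp (- (s3 * lam)) * Psi s1 (adj E) (\<lambda>u. exp (- s2 * (p * real (nb E R u)))) A =
        (1 - s1) ^ ec E A * ?e A"
      unfolding Psi_def Psi_adj[OF g fA] e lam_def by (simp add: exp_add[symmetric] exp_diff exp_minus field_simps)
  qed
  have A: "\<bar>bern {1..n} p F - exp (- (s3 * lam)) * bern H p ?P\<bar> \<le> bern H p err"
  proof -
    have "\<bar>bern {1..n} p F - exp (- (s3 * lam)) * bern H p ?P\<bar>
      \<le> bern H p (\<lambda>A. \<bar>(1 - s1) ^ ec E A * ?b A
         - (1 - s1) ^ ec E A * ?e A\<bar>)"
      unfolding L mid bern_diff[symmetric] by (rule bern_abs[OF p'])
    also have "\<dots> \<le> bern H p err"
    proof (rule bern_mono[OF p'])
      fix A assume "A \<subseteq> H"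
      have "\<bar>(1 - s1) ^ ec E A * ?b A
         - (1 - s1) ^ ec E A * ?e A\<bar>
        = (1 - s1) ^ ec E A * \<bar>?b A
         - ?e A\<bar>"
        using s by (simp add: right_diff_distrib[symmetric] abs_mult power_abs)
      also have "\<dots> \<le> 1 * err A"
        unfolding err_def using s
        by (intro mult_mono bern_poisson_approx[OF HR(2) gD(1,2) p' s(3-6)] power_le_one) auto
      finally show "\<bar>(1 - s1) ^ ec E A * ?b A
         - (1 - s1) ^ ec E A * ?e A\<bar> \<le> err A" by simp
    qed
    finally show ?thesis .
  qed
  have nbD: "real (nb E H v) \<le> D v" "real (nb E R v) \<le> D v" for v
  proof -
    have "nb E H v = nb E (H \<inter> {1..n}) v" by (simp only: nbn)
    also have "\<dots> \<le> nb E {1..n} v" by (rule nb_mono) auto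
    finally show "real (nb E H v) \<le> D v" by (simp add: D_def)
    have "nb E R v = nb E (R \<inter> {1..n}) v" by (simp only: nbn)
    also have "\<dots> \<le> nb E {1..n} v" by (rule nb_mono) auto
    finally show "real (nb E R v) \<le> D v" by (simp add: D_def)
  qed
  have D0: "D v \<ge> 0" for v by (simp add: D_def)
  have B: "bern H p err \<le> 4 * p * C + 16 * C\<^sup>2 / K"
  proof -
    \<comment> \<open>Sorted by the dependence on the random count \<open>c A v\<close>: its
      factorial moment, its mean and a constant.\<close>
    have "err A = (\<Sum>v\<in>R. p * (real (c A v) * (real (c A v) - 1)) + ?q v * real (c A v)
         + p\<^sup>2 * (real (nb E R v) * (p + p * nb E R v)))" for A
      unfolding err_def sum_distrib_left sum.distrib[symmetric] by (intro sum.cong refl) (simp add: algebra_simps)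
    then have "err = (\<lambda>A. \<Sum>v\<in>R. p * (real (c A v) * (real (c A v) - 1)) + ?q v * real (c A v)
         + p\<^sup>2 * (real (nb E R v) * (p + p * nb E R v)))" by (rule ext)
    then have "bern H p err = (\<Sum>v\<in>R. p * bern H p (\<lambda>A. real (c A v) * (real (c A v) - 1)) + ?q v * bern H p (\<lambda>A. real (c A v))
         + p\<^sup>2 * (real (nb E R v) * (p + p * nb E R v)))"
      by (simp only: bern_sum bern_add bern_cmult bern_const[OF HR(1)])
    also have "\<dots> \<le> (\<Sum>v\<in>R. p * (p\<^sup>2 * (D v)\<^sup>2) + (p * (p + p * D v) + p\<^sup>2 * D v) * (p * D v)
         + p\<^sup>2 * (D v * (p + p * D v)))"
    proof (intro sum_mono add_mono mult_left_mono)
      fix v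
      have "bern H p (\<lambda>A. real (c A v) * (real (c A v) - 1)) \<le> p\<^sup>2 * (real (nb E H v))\<^sup>2"
        unfolding c_def by (rule bern_nb_square[OF HR(1) p'(1)])
      also have "\<dots> \<le> p\<^sup>2 * (D v)\<^sup>2" using nbD by (intro mult_left_mono power_mono) auto
      finally show "bern H p (\<lambda>A. real (c A v) * (real (c A v) - 1)) \<le> p\<^sup>2 * (D v)\<^sup>2" .
      have "bern H p (\<lambda>A. real (c A v)) = p * nb E H v" unfolding c_def by (rule bern_nb[OF HR(1)])
      then show "?q v * bern H p (\<lambda>A. real (c A v)) \<le> (p * (p + p * D v) + p\<^sup>2 * D v) * (p * D v)"
        using nbD[of v] p' D0[of v] by (auto intro!: mult_mono add_mono mult_nonneg_nonneg add_nonneg_nonneg)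
      show "real (nb E R v) * (p + p * nb E R v) \<le> D v * (p + p * D v)"
        using nbD[of v] p' D0[of v] by (intro mult_mono add_mono) (auto intro!: mult_left_mono)
    qed (use p' in auto)
    also have "\<dots> = (\<Sum>v\<in>R. (2 * p) * (p\<^sup>2 * D v) + 4 * (p * D v) * (p\<^sup>2 * D v))"
      by (intro sum.cong refl) (simp add: algebra_simps power2_eq_square)
    \<comment> \<open>Tail vertices come after \<open>K / p\<close>, so the rank bound gives
      \<open>p * D v \<le> 2 * C / K\<close>. One of two factors \<open>D v\<close> is estimated in
      this way; the other is summed, with total at most \<open>2 * C\<close> after scaling by
      \<open>p\<^sup>2\<close>.\<close>
    also have "\<dots> \<le> (\<Sum>v\<in>R. (2 * p) * (p\<^sup>2 * D v) + 4 * (2 * C / K) * (p\<^sup>2 * D v))"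
    proof (intro sum_mono add_mono order_refl mult_right_mono mult_left_mono)
      fix v assume "v \<in> R"
      then have "N < v" by (auto simp: R_def)
      then have "K / p \<le> real v" unfolding N_def using K p by linarith
      then have "K / p * D v \<le> real v * D v" by (intro mult_right_mono D0)
      also have "\<dots> \<le> 2 * real (card E)" unfolding D_def by (rule degree_rank_bound[OF g o])
      finally have "K / p * D v * p\<^sup>2 \<le> 2 * real (card E) * p\<^sup>2" by (intro mult_right_mono) auto
      then have "K * (p * D v) \<le> 2 * C" using p by (simp add: C_def power2_eq_square)
      then show "p * D v \<le> 2 * C / K" using K by (simp add: pos_le_divide_eq mult.commute)
    qed (use D0 in auto)
    also have "\<dots> = (2 * p + 4 * (2 * C / K)) * (p\<^sup>2 * (\<Sum>v\<in>R. D v))"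
      by (simp add: sum_distrib_left sum.distrib[symmetric] distrib_right)
    also have "\<dots> \<le> (2 * p + 4 * (2 * C / K)) * (2 * C)"
    proof (intro mult_left_mono)
      have "(\<Sum>v\<in>R. D v) \<le> (\<Sum>v\<in>{1..n}. D v)" using D0 by (intro sum_mono2) (auto simp: R_def)
      also have "\<dots> = 2 * real (card E)" unfolding D_def by (rule sum_degrees[OF g])
      finally have "p\<^sup>2 * (\<Sum>v\<in>R. D v) \<le> p\<^sup>2 * (2 * real (card E))" by (intro mult_left_mono) auto
      then show "p\<^sup>2 * (\<Sum>v\<in>R. D v) \<le> 2 * C" by (simp add: C_def mult_ac)
      show "0 \<le> 2 * p + 4 * (2 * C / K)" using p K by (simp add: C_def)
    qed
    also have "\<dots> = 4 * p * C + 16 * C\<^sup>2 / K" by (simp add: algebra_simps power2_eq_square)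
    finally show ?thesis .
  qed
  have a01: "0 \<le> adj E u v \<and> adj E u v \<le> 1 \<and> adj E u v = adj E v u \<and> adj E u u = 0" for u v
    using gD(3)[of u u] by (auto simp: adj_def insert_commute)
  have th01: "0 \<le> exp (- s2 * x) \<and> exp (- s2 * x) \<le> 1" if "x \<ge> 0" for x using that s by simp
  have Cst: "\<bar>bern H p ?P - bern H p ?P1\<bar>
     \<le> p * (\<Sum>u\<in>H. min 1 \<bar>p * real (nb E R u) - \<eta> u\<bar>)"
  proof -
    have "\<bar>bern H p ?P - bern H p ?P1\<bar>
      \<le> p * (\<Sum>u\<in>H. \<bar>exp (- s2 * (p * real (nb E R u))) - exp (- s2 * \<eta> u)\<bar>)"
      using a01 th01 \<eta> p' by (intro bern_Psi_theta[OF HR(1) p' s(1,2)]) auto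
    \<comment> \<open>The exponentials are Lipschitz in the degree and also confined to [0, 1]. The
      cap at 1 matters, because the degrees will converge only in the capped distance.\<close>
    also have "\<dots> \<le> p * (\<Sum>u\<in>H. min 1 \<bar>p * real (nb E R u) - \<eta> u\<bar>)"
    proof (intro mult_left_mono sum_mono)
      fix u
      define x where "x = p * real (nb E R u)"
      have x: "x \<ge> 0" using p' by (simp add: x_def)
      have "\<bar>exp (- s2 * x) - exp (- s2 * \<eta> u)\<bar> \<le> \<bar>- s2 * x - (- s2 * \<eta> u)\<bar>"
        using s x \<eta>[of u] by (intro exp_lipschitz) auto
      also have "- s2 * x - (- s2 * \<eta> u) = - s2 * (x - \<eta> u)" by (simp add: algebra_simps)
      also have "\<bar>- s2 * (x - \<eta> u)\<bar> \<le> 1 * \<bar>x - \<eta> u\<bar>"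
        using s unfolding abs_mult by (intro mult_right_mono) auto
      finally have "\<bar>exp (- s2 * x) - exp (- s2 * \<eta> u)\<bar> \<le> \<bar>x - \<eta> u\<bar>" by simp
      moreover have "\<bar>exp (- s2 * x) - exp (- s2 * \<eta> u)\<bar> \<le> 1" using th01[OF x] th01[OF \<eta>[of u]] by (intro abs_leI) linarith+
      ultimately show "\<bar>exp (- s2 * (p * real (nb E R u))) - exp (- s2 * \<eta> u)\<bar> \<le> min 1 \<bar>p * real (nb E R u) - \<eta> u\<bar>"
        by (simp add: x_def)
    qed (use p' in auto)
    finally show ?thesis .
  qed
  have Dst: "\<bar>bern H p (Psi s1 w ?T) - bern H p ?P1\<bar> \<le> \<kappa> + 2 * p ^ 3 * (real (card H))\<^sup>2"
  proof (rule bern_Psi_cut[OF HR(1) p' s(1,2)])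
    fix f :: "nat \<Rightarrow> real" assume f: "\<And>u. u \<in> H \<Longrightarrow> 0 \<le> f u \<and> f u \<le> 1"
    define f' where "f' u = (if u \<in> H then f u else 0)" for u
    have "(\<Sum>u\<in>H. \<Sum>v\<in>H. (w u v - adj E u v) * f u * f v) = (\<Sum>u\<in>H. \<Sum>v\<in>H. (w u v - adj E u v) * f' u * f' v)"
      by (intro sum.cong refl) (simp add: f'_def)
    then show "\<bar>p\<^sup>2 * (\<Sum>u\<in>H. \<Sum>v\<in>H. (w u v - adj E u v) * f u * f v)\<bar> \<le> \<kappa>"
      using cut[of f'] f by (auto simp: f'_def H_def N_def)
  qed (use a01 w th01 \<eta> in blast)+
  have e1: "0 \<le> exp (- (s3 * lam))" "exp (- (s3 * lam)) \<le> 1" using s p by (auto simp: lam_def)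
  have "\<bar>bern {1..n} p F - exp (- (s3 * lam)) * bern H p (Psi s1 w ?T)\<bar>
    \<le> \<bar>bern {1..n} p F - exp (- (s3 * lam)) * bern H p ?P\<bar>
     + \<bar>exp (- (s3 * lam)) * (bern H p ?P - bern H p ?P1)\<bar>
     + \<bar>exp (- (s3 * lam)) * (bern H p (Psi s1 w ?T) - bern H p ?P1)\<bar>"
    unfolding right_diff_distrib by linarith
  also have "\<dots> \<le> (4 * p * C + 16 * C\<^sup>2 / K) + p * (\<Sum>u\<in>H. min 1 \<bar>p * real (nb E R u) - \<eta> u\<bar>) + (\<kappa> + 2 * p ^ 3 * (real (card H))\<^sup>2)"
  proof (intro add_mono)
    have m: "\<bar>exp (- (s3 * lam)) * x\<bar> \<le> y" if "\<bar>x\<bar> \<le> y" for x y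
    proof -
      have "\<bar>exp (- (s3 * lam)) * x\<bar> = exp (- (s3 * lam)) * \<bar>x\<bar>" by (simp add: abs_mult)
      also have "\<dots> \<le> 1 * \<bar>x\<bar>" using e1 by (intro mult_right_mono) auto
      finally show ?thesis using that by simp
    qed
    show "\<bar>exp (- (s3 * lam)) * (bern H p ?P - bern H p ?P1)\<bar>
       \<le> p * (\<Sum>u\<in>H. min 1 \<bar>p * real (nb E R u) - \<eta> u\<bar>)" by (rule m[OF Cst])
    show "\<bar>exp (- (s3 * lam)) * (bern H p (Psi s1 w ?T) - bern H p ?P1)\<bar>
       \<le> \<kappa> + 2 * p ^ 3 * (real (card H))\<^sup>2" by (rule m[OF Dst])
    show "\<bar>bern {1..n} p F - exp (- (s3 * lam)) * bern H p ?P\<bar> \<le> 4 * p * C + 16 * C\<^sup>2 / K"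
      using A B by (rule order_trans)
  qed
  finally show ?thesis unfolding F_def lam_def H_def R_def by simp
qed

section \<open>Graph kernels as functions on the half line\<close>

text \<open>\<open>cl r x\<close> is the vertex that a graph kernel assigns to \<open>x > 0\<close>, and \<open>cellI r u\<close> is the set of points assigned to \<open>u \<ge> 1\<close>.\<close>

definition cl :: "real \<Rightarrow> real \<Rightarrow> nat" where
  "cl r x = nat \<lceil>x * r\<rceil>"

definition cellI :: "real \<Rightarrow> nat \<Rightarrow> real set" where
  "cellI r u = {(real u - 1) / r<..real u / r}"

lemma cl_iff:
  assumes "r > 0" "u \<ge> 1" shows "cl r x = u \<longleftrightarrow> x \<in> cellI r u"
proof -
  have "cl r x = u \<longleftrightarrow> \<lceil>x * r\<rceil> = int u" using assms(2) by (auto simp: cl_def)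
  also have "\<dots> \<longleftrightarrow> real u - 1 < x * r \<and> x * r \<le> real u" by (simp add: ceiling_eq_iff)
  also have "\<dots> \<longleftrightarrow> x \<in> cellI r u" using assms(1) by (simp add: cellI_def pos_divide_less_eq pos_le_divide_eq)
  finally show ?thesis .
qed

lemma cl_pos: "r > 0 \<Longrightarrow> cl r x \<ge> 1 \<longleftrightarrow> x > 0"
  by (auto simp: cl_def zero_less_mult_iff Suc_le_eq)

lemma cl_le: "r > 0 \<Longrightarrow> cl r x \<le> N \<longleftrightarrow> x \<le> real N / r"
  by (simp add: cl_def nat_le_iff ceiling_le_iff pos_le_divide_eq)

lemma measurable_cl [measurable]: "cl r \<in> measurable borel (count_space UNIV)"
  unfolding cl_def[abs_def] by measurable

lemma cellI_sets [measurable]: "cellI r u \<in> sets borel" by (simp add: cellI_def)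

lemma emeasure_cellI: "r > 0 \<Longrightarrow> emeasure lborel (cellI r u) = ennreal (1 / r)"
proof -
  assume r: "r > 0"
  have "(real u - 1) / r \<le> real u / r" using r by (intro divide_right_mono) auto
  then have "emeasure lborel (cellI r u) = ennreal (real u / r - (real u - 1) / r)" by (simp add: cellI_def)
  also have "real u / r - (real u - 1) / r = 1 / r" by (simp add: diff_divide_distrib)
  finally show ?thesis .
qed

lemma cl_expand:
  fixes h :: "nat \<Rightarrow> real"
  assumes "r > 0" "\<And>u. u \<notin> {1..N} \<Longrightarrow> h u = 0"
  shows "h (cl r y) = (\<Sum>v\<in>{1..N}. h v * indicator (cellI r v) y)"
proof -
  have "(\<Sum>v\<in>{1..N}. h v * indicator (cellI r v) y) = (\<Sum>v\<in>{1..N}. if v = cl r y then h v else 0)"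
  proof (rule sum.cong[OF refl])
    fix v assume "v \<in> {1..N}"
    then have "v = cl r y \<longleftrightarrow> y \<in> cellI r v" using cl_iff[OF assms(1), of v y] by auto
    then show "h v * indicator (cellI r v) y = (if v = cl r y then h v else 0)" by (simp add: indicator_def)
  qed
  also have "\<dots> = h (cl r y)" using assms(2)[of "cl r y"] by (auto simp: sum.delta)
  finally show ?thesis by simp
qed

lemma integral_cl:
  fixes h :: "nat \<Rightarrow> real"
  assumes r: "r > 0" and h: "\<And>u. u \<notin> {1..N} \<Longrightarrow> h u = 0" and A: "A \<in> sets borel"
  shows "set_integrable lborel A (\<lambda>y. h (cl r y))"
    and "(LINT y:A|lborel. h (cl r y)) = (\<Sum>v\<in>{1..N}. h v * measure lborel (A \<inter> cellI r v))"
proof -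
  have fin: "emeasure lborel (A \<inter> cellI r v) < \<infinity>" for v
  proof -
    have "emeasure lborel (A \<inter> cellI r v) \<le> emeasure lborel (cellI r v)" by (intro emeasure_mono) auto
    then show ?thesis using emeasure_cellI[OF r, of v] by (auto simp: top_unique less_top[symmetric])
  qed
  have eq: "indicator A y *\<^sub>R h (cl r y) = (\<Sum>v\<in>{1..N}. h v * indicator (A \<inter> cellI r v) y)" for y
  proof -
    have "h (cl r y) = (\<Sum>v\<in>{1..N}. h v * indicator (cellI r v) y)" by (rule cl_expand[OF r h])
    then have "indicator A y *\<^sub>R h (cl r y) = indicator A y * (\<Sum>v\<in>{1..N}. h v * indicator (cellI r v) y)" by (simp only: real_scaleR_def)
    also have "\<dots> = (\<Sum>v\<in>{1..N}. h v * indicator (A \<inter> cellI r v) y)"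
      unfolding sum_distrib_left indicator_inter_arith by (intro sum.cong refl) (simp only: mult_ac)
    finally show ?thesis .
  qed
  have int: "integrable lborel (\<lambda>y. h v * indicator (A \<inter> cellI r v) y)" for v
    using fin[of v] A by (intro integrable_mult_right integrable_real_indicator) auto
  show "set_integrable lborel A (\<lambda>y. h (cl r y))"
    unfolding set_integrable_def eq by (intro Bochner_Integration.integrable_sum int)
  have "(LINT y:A|lborel. h (cl r y)) = (\<Sum>v\<in>{1..N}. LINT y|lborel. h v * indicator (A \<inter> cellI r v) y)"
    unfolding set_lebesgue_integral_def eq by (intro Bochner_Integration.integral_sum int)
  then show "(LINT y:A|lborel. h (cl r y)) = (\<Sum>v\<in>{1..N}. h v * measure lborel (A \<inter> cellI r v))"
    by simp
qed

lemma nn_integral_cl: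
  fixes h :: "nat \<Rightarrow> real"
  assumes r: "r > 0" and h: "\<And>u. u \<notin> {1..N} \<Longrightarrow> h u = 0" "\<And>u. h u \<ge> 0"
  shows "(\<integral>\<^sup>+y. ennreal (h (cl r y)) \<partial>lborel) = ennreal (1 / r * (\<Sum>v\<in>{1..N}. h v))"
proof -
  have i: "integrable lborel (\<lambda>y. h (cl r y))" and e: "(LINT y|lborel. h (cl r y)) = (\<Sum>v\<in>{1..N}. h v * measure lborel (cellI r v))"
    using integral_cl[where h = h and N = N and A = UNIV, OF r h(1)] by (simp_all add: set_integrable_def set_lebesgue_integral_def)
  have m: "measure lborel (cellI r v) = 1 / r" for v using emeasure_cellI[OF r, of v] r by (simp add: measure_def)
  have "(\<integral>\<^sup>+y. ennreal (h (cl r y)) \<partial>lborel) = ennreal (LINT y|lborel. h (cl r y))"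
    using i h(2) by (intro nn_integral_eq_integral) auto
  also have "(LINT y|lborel. h (cl r y)) = 1 / r * (\<Sum>v\<in>{1..N}. h v)"
    unfolding e m by (simp add: sum_distrib_left mult.commute)
  finally show ?thesis .
qed

lemma integral_cl2:
  fixes h :: "nat \<Rightarrow> nat \<Rightarrow> real"
  assumes r: "r > 0" and h: "\<And>u v. u \<notin> {1..N} \<or> v \<notin> {1..N} \<Longrightarrow> h u v = 0"
  shows "integrable lborel (\<lambda>z. h (cl r (fst z)) (cl r (snd z)))"
    and "(LINT z|lborel. h (cl r (fst z)) (cl r (snd z))) = (1 / r)\<^sup>2 * (\<Sum>u\<in>{1..N}. \<Sum>v\<in>{1..N}. h u v)"
proof -
  have eq: "h (cl r (fst z)) (cl r (snd z)) = (\<Sum>u\<in>{1..N}. \<Sum>v\<in>{1..N}. h u v * indicator (cellI r u \<times> cellI r v) z)" for z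
  proof -
    have "h (cl r (fst z)) (cl r (snd z)) = (\<Sum>u\<in>{1..N}. h u (cl r (snd z)) * indicator (cellI r u) (fst z))"
      by (rule cl_expand[OF r, of N "\<lambda>u. h u (cl r (snd z))"]) (use h in auto)
    also have "\<dots> = (\<Sum>u\<in>{1..N}. (\<Sum>v\<in>{1..N}. h u v * indicator (cellI r v) (snd z)) * indicator (cellI r u) (fst z))"
      by (intro sum.cong refl arg_cong2[where f = "(*)"] cl_expand[OF r]) (use h in auto)
    also have "\<dots> = (\<Sum>u\<in>{1..N}. \<Sum>v\<in>{1..N}. h u v * indicator (cellI r u \<times> cellI r v) z)"
      unfolding sum_distrib_right by (intro sum.cong refl) (cases z, auto simp: indicator_def)
    finally show ?thesis .
  qed
  have em: "emeasure lborel (cellI r u \<times> cellI r v) = ennreal ((1 / r)\<^sup>2)" for u v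
  proof -
    have "emeasure (lborel \<Otimes>\<^sub>M lborel) (cellI r u \<times> cellI r v) = emeasure lborel (cellI r u) * emeasure lborel (cellI r v)"
      by (intro lborel.emeasure_pair_measure_Times) auto
    then show ?thesis using r by (simp add: lborel_prod emeasure_cellI ennreal_mult[symmetric] power2_eq_square)
  qed
  have s: "cellI r u \<times> cellI r v \<in> sets lborel" for u v
  proof -
    have "cellI r u \<times> cellI r v \<in> sets (borel \<Otimes>\<^sub>M borel)" by (intro pair_measureI) auto
    then show ?thesis unfolding borel_prod by (simp only: sets_lborel)
  qed
  have int: "integrable lborel (\<lambda>z. h u v * indicator (cellI r u \<times> cellI r v) z)" for u v
    using s em by (intro integrable_mult_right integrable_real_indicator) auto
  show "integrable lborel (\<lambda>z. h (cl r (fst z)) (cl r (snd z)))"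
    unfolding eq by (intro Bochner_Integration.integrable_sum int)
  have "(LINT z|lborel. h (cl r (fst z)) (cl r (snd z))) = (\<Sum>u\<in>{1..N}. \<Sum>v\<in>{1..N}. LINT z|lborel. h u v * indicator (cellI r u \<times> cellI r v) z)"
  proof -
    have "(LINT z|lborel. h (cl r (fst z)) (cl r (snd z))) = (\<Sum>u\<in>{1..N}. LINT z|lborel. (\<Sum>v\<in>{1..N}. h u v * indicator (cellI r u \<times> cellI r v) z))"
      unfolding eq by (intro Bochner_Integration.integral_sum Bochner_Integration.integrable_sum int)
    also have "\<dots> = (\<Sum>u\<in>{1..N}. \<Sum>v\<in>{1..N}. LINT z|lborel. h u v * indicator (cellI r u \<times> cellI r v) z)"
      by (rule sum.cong[OF refl], rule Bochner_Integration.integral_sum, rule int)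
    finally show ?thesis .
  qed
  also have "\<dots> = (1 / r)\<^sup>2 * (\<Sum>u\<in>{1..N}. \<Sum>v\<in>{1..N}. h u v)"
    using s em r by (simp add: measure_def sum_distrib_left sum_distrib_right mult.commute)
  finally show "(LINT z|lborel. h (cl r (fst z)) (cl r (snd z))) = (1 / r)\<^sup>2 * (\<Sum>u\<in>{1..N}. \<Sum>v\<in>{1..N}. h u v)" .
qed

abbreviation sqr :: "real \<Rightarrow> (real \<times> real) set" where
  "sqr K \<equiv> {0..K} \<times> {0..K}"

lemma box_sets [measurable]: "sqr K \<in> sets borel"
  by (intro borel_closed closed_Times) auto

lemma emeasure_box: "K \<ge> 0 \<Longrightarrow> emeasure lborel (sqr K) = ennreal (K\<^sup>2)"
proof -
  assume K: "K \<ge> 0"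
  have "emeasure (lborel \<Otimes>\<^sub>M lborel) (sqr K) = emeasure lborel {0..K} * emeasure lborel {0..K}"
    by (intro lborel.emeasure_pair_measure_Times) auto
  then show ?thesis using K by (simp add: lborel_prod ennreal_mult[symmetric] power2_eq_square)
qed

text \<open>A supremum of reals bounds its members only if the set is bounded above; here the area
  \<open>K\<^sup>2\<close> is a bound.\<close>

lemma cut_dist_upper:
  assumes K: "K \<ge> 0" and W: "\<And>z. z \<in> sqr K \<Longrightarrow> \<bar>W1 (fst z) (snd z) - W2 (fst z) (snd z)\<bar> \<le> 1"
    and f: "f \<in> borel_measurable borel" "\<And>x. \<bar>f x\<bar> \<le> 1" and g: "g \<in> borel_measurable borel" "\<And>x. \<bar>g x\<bar> \<le> 1"
  shows "\<bar>LINT z:sqr K|lborel. (W1 (fst z) (snd z) - W2 (fst z) (snd z)) * f (fst z) * g (snd z)\<bar> \<le> cut_dist K W1 W2"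
  unfolding cut_dist_def
proof (rule cSup_upper)
  let ?d = "\<lambda>z. W1 (fst z) (snd z) - W2 (fst z) (snd z)"
  let ?S = "{\<bar>LINT z:sqr K|lborel. ?d z * f (fst z) * g (snd z)\<bar> | f g.
          f \<in> borel_measurable (restrict_space borel {0..K}) \<and> f ` {0..K} \<subseteq> {-1..1} \<and>
          g \<in> borel_measurable (restrict_space borel {0..K}) \<and> g ` {0..K} \<subseteq> {-1..1}}"
  have "f ` {0..K} \<subseteq> {-1..1}" "g ` {0..K} \<subseteq> {-1..1}" using f(2) g(2) by (auto simp: abs_le_iff image_subset_iff)
  then show "\<bar>LINT z:sqr K|lborel. ?d z * f (fst z) * g (snd z)\<bar> \<in> ?S"
    using f(1) g(1) measurable_restrict_space1 by blast
  have bd: "\<bar>LINT z:sqr K|lborel. ?d z * f (fst z) * g (snd z)\<bar> \<le> K\<^sup>2"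
    if "f ` {0..K} \<subseteq> {-1..1}" "g ` {0..K} \<subseteq> {-1..1}" for f g
  proof -
    let ?h = "\<lambda>z. indicator (sqr K) z *\<^sub>R (?d z * f (fst z) * g (snd z))"
    have b: "norm (?h z) \<le> indicator (sqr K) z" for z
    proof (cases "z \<in> sqr K")
      case True
      then have "fst z \<in> {0..K}" "snd z \<in> {0..K}" by auto
      then have "f (fst z) \<in> {-1..1}" "g (snd z) \<in> {-1..1}" using that by blast+
      then have "\<bar>f (fst z)\<bar> \<le> 1" "\<bar>g (snd z)\<bar> \<le> 1" by auto
      then show ?thesis using True W[OF True] by (auto simp: abs_mult intro!: mult_le_one)
    qed auto
    have ib: "integrable lborel (indicator (sqr K) :: real \<times> real \<Rightarrow> real)"
      using emeasure_box[OF K] by (intro integrable_real_indicator) auto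
    show ?thesis
    proof (cases "integrable lborel ?h")
      case True
      have "norm (integral\<^sup>L lborel ?h) \<le> integral\<^sup>L lborel (indicator (sqr K) :: real \<times> real \<Rightarrow> real)"
      proof (rule order_trans[OF integral_norm_bound])
        show "(LINT z|lborel. norm (?h z)) \<le> integral\<^sup>L lborel (indicator (sqr K) :: real \<times> real \<Rightarrow> real)"
          by (rule integral_mono[OF integrable_norm[OF True] ib b])
      qed
      also have "\<dots> = K\<^sup>2" using emeasure_box[OF K] by (simp add: measure_def)
      finally show ?thesis by (simp add: set_lebesgue_integral_def)
    next
      \<comment> \<open>The integral of a non-integrable function is 0 by convention, so such
        members of the set are bounded as well.\<close>
      case False
      then show ?thesis by (simp add: set_lebesgue_integral_def not_integrable_integral_eq)
    qed
  qed
  show "bdd_above ?S" by (rule bdd_aboveI[of _ "K\<^sup>2"]) (use bd in blast)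
qed

text \<open>Beyond \<open>n / r\<close> the ceiling exceeds \<open>n\<close>, and at 0 it is 0;
  neither is a vertex. So the case distinction in the kernel is automatic, and its value depends on
  the two labels alone.\<close>

lemma graph_kernel_cl:
  assumes g: "simple_graph n E" and r: "r > 0" and x: "x \<ge> 0" "y \<ge> 0"
  shows "graph_kernel n r E x y = adj E (cl r x) (cl r y)"
proof (cases "x \<le> real n / r \<and> y \<le> real n / r")
  case True
  then show ?thesis using x by (simp add: graph_kernel_def cl_def)
next
  case False
  then have "\<not> (cl r x \<le> n \<and> cl r y \<le> n)" using cl_le[OF r] by simp
  then have "{cl r x, cl r y} \<notin> E" using g by (auto simp: simple_graph_def)
  then show ?thesis using False by (auto simp: graph_kernel_def adj_def)
qed

lemma adj_bounds: "0 \<le> adj E u v" "adj E u v \<le> 1" by (auto simp: adj_def)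

lemma adj_outside: "simple_graph n E \<Longrightarrow> u \<notin> {1..n} \<or> v \<notin> {1..n} \<Longrightarrow> adj E u v = 0"
  by (auto simp: adj_def simple_graph_def)

section \<open>Limits along the graph sequence\<close>

locale graph_seq =
  fixes p r :: "nat \<Rightarrow> real" and E :: "nat \<Rightarrow> nat set set"
    and W :: "real \<Rightarrow> real \<Rightarrow> real" and d :: "real \<Rightarrow> real" and lam0 :: real
  assumes p_pos: "\<And>n. n \<ge> 1 \<Longrightarrow> p n > 0" and p_le1: "\<And>n. n \<ge> 1 \<Longrightarrow> p n \<le> 1"
    and p_lim: "p \<longlonglongrightarrow> 0"
    and r_eq: "\<And>n. n \<ge> 1 \<Longrightarrow> r n = 1 / p n"
    and graph: "\<And>n. n \<ge> 1 \<Longrightarrow> simple_graph n (E n)"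
    and edges: "(\<lambda>n. real (card (E n)) * (p n)\<^sup>2) \<in> \<Theta>(\<lambda>_. 1)"
    and labels: "\<And>n. n \<ge> 1 \<Longrightarrow> degree_ordered n (E n)"
    and a: "has_double_lim (\<lambda>n K. 1 / 2 *
      (LINT x:{K..}|lborel. LINT y:{K..}|lborel. graph_kernel n (r n) (E n) x y)) lam0"
    and W: "graphon W"
    and b: "\<forall>\<^sub>F K in at_top. (\<lambda>n. cut_dist K (graph_kernel n (r n) (E n)) W) \<longlonglongrightarrow> 0"
    and d_nonneg: "\<And>x. x \<ge> 0 \<Longrightarrow> d x \<ge> 0"
    and d_L1: "set_integrable lborel {0..} d"
    and c: "\<exists>C>0. \<forall>K\<ge>C. \<forall>B\<ge>C. (\<lambda>n. LINT x:{0..K}|lborel.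
      \<bar>kernel_degree (graph_kernel n (r n) (E n)) x *
          of_bool (kernel_degree (graph_kernel n (r n) (E n)) x \<le> B)
        - d x * of_bool (d x \<le> B)\<bar>) \<longlonglongrightarrow> 0"
begin

section \<open>Rescaled adjacency, degrees and their integrals\<close>

abbreviation gk :: "nat \<Rightarrow> real \<Rightarrow> real \<Rightarrow> real" where
  "gk n \<equiv> graph_kernel n (r n) (E n)"

definition wn :: "nat \<Rightarrow> real \<times> real \<Rightarrow> real" where
  "wn n z = adj (E n) (cl (r n) (fst z)) (cl (r n) (snd z))"

definition dn :: "nat \<Rightarrow> real \<Rightarrow> real" where
  "dn n x = p n * real (nb (E n) {1..n} (cl (r n) x))"

definition W0 :: "real \<times> real \<Rightarrow> real" where "W0 = ext2 W"
definition d0 :: "real \<Rightarrow> real" where "d0 = ext1 d"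

lemma r_pos: "n \<ge> 1 \<Longrightarrow> r n > 0" and p_r: "n \<ge> 1 \<Longrightarrow> 1 / r n = p n"
  using p_pos[of n] r_eq[of n] by auto

lemma W0: "W0 \<in> borel_measurable borel" "0 \<le> W0 z" "W0 z \<le> 1"
  using ext2_graphon(1,2)[OF W] by (auto simp: W0_def)

lemma W0_measurable [measurable]: "W0 \<in> borel_measurable borel" by (rule W0(1))

lemma wn_bounds: "0 \<le> wn n z" "wn n z \<le> 1" by (simp_all add: wn_def adj_bounds)

lemma measurable_cl_pair: "(\<lambda>z::real \<times> real. F (cl q (fst z)) (cl q (snd z)) :: real) \<in> borel_measurable borel"
proof -
  have "(\<lambda>z::real \<times> real. (cl q (fst z), cl q (snd z))) \<in> measurable borel (count_space UNIV \<Otimes>\<^sub>M count_space UNIV)"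
    by (intro measurable_Pair measurable_compose[OF _ measurable_cl]) (auto simp: borel_prod[symmetric])
  then have "(\<lambda>z::real \<times> real. (cl q (fst z), cl q (snd z))) \<in> measurable borel (count_space UNIV)"
    by (simp add: pair_measure_countable)
  then show ?thesis
    using measurable_compose[of "\<lambda>z::real \<times> real. (cl q (fst z), cl q (snd z))" borel "count_space UNIV" "\<lambda>(a, b). F a b" borel] by simp
qed

lemma wn_measurable [measurable]: "wn n \<in> borel_measurable borel"
  unfolding wn_def[abs_def] by (rule measurable_cl_pair)

lemma dn_measurable [measurable]: "dn n \<in> borel_measurable borel"
  unfolding dn_def[abs_def] using measurable_compose[OF measurable_cl, of "\<lambda>u. p n * real (nb (E n) {1..n} u)" borel "r n"] by simp

lemma dn_nonneg: "n \<ge> 1 \<Longrightarrow> dn n x \<ge> 0" using p_pos[of n] by (simp add: dn_def)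

lemma gk_wn: "n \<ge> 1 \<Longrightarrow> x \<ge> 0 \<Longrightarrow> y \<ge> 0 \<Longrightarrow> gk n x y = wn n (x, y)"
  using graph_kernel_cl[OF graph r_pos] by (simp add: wn_def)

lemma edge_bound: obtains C where "C > 0" "\<forall>\<^sub>F n in sequentially. real (card (E n)) * (p n)\<^sup>2 \<le> C"
proof -
  have "(\<lambda>n. real (card (E n)) * (p n)\<^sup>2) \<in> O(\<lambda>_. 1)" using edges by (rule bigthetaD1)
  then obtain C where "C > 0" "\<forall>\<^sub>F n in sequentially. norm (real (card (E n)) * (p n)\<^sup>2) \<le> C * norm (1::real)"
    by (rule landau_o.bigE)
  then show ?thesis using that[of C] by (auto elim: eventually_mono)
qed

lemma wn_slice:
  assumes n: "n \<ge> 1" and A: "A \<in> sets borel"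
  shows "set_integrable lborel A (\<lambda>y. wn n (x, y))"
    and "(LINT y:A|lborel. wn n (x, y)) = (\<Sum>v\<in>{1..n}. adj (E n) (cl (r n) x) v * measure lborel (A \<inter> cellI (r n) v))"
  unfolding wn_def fst_conv snd_conv
  by (rule integral_cl[OF r_pos[OF n] _ A]; use adj_outside[OF graph[OF n]] in auto)+

lemma measure_cellI: "n \<ge> 1 \<Longrightarrow> measure lborel (cellI (r n) v) = p n"
  using emeasure_cellI[OF r_pos[of n], of v] p_r[of n] p_pos[of n] by (simp add: measure_def)

lemma cellI_p: "n \<ge> 1 \<Longrightarrow> cellI (r n) v = {(real v - 1) * p n<..real v * p n}"
  using p_pos[of n] r_eq[of n] by (simp add: cellI_def)

lemma measure_part_cellI:
  assumes n: "n \<ge> 1" and A: "A \<in> sets borel"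
  shows "0 \<le> measure lborel (A \<inter> cellI (r n) v)" "measure lborel (A \<inter> cellI (r n) v) \<le> p n"
proof -
  have "measure lborel (A \<inter> cellI (r n) v) \<le> measure lborel (cellI (r n) v)"
    using emeasure_cellI[OF r_pos[OF n], of v] A by (intro measure_mono_fmeasurable) (auto simp: fmeasurable_def)
  then show "measure lborel (A \<inter> cellI (r n) v) \<le> p n" by (simp add: measure_cellI[OF n])
qed simp

lemma wn_slice_full:
  assumes n: "n \<ge> 1" and A: "A \<in> sets borel" "\<And>v. v \<in> {1..n} \<Longrightarrow> cellI (r n) v \<subseteq> A"
  shows "(LINT y:A|lborel. wn n (x, y)) = dn n x"
proof -
  have "(LINT y:A|lborel. wn n (x, y)) = (\<Sum>v\<in>{1..n}. adj (E n) (cl (r n) x) v * p n)"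
    unfolding wn_slice(2)[OF n A(1)] using A(2) by (intro sum.cong refl) (simp add: Int_absorb1 measure_cellI[OF n])
  also have "(\<Sum>v\<in>{1..n}. adj (E n) (cl (r n) x) v) = real (nb (E n) {1..n} (cl (r n) x))"
    by (simp add: nb_def adj_def insert_commute sum.If_cases Int_def)
  then have "(\<Sum>v\<in>{1..n}. adj (E n) (cl (r n) x) v * p n) = dn n x"
    by (simp only: sum_distrib_right[symmetric]) (simp add: dn_def)
  finally show ?thesis .
qed

lemma cellI_nonneg: "n \<ge> 1 \<Longrightarrow> v \<ge> 1 \<Longrightarrow> cellI (r n) v \<subseteq> {0<..}"
proof
  fix x assume n: "n \<ge> 1" "v \<ge> 1" and x: "x \<in> cellI (r n) v"
  have "0 \<le> (real v - 1) / r n" using n r_pos[of n] by simp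
  then show "x \<in> {0<..}" using x by (auto simp: cellI_def)
qed

lemma kernel_degree_gk: "n \<ge> 1 \<Longrightarrow> x \<ge> 0 \<Longrightarrow> kernel_degree (gk n) x = dn n x"
proof -
  assume n: "n \<ge> 1" and x: "x \<ge> 0"
  have "kernel_degree (gk n) x = (LINT y:{0..}|lborel. wn n (x, y))"
    unfolding kernel_degree_def using gk_wn[OF n x] by (intro set_lebesgue_integral_cong) auto
  also have "\<dots> = dn n x"
    by (rule wn_slice_full[OF n]) (use cellI_nonneg[OF n] in force)+
  finally show ?thesis .
qed

lemma nn_integral_dn: "n \<ge> 1 \<Longrightarrow> (\<integral>\<^sup>+x. ennreal (dn n x) \<partial>lborel) = ennreal (2 * (real (card (E n)) * (p n)\<^sup>2))"
proof -
  assume n: "n \<ge> 1"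
  have z: "p n * real (nb (E n) {1..n} u) = 0" if "u \<notin> {1..n}" for u
  proof -
    have "{v \<in> {1..n}. {v, u} \<in> E n} = {}" using simple_graphD(3)[OF graph[OF n], of _ u] that by auto
    then show ?thesis by (simp only: nb_def card.empty)
  qed
  have "(\<integral>\<^sup>+x. ennreal (dn n x) \<partial>lborel) = ennreal (1 / r n * (\<Sum>v\<in>{1..n}. p n * real (nb (E n) {1..n} v)))"
    unfolding dn_def by (rule nn_integral_cl[OF r_pos[OF n] z]) (use p_pos[OF n] in auto)
  also have "1 / r n * (\<Sum>v\<in>{1..n}. p n * real (nb (E n) {1..n} v)) = 2 * (real (card (E n)) * (p n)\<^sup>2)"
    unfolding p_r[OF n] sum_distrib_left[symmetric] sum_degrees[OF graph[OF n]] by (simp add: power2_eq_square)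
  finally show ?thesis .
qed

lemma integral_wn: "n \<ge> 1 \<Longrightarrow> integrable lborel (wn n) \<and> (LINT z|lborel. wn n z) = 2 * (real (card (E n)) * (p n)\<^sup>2)"
proof -
  assume n: "n \<ge> 1"
  note i = integral_cl2[OF r_pos[OF n], of n "adj (E n)", OF adj_outside[OF graph[OF n]]]
  note sum_adj[OF graph[OF n]]
  then show ?thesis
    using i p_r[OF n] unfolding wn_def[abs_def] by (simp add: power2_eq_square mult_ac)
qed

lemma integrable_on_sqr:
  assumes "f \<in> borel_measurable borel" "\<And>z. \<bar>f z\<bar> \<le> 1" "K \<ge> 0"
  shows "integrable lborel (\<lambda>z. indicator (sqr K) z * f z :: real)"
proof (rule Bochner_Integration.integrable_bound)
  show "integrable lborel (indicator (sqr K) :: real \<times> real \<Rightarrow> real)"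
    using emeasure_box[OF assms(3)] by (intro integrable_real_indicator) auto
qed (use assms(1,2) in \<open>auto simp: indicator_def\<close>)

lemma W_diff: "\<bar>wn n z - W0 z\<bar> \<le> 1"
  using wn_bounds[of n z] W0(2,3)[of z] by (simp add: abs_le_iff)

lemma cut_bound:
  assumes n: "n \<ge> 1" and K: "K \<ge> 0"
    and f: "f \<in> borel_measurable borel" "\<And>x. \<bar>f x\<bar> \<le> 1" and g: "g \<in> borel_measurable borel" "\<And>x. \<bar>g x\<bar> \<le> 1"
  shows "\<bar>LINT z|lborel. indicator (sqr K) z * ((wn n z - W0 z) * f (fst z) * g (snd z))\<bar> \<le> cut_dist K (gk n) W"
proof -
  have eq: "gk n (fst z) (snd z) - W (fst z) (snd z) = wn n z - W0 z" if "z \<in> sqr K" for z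
    using that gk_wn[OF n, of "fst z" "snd z"] by (auto simp: W0_def ext2_def)
  have "\<bar>LINT z:sqr K|lborel. (gk n (fst z) (snd z) - W (fst z) (snd z)) * f (fst z) * g (snd z)\<bar> \<le> cut_dist K (gk n) W"
    by (rule cut_dist_upper[OF K _ f g]) (simp only: eq W_diff)
  moreover have "(LINT z:sqr K|lborel. (gk n (fst z) (snd z) - W (fst z) (snd z)) * f (fst z) * g (snd z))
     = (LINT z|lborel. indicator (sqr K) z * ((wn n z - W0 z) * f (fst z) * g (snd z)))"
    unfolding set_lebesgue_integral_def
    by (intro Bochner_Integration.integral_cong refl) (simp add: indicator_def eq)
  ultimately show ?thesis by simp
qed

lemma cut_tendsto: "\<forall>\<^sub>F K in at_top. K > 0 \<and> (\<lambda>n. cut_dist K (gk n) W) \<longlonglongrightarrow> 0"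
  using b eventually_gt_at_top[of 0] by eventually_elim simp

text \<open>With constant test functions the cut norm compares the mass of \<open>W0\<close> in a
  square with that of the graph kernel, which is at most twice the rescaled number of edges and so
  bounded. Fatou's lemma lets the square grow.\<close>

lemma integrable_W0: "integrable lborel W0"
proof -
  obtain C where C: "C > 0" "\<forall>\<^sub>F n in sequentially. real (card (E n)) * (p n)\<^sup>2 \<le> C" by (rule edge_bound)
  have bound: "(\<integral>\<^sup>+z. ennreal (W0 z) * indicator (sqr K) z \<partial>lborel) \<le> ennreal (2 * C)"
    if K: "K > 0" "(\<lambda>n. cut_dist K (gk n) W) \<longlonglongrightarrow> 0" for K
  proof -
    have i1: "integrable lborel (\<lambda>z. indicator (sqr K) z * W0 z)" using W0 K by (intro integrable_on_sqr) auto
    have "(LINT z|lborel. indicator (sqr K) z * W0 z) \<le> 2 * C + 0"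
    proof (rule tendsto_lowerbound)
      show "(\<lambda>n. 2 * C + cut_dist K (gk n) W) \<longlonglongrightarrow> 2 * C + 0" by (intro tendsto_add tendsto_const K)
      show "\<forall>\<^sub>F n in sequentially. (LINT z|lborel. indicator (sqr K) z * W0 z) \<le> 2 * C + cut_dist K (gk n) W"
        using C(2) eventually_ge_at_top[of 1]
      proof eventually_elim
        case (elim n)
        have i2: "integrable lborel (\<lambda>z. indicator (sqr K) z * wn n z)" using wn_bounds K by (intro integrable_on_sqr) auto
        have "(LINT z|lborel. indicator (sqr K) z * wn n z) - (LINT z|lborel. indicator (sqr K) z * W0 z) = (LINT z|lborel. indicator (sqr K) z * ((wn n z - W0 z) * 1 * 1))"
          by (subst Bochner_Integration.integral_diff[OF i2 i1, symmetric]) (simp add: right_diff_distrib)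
        then have "(LINT z|lborel. indicator (sqr K) z * W0 z) - (LINT z|lborel. indicator (sqr K) z * wn n z) \<le> cut_dist K (gk n) W"
          using cut_bound[OF elim(2), of K "\<lambda>_. 1" "\<lambda>_. 1"] K by simp
        moreover have "(LINT z|lborel. indicator (sqr K) z * wn n z) \<le> (LINT z|lborel. wn n z)"
          using integral_wn[OF elim(2)] wn_bounds i2 by (intro integral_mono) (auto simp: indicator_def)
        ultimately show ?case using integral_wn[OF elim(2)] elim(1) by linarith
      qed
    qed simp
    moreover have "(\<integral>\<^sup>+z. ennreal (W0 z) * indicator (sqr K) z \<partial>lborel) = ennreal (LINT z|lborel. indicator (sqr K) z * W0 z)"
      using i1 W0(2) by (subst nn_integral_eq_integral[symmetric]) (auto intro!: nn_integral_cong simp: indicator_def)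
    ultimately show ?thesis by (simp add: ennreal_leI)
  qed
  have ev: "\<forall>\<^sub>F k in sequentially. (\<integral>\<^sup>+z. ennreal (W0 z) * indicator (sqr (real k)) z \<partial>lborel) \<le> ennreal (2 * C)"
    using filterlim_real_sequentially[THEN filterlim_compose[OF filterlim_ident], unfolded filterlim_iff, rule_format, OF cut_tendsto]
    by eventually_elim (use bound in auto)
  have "(\<integral>\<^sup>+z. ennreal (W0 z) \<partial>lborel) = (\<integral>\<^sup>+z. liminf (\<lambda>k. ennreal (W0 z) * indicator (sqr (real k)) z) \<partial>lborel)"
  proof (rule nn_integral_cong)
    fix z
    have "\<forall>\<^sub>F k in sequentially. ennreal (W0 z) * indicator (sqr (real k)) z = ennreal (W0 z)"
    proof (cases "fst z \<ge> 0 \<and> snd z \<ge> 0")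
      case True
      have "\<forall>\<^sub>F k in sequentially. fst z < real k" "\<forall>\<^sub>F k in sequentially. snd z < real k"
        using filterlim_real_sequentially by (auto simp: filterlim_at_top_dense)
      then show ?thesis by eventually_elim (use True in \<open>simp add: mem_Times_iff indicator_def\<close>)
    next
      case False
      then have "W0 z = 0" by (auto simp: W0_def ext2_def)
      then show ?thesis by simp
    qed
    then have "(\<lambda>k. ennreal (W0 z) * indicator (sqr (real k)) z) \<longlonglongrightarrow> ennreal (W0 z)" by (rule tendsto_eventually)
    then show "ennreal (W0 z) = liminf (\<lambda>k. ennreal (W0 z) * indicator (sqr (real k)) z)"
      by (rule lim_imp_Liminf[OF sequentially_bot, symmetric])
  qed
  also have "\<dots> \<le> liminf (\<lambda>k. \<integral>\<^sup>+z. ennreal (W0 z) * indicator (sqr (real k)) z \<partial>lborel)"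
    by (intro nn_integral_liminf) measurable
  also have "\<dots> \<le> ennreal (2 * C)"
    by (rule Liminf_le) (use ev in \<open>auto elim: eventually_frequently[rotated]\<close>)
  also have "\<dots> < \<infinity>" by simp
  finally show ?thesis using W0 by (intro integrableI_nonneg) auto
qed

section \<open>Capped L1 convergence of the degrees\<close>

lemma integrable_d0: "integrable lborel d0"
  using d_L1 unfolding set_integrable_def d0_def ext1_def
  by (rule Bochner_Integration.integrable_cong[THEN iffD1, rotated -1]) (auto simp: indicator_def)

lemma d0_measurable [measurable]: "d0 \<in> borel_measurable borel" using integrable_d0 by auto

lemma d0_nonneg: "d0 x \<ge> 0" using d_nonneg by (simp add: d0_def ext1_def)

text \<open>Hypothesis (c) controls truncated degrees only, and rescaled degrees may be unbounded.
  The distance is therefore capped at 1, which suffices because degrees enter through exponentials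
  with values in [0, 1].\<close>

definition T1 :: "real \<Rightarrow> nat \<Rightarrow> ennreal" where
  "T1 K n = (\<integral>\<^sup>+x. ennreal (min 1 \<bar>dn n x - d0 x\<bar>) * indicator {0..K} x \<partial>lborel)"

text \<open>If one of the numbers exceeds \<open>B\<close>, then \<open>x / B\<close> or
  \<open>y / B\<close> alone is at least 1; in integrated form this is Markov's inequality.\<close>

lemma truncation_bound:
  fixes x y B :: real
  assumes "x \<ge> 0" "y \<ge> 0" "B > 0"
  shows "min 1 \<bar>x - y\<bar> \<le> \<bar>x * of_bool (x \<le> B) - y * of_bool (y \<le> B)\<bar> + x / B + y / B"
proof (cases "x \<le> B \<and> y \<le> B")
  case True
  then show ?thesis using assms by (simp add: add_increasing2 min.coboundedI2)
next
  case False
  then have "1 \<le> x / B \<or> 1 \<le> y / B" using assms by auto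
  moreover have "0 \<le> x / B" "0 \<le> y / B" using assms by auto
  ultimately show ?thesis by (smt (verit))
qed

lemma T1_tendsto: "\<forall>\<^sub>F K in at_top. T1 K \<longlonglongrightarrow> 0"
proof -
  obtain C where C: "C > 0" "\<And>K B. K \<ge> C \<Longrightarrow> B \<ge> C \<Longrightarrow> (\<lambda>n. LINT x:{0..K}|lborel.
      \<bar>kernel_degree (gk n) x * of_bool (kernel_degree (gk n) x \<le> B) - d x * of_bool (d x \<le> B)\<bar>) \<longlonglongrightarrow> 0"
    using c by blast
  obtain CE where CE: "CE > 0" "\<forall>\<^sub>F n in sequentially. real (card (E n)) * (p n)\<^sup>2 \<le> CE" by (rule edge_bound)
  define D where "D = (LINT x|lborel. d0 x)"
  have D: "(\<integral>\<^sup>+x. ennreal (d0 x) \<partial>lborel) = ennreal D" "D \<ge> 0"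
    unfolding D_def using integrable_d0 d0_nonneg by (auto intro!: nn_integral_eq_integral integral_nonneg_AE)
  have "T1 K \<longlonglongrightarrow> 0" if K: "K \<ge> C" for K
  proof (rule order_tendstoI)
    fix e :: ennreal assume e: "0 < e"
    \<comment> \<open>The given bound may be infinite; a positive real below it is used
      instead.\<close>
    obtain e' where e': "e' > 0" "ennreal e' \<le> e"
    proof (cases e)
      case (real x)
      then show ?thesis using that[of x] e by auto
    next
      case top
      then show ?thesis using that[of 1] by simp
    qed
    \<comment> \<open>The truncation level at which the two Markov terms, with masses at most
      \<open>2 * CE\<close> and \<open>D\<close>, together fall below \<open>e' / 3\<close>.\<close>
    define B where "B = max C ((2 * CE + D) * 3 / e')"
    have B: "B \<ge> C" "B > 0" "(2 * CE + D) * 3 / e' \<le> B" using C(1) by (auto simp: B_def)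
    have BB: "(2 * CE + D) / B \<le> e' / 3"
    proof -
      have "(2 * CE + D) * 3 \<le> B * e'" using B(3) e'(1) by (simp add: pos_divide_le_eq)
      then show ?thesis using B(2) by (simp add: pos_divide_le_eq mult.commute)
    qed
    let ?tr = "\<lambda>n x. \<bar>dn n x * of_bool (dn n x \<le> B) - d0 x * of_bool (d0 x \<le> B)\<bar>"
    have "\<forall>\<^sub>F n in sequentially. (LINT x:{0..K}|lborel.
      \<bar>kernel_degree (gk n) x * of_bool (kernel_degree (gk n) x \<le> B) - d x * of_bool (d x \<le> B)\<bar>) < e' / 3"
      using order_tendstoD(2)[OF C(2)[OF K B(1)], of "e' / 3"] e'(1) by simp
    then show "\<forall>\<^sub>F n in sequentially. T1 K n < e"
      using CE(2) eventually_ge_at_top[of 1]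
    proof eventually_elim
      case (elim n)
      have trm: "?tr n \<in> borel_measurable borel" by measurable
      have trb: "?tr n x \<le> B" for x
        using dn_nonneg[OF elim(3), of x] d0_nonneg[of x] B by (auto simp: of_bool_def abs_le_iff)
      have tri: "integrable lborel (\<lambda>x. indicator {0..K} x * ?tr n x)"
      proof (rule Bochner_Integration.integrable_bound)
        show "integrable lborel (\<lambda>x. indicator {0..K} x * B)" by (intro integrable_mult_left integrable_real_indicator) (auto simp: emeasure_lborel_Icc_eq)
      qed (use trm trb B in \<open>auto simp: indicator_def intro!: AE_I2 order_trans[OF trb]\<close>)
      have eq: "(LINT x:{0..K}|lborel. \<bar>kernel_degree (gk n) x * of_bool (kernel_degree (gk n) x \<le> B) - d x * of_bool (d x \<le> B)\<bar>)
         = (LINT x|lborel. indicator {0..K} x * ?tr n x)"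
        unfolding set_lebesgue_integral_def
        by (intro Bochner_Integration.integral_cong refl) (auto simp: indicator_def kernel_degree_gk[OF elim(3)] d0_def ext1_def)
      have tr: "(\<integral>\<^sup>+x. ennreal (?tr n x) * indicator {0..K} x \<partial>lborel) = ennreal (LINT x|lborel. indicator {0..K} x * ?tr n x)"
        using tri by (subst nn_integral_eq_integral[symmetric]) (auto intro!: nn_integral_cong simp: indicator_def)
      have "T1 K n \<le> (\<integral>\<^sup>+x. (ennreal (?tr n x) * indicator {0..K} x + ennreal (1 / B) * ennreal (dn n x)) + ennreal (1 / B) * ennreal (d0 x) \<partial>lborel)"
        unfolding T1_def
      proof (rule nn_integral_mono)
        fix x
        have "ennreal (min 1 \<bar>dn n x - d0 x\<bar>) \<le> ennreal (?tr n x + 1 / B * dn n x + 1 / B * d0 x)"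
          using truncation_bound[OF dn_nonneg[OF elim(3)] d0_nonneg B(2), of x x] by (intro ennreal_leI) simp
        also have "\<dots> = (ennreal (?tr n x) + ennreal (1 / B) * ennreal (dn n x)) + ennreal (1 / B) * ennreal (d0 x)"
          using B(2) dn_nonneg[OF elim(3), of x] d0_nonneg[of x] by (simp add: ennreal_mult'[symmetric])
        finally show "ennreal (min 1 \<bar>dn n x - d0 x\<bar>) * indicator {0..K} x \<le> (ennreal (?tr n x) * indicator {0..K} x + ennreal (1 / B) * ennreal (dn n x)) + ennreal (1 / B) * ennreal (d0 x)"
          by (cases "x \<in> {0..K}") auto
      qed
      also have "\<dots> = ((\<integral>\<^sup>+x. ennreal (?tr n x) * indicator {0..K} x \<partial>lborel) + ennreal (1 / B) * (\<integral>\<^sup>+x. ennreal (dn n x) \<partial>lborel)) + ennreal (1 / B) * (\<integral>\<^sup>+x. ennreal (d0 x) \<partial>lborel)"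
        using trm by (simp add: nn_integral_add nn_integral_cmult)
      also have "\<dots> \<le> (ennreal (e' / 3) + ennreal (1 / B) * ennreal (2 * CE)) + ennreal (1 / B) * ennreal D"
        unfolding tr D(1) nn_integral_dn[OF elim(3)] eq[symmetric] using elim(1,2)
        by (intro add_mono mult_left_mono ennreal_leI) auto
      also have "\<dots> = ennreal (e' / 3 + (2 * CE + D) / B)"
        using B CE D(2) e'(1) by (simp add: ennreal_mult'[symmetric] ennreal_plus[symmetric] add_divide_distrib del: ennreal_plus)
      also have "\<dots> < ennreal e'" by (rule ennreal_lessI[OF e'(1)]) (use BB e'(1) in linarith)
      also have "\<dots> \<le> e" by (rule e'(2))
      finally show ?case .
    qed
  qed simp
  then show ?thesis by (intro eventually_mono[OF eventually_ge_at_top[of C]])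
qed

text \<open>\<open>res K n\<close> is, up to an error \<open>p n\<close>, the rescaled number of tail neighbours of a vertex, which has to be compared with \<open>D0\<close>.\<close>

definition gap :: "real \<Rightarrow> nat \<Rightarrow> real \<Rightarrow> real" where
  "gap K n x = (LINT y|lborel. indicator {0..K} y * (wn n (x, y) - W0 (x, y)))"

definition res :: "real \<Rightarrow> nat \<Rightarrow> real \<Rightarrow> real" where
  "res K n x = dn n x - (LINT y|lborel. indicator {0..K} y * wn n (x, y))"

definition tl :: "real \<Rightarrow> real \<Rightarrow> real" where
  "tl K x = (LINT y|lborel. indicator {K<..} y * W0 (x, y))"

definition D0 :: "real \<Rightarrow> real" where
  "D0 x = d0 x - (LINT y|lborel. W0 (x, y))"

definition T2 :: "real \<Rightarrow> nat \<Rightarrow> ennreal" where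
  "T2 K n = (\<integral>\<^sup>+x. ennreal \<bar>gap K n x\<bar> * indicator {0..K} x \<partial>lborel)"

definition T3 :: "real \<Rightarrow> ennreal" where
  "T3 K = (\<integral>\<^sup>+z. ennreal (W0 z) * indicator {K<..} (snd z) \<partial>lborel)"

lemma pair_integral_measurable:
  fixes f :: "real \<times> real \<Rightarrow> real"
  assumes "f \<in> borel_measurable borel"
  shows "(\<lambda>x. LINT y|lborel. f (x, y)) \<in> borel_measurable borel"
proof -
  have "f \<in> borel_measurable (borel \<Otimes>\<^sub>M lborel)" using assms by (simp add: borel_prod[symmetric])
  then show ?thesis using lborel.borel_measurable_lebesgue_integral[of "\<lambda>x y. f (x, y)" borel] by simp
qed

lemma gap_measurable [measurable]: "gap K n \<in> borel_measurable borel"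
  unfolding gap_def[abs_def]
  using pair_integral_measurable[of "\<lambda>z. indicator {0..K} (snd z) * (wn n z - W0 z)"] by simp

lemma D0_measurable [measurable]: "D0 \<in> borel_measurable borel"
  unfolding D0_def[abs_def] using pair_integral_measurable[OF W0(1)] by measurable

lemma res_measurable [measurable]: "res K n \<in> borel_measurable borel"
  unfolding res_def[abs_def]
  using pair_integral_measurable[of "\<lambda>z. indicator {0..K} (snd z) * wn n z"] by (intro borel_measurable_diff dn_measurable) simp

lemma tl_measurable [measurable]: "tl K \<in> borel_measurable borel"
  unfolding tl_def[abs_def]
  using pair_integral_measurable[of "\<lambda>z. indicator {K<..} (snd z) * W0 z"] by simp

lemma tl_nonneg: "tl K x \<ge> 0" unfolding tl_def using W0(2) by (intro integral_nonneg_AE) auto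

text \<open>The test functions \<open>sgn (gap K n x)\<close> in the first variable and 1 in the
  second turn the bilinear form into the L1 norm of the gap: row integrals converge in L1 although
  the kernels converge only in the cut norm.\<close>

lemma T2_bound:
  assumes n: "n \<ge> 1" and K: "K \<ge> 0"
  shows "T2 K n \<le> ennreal (cut_dist K (gk n) W)"
proof -
  let ?f = "\<lambda>x. sgn (gap K n x)"
  let ?F = "\<lambda>z. indicator (sqr K) z * ((wn n z - W0 z) * ?f (fst z) * 1)"
  have fm: "?f \<in> borel_measurable borel" unfolding sgn_if by measurable
  have fb: "\<bar>?f x\<bar> \<le> 1" for x by (simp add: sgn_if)
  have Fm: "(\<lambda>z. (wn n z - W0 z) * ?f (fst z) * 1) \<in> borel_measurable borel"
  proof -
    have "(fst :: real \<times> real \<Rightarrow> real) \<in> borel_measurable borel"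
      by (intro borel_measurable_continuous_onI continuous_intros)
    then have "(\<lambda>z::real \<times> real. ?f (fst z)) \<in> borel_measurable borel" by (rule measurable_compose[OF _ fm])
    then show ?thesis by simp
  qed
  have Fb: "\<bar>(wn n z - W0 z) * ?f (fst z) * 1\<bar> \<le> 1" for z
    using mult_mono[OF W_diff[of n z] fb[of "fst z"]] by (simp add: abs_mult)
  have Fi: "integrable lborel ?F" by (rule integrable_on_sqr[OF Fm Fb K])
  have in2: "(LINT y|lborel. ?F (x, y)) = indicator {0..K} x * \<bar>gap K n x\<bar>" for x
  proof -
    have "(LINT y|lborel. ?F (x, y)) = (LINT y|lborel. (indicator {0..K} x * ?f x) * (indicator {0..K} y * (wn n (x, y) - W0 (x, y))))"
      by (intro Bochner_Integration.integral_cong refl) (simp add: indicator_def)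
    also have "\<dots> = (indicator {0..K} x * ?f x) * gap K n x" by (simp only: integral_mult_right_zero gap_def)
    finally show ?thesis by (simp add: mult.assoc linordered_idom_class.abs_sgn mult.commute)
  qed
  have Fi': "integrable (lborel \<Otimes>\<^sub>M lborel) ?F" using Fi by (simp only: lborel_prod)
  have i1: "integrable lborel (\<lambda>x. indicator {0..K} x * \<bar>gap K n x\<bar>)"
    using lborel_pair.integrable_fst'[OF Fi'] by (simp only: in2)
  have "(LINT z|lborel. ?F z) = (LINT x|lborel. indicator {0..K} x * \<bar>gap K n x\<bar>)"
    using lborel_pair.integral_fst'[OF Fi'] by (simp only: in2 lborel_prod)
  moreover have "\<bar>LINT z|lborel. ?F z\<bar> \<le> cut_dist K (gk n) W"
    by (rule cut_bound[OF n K fm fb]) auto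
  moreover have "T2 K n = ennreal (LINT x|lborel. indicator {0..K} x * \<bar>gap K n x\<bar>)"
    unfolding T2_def using i1
    by (subst nn_integral_eq_integral[symmetric]) (auto intro!: nn_integral_cong simp: indicator_def)
  ultimately show ?thesis by (simp add: ennreal_leI)
qed

lemma AE_W0_slice: "AE x in lborel. integrable lborel (\<lambda>y. W0 (x, y))"
proof -
  have "integrable (lborel \<Otimes>\<^sub>M lborel) W0" using integrable_W0 by (simp only: lborel_prod)
  then show ?thesis by (rule lborel_pair.AE_integrable_fst')
qed

lemma integrable_D0: "integrable lborel D0"
proof -
  have "integrable (lborel \<Otimes>\<^sub>M lborel) W0" using integrable_W0 by (simp only: lborel_prod)
  from lborel_pair.integrable_fst'[OF this] show ?thesis
    unfolding D0_def[abs_def] by (intro Bochner_Integration.integrable_diff integrable_d0)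
qed

lemma D0_eq: "ext1 (Delta d W) = D0"
proof
  fix x
  show "ext1 (Delta d W) x = D0 x"
  proof (cases "x \<ge> 0")
    case True
    have "kernel_degree W x = (LINT y|lborel. W0 (x, y))"
      unfolding kernel_degree_def set_lebesgue_integral_def
      by (intro Bochner_Integration.integral_cong refl) (use True in \<open>auto simp: W0_def ext2_def indicator_def\<close>)
    then show ?thesis using True by (simp add: ext1_def Delta_def D0_def d0_def)
  next
    case False
    then have "(\<lambda>y. W0 (x, y)) = (\<lambda>_. 0)" by (auto simp: W0_def ext2_def)
    then show ?thesis using False by (simp add: ext1_def D0_def d0_def)
  qed
qed

lemma AE_slice_W: "AE x in lborel. x \<ge> 0 \<longrightarrow> set_integrable lborel {0..} (W x)"
  using AE_W0_slice
proof eventually_elim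
  case (elim x)
  show ?case
  proof
    assume "x \<ge> 0"
    then have "(\<lambda>y. W0 (x, y)) = (\<lambda>y. indicator {0..} y *\<^sub>R W x y)" by (auto simp: W0_def ext2_def indicator_def)
    then show "set_integrable lborel {0..} (W x)" using elim by (simp add: set_integrable_def)
  qed
qed

lemma T3_integrand_measurable [measurable]: "(\<lambda>z. ennreal (W0 z) * indicator {K<..} (snd z)) \<in> borel_measurable borel"
proof -
  have "(snd :: real \<times> real \<Rightarrow> real) \<in> borel_measurable borel"
    by (intro borel_measurable_continuous_onI continuous_intros)
  then have "(\<lambda>z::real \<times> real. indicator {K<..} (snd z) :: ennreal) \<in> borel_measurable borel"
    by (rule measurable_compose) simp
  then show ?thesis by measurable
qed

lemma nn_integral_tl: "(\<integral>\<^sup>+x. ennreal (tl K x) \<partial>lborel) = T3 K"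
proof -
  have "T3 K = (\<integral>\<^sup>+z. ennreal (W0 z) * indicator {K<..} (snd z) \<partial>(lborel \<Otimes>\<^sub>M lborel))" by (simp only: T3_def lborel_prod)
  also have "\<dots> = (\<integral>\<^sup>+x. \<integral>\<^sup>+y. ennreal (W0 (x, y)) * indicator {K<..} y \<partial>lborel \<partial>lborel)"
    by (subst lborel.nn_integral_fst[symmetric]) (simp_all add: lborel_prod)
  also have "\<dots> = (\<integral>\<^sup>+x. ennreal (tl K x) \<partial>lborel)"
  proof (rule nn_integral_cong_AE)
    show "AE x in lborel. (\<integral>\<^sup>+y. ennreal (W0 (x, y)) * indicator {K<..} y \<partial>lborel) = ennreal (tl K x)"
      using AE_W0_slice
    proof eventually_elim
      case (elim x)
      have "integrable lborel (\<lambda>y. indicator {K<..} y * W0 (x, y))"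
        using integrable_mult_indicator[OF _ elim, of "{K<..}"] by simp
      then show ?case unfolding tl_def using W0(2)
        by (subst nn_integral_eq_integral[symmetric]) (auto intro!: nn_integral_cong simp: indicator_def)
    qed
  qed
  finally show ?thesis by simp
qed

lemma T3_tendsto: "(T3 \<longlongrightarrow> 0) at_top"
proof -
  \<comment> \<open>Monotonicity transfers the limit along natural numbers to real
    \<open>K\<close>.\<close>
  have anti: "T3 L \<le> T3 K" if "K \<le> L" for K L
    unfolding T3_def using that by (intro nn_integral_mono mult_left_mono) (auto simp: indicator_def)
  have "(\<lambda>k. T3 (real k)) \<longlonglongrightarrow> (\<integral>\<^sup>+z. 0 \<partial>(lborel :: (real \<times> real) measure))"
    unfolding T3_def
  proof (rule nn_integral_dominated_convergence[where w = "\<lambda>z. ennreal (W0 z)"])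
    show "AE z in lborel. (\<lambda>k. ennreal (W0 z) * indicator {real k<..} (snd z)) \<longlonglongrightarrow> 0"
    proof (rule AE_I2)
      fix z :: "real \<times> real"
      have "\<forall>\<^sub>F k in sequentially. snd z < real k"
        using filterlim_real_sequentially by (auto simp: filterlim_at_top_dense)
      then have "\<forall>\<^sub>F k in sequentially. ennreal (W0 z) * indicator {real k<..} (snd z) = 0" by eventually_elim auto
      then show "(\<lambda>k. ennreal (W0 z) * indicator {real k<..} (snd z)) \<longlonglongrightarrow> 0" by (rule tendsto_eventually)
    qed
    show "(\<integral>\<^sup>+z. ennreal (W0 z) \<partial>lborel) < \<infinity>"
      using integrable_W0 W0(2) by (simp add: nn_integral_eq_integral)
  qed (simp_all add: T3_integrand_measurable, auto simp: indicator_def)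
  then have lim: "(\<lambda>k. T3 (real k)) \<longlonglongrightarrow> 0" by simp
  show ?thesis
  proof (rule order_tendstoI)
    fix e :: ennreal assume "0 < e"
    from order_tendstoD(2)[OF lim this] obtain k where "T3 (real k) < e" by (auto simp: eventually_sequentially)
    then show "\<forall>\<^sub>F K in at_top. T3 K < e"
      by (intro eventually_mono[OF eventually_ge_at_top[of "real k"]]) (rule le_less_trans[OF anti])
  qed simp
qed

lemma min_add_le:
  fixes a b c x :: real
  assumes "x \<le> a + b + c" "b \<ge> 0" "c \<ge> 0"
  shows "min 1 x \<le> min 1 a + b + c"
  using assms by (auto simp: min_def)

text \<open>Splitting the row integral of \<open>W0\<close> at \<open>K\<close> gives
  \<open>res - D0 = (dn - d0) - gap + tl\<close> for almost every row. Only the first difference is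
  capped; the other two are bounded in L1.\<close>

lemma res_bound:
  assumes n: "n \<ge> 1" and K: "K \<ge> 0"
  shows "(\<integral>\<^sup>+x. ennreal (min 1 \<bar>res K n x - D0 x\<bar>) * indicator {0..K} x \<partial>lborel) \<le> T1 K n + T2 K n + T3 K"
proof -
  have "(\<integral>\<^sup>+x. ennreal (min 1 \<bar>res K n x - D0 x\<bar>) * indicator {0..K} x \<partial>lborel)
    \<le> (\<integral>\<^sup>+x. (ennreal (min 1 \<bar>dn n x - d0 x\<bar>) * indicator {0..K} x + ennreal \<bar>gap K n x\<bar> * indicator {0..K} x) + ennreal (tl K x) \<partial>lborel)"
  proof (rule nn_integral_mono_AE)
    show "AE x in lborel. ennreal (min 1 \<bar>res K n x - D0 x\<bar>) * indicator {0..K} x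
      \<le> (ennreal (min 1 \<bar>dn n x - d0 x\<bar>) * indicator {0..K} x + ennreal \<bar>gap K n x\<bar> * indicator {0..K} x) + ennreal (tl K x)"
      using AE_W0_slice
    proof eventually_elim
      case (elim x)
      have i0: "integrable lborel (\<lambda>y. indicator A y * W0 (x, y))" if "A \<in> sets borel" for A
        using integrable_mult_indicator[OF _ elim, of A] that by simp
      have iw: "integrable lborel (\<lambda>y. indicator {0..K} y * wn n (x, y))"
        using wn_slice(1)[OF n, of "{0..K}" x] by (simp add: set_integrable_def)
      have "(LINT y|lborel. W0 (x, y)) = (LINT y|lborel. indicator {0..K} y * W0 (x, y) + indicator {K<..} y * W0 (x, y))"
        by (intro Bochner_Integration.integral_cong refl) (use K in \<open>auto simp: indicator_def W0_def ext2_def\<close>)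
      also have "\<dots> = (LINT y|lborel. indicator {0..K} y * W0 (x, y)) + tl K x"
        unfolding tl_def by (intro Bochner_Integration.integral_add i0) auto
      finally have s1: "(LINT y|lborel. W0 (x, y)) = (LINT y|lborel. indicator {0..K} y * W0 (x, y)) + tl K x" .
      have s2: "gap K n x = (LINT y|lborel. indicator {0..K} y * wn n (x, y)) - (LINT y|lborel. indicator {0..K} y * W0 (x, y))"
        unfolding gap_def by (subst Bochner_Integration.integral_diff[OF iw i0, symmetric]) (auto simp: right_diff_distrib)
      have "\<bar>res K n x - D0 x\<bar> \<le> \<bar>dn n x - d0 x\<bar> + \<bar>gap K n x\<bar> + tl K x"
        unfolding res_def D0_def s1 s2 using tl_nonneg[of K x] by linarith
      then have "min 1 \<bar>res K n x - D0 x\<bar> \<le> min 1 \<bar>dn n x - d0 x\<bar> + \<bar>gap K n x\<bar> + tl K x"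
        by (rule min_add_le) (use tl_nonneg in auto)
      then have "ennreal (min 1 \<bar>res K n x - D0 x\<bar>) \<le> ennreal (min 1 \<bar>dn n x - d0 x\<bar>) + ennreal \<bar>gap K n x\<bar> + ennreal (tl K x)"
        using tl_nonneg[of K x] by (simp add: ennreal_plus[symmetric] ennreal_leI del: ennreal_plus)
      then show ?case by (cases "x \<in> {0..K}") auto
    qed
  qed
  also have "\<dots> = T1 K n + T2 K n + (\<integral>\<^sup>+x. ennreal (tl K x) \<partial>lborel)"
    unfolding T1_def T2_def by (simp add: nn_integral_add)
  finally show ?thesis by (simp only: nn_integral_tl)
qed

text \<open>The mass of \<open>W0\<close> beyond \<open>K\<close> remains after \<open>n\<close> has
  tended to infinity; it vanishes only when \<open>K\<close> grows as well.\<close>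

lemma T_sum_tendsto: "\<forall>\<^sub>F K in at_top. (\<lambda>n. T1 K n + T2 K n + T3 K) \<longlonglongrightarrow> T3 K"
  using T1_tendsto cut_tendsto
proof eventually_elim
  case (elim K)
  have "(\<lambda>n. ennreal (cut_dist K (gk n) W)) \<longlonglongrightarrow> ennreal 0" using elim by (intro tendsto_ennrealI) auto
  then have "(\<lambda>n. T2 K n) \<longlonglongrightarrow> 0"
    by (intro tendsto_sandwich[of "\<lambda>_. 0" "\<lambda>n. T2 K n" sequentially "\<lambda>n. ennreal (cut_dist K (gk n) W)"])
      (use T2_bound elim in \<open>auto intro!: eventually_sequentiallyI[of 1]\<close>)
  then have "(\<lambda>n. T1 K n + T2 K n + T3 K) \<longlonglongrightarrow> 0 + 0 + T3 K" using elim by (intro tendsto_add tendsto_const) auto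
  then show ?case by simp
qed

lemma res_nonneg: "n \<ge> 1 \<Longrightarrow> res K n x \<ge> 0"
proof -
  assume n: "n \<ge> 1"
  have "(LINT y:{0..K}|lborel. wn n (x, y)) \<le> (LINT y:UNIV|lborel. wn n (x, y))"
    unfolding set_lebesgue_integral_def
    using wn_slice(1)[OF n, of "{0..K}" x] wn_slice(1)[OF n, of UNIV x] wn_bounds
    by (intro integral_mono) (auto simp: set_integrable_def indicator_def)
  also have "\<dots> = dn n x" by (rule wn_slice_full[OF n]) auto
  finally show ?thesis by (simp add: res_def set_lebesgue_integral_def)
qed

text \<open>The functions \<open>res K n\<close> are non-negative and converge to \<open>D0\<close> in the iterated limit.\<close>

lemma D0_nonneg: "AE x in lborel. D0 x \<ge> 0"
proof -
  have K: "AE x in lborel. x \<in> {0..real k} \<longrightarrow> D0 x \<ge> 0" for k :: nat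
  proof -
    \<comment> \<open>The negative part of \<open>D0\<close>, capped at 1 and restricted to a fixed
      interval. As \<open>res\<close> is non-negative, it lies below the capped distance for every
      \<open>K \<ge> k\<close>, while it does not itself depend on \<open>K\<close>.\<close>
    let ?F = "\<lambda>x. ennreal (min 1 (max 0 (- D0 x))) * indicator {0..real k} x"
    have "\<forall>\<^sub>F K in at_top. (\<integral>\<^sup>+x. ?F x \<partial>lborel) \<le> T3 K"
      using T_sum_tendsto eventually_ge_at_top[of "real k"]
    proof eventually_elim
      case (elim K)
      show ?case
      proof (rule tendsto_lowerbound[OF elim(1)])
        show "\<forall>\<^sub>F n in sequentially. (\<integral>\<^sup>+x. ?F x \<partial>lborel) \<le> T1 K n + T2 K n + T3 K"
          using eventually_ge_at_top[of 1]
        proof eventually_elim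
          case (elim n)
          note n = elim
          have "(\<integral>\<^sup>+x. ?F x \<partial>lborel) \<le> (\<integral>\<^sup>+x. ennreal (min 1 \<bar>res K n x - D0 x\<bar>) * indicator {0..K} x \<partial>lborel)"
          proof (intro nn_integral_mono mult_mono)
            fix x
            show "ennreal (min 1 (max 0 (- D0 x))) \<le> ennreal (min 1 \<bar>res K n x - D0 x\<bar>)"
              using res_nonneg[OF n, of K x] by (intro ennreal_leI min.mono) auto
            show "(indicator {0..real k} x :: ennreal) \<le> indicator {0..K} x"
              using \<open>real k \<le> K\<close> by (auto simp: indicator_def)
          qed auto
          also have "\<dots> \<le> T1 K n + T2 K n + T3 K" using \<open>real k \<le> K\<close> by (intro res_bound n) auto
          finally show ?case .
        qed
      qed simp
    qed
    then have "(\<integral>\<^sup>+x. ?F x \<partial>lborel) \<le> 0" by (intro tendsto_lowerbound[OF T3_tendsto]) auto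
    then have "AE x in lborel. ?F x = 0" by (subst nn_integral_0_iff_AE[symmetric]) auto
    then show ?thesis by eventually_elim (auto simp: min_def max_def split: if_splits)
  qed
  have "AE x in lborel. \<forall>k::nat. x \<in> {0..real k} \<longrightarrow> D0 x \<ge> 0" unfolding AE_all_countable using K by blast
  then show ?thesis
  proof eventually_elim
    case (elim x)
    show ?case
    proof (cases "x \<ge> 0")
      case True
      then show ?thesis using elim real_arch_simple[of x] by auto
    next
      case False
      then show ?thesis by (simp add: D0_eq[symmetric] ext1_def)
    qed
  qed
qed

section \<open>The rate of the edges inside the tail\<close>

definition lam :: "real \<Rightarrow> nat \<Rightarrow> real" where
  "lam K n = (p n)\<^sup>2 * real (ec (E n) {nat \<lfloor>K / p n\<rfloor><..n})"

lemma floor_K: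
  assumes n: "n \<ge> 1" and K: "K > 0"
  shows "real (nat \<lfloor>K / p n\<rfloor>) * p n \<le> K" "K < (real (nat \<lfloor>K / p n\<rfloor>) + 1) * p n"
proof -
  have "0 \<le> K / p n" using K p_pos[OF n] by simp
  then have "real (nat \<lfloor>K / p n\<rfloor>) = of_int \<lfloor>K / p n\<rfloor>" by (simp only: of_nat_nat zero_le_floor)
  then have "real (nat \<lfloor>K / p n\<rfloor>) \<le> K / p n" "K / p n < real (nat \<lfloor>K / p n\<rfloor>) + 1" by linarith+
  then show "real (nat \<lfloor>K / p n\<rfloor>) * p n \<le> K" "K < (real (nat \<lfloor>K / p n\<rfloor>) + 1) * p n"
    using p_pos[OF n] by (simp_all add: pos_le_divide_eq pos_divide_less_eq)
qed

text \<open>Only the vertex after \<open>nat \<lfloor>K / p n\<rfloor>\<close>, whose interval may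
  be cut at \<open>K\<close>, is counted with a part of its mass. The pairs involving it weigh at
  most \<open>p\<^sup>2\<close> each, and the degree order bounds their number.\<close>

lemma tail_integral:
  assumes n: "n \<ge> 1" and K: "K > 0"
  shows "\<bar>1 / 2 * (LINT x:{K..}|lborel. LINT y:{K..}|lborel. gk n x y) - lam K n\<bar> \<le> 2 * (real (card (E n)) * (p n)\<^sup>2) * p n / K"
proof -
  let ?N = "nat \<lfloor>K / p n\<rfloor>" and ?p = "p n"
  define m where "m v = measure lborel ({K..} \<inter> cellI (r n) v)" for v
  let ?I = "LINT x:{K..}|lborel. LINT y:{K..}|lborel. gk n x y"
  have p: "?p > 0" by (rule p_pos[OF n])
  note cell = cellI_p[OF n]
  have m01: "0 \<le> m v" "m v \<le> ?p" for v
    using measure_part_cellI[OF n, of _ v] by (simp_all add: m_def)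
  \<comment> \<open>Such an interval can meet \<open>{K..}\<close> only in its right end
    point.\<close>
  have m0: "m v = 0" if "v \<le> ?N" for v
  proof -
    have "real v * ?p \<le> real ?N * ?p" using that p by (intro mult_right_mono) auto
    then have "{K..} \<inter> cellI (r n) v \<subseteq> {K}" using floor_K(1)[OF n K] by (auto simp: cell)
    then have "m v \<le> measure lborel {K}" unfolding m_def by (intro measure_mono_fmeasurable) (auto simp: fmeasurable_def)
    then show ?thesis using m01[of v] by (simp add: measure_def)
  qed
  have m1: "m v = ?p" if "v > Suc ?N" for v
  proof -
    have "(real ?N + 1) * ?p \<le> (real v - 1) * ?p" using that p by (intro mult_right_mono) auto
    then have "{K..} \<inter> cellI (r n) v = cellI (r n) v" using floor_K(2)[OF n K] by (auto simp: cell)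
    then show ?thesis by (simp add: m_def measure_cellI[OF n])
  qed
  have inner: "(LINT y:{K..}|lborel. gk n x y) = (\<Sum>v\<in>{1..n}. adj (E n) (cl (r n) x) v * m v)" if "x \<ge> K" for x
  proof -
    have "(LINT y:{K..}|lborel. gk n x y) = (LINT y:{K..}|lborel. wn n (x, y))"
      using gk_wn[OF n] that K by (intro set_lebesgue_integral_cong) auto
    also have "\<dots> = (\<Sum>v\<in>{1..n}. adj (E n) (cl (r n) x) v * m v)"
      unfolding m_def by (intro wn_slice(2)[OF n]) auto
    finally show ?thesis .
  qed
  have "?I = (LINT x:{K..}|lborel. (\<lambda>u. \<Sum>v\<in>{1..n}. adj (E n) u v * m v) (cl (r n) x))"
    using inner by (intro set_lebesgue_integral_cong) auto
  also have "\<dots> = (\<Sum>u\<in>{1..n}. (\<Sum>v\<in>{1..n}. adj (E n) u v * m v) * m u)"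
    unfolding m_def
    by (rule integral_cl(2)[OF r_pos[OF n]]) (use adj_outside[OF graph[OF n]] in \<open>auto intro!: sum.neutral\<close>)
  finally have I: "?I = (\<Sum>u\<in>{1..n}. \<Sum>v\<in>{1..n}. adj (E n) u v * (m u * m v))"
    by (simp only: sum_distrib_right mult.assoc mult.commute[of "m _" "m _"])
  let ?q = "\<lambda>u. if u > ?N then ?p else 0"
  have L: "2 * lam K n = (\<Sum>u\<in>{1..n}. \<Sum>v\<in>{1..n}. adj (E n) u v * (?q u * ?q v))"
  proof -
    have "2 * real (ec (E n) {?N<..n}) = (\<Sum>u\<in>{?N<..n}. \<Sum>v\<in>{?N<..n}. adj (E n) u v)"
      by (rule ec_adj[OF graph[OF n]]) auto
    then have "2 * lam K n = (\<Sum>u\<in>{?N<..n}. \<Sum>v\<in>{?N<..n}. adj (E n) u v * (?q u * ?q v))"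
      unfolding lam_def by (simp add: sum_distrib_left sum_distrib_right power2_eq_square mult_ac)
    also have "\<dots> = (\<Sum>u\<in>{?N<..n}. \<Sum>v\<in>{1..n}. adj (E n) u v * (?q u * ?q v))"
      by (intro sum.cong refl sum.mono_neutral_left) auto
    also have "\<dots> = (\<Sum>u\<in>{1..n}. \<Sum>v\<in>{1..n}. adj (E n) u v * (?q u * ?q v))"
      by (intro sum.mono_neutral_left) (auto intro!: sum.neutral)
    finally show ?thesis .
  qed
  let ?o = "\<lambda>u. of_bool (u = Suc ?N) :: real"
  have pt: "\<bar>adj (E n) u v * (?q u * ?q v) - adj (E n) u v * (m u * m v)\<bar> \<le> ?p\<^sup>2 * (adj (E n) u v * ?o u) + ?p\<^sup>2 * (adj (E n) u v * ?o v)" for u v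
  proof -
    have "\<bar>?q u * ?q v - m u * m v\<bar> \<le> ?p\<^sup>2 * ?o u + ?p\<^sup>2 * ?o v"
    proof -
      consider "u \<le> ?N \<or> v \<le> ?N" | "u > Suc ?N" "v > Suc ?N" | "u > ?N" "v > ?N" "u = Suc ?N \<or> v = Suc ?N" by linarith
      then show ?thesis
      proof cases
        case 1 then show ?thesis using m0 by auto
      next
        case 2 then show ?thesis using m1 by auto
      next
        case 3
        have "0 \<le> m u * m v" "m u * m v \<le> ?p * ?p" using m01 p by (auto intro!: mult_mono)
        then have "\<bar>?q u * ?q v - m u * m v\<bar> \<le> ?p\<^sup>2" using 3 by (auto simp: power2_eq_square abs_le_iff)
        also have "\<dots> \<le> ?p\<^sup>2 * ?o u + ?p\<^sup>2 * ?o v" using 3(3) by auto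
        finally show ?thesis .
      qed
    qed
    then have "adj (E n) u v * \<bar>?q u * ?q v - m u * m v\<bar> \<le> adj (E n) u v * (?p\<^sup>2 * ?o u + ?p\<^sup>2 * ?o v)"
      by (intro mult_left_mono adj_bounds)
    moreover have "\<bar>adj (E n) u v * (?q u * ?q v) - adj (E n) u v * (m u * m v)\<bar> = adj (E n) u v * \<bar>?q u * ?q v - m u * m v\<bar>"
      by (simp only: right_diff_distrib[symmetric] abs_mult abs_of_nonneg[OF adj_bounds(1)])
    ultimately show ?thesis by (simp only: distrib_left mult_ac)
  qed
  have deg: "(\<Sum>u\<in>{1..n}. adj (E n) u (Suc ?N)) = real (nb (E n) {1..n} (Suc ?N))"
    by (simp add: nb_def adj_def sum.If_cases Int_def)
  have row: "(\<Sum>u\<in>{1..n}. \<Sum>v\<in>{1..n}. adj (E n) u v * ?o v) \<le> real (nb (E n) {1..n} (Suc ?N))"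
  proof -
    have "(\<Sum>v\<in>{1..n}. adj (E n) u v * ?o v) \<le> adj (E n) u (Suc ?N)" for u
      using adj_bounds(1)[of "E n" u "Suc ?N"] by (simp add: of_bool_def sum.delta if_distrib cong: if_cong)
    then show ?thesis unfolding deg[symmetric] by (intro sum_mono)
  qed
  have col: "(\<Sum>u\<in>{1..n}. \<Sum>v\<in>{1..n}. adj (E n) u v * ?o u) \<le> real (nb (E n) {1..n} (Suc ?N))"
    using row by (subst sum.swap) (simp only: adj_sym)
  have "\<bar>?I - 2 * lam K n\<bar>
      = \<bar>\<Sum>u\<in>{1..n}. \<Sum>v\<in>{1..n}. adj (E n) u v * (?q u * ?q v) - adj (E n) u v * (m u * m v)\<bar>"
    unfolding I L by (simp only: sum_subtractf abs_minus_commute)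
  also have "\<dots> \<le> (\<Sum>u\<in>{1..n}. \<Sum>v\<in>{1..n}. ?p\<^sup>2 * (adj (E n) u v * ?o u) + ?p\<^sup>2 * (adj (E n) u v * ?o v))"
    by (intro order_trans[OF sum_abs] sum_mono pt)
  also have "\<dots> = ?p\<^sup>2 * ((\<Sum>u\<in>{1..n}. \<Sum>v\<in>{1..n}. adj (E n) u v * ?o u) + (\<Sum>u\<in>{1..n}. \<Sum>v\<in>{1..n}. adj (E n) u v * ?o v))"
    by (simp only: sum.distrib sum_distrib_left distrib_left)
  also have "\<dots> \<le> ?p\<^sup>2 * (2 * real (nb (E n) {1..n} (Suc ?N)))" using row col by (intro mult_left_mono) auto
  also have "\<dots> \<le> ?p\<^sup>2 * (2 * (2 * real (card (E n)) * ?p / K))"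
  proof (intro mult_left_mono)
    have "real (nb (E n) {1..n} (Suc ?N)) * K \<le> real (nb (E n) {1..n} (Suc ?N)) * ((real ?N + 1) * ?p)"
      using floor_K(2)[OF n K] by (intro mult_left_mono) auto
    also have "\<dots> = (real (Suc ?N) * real (nb (E n) {1..n} (Suc ?N))) * ?p" by (simp add: algebra_simps)
    also have "\<dots> \<le> 2 * real (card (E n)) * ?p"
      using degree_rank_bound[OF graph[OF n] labels[OF n], of "Suc ?N"] p by (intro mult_right_mono) auto
    finally show "real (nb (E n) {1..n} (Suc ?N)) \<le> 2 * real (card (E n)) * ?p / K" using K by (simp add: pos_le_divide_eq)
  qed auto
  also have "\<dots> = 2 * (2 * (real (card (E n)) * ?p\<^sup>2) * ?p / K)" by simp
  finally show ?thesis by linarith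
qed

text \<open>The nested upper and lower limits give strict inequalities for large \<open>K\<close>
  and then large \<open>n\<close>, which is convergence along \<open>iter_filter\<close>; for fixed
  \<open>K\<close> the integral differs from \<open>lam\<close> by a term that vanishes with
  \<open>p n\<close>.\<close>

lemma lam_tendsto: "((\<lambda>(K, n). lam K n) \<longlongrightarrow> lam0) iter_filter"
proof (rule tendstoI)
  fix e :: real assume e: "e > 0"
  obtain C where C: "C > 0" "\<forall>\<^sub>F n in sequentially. real (card (E n)) * (p n)\<^sup>2 \<le> C" by (rule edge_bound)
  let ?a = "\<lambda>n K. 1 / 2 * (LINT x:{K..}|lborel. LINT y:{K..}|lborel. gk n x y)"
  have l: "Limsup at_top (\<lambda>K. limsup (\<lambda>n. ereal (?a n K))) < ereal (lam0 + e / 2)"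
    "ereal (lam0 - e / 2) < Liminf at_top (\<lambda>K. liminf (\<lambda>n. ereal (?a n K)))"
    using a e unfolding has_double_lim_def by simp_all
  have "\<forall>\<^sub>F K in at_top. \<forall>\<^sub>F n in sequentially. dist (lam K n) lam0 < e"
    using Limsup_lessD[OF l(1)] less_LiminfD[OF l(2)] eventually_gt_at_top[of 0]
  proof eventually_elim
    case (elim K)
    have "(\<lambda>n. 2 * C * p n / K) \<longlonglongrightarrow> 2 * C * 0 / K" by (intro tendsto_intros p_lim) (use elim in auto)
    then have "\<forall>\<^sub>F n in sequentially. 2 * C * p n / K < e / 2" using e by (intro order_tendstoD(2)) auto
    then show ?case using Limsup_lessD[OF elim(1)] less_LiminfD[OF elim(2)] C(2) eventually_ge_at_top[of 1]
    proof eventually_elim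
      case (elim n)
      have "2 * (real (card (E n)) * (p n)\<^sup>2) * p n / K \<le> 2 * C * p n / K"
        using elim p_pos[of n] \<open>0 < K\<close> by (intro divide_right_mono mult_right_mono mult_left_mono) auto
      then show ?case using elim tail_integral[OF elim(5) \<open>0 < K\<close>] by (auto simp: dist_real_def)
    qed
  qed
  then show "\<forall>\<^sub>F z in iter_filter. dist (case z of (K, n) \<Rightarrow> lam K n) lam0 < e" by (simp add: eventually_iter_filter)
qed

lemma lam_nonneg: "lam K n \<ge> 0" by (simp add: lam_def)

lemma lam0_nonneg: "lam0 \<ge> 0"
  by (rule tendsto_lowerbound[OF lam_tendsto _ iter_filter_neq_bot]) (simp add: lam_nonneg case_prod_beta)

section \<open>Step data evaluated at the vertices\<close>

lemma min_add4_le: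
  fixes a b c x y :: real
  assumes "x \<le> a + b + c + y" "a \<ge> 0" "b \<ge> 0" "c \<ge> 0" "y \<ge> 0"
  shows "min 1 x \<le> min 1 a + b + c + min 1 y"
  using assms by (auto simp: min_def)

definition nK :: "real \<Rightarrow> nat \<Rightarrow> nat" where "nK K n = nat \<lfloor>K / p n\<rfloor>"

lemma cl_p:
  assumes n: "n \<ge> 1" and x: "x \<ge> 0"
  shows "x \<le> real (cl (r n) x) * p n" "real (cl (r n) x) * p n < x + p n"
proof -
  have p: "p n > 0" by (rule p_pos[OF n])
  have "real (cl (r n) x) = of_int \<lceil>x * r n\<rceil>" using x r_pos[OF n] by (simp add: cl_def)
  then have c: "x * r n \<le> real (cl (r n) x)" "real (cl (r n) x) < x * r n + 1" by linarith+
  have eq: "x * r n * p n = x" using p r_eq[OF n] by simp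
  then show "x \<le> real (cl (r n) x) * p n" "real (cl (r n) x) * p n < x + p n"
    using mult_right_mono[OF c(1), of "p n"] mult_strict_right_mono[OF c(2) p] p unfolding distrib_right eq by auto
qed

text \<open>A point is rounded up to the right end of its vertex interval, by less than
  \<open>p n\<close>, and the grid cells are open on the right; so the cell is eventually preserved
  at every point, boundaries included.\<close>

lemma cell_cl_eventually:
  assumes h: "h > 0" and x: "x \<ge> 0"
  shows "\<forall>\<^sub>F n in sequentially. cell h (real (cl (r n) x) * p n) = cell h x"
proof -
  have "x / h < of_int \<lfloor>x / h\<rfloor> + 1" by linarith
  then have "x < (of_int \<lfloor>x / h\<rfloor> + 1) * h" using h by (simp only: pos_divide_less_eq)
  then have "\<forall>\<^sub>F n in sequentially. p n < (of_int \<lfloor>x / h\<rfloor> + 1) * h - x" by (intro order_tendstoD(2)[OF p_lim]) simp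
  then show ?thesis using eventually_ge_at_top[of 1]
  proof eventually_elim
    case (elim n)
    let ?t = "real (cl (r n) x) * p n"
    have "x / h \<le> ?t / h" using cl_p(1)[OF elim(2) x] h by (intro divide_right_mono) auto
    moreover have "?t / h < of_int \<lfloor>x / h\<rfloor> + 1"
      using cl_p(2)[OF elim(2) x] elim(1) h by (simp add: pos_divide_less_eq)
    ultimately have "\<lfloor>?t / h\<rfloor> = \<lfloor>x / h\<rfloor>" by linarith
    then show ?case by (simp add: cell_def)
  qed
qed

lemma nK_cl:
  assumes n: "n \<ge> 1" and K: "K > 0" and c: "cl (r n) x \<in> {1..nK K n}"
  shows "x \<in> {0<..K}"
proof -
  have "x > 0" using c cl_pos[OF r_pos[OF n], of x] by simp
  moreover have "x \<le> real (nK K n) / r n" using c cl_le[OF r_pos[OF n], of x "nK K n"] by simp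
  moreover have "real (nK K n) / r n \<le> K"
    using floor_K(1)[OF n K] p_pos[OF n] by (simp add: nK_def r_eq[OF n])
  ultimately show ?thesis by auto
qed

text \<open>The step kernel is sampled at \<open>u * p n\<close>, the right end point of the
  interval of \<open>u\<close>; these are the positions used in
  \<open>bern_step_limit\<close>.\<close>

definition stepA :: "real \<Rightarrow> (nat \<Rightarrow> nat \<Rightarrow> real) \<Rightarrow> nat \<Rightarrow> nat \<Rightarrow> nat \<Rightarrow> real" where
  "stepA h w n u v = w (cell h (real u * p n)) (cell h (real v * p n))"

definition discrW :: "real \<Rightarrow> (nat \<Rightarrow> nat \<Rightarrow> real) \<Rightarrow> real \<Rightarrow> nat \<Rightarrow> real" where
  "discrW h w K n = (LINT z|lborel. indicator (sqr K) z * \<bar>stepA h w n (cl (r n) (fst z)) (cl (r n) (snd z)) - stepW h w z\<bar>)"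

definition discrD :: "real \<Rightarrow> (nat \<Rightarrow> real) \<Rightarrow> real \<Rightarrow> nat \<Rightarrow> ennreal" where
  "discrD h \<eta> K n = (\<integral>\<^sup>+x. ennreal (min 1 \<bar>stepD h \<eta> x - \<eta> (cell h (real (cl (r n) x) * p n))\<bar>) * indicator {0..K} x \<partial>lborel)"

lemma stepA_measurable: "(\<lambda>z. stepA h w n (cl (r n) (fst z)) (cl (r n) (snd z))) \<in> borel_measurable borel"
  by (rule measurable_cl_pair)

lemma stepA_diff:
  assumes "step_data h m w \<eta>"
  shows "\<bar>stepA h w n u v - stepW h w z\<bar> \<le> 1"
  using step_dataD(2)[OF assms, of "cell h (real u * p n)" "cell h (real v * p n)"] stepW_bounds[OF assms, of z]
  by (simp add: stepA_def abs_le_iff)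

text \<open>Sampled and exact step kernel agree eventually at each point of the square, and the
  square is bounded, so dominated convergence applies.\<close>

lemma discrW_tendsto:
  assumes sd: "step_data h m w \<eta>" and K: "K > 0"
  shows "discrW h w K \<longlonglongrightarrow> 0"
proof -
  let ?m = "\<lambda>n z. indicator (sqr K) z * \<bar>stepA h w n (cl (r n) (fst z)) (cl (r n) (snd z)) - stepW h w z\<bar>"
  have "(\<lambda>n. discrW h w K n) \<longlonglongrightarrow> (LINT z|(lborel :: (real \<times> real) measure). 0)"
    unfolding discrW_def
  proof (rule integral_dominated_convergence[where w = "indicator (sqr K)"])
    show "integrable lborel (indicator (sqr K) :: real \<times> real \<Rightarrow> real)"
      using emeasure_box[of K] K by (intro integrable_real_indicator) auto
    show "AE z in lborel. (\<lambda>n. ?m n z) \<longlonglongrightarrow> 0"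
    proof (rule AE_I2)
      fix z :: "real \<times> real"
      have "\<forall>\<^sub>F n in sequentially. ?m n z = 0"
      proof (cases "z \<in> sqr K")
        case True
        then have z: "fst z \<ge> 0" "snd z \<ge> 0" by auto
        show ?thesis
          using cell_cl_eventually[OF step_dataD(1)[OF sd] z(1)] cell_cl_eventually[OF step_dataD(1)[OF sd] z(2)]
          by eventually_elim (use z in \<open>simp add: stepA_def stepW_def\<close>)
      qed simp
      then show "(\<lambda>n. ?m n z) \<longlonglongrightarrow> 0"
        by (rule tendsto_eventually)
    qed
    show "AE z in lborel. norm (?m n z) \<le> indicator (sqr K) z" for n
      using stepA_diff[OF sd] by (auto simp: indicator_def)
    have [measurable]: "(\<lambda>z. stepA h w n (cl (r n) (fst z)) (cl (r n) (snd z))) \<in> borel_measurable borel" for n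
      by (rule stepA_measurable)
    show "(\<lambda>z. ?m n z) \<in> borel_measurable lborel" for n
      by measurable
  qed simp
  then show ?thesis by simp
qed

lemma measurable_comp_cl: "(\<lambda>x. F (cl q x)) \<in> borel_measurable borel" for F :: "nat \<Rightarrow> real"
  using measurable_compose[OF measurable_cl, of F borel] by simp

lemma discrD_tendsto:
  assumes sd: "step_data h m w \<eta>" and K: "K > 0"
  shows "discrD h \<eta> K \<longlonglongrightarrow> 0"
proof -
  let ?m = "\<lambda>n x. min 1 \<bar>stepD h \<eta> x - \<eta> (cell h (real (cl (r n) x) * p n))\<bar>"
  have "(\<lambda>n. discrD h \<eta> K n) \<longlonglongrightarrow> (\<integral>\<^sup>+x. 0 \<partial>(lborel :: real measure))"
    unfolding discrD_def
  proof (rule nn_integral_dominated_convergence[where w = "indicator {0..K}"])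
    have [measurable]: "(\<lambda>x. \<eta> (cell h (real (cl (r n) x) * p n))) \<in> borel_measurable borel" for n
      by (rule measurable_comp_cl)
    show "(\<lambda>x. ennreal (?m n x) * indicator {0..K} x) \<in> borel_measurable lborel" for n
      by measurable
    show "AE x in lborel. ennreal (?m n x) * indicator {0..K} x \<le> indicator {0..K} x" for n
      by (rule AE_I2) (auto simp: indicator_def ennreal_le_1)
    show "AE x in lborel. (\<lambda>n. ennreal (?m n x) * indicator {0..K} x) \<longlonglongrightarrow> 0"
    proof (rule AE_I2)
      fix x
      have "\<forall>\<^sub>F n in sequentially. ennreal (?m n x) * indicator {0..K} x = 0"
      proof (cases "x \<in> {0..K}")
        case True
        then have x: "x \<ge> 0" by simp
        show ?thesis
          using cell_cl_eventually[OF step_dataD(1)[OF sd] x] by eventually_elim (use x in \<open>simp add: stepD_def\<close>)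
      qed simp
      then show "(\<lambda>n. ennreal (?m n x) * indicator {0..K} x) \<longlonglongrightarrow> 0"
        by (rule tendsto_eventually)
    qed
    show "(\<integral>\<^sup>+x. indicator {0..K} x \<partial>lborel) < \<infinity>" using K by simp
  qed simp_all
  then show ?thesis by simp
qed

text \<open>The sum is an integral over \<open>sqr K\<close> of
  \<open>(stepA - stepW) + (stepW - W0) - (wn - W0)\<close> against the test functions. The first
  two differences are estimated in L1; only the last, which need not be small in L1, takes the cut
  norm.\<close>

lemma head_cut_bound:
  assumes sd: "step_data h m w \<eta>" and n: "n \<ge> 1" and K: "K > 0" and f: "\<And>u. 0 \<le> f u \<and> f u \<le> 1"
    and i: "integrable lborel (\<lambda>z. \<bar>stepW h w z - W0 z\<bar>)"
  shows "\<bar>(p n)\<^sup>2 * (\<Sum>u\<in>{1..nK K n}. \<Sum>v\<in>{1..nK K n}. (stepA h w n u v - adj (E n) u v) * f u * f v)\<bar>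
    \<le> discrW h w K n + (LINT z|lborel. \<bar>stepW h w z - W0 z\<bar>) + cut_dist K (gk n) W"
proof -
  let ?N = "nK K n"
  \<comment> \<open>Restricted to the head, the test function vanishes outside the square of side
    \<open>K\<close>, because \<open>nK K n * p n \<le> K\<close>; composed with
    \<open>cl (r n)\<close> it is a test function on the line.\<close>
  define F :: "nat \<Rightarrow> real" where "F u = (if u \<in> {1..?N} then f u else 0)" for u
  let ?c = "\<lambda>z. cl (r n) (fst z)" and ?d = "\<lambda>z. cl (r n) (snd z)"
  let ?I = "\<lambda>z. indicator (sqr K) z :: real"
  have F01: "\<bar>F u\<bar> \<le> 1" for u using f[of u] by (simp add: F_def)
  have FF: "\<bar>a * F u * F v\<bar> \<le> \<bar>a\<bar>" for a u v
  proof -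
    have "\<bar>a\<bar> * \<bar>F u\<bar> * \<bar>F v\<bar> \<le> \<bar>a\<bar> * 1 * 1" by (intro mult_mono F01) auto
    then show ?thesis by (simp add: abs_mult)
  qed
  have [measurable]: "(\<lambda>z. stepA h w n (?c z) (?d z)) \<in> borel_measurable borel" by (rule stepA_measurable)
  have [measurable]: "(\<lambda>z::real \<times> real. F (?c z)) \<in> borel_measurable borel" "(\<lambda>z::real \<times> real. F (?d z)) \<in> borel_measurable borel"
    using measurable_cl_pair[of "\<lambda>a b. F a" "r n"] measurable_cl_pair[of "\<lambda>a b. F b" "r n"] by auto
  let ?a = "\<lambda>z. (stepA h w n (?c z) (?d z) - stepW h w z) * F (?c z) * F (?d z)"
  let ?b = "\<lambda>z. (stepW h w z - W0 z) * F (?c z) * F (?d z)"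
  let ?e = "\<lambda>z. (wn n z - W0 z) * F (?c z) * F (?d z)"
  have ab: "\<bar>?a z\<bar> \<le> 1" for z by (rule order_trans[OF FF stepA_diff[OF sd]])
  have sW: "\<bar>stepW h w z - W0 z\<bar> \<le> 1" for z using stepW_bounds[OF sd, of z] W0(2,3)[of z] by (simp add: abs_le_iff)
  have bb: "\<bar>?b z\<bar> \<le> 1" for z by (rule order_trans[OF FF sW])
  have eb: "\<bar>?e z\<bar> \<le> 1" for z by (rule order_trans[OF FF W_diff])
  have ia: "integrable lborel (\<lambda>z. ?I z * ?a z)" using K ab by (intro integrable_on_sqr) auto
  have ib: "integrable lborel (\<lambda>z. ?I z * ?b z)" using K bb by (intro integrable_on_sqr) auto
  have ie: "integrable lborel (\<lambda>z. ?I z * ?e z)" using K eb by (intro integrable_on_sqr) auto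
  have "(LINT z|lborel. (stepA h w n (?c z) (?d z) - adj (E n) (?c z) (?d z)) * F (?c z) * F (?d z))
     = (1 / r n)\<^sup>2 * (\<Sum>u\<in>{1..?N}. \<Sum>v\<in>{1..?N}. (stepA h w n u v - adj (E n) u v) * F u * F v)"
    by (rule integral_cl2(2)[OF r_pos[OF n], of ?N "\<lambda>u v. (stepA h w n u v - adj (E n) u v) * F u * F v"]) (auto simp: F_def)
  also have "(\<Sum>u\<in>{1..?N}. \<Sum>v\<in>{1..?N}. (stepA h w n u v - adj (E n) u v) * F u * F v) = (\<Sum>u\<in>{1..?N}. \<Sum>v\<in>{1..?N}. (stepA h w n u v - adj (E n) u v) * f u * f v)"
    by (intro sum.cong refl) (simp add: F_def)
  finally have S: "(p n)\<^sup>2 * (\<Sum>u\<in>{1..?N}. \<Sum>v\<in>{1..?N}. (stepA h w n u v - adj (E n) u v) * f u * f v)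
     = (LINT z|lborel. (stepA h w n (?c z) (?d z) - adj (E n) (?c z) (?d z)) * F (?c z) * F (?d z))"
    by (simp only: p_r[OF n])
  also have "\<dots> = (LINT z|lborel. (?I z * ?a z + ?I z * ?b z) - ?I z * ?e z)"
  proof (intro Bochner_Integration.integral_cong refl)
    fix z
    show "(stepA h w n (?c z) (?d z) - adj (E n) (?c z) (?d z)) * F (?c z) * F (?d z) = (?I z * ?a z + ?I z * ?b z) - ?I z * ?e z"
    proof (cases "z \<in> sqr K")
      case True
      then show ?thesis by (simp add: wn_def algebra_simps)
    next
      case False
      have "F (?c z) = 0 \<or> F (?d z) = 0"
      proof (rule ccontr)
        assume "\<not> ?thesis"
        then have "?c z \<in> {1..?N}" "?d z \<in> {1..?N}" by (auto simp: F_def split: if_splits)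
        then have "fst z \<in> {0<..K}" "snd z \<in> {0<..K}" using nK_cl[OF n K] by blast+
        then show False using False by (cases z) auto
      qed
      then show ?thesis using False by auto
    qed
  qed
  also have "\<dots> = ((LINT z|lborel. ?I z * ?a z) + (LINT z|lborel. ?I z * ?b z)) - (LINT z|lborel. ?I z * ?e z)"
    by (simp only: Bochner_Integration.integral_diff[OF Bochner_Integration.integrable_add[OF ia ib] ie] Bochner_Integration.integral_add[OF ia ib])
  finally have eq: "(p n)\<^sup>2 * (\<Sum>u\<in>{1..?N}. \<Sum>v\<in>{1..?N}. (stepA h w n u v - adj (E n) u v) * f u * f v)
    = ((LINT z|lborel. ?I z * ?a z) + (LINT z|lborel. ?I z * ?b z)) - (LINT z|lborel. ?I z * ?e z)" .
  have "\<bar>LINT z|lborel. ?I z * ?a z\<bar> \<le> discrW h w K n"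
    unfolding discrW_def
  proof (rule order_trans[OF integral_abs_bound], rule integral_mono)
    show "integrable lborel (\<lambda>z. ?I z * \<bar>stepA h w n (?c z) (?d z) - stepW h w z\<bar>)"
      using K stepA_diff[OF sd] by (intro integrable_on_sqr) auto
  qed (use ia FF in \<open>auto simp: indicator_def\<close>)
  moreover have "\<bar>LINT z|lborel. ?I z * ?b z\<bar> \<le> (LINT z|lborel. \<bar>stepW h w z - W0 z\<bar>)"
    by (rule order_trans[OF integral_abs_bound], rule integral_mono) (use ib i FF in \<open>auto simp: indicator_def\<close>)
  moreover have "\<bar>LINT z|lborel. ?I z * ?e z\<bar> \<le> cut_dist K (gk n) W"
    using cut_bound[OF n less_imp_le[OF K] measurable_comp_cl[of F "r n"] F01 measurable_comp_cl[of F "r n"] F01] by simp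
  ultimately show ?thesis unfolding eq by linarith
qed

text \<open>The point \<open>K\<close> cuts at most the interval of the vertex after
  \<open>nK K n\<close>, whose contribution to a row is at most \<open>p n\<close>.\<close>

lemma res_tail_degree:
  assumes n: "n \<ge> 1" and K: "K > 0"
  shows "\<bar>p n * real (nb (E n) {nK K n<..n} (cl (r n) x)) - res K n x\<bar> \<le> p n"
proof -
  let ?N = "nK K n" and ?p = "p n" and ?u = "cl (r n) x"
  define m where "m v = measure lborel ({0..K} \<inter> cellI (r n) v)" for v
  have p: "?p > 0" by (rule p_pos[OF n])
  note cell = cellI_p[OF n]
  have m01: "0 \<le> m v" "m v \<le> ?p" for v
    using measure_part_cellI[OF n, of _ v] by (simp_all add: m_def)
  have m1: "m v = ?p" if "v \<ge> 1" "v \<le> ?N" for v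
  proof -
    have "real v * ?p \<le> real ?N * ?p" "0 \<le> (real v - 1) * ?p" using that p by (auto intro!: mult_right_mono)
    then have "{0..K} \<inter> cellI (r n) v = cellI (r n) v" using floor_K(1)[OF n K] by (auto simp: cell nK_def)
    then show ?thesis by (simp add: m_def measure_cellI[OF n])
  qed
  have m0: "m v = 0" if "v > Suc ?N" for v
  proof -
    have "(real ?N + 1) * ?p \<le> (real v - 1) * ?p" using that p by (intro mult_right_mono) auto
    then have "{0..K} \<inter> cellI (r n) v = {}" using floor_K(2)[OF n K] by (auto simp: cell nK_def)
    then show ?thesis by (simp add: m_def)
  qed
  have sl: "(LINT y|lborel. indicator {0..K} y * wn n (x, y)) = (\<Sum>v\<in>{1..n}. adj (E n) ?u v * m v)"
    using wn_slice(2)[OF n, of "{0..K}" x] by (simp add: set_lebesgue_integral_def m_def)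
  have dnx: "dn n x = (\<Sum>v\<in>{1..n}. adj (E n) ?u v * ?p)"
    by (simp add: dn_def nb_def adj_def insert_commute sum.If_cases Int_def sum_distrib_right[symmetric])
  have tail: "?p * real (nb (E n) {?N<..n} ?u) = (\<Sum>v\<in>{1..n}. adj (E n) ?u v * (if v > ?N then ?p else 0))"
  proof -
    have "?p * real (nb (E n) {?N<..n} ?u) = (\<Sum>v\<in>{?N<..n}. adj (E n) ?u v * ?p)"
      by (simp add: nb_def adj_def insert_commute sum.If_cases Int_def sum_distrib_right[symmetric])
    also have "\<dots> = (\<Sum>v\<in>{?N<..n}. adj (E n) ?u v * (if v > ?N then ?p else 0))" by (intro sum.cong) auto
    also have "\<dots> = (\<Sum>v\<in>{1..n}. adj (E n) ?u v * (if v > ?N then ?p else 0))"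
      by (intro sum.mono_neutral_left) auto
    finally show ?thesis .
  qed
  have "?p * real (nb (E n) {?N<..n} ?u) - res K n x = (\<Sum>v\<in>{1..n}. adj (E n) ?u v * ((if v > ?N then ?p else 0) + m v - ?p))"
    unfolding res_def sl dnx tail by (simp add: sum.distrib sum_subtractf distrib_left right_diff_distrib)
  also have "\<bar>\<dots>\<bar> \<le> (\<Sum>v\<in>{1..n}. if v = Suc ?N then ?p else 0)"
  proof (rule order_trans[OF sum_abs], rule sum_mono)
    fix v assume v: "v \<in> {1..n}"
    consider "v \<le> ?N" | "v > Suc ?N" | "v = Suc ?N" by linarith
    then show "\<bar>adj (E n) ?u v * ((if v > ?N then ?p else 0) + m v - ?p)\<bar> \<le> (if v = Suc ?N then ?p else 0)"
    proof cases
      case 1 then show ?thesis using m1 v by simp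
    next
      case 2 then show ?thesis using m0 by simp
    next
      case 3
      have "adj (E n) ?u v * m v \<le> 1 * ?p" using adj_bounds m01 by (intro mult_mono) auto
      then show ?thesis using 3 adj_bounds(1)[of "E n" ?u v] m01[of v] by (simp add: abs_mult)
    qed
  qed
  also have "\<dots> \<le> ?p" using p by (simp add: sum.delta)
  finally show ?thesis .
qed

text \<open>The sum is the integral of a function constant on vertex intervals, and the triangle
  inequality leads through \<open>res\<close>, \<open>D0\<close> and the step function. The term
  \<open>p n * K\<close> is the error of the cut interval, integrated over the rows up to
  \<open>K\<close>.\<close>

lemma head_degree_bound:
  assumes sd: "step_data h m w \<eta>" and n: "n \<ge> 1" and K: "K > 0"
  shows "ennreal (p n * (\<Sum>u\<in>{1..nK K n}. min 1 \<bar>p n * real (nb (E n) {nK K n<..n} u) - \<eta> (cell h (real u * p n))\<bar>))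
    \<le> (T1 K n + T2 K n + T3 K) + ennreal (p n * K) + L1dist lborel (stepD h \<eta>) D0 + discrD h \<eta> K n"
proof -
  let ?N = "nK K n" and ?p = "p n"
  define g where "g u = (if u \<in> {1..?N} then min 1 \<bar>?p * real (nb (E n) {?N<..n} u) - \<eta> (cell h (real u * ?p))\<bar> else 0)" for u
  have p: "?p > 0" by (rule p_pos[OF n])
  let ?d = "\<lambda>x. min 1 \<bar>stepD h \<eta> x - \<eta> (cell h (real (cl (r n) x) * ?p))\<bar>" and ?r = "\<lambda>x. min 1 \<bar>res K n x - D0 x\<bar>"
  have [measurable]: "(\<lambda>x. \<eta> (cell h (real (cl (r n) x) * p n))) \<in> borel_measurable borel"
    by (rule measurable_comp_cl)
  have "ennreal (?p * (\<Sum>u\<in>{1..?N}. min 1 \<bar>?p * real (nb (E n) {?N<..n} u) - \<eta> (cell h (real u * ?p))\<bar>))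
     = ennreal (1 / r n * (\<Sum>u\<in>{1..?N}. g u))" by (simp add: p_r[OF n] g_def)
  also have "\<dots> = (\<integral>\<^sup>+x. ennreal (g (cl (r n) x)) \<partial>lborel)"
    by (rule nn_integral_cl[OF r_pos[OF n], symmetric]) (auto simp: g_def)
  also have "\<dots> \<le> (\<integral>\<^sup>+x. ennreal (?r x) * indicator {0..K} x + ennreal ?p * indicator {0..K} x
      + ennreal \<bar>stepD h \<eta> x - D0 x\<bar> + ennreal (?d x) * indicator {0..K} x \<partial>lborel)"
  proof (rule nn_integral_mono)
    fix x
    show "ennreal (g (cl (r n) x)) \<le> ennreal (?r x) * indicator {0..K} x + ennreal ?p * indicator {0..K} x
      + ennreal \<bar>stepD h \<eta> x - D0 x\<bar> + ennreal (?d x) * indicator {0..K} x"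
    proof (cases "cl (r n) x \<in> {1..?N}")
      case True
      then have x: "x \<in> {0..K}" using nK_cl[OF n K True] by auto
      let ?s = "\<eta> (cell h (real (cl (r n) x) * ?p))"
      have "g (cl (r n) x) = min 1 \<bar>?p * real (nb (E n) {?N<..n} (cl (r n) x)) - ?s\<bar>" using True by (simp add: g_def)
      also have "\<dots> \<le> min 1 \<bar>res K n x - D0 x\<bar> + ?p + \<bar>stepD h \<eta> x - D0 x\<bar> + min 1 \<bar>stepD h \<eta> x - ?s\<bar>"
      proof -
        have "\<bar>?p * real (nb (E n) {?N<..n} (cl (r n) x)) - ?s\<bar> \<le> \<bar>res K n x - D0 x\<bar> + ?p + \<bar>stepD h \<eta> x - D0 x\<bar> + \<bar>stepD h \<eta> x - ?s\<bar>"
          using res_tail_degree[OF n K, of x] by linarith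
        then show ?thesis by (rule min_add4_le) (use p in auto)
      qed
      finally have "ennreal (g (cl (r n) x)) \<le> ennreal (min 1 \<bar>res K n x - D0 x\<bar> + ?p + \<bar>stepD h \<eta> x - D0 x\<bar> + min 1 \<bar>stepD h \<eta> x - ?s\<bar>)"
        by (rule ennreal_leI)
      also have "\<dots> = ennreal (?r x) + ennreal ?p + ennreal \<bar>stepD h \<eta> x - D0 x\<bar> + ennreal (min 1 \<bar>stepD h \<eta> x - ?s\<bar>)"
        using p by simp
      finally show ?thesis using x by simp
    next
      case False
      then have "g (cl (r n) x) = 0" by (auto simp: g_def)
      then show ?thesis by simp
    qed
  qed
  also have "\<dots> = (\<integral>\<^sup>+x. ennreal (?r x) * indicator {0..K} x \<partial>lborel) + ennreal (?p * K)
      + L1dist lborel (stepD h \<eta>) D0 + discrD h \<eta> K n"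
    unfolding discrD_def using K p by (simp add: nn_integral_add nn_integral_cmult_indicator ennreal_mult)
  also have "\<dots> \<le> (T1 K n + T2 K n + T3 K) + ennreal (p n * K) + L1dist lborel (stepD h \<eta>) D0 + discrD h \<eta> K n"
    using K by (intro add_mono res_bound n) auto
  finally show ?thesis .
qed

text \<open>The joint generating function of the numbers of head-head, head-tail and tail-tail edges
  in the random set; only the splitting depends on \<open>K\<close>.\<close>

definition gf :: "real \<Rightarrow> real \<Rightarrow> real \<Rightarrow> real \<Rightarrow> nat \<Rightarrow> real" where
  "gf z1 z2 z3 K n = bern {1..n} (p n) (\<lambda>A. z1 ^ ec (E n) (A \<inter> {..nK K n}) * z2 ^ eHR (E n) (nK K n) A * z3 ^ ec (E n) (A \<inter> {nK K n<..}))"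

abbreviation laplace :: "'b measure \<Rightarrow> ('b \<Rightarrow> real set) \<Rightarrow> real \<Rightarrow> real \<Rightarrow> real" where
  "laplace P S t1 t2 \<equiv> \<integral>\<omega>. exp (1 / 2 * stoch_integral P S 2 (\<lambda>x. phi W t1 (x 0) (x 1)) \<omega>
                    - (1 - exp (- t2)) * stoch_integral P S 1 (\<lambda>x. Delta d W (x 0)) \<omega>) \<partial>P"

text \<open>The step data are fixed first; only then \<open>K\<close> and finally \<open>n\<close>
  become large, because the convergence to the Poisson process and the discretisation errors are
  controlled only for fixed data and fixed \<open>K\<close>.\<close>

lemma gf_tendsto:
  assumes pp: "pois_proc P S" and t: "t1 \<ge> 0" "t2 \<ge> 0" and s3: "0 \<le> s3" "s3 \<le> 1"
  shows "((\<lambda>(K, n). gf (exp (- t1)) (exp (- t2)) (1 - s3) K n) \<longlongrightarrow>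
    exp (- (s3 * lam0)) * laplace P S t1 t2) iter_filter"
proof -
  interpret pois_proc P S by (rule pp)
  let ?s1 = "1 - exp (- t1)" and ?s2 = "1 - exp (- t2)"
  let ?G = "laplace P S t1 t2"
  note ctx = W integrable_W0[unfolded W0_def] integrable_D0[folded D0_eq] D0_nonneg[folded D0_eq]
  obtain C where C: "C > 0" "\<forall>\<^sub>F n in sequentially. real (card (E n)) * (p n)\<^sup>2 \<le> C" by (rule edge_bound)
  have s: "0 \<le> ?s1" "?s1 \<le> 1" "?s1 < 1" "0 \<le> ?s2" "?s2 \<le> 1" using t by auto
  have p_ev: "\<forall>\<^sub>F n in sequentially. 0 < p n" using p_pos by (auto simp: eventually_sequentially)
  show ?thesis
  proof (rule tendstoI)
    fix \<epsilon> :: real assume \<epsilon>: "\<epsilon> > 0"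
    \<comment> \<open>The errors below add up to less than \<open>(exp t1 + 1) * e\<close> from the
      step data in the limit and \<open>19 * e\<close> from everything else.\<close>
    define e where "e = \<epsilon> / (exp t1 + 20)"
    have e: "e > 0" using \<epsilon> by (simp add: e_def add_pos_pos)
    have "exp t1 + 20 > (0::real)" by (simp add: add_pos_pos)
    then have e\<epsilon>: "(exp t1 + 20) * e = \<epsilon>" by (simp add: e_def)
    obtain h m w \<eta> where sd: "step_data h m w \<eta>" and dW: "L1dist lborel (stepW h w) (ext2 W) < ennreal e"
      and dD: "L1dist lborel (stepD h \<eta>) (ext1 (Delta d W)) < ennreal e"
      by (rule step_approx_ex[OF ctx e])
    let ?L = "expectation (\<lambda>\<omega>. exp (1/2 * elem_integral S 2 m (grid h) (\<lambda>i. ln (1 - ?s1 * w (i 0) (i 1))) \<omega>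
        - ?s2 * elem_integral S 1 m (grid h) (\<lambda>i. \<eta> (i 0)) \<omega>))"
    have LG: "\<bar>?L - ?G\<bar> \<le> (exp t1 + 1) * e" by (rule step_laplace_dist[OF ctx t e sd dW dD])
    have dD': "L1dist lborel (stepD h \<eta>) D0 < ennreal e" using dD by (simp only: D0_eq)
    have dW': "L1dist lborel (stepW h w) W0 < ennreal e" using dW by (simp only: W0_def)
    have iW: "integrable lborel (\<lambda>z. \<bar>stepW h w z - W0 z\<bar>)"
      using dW' by (intro integrableI_nonneg) (auto intro: less_trans)
    have eW: "(LINT z|lborel. \<bar>stepW h w z - W0 z\<bar>) < e"
      using dW' nn_integral_eq_integral[OF iW] e by (simp add: ennreal_less_iff)
    define \<eta>v where "\<eta>v n u = \<eta> (cell h (real u * p n))" for n and u :: nat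
    define B where "B K n = bern {1..nK K n} (p n) (Psi ?s1 (stepA h w n) (\<lambda>u. exp (- ?s2 * \<eta>v n u)))" for K n
    have B_lim: "B K \<longlonglongrightarrow> ?L" if K: "K > real m * h" for K
      unfolding B_def stepA_def[abs_def] \<eta>v_def nK_def
      using bern_step_limit[OF p_lim p_ev step_dataD(1)[OF sd] K, of w \<eta> ?s1 ?s2] step_dataD[OF sd] s by simp
    have "((\<lambda>(K, n). B K n) \<longlongrightarrow> ?L) iter_filter"
    proof (rule tendstoI)
      fix \<delta> :: real assume \<delta>: "\<delta> > 0"
      have "\<forall>\<^sub>F K in at_top. \<forall>\<^sub>F n in sequentially. dist (B K n) ?L < \<delta>"
        using eventually_gt_at_top[of "real m * h"] by eventually_elim (intro tendstoD B_lim \<delta>)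
      then show "\<forall>\<^sub>F z in iter_filter. dist (case z of (K, n) \<Rightarrow> B K n) ?L < \<delta>" by (simp add: eventually_iter_filter)
    qed
    then have "((\<lambda>z. exp (- (s3 * (case z of (K, n) \<Rightarrow> lam K n))) * (case z of (K, n) \<Rightarrow> B K n)) \<longlongrightarrow> exp (- (s3 * lam0)) * ?L) iter_filter"
      by (intro tendsto_intros lam_tendsto)
    from tendstoD[OF this e] have ev1: "\<forall>\<^sub>F K in at_top. \<forall>\<^sub>F n in sequentially. \<bar>exp (- (s3 * lam K n)) * B K n - exp (- (s3 * lam0)) * ?L\<bar> < e"
      by (simp add: eventually_iter_filter dist_real_def)
    have T3e: "\<forall>\<^sub>F K in at_top. T3 K < ennreal e" using e by (intro order_tendstoD(2)[OF T3_tendsto]) simp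
    have Ke: "\<forall>\<^sub>F K in at_top. 16 * C\<^sup>2 / K < e"
    proof -
      have "((\<lambda>K. 16 * C\<^sup>2 / K) \<longlongrightarrow> 0) at_top" by (intro tendsto_divide_0[OF tendsto_const] filterlim_at_top_imp_at_infinity filterlim_ident)
      then show ?thesis using e by (rule order_tendstoD)
    qed
    have "\<forall>\<^sub>F K in at_top. \<forall>\<^sub>F n in sequentially. \<bar>gf (exp (- t1)) (exp (- t2)) (1 - s3) K n - exp (- (s3 * lam0)) * ?G\<bar> < \<epsilon>"
      using ev1 T3e Ke T_sum_tendsto cut_tendsto
    proof eventually_elim
      case (elim K)
      then have K: "K > 0" by simp
      have c1: "\<forall>\<^sub>F n in sequentially. 4 * p n * C < e"
      proof -
        have "(\<lambda>n. 4 * p n * C) \<longlonglongrightarrow> 4 * 0 * C" by (intro tendsto_intros p_lim)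
        then show ?thesis using e by (intro order_tendstoD(2)) auto
      qed
      have c2: "\<forall>\<^sub>F n in sequentially. T1 K n + T2 K n + T3 K < ennreal e"
        using elim by (intro order_tendstoD(2)) auto
      have c3: "\<forall>\<^sub>F n in sequentially. p n * K < e"
      proof -
        have "(\<lambda>n. p n * K) \<longlonglongrightarrow> 0 * K" by (intro tendsto_intros p_lim)
        then show ?thesis using e by (intro order_tendstoD(2)) auto
      qed
      have c4: "\<forall>\<^sub>F n in sequentially. discrD h \<eta> K n < ennreal e"
        using e by (intro order_tendstoD(2)[OF discrD_tendsto[OF sd K]]) auto
      have c5: "\<forall>\<^sub>F n in sequentially. discrW h w K n < e" using e by (intro order_tendstoD(2)[OF discrW_tendsto[OF sd K]]) auto
      have c6: "\<forall>\<^sub>F n in sequentially. cut_dist K (gk n) W < e" using elim(5) e by (intro order_tendstoD(2)[of _ 0]) auto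
      have c7: "\<forall>\<^sub>F n in sequentially. 2 * p n * K\<^sup>2 < e"
      proof -
        have "(\<lambda>n. 2 * p n * K\<^sup>2) \<longlonglongrightarrow> 2 * 0 * K\<^sup>2" by (intro tendsto_intros p_lim)
        then show ?thesis using e by (intro order_tendstoD(2)) auto
      qed
      from elim(1) C(2) eventually_ge_at_top[of 1] c1 c2 c3 c4 c5 c6 c7 show ?case
      proof eventually_elim
        case (elim n)
        note n = elim(3)
        have p: "0 < p n" "p n \<le> 1" using p_pos[OF n] p_le1[OF n] by auto
        let ?Cn = "real (card (E n)) * (p n)\<^sup>2"
        let ?\<kappa> = "discrW h w K n + (LINT z|lborel. \<bar>stepW h w z - W0 z\<bar>) + cut_dist K (gk n) W"
        have A: "\<bar>gf (exp (- t1)) (exp (- t2)) (1 - s3) K n - exp (- (s3 * lam K n)) * B K n\<bar>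
          \<le> (4 * p n * ?Cn + 16 * ?Cn\<^sup>2 / K) + p n * (\<Sum>u\<in>{1..nK K n}. min 1 \<bar>p n * real (nb (E n) {nK K n<..n} u) - \<eta>v n u\<bar>)
            + (?\<kappa> + 2 * p n ^ 3 * (real (nK K n))\<^sup>2)"
        proof -
          have wb: "0 \<le> stepA h w n u v \<and> stepA h w n u v \<le> 1 \<and> stepA h w n u v = stepA h w n v u \<and> stepA h w n u u = 0" for u v
            using step_dataD(2-4)[OF sd] by (simp add: stepA_def)
          have \<eta>b: "\<eta>v n u \<ge> 0" for u using step_dataD(7)[OF sd] by (simp add: \<eta>v_def)
          have z: "1 - ?s1 = exp (- t1)" "1 - ?s2 = exp (- t2)" by simp_all
          note gb = generating_function_bound[OF graph[OF n] labels[OF n] p K s(1,2,4,5) s3, of "stepA h w n" "\<eta>v n" ?\<kappa>]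
          show ?thesis
            using gb[folded nK_def, OF wb \<eta>b head_cut_bound[OF sd n K _ iW]] unfolding z gf_def B_def lam_def nK_def .
        qed
        have a1: "4 * p n * ?Cn < e"
        proof -
          have "4 * p n * ?Cn \<le> 4 * p n * C" using elim(2) p by (intro mult_left_mono) auto
          then show ?thesis using elim(4) by linarith
        qed
        have a2: "16 * ?Cn\<^sup>2 / K < e"
        proof -
          have "16 * ?Cn\<^sup>2 / K \<le> 16 * C\<^sup>2 / K" using elim(2) p K by (intro divide_right_mono mult_left_mono power_mono) auto
          then show ?thesis using \<open>16 * C\<^sup>2 / K < e\<close> by linarith
        qed
        have a3: "p n * (\<Sum>u\<in>{1..nK K n}. min 1 \<bar>p n * real (nb (E n) {nK K n<..n} u) - \<eta>v n u\<bar>) \<le> 4 * e"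
        proof -
          have "ennreal (p n * (\<Sum>u\<in>{1..nK K n}. min 1 \<bar>p n * real (nb (E n) {nK K n<..n} u) - \<eta>v n u\<bar>))
            \<le> ennreal e + ennreal e + ennreal e + ennreal e"
            unfolding \<eta>v_def
            by (rule order_trans[OF head_degree_bound[OF sd n K]]) (use elim dD' in \<open>intro add_mono ennreal_leI; simp add: less_imp_le\<close>)
          also have "\<dots> = ennreal (4 * e)" using e by (simp add: ennreal_plus[symmetric] del: ennreal_plus)
          finally show ?thesis using e by (simp add: ennreal_le_iff)
        qed
        have a4: "2 * p n ^ 3 * (real (nK K n))\<^sup>2 < e"
        proof -
          have "(real (nK K n) * p n)\<^sup>2 \<le> K\<^sup>2" using floor_K(1)[OF n K] p by (intro power_mono) (auto simp: nK_def)
          then have "2 * p n * (real (nK K n) * p n)\<^sup>2 \<le> 2 * p n * K\<^sup>2" using p by (intro mult_left_mono) auto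
          then show ?thesis using elim(10) by (simp add: power2_eq_square power3_eq_cube mult_ac)
        qed
        have a5: "\<bar>exp (- (s3 * lam0)) * ?L - exp (- (s3 * lam0)) * ?G\<bar> \<le> (exp t1 + 1) * e"
        proof -
          have "\<bar>exp (- (s3 * lam0)) * ?L - exp (- (s3 * lam0)) * ?G\<bar> = exp (- (s3 * lam0)) * \<bar>?L - ?G\<bar>"
            by (simp add: right_diff_distrib[symmetric] abs_mult)
          also have "\<dots> \<le> 1 * \<bar>?L - ?G\<bar>" using s3 lam0_nonneg by (intro mult_right_mono) auto
          finally show ?thesis using LG by simp
        qed
        have "\<epsilon> = (exp t1 + 1) * e + 19 * e" unfolding e\<epsilon>[symmetric] by (simp add: algebra_simps)
        then show ?case using A a1 a2 a3 a4 a5 elim(1,8,9) eW e by linarith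
      qed
    qed
    then show "\<forall>\<^sub>F z in iter_filter. dist (case z of (K, n) \<Rightarrow> gf (exp (- t1)) (exp (- t2)) (1 - s3) K n) (exp (- (s3 * lam0)) * ?G) < \<epsilon>"
      by (simp add: eventually_iter_filter dist_real_def)
  qed
qed

end

section \<open>Reduction to indicators\<close>

lemma edge_count_eq:
  assumes g: "simple_graph n E"
  shows "2 * real (ec E {u \<in> {1..n}. Q u}) = (\<Sum>u\<in>{1..n}. \<Sum>v\<in>{1..n}. adj E u v * (of_bool (Q u) * of_bool (Q v)))"
proof -
  let ?A = "{u \<in> {1..n}. Q u}"
  have "2 * real (ec E ?A) = (\<Sum>u\<in>?A. \<Sum>v\<in>?A. adj E u v)" by (rule ec_adj[OF g]) simp
  also have "\<dots> = (\<Sum>u\<in>?A. \<Sum>v\<in>{1..n}. adj E u v * (of_bool (Q u) * of_bool (Q v)))"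
    by (intro sum.cong refl sum.mono_neutral_cong_left) auto
  also have "\<dots> = (\<Sum>u\<in>{1..n}. \<Sum>v\<in>{1..n}. adj E u v * (of_bool (Q u) * of_bool (Q v)))"
    by (intro sum.mono_neutral_left) auto
  finally show ?thesis .
qed

lemma T_stat_measurable:
  assumes X: "\<And>u. u \<in> {1..n} \<Longrightarrow> X u \<in> measurable M (count_space UNIV)"
  shows "T_stat n E X \<in> borel_measurable M"
proof -
  have fX: "(\<lambda>\<omega>. f (X u \<omega>)) \<in> borel_measurable M" if "u \<in> {1..n}" for u and f :: "nat \<Rightarrow> real"
    using measurable_compose[OF X[OF that], of f borel] by simp
  have "(\<lambda>\<omega>. 1 / 2 * (\<Sum>u=1..n. \<Sum>v=1..n. adj E u v * real (X u \<omega>) * real (X v \<omega>))) \<in> borel_measurable M"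
    by (intro borel_measurable_times borel_measurable_const borel_measurable_sum fX)
  then show ?thesis by (simp only: T_stat_def[abs_def])
qed

lemma edge_count_measurable:
  assumes X: "\<And>u. u \<in> {1..n} \<Longrightarrow> X u \<in> measurable M (count_space UNIV)" and g: "simple_graph n E"
  shows "(\<lambda>\<omega>. ec E {u \<in> {1..n}. X u \<omega> = (1::nat)}) \<in> measurable M (count_space UNIV)"
proof -
  have fX: "(\<lambda>\<omega>. of_bool (X u \<omega> = 1) :: real) \<in> borel_measurable M" if "u \<in> {1..n}" for u
    using measurable_compose[OF X[OF that], of "\<lambda>k. of_bool (k = 1)" borel] by simp
  have "(\<lambda>\<omega>. 1 / 2 * (\<Sum>u\<in>{1..n}. \<Sum>v\<in>{1..n}. adj E u v * (of_bool (X u \<omega> = 1) * of_bool (X v \<omega> = 1)))) \<in> borel_measurable M"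
    by (intro borel_measurable_times borel_measurable_const borel_measurable_sum fX)
  then have [measurable]: "(\<lambda>\<omega>. real (ec E {u \<in> {1..n}. X u \<omega> = 1})) \<in> borel_measurable M"
    unfolding edge_count_eq[OF g, symmetric] by simp
  \<comment> \<open>A natural number is recovered measurably from its real value.\<close>
  have "(\<lambda>\<omega>. nat \<lfloor>real (ec E {u \<in> {1..n}. X u \<omega> = 1})\<rfloor>) \<in> measurable M (count_space UNIV)" by measurable
  then show ?thesis by simp
qed

text \<open>Twice the difference of the two quadratic forms is a non-negative integer, so the
  probability that it is non-zero is at most its mean. A graph has no loops, hence only products of
  independent variables occur, and each edge contributes \<open>(E X)\<^sup>2 - p\<^sup>2\<close>
  twice.\<close>

lemma (in prob_space) replace_by_indicators:
  fixes X :: "nat \<Rightarrow> 'a \<Rightarrow> nat"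
  assumes ind: "indep_vars (\<lambda>_. count_space UNIV) X {1..n}"
    and ident: "\<And>u. u \<in> {1..n} \<Longrightarrow> distr M (count_space UNIV) (X u) = distr M (count_space UNIV) (X 1)"
    and n: "n \<ge> 1" and int: "integrable M (\<lambda>\<omega>. real (X 1 \<omega>))" and g: "simple_graph n E"
  shows "prob {\<omega> \<in> space M. T_stat n E X \<omega> \<noteq> real (ec E {u \<in> {1..n}. X u \<omega> = 1})}
    \<le> 2 * real (card E) * ((expectation (\<lambda>\<omega>. real (X 1 \<omega>)))\<^sup>2 - (prob {\<omega> \<in> space M. X 1 \<omega> = 1})\<^sup>2)"
proof -
  have Xm: "X u \<in> measurable M (count_space UNIV)" if "u \<in> {1..n}" for u
    using ind that by (auto simp: indep_vars_def)
  have fX: "(\<lambda>\<omega>. f (X u \<omega>)) \<in> borel_measurable M" if "u \<in> {1..n}" for u and f :: "nat \<Rightarrow> real"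
    using measurable_compose[OF Xm[OF that], of f borel] by simp
  have law: "integrable M (\<lambda>\<omega>. f (X u \<omega>)) \<longleftrightarrow> integrable M (\<lambda>\<omega>. f (X 1 \<omega>))"
    "expectation (\<lambda>\<omega>. f (X u \<omega>)) = expectation (\<lambda>\<omega>. f (X 1 \<omega>))" if u: "u \<in> {1..n}" for u and f :: "nat \<Rightarrow> real"
  proof -
    have 1: "1 \<in> {1..n}" using n by simp
    show "integrable M (\<lambda>\<omega>. f (X u \<omega>)) \<longleftrightarrow> integrable M (\<lambda>\<omega>. f (X 1 \<omega>))"
      using integrable_distr_eq[OF Xm[OF u], of f] integrable_distr_eq[OF Xm[OF 1], of f] ident[OF u] by simp
    show "expectation (\<lambda>\<omega>. f (X u \<omega>)) = expectation (\<lambda>\<omega>. f (X 1 \<omega>))"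
      using integral_distr[OF Xm[OF u], of f] integral_distr[OF Xm[OF 1], of f] ident[OF u] by simp
  qed
  have prod: "integrable M (\<lambda>\<omega>. f (X u \<omega>) * f (X v \<omega>)) \<and> expectation (\<lambda>\<omega>. f (X u \<omega>) * f (X v \<omega>)) = (expectation (\<lambda>\<omega>. f (X 1 \<omega>)))\<^sup>2"
    if uv: "u \<in> {1..n}" "v \<in> {1..n}" "u \<noteq> v" and f: "integrable M (\<lambda>\<omega>. f (X 1 \<omega>))" for u v and f :: "nat \<Rightarrow> real"
  proof -
    have i2: "indep_vars (\<lambda>_. borel) (\<lambda>i \<omega>. f (X i \<omega>)) {u, v}"
      using uv by (intro indep_vars_compose2[OF indep_vars_subset[OF ind]]) auto
    have "integrable M (\<lambda>\<omega>. f (X i \<omega>))" if "i \<in> {u, v}" for i using law(1)[of i f] that uv f by auto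
    with i2 have "expectation (\<lambda>\<omega>. \<Prod>i\<in>{u, v}. f (X i \<omega>)) = (\<Prod>i\<in>{u, v}. expectation (\<lambda>\<omega>. f (X i \<omega>)))"
      and "integrable M (\<lambda>\<omega>. \<Prod>i\<in>{u, v}. f (X i \<omega>))"
      by (intro indep_vars_lebesgue_integral indep_vars_integrable; simp)+
    then show ?thesis using uv law(2)[of u f] law(2)[of v f] by (simp add: power2_eq_square)
  qed
  define y where "y k = (of_bool (k = 1) :: nat)" for k :: nat
  have yx: "y a * y b \<le> a * b" for a b by (auto simp: y_def)
  have yint: "integrable M (\<lambda>\<omega>. real (y (X 1 \<omega>)))"
    using fX[of 1 "\<lambda>k. real (y k)"] n by (intro integrable_const_bound[of _ 1]) (auto simp: y_def)
  have yexp: "expectation (\<lambda>\<omega>. real (y (X 1 \<omega>))) = prob {\<omega> \<in> space M. X 1 \<omega> = 1}"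
  proof -
    have "expectation (\<lambda>\<omega>. real (y (X 1 \<omega>))) = expectation (indicator {\<omega> \<in> space M. X 1 \<omega> = 1})"
      by (intro Bochner_Integration.integral_cong refl) (auto simp: y_def indicator_def)
    also have "\<dots> = prob ({\<omega> \<in> space M. X 1 \<omega> = 1} \<inter> space M)" by simp
    also have "{\<omega> \<in> space M. X 1 \<omega> = 1} \<inter> space M = {\<omega> \<in> space M. X 1 \<omega> = 1}" by auto
    finally show ?thesis .
  qed
  \<comment> \<open>Natural subtraction is exact here, because the indicator of \<open>X = 1\<close>
    is at most \<open>X\<close>; that \<open>Z\<close> is an integer is then built in.\<close>
  define z where "z \<omega> u v = (if {u, v} \<in> E then X u \<omega> * X v \<omega> - y (X u \<omega>) * y (X v \<omega>) else 0)" for \<omega> u v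
  define Z where "Z \<omega> = (\<Sum>u\<in>{1..n}. \<Sum>v\<in>{1..n}. z \<omega> u v)" for \<omega>
  let ?T' = "\<lambda>\<omega>. ec E {u \<in> {1..n}. X u \<omega> = 1}"
  let ?v = "(expectation (\<lambda>\<omega>. real (X 1 \<omega>)))\<^sup>2 - (prob {\<omega> \<in> space M. X 1 \<omega> = 1})\<^sup>2"
  let ?D = "{\<omega> \<in> space M. T_stat n E X \<omega> \<noteq> real (?T' \<omega>)}"
  have zr: "real (z \<omega> u v) = adj E u v * (real (X u \<omega>) * real (X v \<omega>)) - adj E u v * (real (y (X u \<omega>)) * real (y (X v \<omega>)))" for \<omega> u v
    by (simp add: z_def adj_def of_nat_diff[OF yx])
  have T'eq: "2 * real (?T' \<omega>) = (\<Sum>u\<in>{1..n}. \<Sum>v\<in>{1..n}. adj E u v * (real (y (X u \<omega>)) * real (y (X v \<omega>))))" for \<omega>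
    using edge_count_eq[OF g, of "\<lambda>u. X u \<omega> = 1"] by (simp add: y_def)
  have Teq: "2 * T_stat n E X \<omega> = (\<Sum>u\<in>{1..n}. \<Sum>v\<in>{1..n}. adj E u v * (real (X u \<omega>) * real (X v \<omega>)))" for \<omega>
    by (simp add: T_stat_def mult.assoc)
  have TZ: "2 * (T_stat n E X \<omega> - real (?T' \<omega>)) = real (Z \<omega>)" for \<omega>
    unfolding right_diff_distrib Teq T'eq Z_def of_nat_sum zr sum_subtractf ..
  have one: "(1 :: real) \<le> real (Z \<omega>)" if "T_stat n E X \<omega> \<noteq> real (?T' \<omega>)" for \<omega>
  proof -
    have "real (Z \<omega>) \<noteq> 0" using TZ[of \<omega>] that by auto
    then show ?thesis by simp
  qed
  have Tm: "T_stat n E X \<in> borel_measurable M" by (rule T_stat_measurable[OF Xm])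
  have T'm: "(\<lambda>\<omega>. real (?T' \<omega>)) \<in> borel_measurable M"
    by (rule measurable_compose[OF edge_count_measurable[OF Xm g]]) simp_all
  define e where "e u v \<omega> = adj E u v * (real (X u \<omega>) * real (X v \<omega>)) - adj E u v * (real (y (X u \<omega>)) * real (y (X v \<omega>)))" for u v \<omega>
  have ee: "integrable M (e u v) \<and> expectation (e u v) = adj E u v * ?v"
    if uv: "u \<in> {1..n}" "v \<in> {1..n}" for u v
  proof (cases "u = v")
    case True
    then have "adj E u v = 0" using adj_diag[OF g] by simp
    then show ?thesis by (simp add: e_def[abs_def])
  next
    case False
    note a = prod[OF uv False int] and b = prod[OF uv False yint]
    show ?thesis
      unfolding e_def[abs_def] using a b by (simp add: Bochner_Integration.integral_diff yexp[unfolded One_nat_def] right_diff_distrib)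
  qed
  have "prob ?D = expectation (indicator ?D)"
    by (auto intro!: arg_cong[where f = prob])
  also have "\<dots> \<le> expectation (\<lambda>\<omega>. \<Sum>u\<in>{1..n}. \<Sum>v\<in>{1..n}. e u v \<omega>)"
  proof (rule integral_mono)
    have "?D \<in> events" using Tm T'm by measurable
    then show "integrable M (indicator ?D :: 'a \<Rightarrow> real)"
      by (intro integrable_real_indicator) (auto simp: emeasure_eq_measure)
    show "integrable M (\<lambda>\<omega>. \<Sum>u\<in>{1..n}. \<Sum>v\<in>{1..n}. e u v \<omega>)"
      by (intro Bochner_Integration.integrable_sum) (use ee in blast)
    fix \<omega>
    have "(\<Sum>u\<in>{1..n}. \<Sum>v\<in>{1..n}. e u v \<omega>) = real (Z \<omega>)" unfolding Z_def e_def zr[symmetric] of_nat_sum ..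
    then show "indicator ?D \<omega> \<le> (\<Sum>u\<in>{1..n}. \<Sum>v\<in>{1..n}. e u v \<omega>)"
      using one[of \<omega>] by (auto simp: indicator_def)
  qed
  also have "\<dots> = (\<Sum>u\<in>{1..n}. \<Sum>v\<in>{1..n}. expectation (e u v))"
  proof -
    have "expectation (\<lambda>\<omega>. \<Sum>u\<in>{1..n}. \<Sum>v\<in>{1..n}. e u v \<omega>) = (\<Sum>u\<in>{1..n}. expectation (\<lambda>\<omega>. \<Sum>v\<in>{1..n}. e u v \<omega>))"
      by (intro Bochner_Integration.integral_sum Bochner_Integration.integrable_sum) (use ee in blast)
    also have "\<dots> = (\<Sum>u\<in>{1..n}. \<Sum>v\<in>{1..n}. expectation (e u v))"
      by (intro sum.cong refl Bochner_Integration.integral_sum) (use ee in blast)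
    finally show ?thesis .
  qed
  also have "\<dots> = (\<Sum>u\<in>{1..n}. \<Sum>v\<in>{1..n}. adj E u v * ?v)"
    by (intro sum.cong refl) (use ee in blast)
  also have "\<dots> = 2 * real (card E) * ?v"
    by (simp only: sum_distrib_right[symmetric] sum_adj[OF g])
  finally show "prob ?D
    \<le> 2 * real (card E) * ?v" .
qed

lemma expectation_pair_pmf_mult:
  fixes f :: "'a \<Rightarrow> real" and g :: "'b \<Rightarrow> real"
  assumes f: "\<And>x. 0 \<le> f x \<and> f x \<le> 1" and g: "\<And>x. 0 \<le> g x \<and> g x \<le> 1"
  shows "measure_pmf.expectation (pair_pmf A B) (\<lambda>x. f (fst x) * g (snd x)) = measure_pmf.expectation A f * measure_pmf.expectation B g"
proof -
  have i: "(\<integral>\<^sup>+x. ennreal (h x) \<partial>measure_pmf C) = ennreal (measure_pmf.expectation C h)"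
    if "\<And>x. 0 \<le> h x \<and> h x \<le> 1" for C :: "'c pmf" and h
    using that by (intro nn_integral_eq_integral measure_pmf.integrable_const_bound[of _ 1]) auto
  have fg: "0 \<le> f (fst x) * g (snd x) \<and> f (fst x) * g (snd x) \<le> 1" for x using f g by (auto intro!: mult_le_one)
  have "ennreal (measure_pmf.expectation (pair_pmf A B) (\<lambda>x. f (fst x) * g (snd x))) = (\<integral>\<^sup>+a. \<integral>\<^sup>+b. ennreal (f a) * ennreal (g b) \<partial>measure_pmf B \<partial>measure_pmf A)"
    unfolding i[OF fg, symmetric] nn_integral_pair_pmf' using f g by (simp add: ennreal_mult)
  also have "\<dots> = ennreal (measure_pmf.expectation A f) * ennreal (measure_pmf.expectation B g)"
    by (simp add: nn_integral_cmult nn_integral_multc i[OF f] i[OF g])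
  also have "\<dots> = ennreal (measure_pmf.expectation A f * measure_pmf.expectation B g)"
    using f by (intro ennreal_mult'[symmetric] integral_nonneg_AE) auto
  finally show ?thesis using f g by (simp add: ennreal_inj integral_nonneg_AE fg)
qed

lemma pois_pgf:
  assumes "l \<ge> 0" "0 \<le> z" "z \<le> 1"
  shows "measure_pmf.expectation (pois l) (\<lambda>c. z ^ c) = exp (- ((1 - z) * l))"
proof (cases "l = 0")
  case True
  then show ?thesis by (simp add: pois_def)
next
  case False
  then have l: "l > 0" using assms by simp
  have z01: "0 \<le> z ^ c \<and> z ^ c \<le> 1" for c using assms by (simp add: power_le_one)
  have s: "(\<lambda>c. (l * z) ^ c / fact c * exp (- l)) sums (exp (l * z) * exp (- l))"
    using exp_converges[of "l * z"] by (intro sums_mult2) (simp add: divide_inverse mult.commute)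
  have "ennreal (measure_pmf.expectation (pois l) (\<lambda>c. z ^ c)) = (\<integral>\<^sup>+c. ennreal (z ^ c) \<partial>measure_pmf (pois l))"
    using z01 by (intro nn_integral_eq_integral[symmetric] measure_pmf.integrable_const_bound[of _ 1]) auto
  also have "\<dots> = (\<integral>\<^sup>+c. ennreal ((l * z) ^ c / fact c * exp (- l)) \<partial>count_space UNIV)"
    unfolding nn_integral_measure_pmf
    using l z01 False by (intro nn_integral_cong) (simp add: pois_def ennreal_mult'[symmetric] power_mult_distrib)
  also have "\<dots> = ennreal (exp (l * z) * exp (- l))"
    unfolding nn_integral_count_space_nat using s assms by (intro suminf_ennreal_eq) auto
  finally have "measure_pmf.expectation (pois l) (\<lambda>c. z ^ c) = exp (l * z) * exp (- l)"
    using z01 by (simp add: ennreal_inj integral_nonneg_AE)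
  then show ?thesis by (simp add: exp_add[symmetric] algebra_simps)
qed

section \<open>Limit laws of the edge counts\<close>

context graph_seq
begin

text \<open>A concrete random set with the required law. On a discrete law every function of the set
  is measurable, and limit points can be sought among mass functions.\<close>

definition bset :: "nat \<Rightarrow> nat set pmf" where
  "bset n = map_pmf (\<lambda>f. {u \<in> {1..n}. f u}) (Pi_pmf {1..n} False (\<lambda>_. bernoulli_pmf (p n)))"

lemma expectation_bset:
  assumes n: "n \<ge> 1"
  shows "measure_pmf.expectation (bset n) f = bern {1..n} (p n) f"
proof -
  let ?Q = "Pi_pmf {1..n} False (\<lambda>_. bernoulli_pmf (p n))"
  have pr: "measure_pmf.prob ?Q {g \<in> space (measure_pmf ?Q). g v} = p n" if v: "v \<in> {1..n}" for v
  proof -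
    have "measure_pmf.prob ?Q {g \<in> space (measure_pmf ?Q). g v} = pmf (map_pmf (\<lambda>g. g v) ?Q) True"
      by (simp add: pmf_map vimage_def)
    also have "map_pmf (\<lambda>g. g v) ?Q = bernoulli_pmf (p n)" using v by (simp add: Pi_pmf_component)
    finally show ?thesis using p_pos[OF n] p_le1[OF n] by simp
  qed
  have "measure_pmf.expectation (bset n) f = measure_pmf.expectation ?Q (\<lambda>g. f {u \<in> {1..n}. g u})"
    by (simp add: bset_def)
  also have "\<dots> = bern {1..n} (p n) f"
    by (rule measure_pmf.expectation_bern(1)[OF _ indep_vars_Pi_pmf pr]) auto
  finally show ?thesis .
qed

lemma bern_edge_count: "n \<ge> 1 \<Longrightarrow> bern {1..n} (p n) (\<lambda>A. real (ec (E n) A)) = real (card (E n)) * (p n)\<^sup>2"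
proof -
  assume n: "n \<ge> 1"
  have c: "real (ec (E n) A) = (\<Sum>u\<in>{1..n}. \<Sum>v\<in>{1..n}. adj (E n) u v / 2 * of_bool (u \<in> A \<and> v \<in> A))" if A: "A \<subseteq> {1..n}" for A
  proof -
    have "{u \<in> {1..n}. u \<in> A} = A" using A by auto
    then have "2 * real (ec (E n) A) = 2 * (\<Sum>u\<in>{1..n}. \<Sum>v\<in>{1..n}. adj (E n) u v / 2 * of_bool (u \<in> A \<and> v \<in> A))"
      using edge_count_eq[OF graph[OF n], of "\<lambda>u. u \<in> A"] by (simp add: sum_distrib_left of_bool_conj)
    then show ?thesis by simp
  qed
  have b: "bern {1..n} (p n) (\<lambda>A. adj (E n) u v / 2 * of_bool (u \<in> A \<and> v \<in> A)) = adj (E n) u v / 2 * (p n)\<^sup>2"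
    if "u \<in> {1..n}" "v \<in> {1..n}" for u v
  proof (cases "u = v")
    case True
    then show ?thesis using adj_diag[OF graph[OF n]] by (simp add: bern_const)
  next
    case False
    then show ?thesis using bern_prob2[OF finite_atLeastAtMost that False, of "p n"] by (simp only: bern_cmult)
  qed
  have "bern {1..n} (p n) (\<lambda>A. real (ec (E n) A)) = (\<Sum>u\<in>{1..n}. \<Sum>v\<in>{1..n}. adj (E n) u v / 2 * (p n)\<^sup>2)"
    by (subst bern_cong[OF c]) (simp_all only: bern_sum b cong: sum.cong)
  also have "\<dots> = (\<Sum>u\<in>{1..n}. \<Sum>v\<in>{1..n}. adj (E n) u v) / 2 * (p n)\<^sup>2"
    by (simp only: sum_distrib_right[symmetric] sum_divide_distrib[symmetric])
  also have "(\<Sum>u\<in>{1..n}. \<Sum>v\<in>{1..n}. adj (E n) u v) = 2 * real (card (E n))"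
  by (rule sum_adj[OF graph[OF n]])
  finally show ?thesis by simp
qed

lemma edge_count_split:
  assumes n: "n \<ge> 1" and A: "A \<subseteq> {1..n}"
  shows "ec (E n) A = ec (E n) (A \<inter> {..N}) + eHR (E n) N A + ec (E n) (A \<inter> {N<..})"
proof -
  have f: "finite A" using A finite_subset by blast
  have "(A \<inter> {..N}) \<union> (A \<inter> {N<..}) = A" by auto
  moreover have "(A \<inter> {..N}) \<inter> (A \<inter> {N<..}) = {}" by auto
  ultimately show ?thesis
    using ec_split[OF graph[OF n], of "A \<inter> {..N}" "A \<inter> {N<..}"] f by (simp add: eHR_def)
qed

text \<open>The pair of counts is encoded as one natural number, so that the compactness result for
  laws on the natural numbers applies to joint laws.\<close>

definition headlaw :: "real \<times> nat \<Rightarrow> nat pmf" where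
  "headlaw = (\<lambda>(K, n). map_pmf (\<lambda>A. prod_encode (ec (E n) (A \<inter> {..nK K n}), eHR (E n) (nK K n) A)) (bset n))"

lemma eventually_iter_snd: "eventually Q sequentially \<Longrightarrow> eventually (\<lambda>z. Q (snd z)) iter_filter"
  by (simp add: eventually_iter_filter)

text \<open>Both counts are at most the number of chosen edges, whose mean is bounded by
  \<open>C\<close> for large \<open>n\<close> and all \<open>K\<close>. Markov's inequality confines
  the pair to a square, which has finitely many codes.\<close>

lemma headlaw_tight:
  assumes e: "e > 0"
  shows "\<exists>R. \<forall>\<^sub>F i in iter_filter. 1 - e \<le> measure_pmf.prob (headlaw i) {..<R}"
proof -
  obtain C where C: "C > 0" "\<forall>\<^sub>F n in sequentially. real (card (E n)) * (p n)\<^sup>2 \<le> C" by (rule edge_bound)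
  \<comment> \<open>Markov's inequality at level \<open>L + 1\<close> leaves probability at most
    \<open>C / (L + 1)\<close>, which is at most \<open>e\<close>.\<close>
  obtain L :: nat where "C / e \<le> real L" using real_arch_simple by blast
  then have L: "C \<le> e * (real L + 1)" using e by (simp add: pos_divide_le_eq algebra_simps)
  define R where "R = Suc (Max (prod_encode ` ({..L} \<times> {..L})))"
  have R: "prod_encode (x, y) < R" if "x \<le> L" "y \<le> L" for x y
    unfolding R_def less_Suc_eq_le using that by (intro Max_ge) auto
  have "\<forall>\<^sub>F i in iter_filter. 1 - e \<le> measure_pmf.prob (headlaw i) {..<R}"
    using eventually_iter_snd[OF C(2)] eventually_iter_snd[OF eventually_ge_at_top[of 1]]
  proof eventually_elim
    case (elim i)
    obtain K n where i: "i = (K, n)" by (cases i)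
    have n: "n \<ge> 1" and Cn: "real (card (E n)) * (p n)\<^sup>2 \<le> C" using elim i by auto
    let ?enc = "\<lambda>A. prod_encode (ec (E n) (A \<inter> {..nK K n}), eHR (E n) (nK K n) A)"
    have "1 - e \<le> 1 - 1 / (real L + 1) * (real (card (E n)) * (p n)\<^sup>2)"
      using Cn L by (simp add: pos_divide_le_eq mult.commute)
    also have "\<dots> = bern {1..n} (p n) (\<lambda>A. 1 - 1 / (real L + 1) * real (ec (E n) A))"
      by (simp only: bern_diff bern_cmult bern_edge_count[OF n] bern_const finite_atLeastAtMost)
    also have "\<dots> \<le> bern {1..n} (p n) (\<lambda>A. indicator {..<R} (?enc A))"
    proof (rule bern_mono)
      fix A assume A: "A \<subseteq> {1..n}"
      show "1 - 1 / (real L + 1) * real (ec (E n) A) \<le> indicator {..<R} (?enc A)"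
      proof (cases "?enc A < R")
        case False
        then have "\<not> (ec (E n) (A \<inter> {..nK K n}) \<le> L \<and> eHR (E n) (nK K n) A \<le> L)" using R by blast
        then have "ec (E n) A \<ge> Suc L" using edge_count_split[OF n A, of "nK K n"] by linarith
        then have "real L + 1 \<le> real (ec (E n) A)" by linarith
        then show ?thesis by (simp add: indicator_def pos_le_divide_eq)
      qed simp
    qed (use p_pos[OF n] p_le1[OF n] in auto)
    also have "\<dots> = measure_pmf.expectation (bset n) (\<lambda>A. indicator {..<R} (?enc A))"
      by (rule expectation_bset[OF n, symmetric])
    also have "\<dots> = measure_pmf.expectation (headlaw i) (indicator {..<R})" by (simp only: headlaw_def i case_prod_conv integral_map_pmf)
    finally show ?case by simp
  qed
  then show ?thesis by blast
qed

text \<open>With \<open>s3 = 0\<close> the tail-tail edges carry no mark, and the generating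
  functions of the head laws tend to the right side. Tightness provides a limit point; its transform
  is a limit along a finer proper filter and so coincides with the full limit.\<close>

lemma joint_law:
  assumes pp: "pois_proc P S"
  obtains q :: "(nat \<times> nat) pmf" where
    "\<And>t1 t2. t1 \<ge> 0 \<Longrightarrow> t2 \<ge> 0 \<Longrightarrow> measure_pmf.expectation q (\<lambda>x. exp (- t1) ^ fst x * exp (- t2) ^ snd x)
      = laplace P S t1 t2"
proof -
  obtain F' q' where F': "F' \<le> iter_filter" "F' \<noteq> bot" "\<And>k. ((\<lambda>i. pmf (headlaw i) k) \<longlongrightarrow> pmf q' k) F'"
    using pmf_subfilter_limit[OF iter_filter_neq_bot headlaw_tight] by blast
  show ?thesis
  proof (rule that[of "map_pmf prod_decode q'"])
    fix t1 t2 :: real assume t: "t1 \<ge> 0" "t2 \<ge> 0"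
    let ?h = "\<lambda>k. exp (- t1) ^ fst (prod_decode k) * exp (- t2) ^ snd (prod_decode k)"
    let ?G = "laplace P S t1 t2"
    have "\<bar>?h k\<bar> \<le> 1" for k using t by (auto simp: abs_mult intro!: mult_le_one power_le_one)
    then have l1: "((\<lambda>i. measure_pmf.expectation (headlaw i) ?h) \<longlongrightarrow> measure_pmf.expectation q' ?h) F'"
      by (rule pmf_expectation_tendsto[OF F'(3)])
    have "((\<lambda>(K, n). gf (exp (- t1)) (exp (- t2)) (1 - 0) K n) \<longlongrightarrow> exp (- (0 * lam0)) * ?G) iter_filter"
      by (rule gf_tendsto[OF pp t]) auto
    then have "((\<lambda>(K, n). gf (exp (- t1)) (exp (- t2)) 1 K n) \<longlongrightarrow> ?G) F'"
      using tendsto_mono[OF F'(1)] by simp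
    moreover have "\<forall>\<^sub>F z in F'. (case z of (K, n) \<Rightarrow> gf (exp (- t1)) (exp (- t2)) 1 K n) = measure_pmf.expectation (headlaw z) ?h"
      using filter_leD[OF F'(1) eventually_iter_snd[OF eventually_ge_at_top[of 1]]]
    proof eventually_elim
      case (elim z)
      obtain K n where z: "z = (K, n)" by (cases z)
      then have n: "n \<ge> 1" using elim by simp
      show ?case by (simp add: z headlaw_def gf_def expectation_bset[OF n])
    qed
    ultimately have "((\<lambda>i. measure_pmf.expectation (headlaw i) ?h) \<longlongrightarrow> ?G) F'" by (rule Lim_transform_eventually)
    with l1 have "measure_pmf.expectation q' ?h = ?G" by (rule tendsto_unique[OF F'(2)])
    then show "measure_pmf.expectation (map_pmf prod_decode q') (\<lambda>x. exp (- t1) ^ fst x * exp (- t2) ^ snd x) = ?G" by simp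
  qed
qed

text \<open>With equal arguments the three marks multiply to \<open>z\<close> to the power of the
  number of all chosen edges, which does not involve the splitting at \<open>K\<close>; so the
  iterated limit is a plain limit in \<open>n\<close>. The factor
  \<open>exp (- ((1 - z) * lam0))\<close> of the limit comes from the independent Poisson
  summand.\<close>

lemma edge_count_law:
  assumes pp: "pois_proc P S"
    and q: "\<And>t1 t2. t1 \<ge> 0 \<Longrightarrow> t2 \<ge> 0 \<Longrightarrow> measure_pmf.expectation q (\<lambda>x. exp (- t1) ^ fst x * exp (- t2) ^ snd x)
      = laplace P S t1 t2"
  shows "(\<lambda>n. pmf (map_pmf (ec (E n)) (bset n)) k) \<longlonglongrightarrow> pmf (map_pmf (\<lambda>x. fst (fst x) + snd (fst x) + snd x) (pair_pmf q (pois lam0))) k"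
proof (rule pgf_tendsto_imp_pmf_tendsto)
  let ?Q = "map_pmf (\<lambda>x. fst (fst x) + snd (fst x) + snd x) (pair_pmf q (pois lam0))"
  fix z :: real assume z: "0 < z" "z < 1"
  define t where "t = - ln z"
  have t: "t \<ge> 0" "exp (- t) = z" using z by (auto simp: t_def)
  have z01: "0 \<le> z ^ k \<and> z ^ k \<le> 1" for k :: nat using z by (simp add: power_le_one)
  have "measure_pmf.expectation ?Q (\<lambda>x. z ^ x)
     = measure_pmf.expectation (pair_pmf q (pois lam0)) (\<lambda>x. (z ^ fst (fst x) * z ^ snd (fst x)) * z ^ snd x)"
    by (simp add: power_add)
  also have "\<dots> = measure_pmf.expectation q (\<lambda>x. z ^ fst x * z ^ snd x) * measure_pmf.expectation (pois lam0) (\<lambda>c. z ^ c)"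
    using z01 by (intro expectation_pair_pmf_mult) (auto intro: mult_le_one)
  also have "\<dots> = exp (- ((1 - z) * lam0)) * laplace P S t t"
    using q[OF t(1) t(1)] pois_pgf[OF lam0_nonneg, of z] z by (simp only: t(2) less_imp_le mult.commute)
  finally have lim_eq: "measure_pmf.expectation ?Q (\<lambda>x. z ^ x) = \<dots>" .
  let ?l = "measure_pmf.expectation ?Q (\<lambda>x. z ^ x)"
  have "((\<lambda>(K, n). gf (exp (- t)) (exp (- t)) (1 - (1 - z)) K n) \<longlongrightarrow> ?l) iter_filter"
    unfolding lim_eq by (rule gf_tendsto[OF pp t(1) t(1)]) (use z in auto)
  then have lim: "((\<lambda>(K, n). gf z z z K n) \<longlongrightarrow> ?l) iter_filter" by (simp add: t(2))
  have eq: "gf z z z K n = measure_pmf.expectation (map_pmf (ec (E n)) (bset n)) (\<lambda>x. z ^ x)" if n: "n \<ge> 1" for K n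
  proof -
    have "gf z z z K n = bern {1..n} (p n) (\<lambda>A. z ^ ec (E n) A)"
      unfolding gf_def by (rule bern_cong) (simp add: edge_count_split[OF n, of _ "nK K n"] power_add)
    then show ?thesis by (simp add: expectation_bset[OF n])
  qed
  show "(\<lambda>n. measure_pmf.expectation (map_pmf (ec (E n)) (bset n)) (\<lambda>x. z ^ x)) \<longlonglongrightarrow> ?l"
  proof (rule tendstoI)
    fix e :: real assume "e > 0"
    from tendstoD[OF lim this] have "\<forall>\<^sub>F K in at_top. \<forall>\<^sub>F n in sequentially. dist (gf z z z K n) ?l < e"
      by (simp add: eventually_iter_filter)
    then obtain K where "\<forall>\<^sub>F n in sequentially. dist (gf z z z K n) ?l < e"
      using eventually_happens'[OF trivial_limit_at_top_linorder] by blast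
    then show "\<forall>\<^sub>F n in sequentially. dist (measure_pmf.expectation (map_pmf (ec (E n)) (bset n)) (\<lambda>x. z ^ x)) ?l < e"
      using eventually_ge_at_top[of 1] by eventually_elim (simp add: eq)
  qed
qed

end

text \<open>The map \<open>h\<close> carries the product law to another type, possibly uncountable;
  \<open>F\<close> and \<open>G\<close> after \<open>h\<close> still depend on one coordinate each.
  All sets are events, so only the product formula has to be checked.\<close>

lemma indep_set_pair_pmf:
  fixes q :: "'a::countable pmf" and q' :: "'b::countable pmf" and h :: "'a \<times> 'b \<Rightarrow> 'c"
  defines "\<Omega> \<equiv> measure_pmf (map_pmf h (pair_pmf q q'))"
  assumes F: "\<And>x. F (h x) = f (fst x)" "\<And>\<omega>. F \<omega> \<in> space M1" and G: "\<And>x. G (h x) = g (snd x)" "\<And>\<omega>. G \<omega> \<in> space M2"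
  shows "prob_space.indep_set \<Omega> (sets (vimage_algebra (space \<Omega>) F M1)) (sets (vimage_algebra (space \<Omega>) G M2))"
proof -
  interpret prob_space \<Omega> unfolding \<Omega>_def by (rule measure_pmf.prob_space_axioms)
  have sp: "space \<Omega> = UNIV" "events = UNIV" by (simp_all add: \<Omega>_def)
  have pr: "prob {\<omega>. R (F \<omega>) \<and> R' (G \<omega>)} = measure_pmf.prob q {x. R (f x)} * measure_pmf.prob q' {x. R' (g x)}" for R R'
  proof -
    have "prob {\<omega>. R (F \<omega>) \<and> R' (G \<omega>)} = measure_pmf.prob (pair_pmf q q') ({x. R (f x)} \<times> {x. R' (g x)})"
      unfolding \<Omega>_def measure_map_pmf by (intro arg_cong[where f = "measure_pmf.prob (pair_pmf q q')"]) (auto simp: F G)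
    also have "\<dots> = measure_pmf.prob q {x. R (f x)} * measure_pmf.prob q' {x. R' (g x)}"
      by (rule measure_pmf_prob_product) auto
    finally show ?thesis .
  qed
  have s1: "sets (vimage_algebra (space \<Omega>) F M1) = {F -` A \<inter> space \<Omega> |A. A \<in> sets M1}"
    by (rule sets_vimage_algebra2) (use F in auto)
  have s2: "sets (vimage_algebra (space \<Omega>) G M2) = {G -` A \<inter> space \<Omega> |A. A \<in> sets M2}"
    by (rule sets_vimage_algebra2) (use G in auto)
  show ?thesis
    unfolding indep_sets2_eq
  proof (intro conjI ballI)
    fix a b assume "a \<in> sets (vimage_algebra (space \<Omega>) F M1)" "b \<in> sets (vimage_algebra (space \<Omega>) G M2)"
    then obtain A B where a: "a = {\<omega>. F \<omega> \<in> A}" and b: "b = {\<omega>. G \<omega> \<in> B}"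
      unfolding sp s1[unfolded sp] s2[unfolded sp] by auto
    have "a \<inter> b = {\<omega>. F \<omega> \<in> A \<and> G \<omega> \<in> B}" by (auto simp: a b)
    then show "prob (a \<inter> b) = prob a * prob b"
      using pr[of "\<lambda>x. x \<in> A" "\<lambda>y. y \<in> B"] pr[of "\<lambda>x. x \<in> A" "\<lambda>_. True"] pr[of "\<lambda>_. True" "\<lambda>y. y \<in> B"]
      by (simp add: a b measure_pmf.prob_space[simplified])
  qed (auto simp: sp)
qed

theorem mainTheorem5:
  fixes M :: "nat \<Rightarrow> 'a measure" and X :: "nat \<Rightarrow> nat \<Rightarrow> 'a \<Rightarrow> nat"
    and p r :: "nat \<Rightarrow> real" and E :: "nat \<Rightarrow> nat set set"
    and W :: "real \<Rightarrow> real \<Rightarrow> real" and d :: "real \<Rightarrow> real" and lam0 :: real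
    and P :: "'b measure" and S :: "'b \<Rightarrow> real set"
  assumes prob: "\<And>n. n \<ge> 1 \<Longrightarrow> prob_space (M n)"
    and indep: "\<And>n. n \<ge> 1 \<Longrightarrow> prob_space.indep_vars (M n) (\<lambda>_. count_space UNIV) (X n) {1..n}"
    and ident: "\<And>n u. n \<ge> 1 \<Longrightarrow> u \<in> {1..n} \<Longrightarrow>
      distr (M n) (count_space UNIV) (X n u) = distr (M n) (count_space UNIV) (X n 1)"
    and p_eq: "\<And>n. n \<ge> 1 \<Longrightarrow> p n = measure (M n) {\<omega> \<in> space (M n). X n 1 \<omega> = 1}"
    and p_pos: "\<And>n. n \<ge> 1 \<Longrightarrow> p n > 0"
    and p_lim: "p \<longlonglongrightarrow> 0"
    and mean: "(\<lambda>n. 1 / p n * (\<integral>\<omega>. real (X n 1 \<omega>) \<partial>M n)) \<longlonglongrightarrow> 1"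
    and r_eq: "\<And>n. n \<ge> 1 \<Longrightarrow> r n = 1 / p n"
    and graph: "\<And>n. n \<ge> 1 \<Longrightarrow> simple_graph n (E n)"
    and edges: "(\<lambda>n. real (card (E n)) * (p n)\<^sup>2) \<in> \<Theta>(\<lambda>_. 1)"
    and labels: "\<And>n. n \<ge> 1 \<Longrightarrow> degree_ordered n (E n)"
    and a: "has_double_lim (\<lambda>n K. 1 / 2 *
      (LINT x:{K..}|lborel. LINT y:{K..}|lborel. graph_kernel n (r n) (E n) x y)) lam0"
    and W: "graphon W"
    and b: "\<forall>\<^sub>F K in at_top. (\<lambda>n. cut_dist K (graph_kernel n (r n) (E n)) W) \<longlonglongrightarrow> 0"
    and d_nonneg: "\<And>x. x \<ge> 0 \<Longrightarrow> d x \<ge> 0"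
    and d_L1: "set_integrable lborel {0..} d"
    and c: "\<exists>C>0. \<forall>K\<ge>C. \<forall>B\<ge>C. (\<lambda>n. LINT x:{0..K}|lborel.
      \<bar>kernel_degree (graph_kernel n (r n) (E n)) x *
          of_bool (kernel_degree (graph_kernel n (r n) (E n)) x \<le> B)
        - d x * of_bool (d x \<le> B)\<bar>) \<longlonglongrightarrow> 0"
    and poisson: "poisson_process P S"
  shows
    \<comment> \<open>the integrals in the Laplace transform below are well defined\<close>
    "(AE x in lborel. x \<ge> 0 \<longrightarrow> set_integrable lborel {0..} (W x)) \<and>
     (\<forall>t\<ge>0. integrable (orthant 2) (\<lambda>x. phi W t (x 0) (x 1))) \<and>
     integrable (orthant 1) (\<lambda>x. Delta d W (x 0)) \<and>
     (\<exists>(\<Omega> :: (real \<times> real \<times> nat) measure) Q1 Q2 Q3.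
        prob_space \<Omega> \<and>
        Q1 \<in> borel_measurable \<Omega> \<and> Q2 \<in> borel_measurable \<Omega> \<and>
        Q3 \<in> measurable \<Omega> (count_space UNIV) \<and>
        distr \<Omega> (count_space UNIV) Q3 = measure_pmf (pois lam0) \<and>
        prob_space.indep_set \<Omega>
          (sets (vimage_algebra (space \<Omega>) (\<lambda>\<omega>. (Q1 \<omega>, Q2 \<omega>)) (borel \<Otimes>\<^sub>M borel)))
          (sets (vimage_algebra (space \<Omega>) Q3 (count_space UNIV))) \<and>
        (\<forall>t1\<ge>0. \<forall>t2\<ge>0.
           (\<integral>\<omega>. exp (- t1 * Q1 \<omega> - t2 * Q2 \<omega>) \<partial>\<Omega>) =
           (\<integral>\<omega>. exp (1 / 2 * stoch_integral P S 2 (\<lambda>x. phi W t1 (x 0) (x 1)) \<omega>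
                    - (1 - exp (- t2)) * stoch_integral P S 1 (\<lambda>x. Delta d W (x 0)) \<omega>) \<partial>P)) \<and>
        weak_conv_m (\<lambda>n. distr (M n) borel (T_stat n (E n) (X n)))
          (distr \<Omega> borel (\<lambda>\<omega>. Q1 \<omega> + Q2 \<omega> + real (Q3 \<omega>))))"
proof -
  have n1: "\<forall>\<^sub>F n in sequentially. (n::nat) \<ge> 1" by (rule eventually_ge_at_top)
  have p_le1: "p n \<le> 1" if "n \<ge> 1" for n
    using p_eq[OF that] prob_space.prob_le_1[OF prob[OF that]] by simp
  interpret graph_seq p r E W d lam0
    by unfold_locales (fact p_pos p_le1 p_lim r_eq graph edges labels a W b d_nonneg d_L1 c)+
  have pp: "pois_proc P S"
    using poisson by (simp add: pois_proc_def pois_proc_axioms_def poisson_process_def)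
  obtain q :: "(nat \<times> nat) pmf" where q: "\<And>t1 t2. t1 \<ge> 0 \<Longrightarrow> t2 \<ge> 0 \<Longrightarrow>
      measure_pmf.expectation q (\<lambda>x. exp (- t1) ^ fst x * exp (- t2) ^ snd x) = laplace P S t1 t2"
    using joint_law[OF pp] by blast
  let ?T' = "\<lambda>n \<omega>. ec (E n) {u \<in> {1..n}. X n u \<omega> = 1}"
  let ?D = "\<lambda>n. {\<omega> \<in> space (M n). T_stat n (E n) (X n) \<omega> \<noteq> real (?T' n \<omega>)}" and ?K = "\<lambda>n k. {\<omega> \<in> space (M n). ?T' n \<omega> = k}"
  let ?\<mu> = "\<lambda>n. \<integral>\<omega>. real (X n 1 \<omega>) \<partial>M n"
  \<comment> \<open>A non-integrable variable would have integral 0 by convention, which for large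
    \<open>n\<close> is incompatible with the limit 1.\<close>
  have int_ev: "\<forall>\<^sub>F n in sequentially. integrable (M n) (\<lambda>\<omega>. real (X n 1 \<omega>))"
  proof -
    have "\<forall>\<^sub>F n in sequentially. 0 < 1 / p n * ?\<mu> n" by (rule order_tendstoD(1)[OF mean]) simp
    then show ?thesis by eventually_elim (metis less_irrefl mult_zero_right not_integrable_integral_eq)
  qed
  obtain C where C: "C > 0" "\<forall>\<^sub>F n in sequentially. real (card (E n)) * (p n)\<^sup>2 \<le> C" by (rule edge_bound)
  have diff: "(\<lambda>n. measure (M n) (?D n)) \<longlonglongrightarrow> 0"
  proof (rule tendsto_sandwich[OF _ _ tendsto_const])
    show "\<forall>\<^sub>F n in sequentially. 0 \<le> measure (M n) (?D n)" by simp
    have "(\<lambda>n. 2 * C * \<bar>(1 / p n * ?\<mu> n)\<^sup>2 - 1\<bar>) \<longlonglongrightarrow> 2 * C * \<bar>1\<^sup>2 - 1\<bar>" by (intro tendsto_intros mean)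
    then show "(\<lambda>n. 2 * C * \<bar>(1 / p n * ?\<mu> n)\<^sup>2 - 1\<bar>) \<longlonglongrightarrow> 0" by simp
    show "\<forall>\<^sub>F n in sequentially. measure (M n) (?D n) \<le> 2 * C * \<bar>(1 / p n * ?\<mu> n)\<^sup>2 - 1\<bar>"
      using int_ev C(2) n1
    proof eventually_elim
      case (elim n)
      interpret prob_space "M n" by (rule prob[OF elim(3)])
      have "prob (?D n) \<le> 2 * real (card (E n)) * ((?\<mu> n)\<^sup>2 - (p n)\<^sup>2)"
        using replace_by_indicators[OF indep[OF elim(3)] ident[OF elim(3)] elim(3) elim(1) graph[OF elim(3)]]
        by (simp only: p_eq[OF elim(3)])
      \<comment> \<open>The factor \<open>p\<^sup>2\<close> is split off to be paired with the
        number of edges, which is bounded in this scaling; the other factor tends to 0 by the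
        assumption on the means.\<close>
      also have "(?\<mu> n)\<^sup>2 - (p n)\<^sup>2 = (p n)\<^sup>2 * ((1 / p n * ?\<mu> n)\<^sup>2 - 1)"
        using p_pos[OF elim(3)] by (simp add: field_simps power2_eq_square)
      also have "2 * real (card (E n)) * ((p n)\<^sup>2 * ((1 / p n * ?\<mu> n)\<^sup>2 - 1)) = 2 * (real (card (E n)) * (p n)\<^sup>2) * ((1 / p n * ?\<mu> n)\<^sup>2 - 1)"
        by (simp only: mult_ac)
      also have "\<dots> \<le> 2 * (real (card (E n)) * (p n)\<^sup>2) * \<bar>(1 / p n * ?\<mu> n)\<^sup>2 - 1\<bar>" by (intro mult_left_mono) auto
      also have "\<dots> \<le> 2 * C * \<bar>(1 / p n * ?\<mu> n)\<^sup>2 - 1\<bar>" using elim(2) by (intro mult_right_mono) auto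
      finally show ?case .
    qed
  qed
  define qt where "qt = map_pmf (\<lambda>x. fst (fst x) + snd (fst x) + snd x) (pair_pmf q (pois lam0))"
  have T_meas: "T_stat n (E n) (X n) \<in> borel_measurable (M n)" "?T' n \<in> measurable (M n) (count_space UNIV)" if n: "n \<ge> 1" for n
  proof -
    interpret prob_space "M n" by (rule prob[OF n])
    have Xm: "X n u \<in> measurable (M n) (count_space UNIV)" if "u \<in> {1..n}" for u
      using indep[OF n] that by (auto simp: indep_vars_def)
    show "T_stat n (E n) (X n) \<in> borel_measurable (M n)" by (rule T_stat_measurable[OF Xm])
    show "?T' n \<in> measurable (M n) (count_space UNIV)" by (rule edge_count_measurable[OF Xm graph[OF n]])
  qed
  have lim: "(\<lambda>n. measure (M n) (?K n k)) \<longlonglongrightarrow> pmf qt k" for k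
  proof -
    have "pmf (map_pmf (ec (E n)) (bset n)) k = measure (M n) (?K n k)" if n: "n \<ge> 1" for n
    proof -
      interpret prob_space "M n" by (rule prob[OF n])
      have Xm: "X n u \<in> measurable (M n) (count_space UNIV)" if "u \<in> {1..n}" for u
        using indep[OF n] that by (auto simp: indep_vars_def)
      have ind: "indep_vars (\<lambda>_. count_space UNIV) (\<lambda>u \<omega>. X n u \<omega> = 1) {1..n}"
        using indep_vars_compose2[OF indep[OF n], of "\<lambda>_ k. k = 1" "\<lambda>_. count_space UNIV"] by simp
      have pr: "prob {\<omega> \<in> space (M n). X n u \<omega> = 1} = p n" if u: "u \<in> {1..n}" for u
      proof -
        have "prob {\<omega> \<in> space (M n). X n v \<omega> = 1} = measure (distr (M n) (count_space UNIV) (X n v)) {1}" if "v \<in> {1..n}" for v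
          by (subst measure_distr[OF Xm[OF that]]) (auto intro!: arg_cong[where f = prob])
        then show ?thesis using ident[OF n u] u n p_eq[OF n] by simp
      qed
      have "pmf (map_pmf (ec (E n)) (bset n)) k = measure_pmf.expectation (bset n) (indicator (ec (E n) -` {k}))"
        by (simp add: pmf_map)
      also have "\<dots> = bern {1..n} (p n) (indicator (ec (E n) -` {k}))" by (rule expectation_bset[OF n])
      also have "\<dots> = expectation (\<lambda>\<omega>. indicator (ec (E n) -` {k}) {u \<in> {1..n}. X n u \<omega> = 1})"
        by (rule expectation_bern(1)[OF _ ind pr, symmetric]) auto
      also have "\<dots> = expectation (indicator (?K n k))"
        by (intro Bochner_Integration.integral_cong refl) (auto simp: indicator_def)
      also have "\<dots> = prob (?K n k)"
        by (auto intro!: arg_cong[where f = prob])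
      finally show ?thesis .
    qed
    then have "\<forall>\<^sub>F n in sequentially. pmf (map_pmf (ec (E n)) (bset n)) k = measure (M n) (?K n k)"
      by (intro eventually_mono[OF n1])
    with edge_count_law[OF pp q, of k] show ?thesis unfolding qt_def by (rule Lim_transform_eventually)
  qed
  have conv: "weak_conv_m (\<lambda>n. distr (M n) borel (T_stat n (E n) (X n))) (distr (measure_pmf qt) borel real)"
    by (rule weak_conv_nat_valued[OF prob T_meas diff lim])
  let ?h = "\<lambda>x::(nat \<times> nat) \<times> nat. (real (fst (fst x)), real (snd (fst x)), snd x)"
  \<comment> \<open>The discrete law of two joint counts and an independent Poisson variable,
    carried to the reals in the first two coordinates; it remains discrete, so all functions on it
    are measurable.\<close>
  define \<Omega> where "\<Omega> = measure_pmf (map_pmf ?h (pair_pmf q (pois lam0)))"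
  let ?Q1 = "\<lambda>\<omega>::real \<times> real \<times> nat. fst \<omega>" and ?Q2 = "\<lambda>\<omega>::real \<times> real \<times> nat. fst (snd \<omega>)"
    and ?Q3 = "\<lambda>\<omega>::real \<times> real \<times> nat. snd (snd \<omega>)"
  have distr\<Omega>: "distr \<Omega> N g = distr (measure_pmf (pair_pmf q (pois lam0))) N (\<lambda>x. g (?h x))"
    if "g \<in> UNIV \<rightarrow> space N" for N :: "'c measure" and g
    unfolding \<Omega>_def map_pmf_rep_eq using that by (subst distr_distr) (auto simp: comp_def)
  have "prob_space \<Omega>" unfolding \<Omega>_def by (rule measure_pmf.prob_space_axioms)
  moreover have "?Q1 \<in> borel_measurable \<Omega>" "?Q2 \<in> borel_measurable \<Omega>" "?Q3 \<in> measurable \<Omega> (count_space UNIV)"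
    by (simp_all add: \<Omega>_def)
  moreover have "distr \<Omega> (count_space UNIV) ?Q3 = measure_pmf (pois lam0)"
    using map_snd_pair_pmf[of q "pois lam0"] map_pmf_rep_eq[of snd "pair_pmf q (pois lam0)"] by (simp add: distr\<Omega>)
  moreover have "prob_space.indep_set \<Omega>
          (sets (vimage_algebra (space \<Omega>) (\<lambda>\<omega>. (?Q1 \<omega>, ?Q2 \<omega>)) (borel \<Otimes>\<^sub>M borel)))
          (sets (vimage_algebra (space \<Omega>) ?Q3 (count_space UNIV)))"
    unfolding \<Omega>_def
    by (rule indep_set_pair_pmf[where f = "\<lambda>x. (real (fst x), real (snd x))" and g = id]) (auto simp: space_pair_measure)
  moreover have "(\<integral>\<omega>. exp (- t1 * ?Q1 \<omega> - t2 * ?Q2 \<omega>) \<partial>\<Omega>) =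
           (\<integral>\<omega>. exp (1 / 2 * stoch_integral P S 2 (\<lambda>x. phi W t1 (x 0) (x 1)) \<omega>
                    - (1 - exp (- t2)) * stoch_integral P S 1 (\<lambda>x. Delta d W (x 0)) \<omega>) \<partial>P)"
    if t: "t1 \<ge> 0" "t2 \<ge> 0" for t1 t2
  proof -
    have e: "exp (- t1 * real a - t2 * real b) = exp (- t1) ^ a * exp (- t2) ^ b" for a b
    proof -
      have "- t1 * real a - t2 * real b = real a * (- t1) + real b * (- t2)" by simp
      then show ?thesis by (simp only: exp_add exp_of_nat_mult)
    qed
    have "(\<integral>\<omega>. exp (- t1 * ?Q1 \<omega> - t2 * ?Q2 \<omega>) \<partial>\<Omega>)
       = measure_pmf.expectation (pair_pmf q (pois lam0)) (\<lambda>x. exp (- t1) ^ fst (fst x) * exp (- t2) ^ snd (fst x))"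
      unfolding \<Omega>_def integral_map_pmf fst_conv snd_conv e ..
    also have "\<dots> = measure_pmf.expectation q (\<lambda>x. exp (- t1) ^ fst x * exp (- t2) ^ snd x)"
      by (rule expectation_pair_pmf_fst)
    finally show ?thesis using q[OF t] by simp
  qed
  moreover have "distr \<Omega> borel (\<lambda>\<omega>. ?Q1 \<omega> + ?Q2 \<omega> + real (?Q3 \<omega>)) = distr (measure_pmf qt) borel real"
    unfolding qt_def map_pmf_rep_eq by (subst distr_distr) (auto simp: distr\<Omega> comp_def)
  ultimately have "\<exists>(\<Omega> :: (real \<times> real \<times> nat) measure) Q1 Q2 Q3.
        prob_space \<Omega> \<and>
        Q1 \<in> borel_measurable \<Omega> \<and> Q2 \<in> borel_measurable \<Omega> \<and>
        Q3 \<in> measurable \<Omega> (count_space UNIV) \<and>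
        distr \<Omega> (count_space UNIV) Q3 = measure_pmf (pois lam0) \<and>
        prob_space.indep_set \<Omega>
          (sets (vimage_algebra (space \<Omega>) (\<lambda>\<omega>. (Q1 \<omega>, Q2 \<omega>)) (borel \<Otimes>\<^sub>M borel)))
          (sets (vimage_algebra (space \<Omega>) Q3 (count_space UNIV))) \<and>
        (\<forall>t1\<ge>0. \<forall>t2\<ge>0.
           (\<integral>\<omega>. exp (- t1 * Q1 \<omega> - t2 * Q2 \<omega>) \<partial>\<Omega>) =
           (\<integral>\<omega>. exp (1 / 2 * stoch_integral P S 2 (\<lambda>x. phi W t1 (x 0) (x 1)) \<omega>
                    - (1 - exp (- t2)) * stoch_integral P S 1 (\<lambda>x. Delta d W (x 0)) \<omega>) \<partial>P)) \<and>
        weak_conv_m (\<lambda>n. distr (M n) borel (T_stat n (E n) (X n)))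
          (distr \<Omega> borel (\<lambda>\<omega>. Q1 \<omega> + Q2 \<omega> + real (Q3 \<omega>)))"
    using conv by (intro exI[of _ \<Omega>] exI[of _ ?Q1] exI[of _ ?Q2] exI[of _ ?Q3]) simp
  moreover have "\<forall>t\<ge>0. integrable (orthant 2) (\<lambda>x. phi W t (x 0) (x 1))"
    using integrable_phi[OF W integrable_W0[unfolded W0_def]] by blast
  moreover have "integrable (orthant 1) (\<lambda>x. Delta d W (x 0))"
    using integrable_orthant1[OF integrable_D0[folded D0_eq]] .
  ultimately show ?thesis using AE_slice_W by blast
qed

end
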